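(* Let $-\infty<a<b<\infty$, and let $q,r,s:(a,b)\to\mathbb{C}$ satisfy $q\in L^1((a,b);dx)$ and $r,s\in L^2((a,b);dx)$. Let $\mathbb{S}_\pi=\{z\in\mathbb{C}\mid 0\leq\operatorname{Re}(z)<\pi\}$, and for $\theta_a,\theta_b\in\mathbb{S}_\pi$ let $L^{(\theta_a,\theta_b)}_{1,q,r,s}$ be the m-sectorial operator in $L^2((a,b);dx)$ associated with the sesquilinear form $\mathfrak{q}^{(\theta_a,\theta_b)}_{1,q,r,s}$ (defined in the context, with leading coefficient equal to $1$). Then $$\operatorname{dom}\Big(\big(L^{(\theta_a,\theta_b)}_{1,q,r,s}\big)^{1/2}\Big)=\operatorname{dom}\big(\mathfrak{q}^{(\theta_a,\theta_b)}_{1,q,r,s}\big)=\operatorname{dom}\big(\mathfrak{q}^{(\theta_a,\theta_b)}_{1,0,0,0}\big),\quad \theta_a,\theta_b\in\mathbb{S}_\pi.$$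
   Context: For $\theta_a,\theta_b\in\mathbb{S}_\pi$ define $$\mathfrak{q}^{(\theta_a,\theta_b)}_{1,q,r,s}(f,g)=\int_a^b dx\,\Big[\overline{f'}g'+\overline{f}rg'+\overline{f'}sg+\overline{f}qg\Big](x)-\cot(\theta_a)\overline{f(a)}g(a)-\cot(\theta_b)\overline{f(b)}g(b),$$ where the term with $\cot(\theta_a)$ is omitted if $\theta_a=0$ and the term with $\cot(\theta_b)$ is omitted if $\theta_b=0$; its domain is the set of all $h\in W^{1,2}((a,b))=\{h\in L^2((a,b);dx)\mid h\in AC([a,b]),\,h'\in L^2((a,b);dx)\}$ satisfying $h(a)=0$ if $\theta_a=0$ and $h(b)=0$ if $\theta_b=0$ (no condition at an endpoint whose parameter is nonzero). Here $AC([a,b])$ is the set of absolutely continuous functions on $[a,b]$. The form $\mathfrak{q}^{(\theta_a,\theta_b)}_{1,0,0,0}$ is the case $q=r=s=0$. Inner products and sesquilinear forms are linear in the second argument and conjugate linear in the first. A form (resp. operator) is sectorial if its numerical range lies in a sector $\{\zeta\in\mathbb{C}\mid|\arg(\zeta-\gamma)|\leq\theta\}$ with vertex $\gamma\in\mathbb{R}$ and semi-angle $\theta\in[0,\pi/2)$. Under the stated hypotheses these forms are densely defined, closed, and sectorial; the m-sectorial operator $T_{\mathfrak q}$ associated with a densely defined, closed, sectorial form $\mathfrak{q}$ in a Hilbert space $\mathcal{H}$ (first representation theorem) is the unique m-sectorial operator with $\operatorname{dom}(T_{\mathfrak q})\subseteq\operatorname{dom}(\mathfrak{q})$ and $\mathfrak{q}(g,f)=(g,T_{\mathfrak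 q}f)_{\mathcal{H}}$ for all $f\in\operatorname{dom}(T_{\mathfrak q})$, $g\in\operatorname{dom}(\mathfrak{q})$. Square root domains: for $T$ m-accretive, $T^{1/2}$ is the (unique) m-accretive square root of $T$. For an m-sectorial operator $T$ (possibly with negative vertex), $\operatorname{dom}(T^{1/2})$ is understood as $\operatorname{dom}((T+EI)^{1/2})=\operatorname{ran}((T+EI)^{-1/2})$ for all sufficiently large $E>0$ (so that $T+EI$ is m-accretive with bounded inverse); this space is independent of such $E$ and coincides with $\operatorname{dom}(T^{1/2})$ if $T$ is itself m-accretive. *)

theory Defs
  imports "HOL-Analysis.Analysis"
begin

text \<open>
  An element of the Hilbert space of square-integrable functions is represented by any function
  in its class modulo a.e. equality. Operators (identified with their graphs), operator domains
  and form domains are sets of representatives that are closed under changing a function on a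
  null set, so that equality of two such sets is equality of the corresponding sets of classes.
\<close>

definition L2 :: "'a measure \<Rightarrow> ('a \<Rightarrow> complex) set" where
  "L2 M = {f \<in> borel_measurable M. integrable M (\<lambda>x. (cmod (f x))\<^sup>2)}"

definition l2_inner :: "'a measure \<Rightarrow> ('a \<Rightarrow> complex) \<Rightarrow> ('a \<Rightarrow> complex) \<Rightarrow> complex" where
  "l2_inner M f g = (\<integral>x. cnj (f x) * g x \<partial>M)"

definition l2_norm :: "'a measure \<Rightarrow> ('a \<Rightarrow> complex) \<Rightarrow> real" where
  "l2_norm M f = sqrt (\<integral>x. (cmod (f x))\<^sup>2 \<partial>M)"

type_synonym 'a l2_op = "(('a \<Rightarrow> complex) \<times> ('a \<Rightarrow> complex)) set"

definition linear_op :: "'a measure \<Rightarrow> 'a l2_op \<Rightarrow> bool" where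
  "linear_op M T \<longleftrightarrow>
     T \<noteq> {} \<and> T \<subseteq> L2 M \<times> L2 M \<and>
     (\<forall>(f, u)\<in>T. \<forall>(g, v)\<in>T. \<forall>c. (\<lambda>x. f x + c * g x, \<lambda>x. u x + c * v x) \<in> T) \<and>
     (\<forall>(f, u)\<in>T. \<forall>g\<in>L2 M. \<forall>v\<in>L2 M.
        (AE x in M. g x = f x) \<and> (AE x in M. v x = u x) \<longrightarrow> (g, v) \<in> T) \<and>
     (\<forall>(f, u)\<in>T. (AE x in M. f x = 0) \<longrightarrow> (AE x in M. u x = 0))"

definition shift_op :: "complex \<Rightarrow> 'a l2_op \<Rightarrow> 'a l2_op" where
  "shift_op z T = (\<lambda>(f, u). (f, \<lambda>x. u x + z * f x)) ` T"

definition numerical_range :: "'a measure \<Rightarrow> 'a l2_op \<Rightarrow> complex set" where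
  "numerical_range M T = {l2_inner M f u | f u. (f, u) \<in> T \<and> l2_norm M f = 1}"

text \<open>The vertex belongs to the sector, since \<open>Arg 0 = 0\<close> and \<open>\<theta> \<ge> 0\<close> wherever this is used.\<close>

definition sector :: "real \<Rightarrow> real \<Rightarrow> complex set" where
  "sector \<gamma> \<theta> = {\<zeta>. \<bar>Arg (\<zeta> - of_real \<gamma>)\<bar> \<le> \<theta>}"

definition sectorial :: "'a measure \<Rightarrow> 'a l2_op \<Rightarrow> bool" where
  "sectorial M T \<longleftrightarrow>
     (\<exists>\<gamma> \<theta>. 0 \<le> \<theta> \<and> \<theta> < pi / 2 \<and> numerical_range M T \<subseteq> sector \<gamma> \<theta>)"

definition accretive :: "'a measure \<Rightarrow> 'a l2_op \<Rightarrow> bool" where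
  "accretive M T \<longleftrightarrow> numerical_range M T \<subseteq> {\<zeta>. 0 \<le> Re \<zeta>}"

text \<open>
  For an accretive \<open>T\<close> and \<open>Re z > 0\<close>, the operator \<open>T + z I\<close> is automatically injective with
  inverse bounded by \<open>1 / Re z\<close>. Hence surjectivity is all that is left to require of the
  resolvent; closedness and density of the domain also follow.
\<close>

definition m_accretive :: "'a measure \<Rightarrow> 'a l2_op \<Rightarrow> bool" where
  "m_accretive M T \<longleftrightarrow>
     linear_op M T \<and> accretive M T \<and> (\<forall>z. 0 < Re z \<longrightarrow> Range (shift_op z T) = L2 M)"

definition m_sectorial :: "'a measure \<Rightarrow> 'a l2_op \<Rightarrow> bool" where
  "m_sectorial M T \<longleftrightarrow>
     linear_op M T \<and> sectorial M T \<and> (\<exists>E::real. m_accretive M (shift_op (of_real E) T))"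

definition sqrt_op :: "'a measure \<Rightarrow> 'a l2_op \<Rightarrow> 'a l2_op" where
  "sqrt_op M T = (THE S. m_accretive M S \<and> S O S = T)"

text \<open>
  The domain of \<open>T\<^sup>1\<^sup>/\<^sup>2\<close> for an m-sectorial \<open>T\<close> whose vertex may be negative: the common domain of
  the square roots of \<open>T + E I\<close> for all sufficiently large real \<open>E\<close>.
\<close>

definition sqrt_dom :: "'a measure \<Rightarrow> 'a l2_op \<Rightarrow> ('a \<Rightarrow> complex) set" where
  "sqrt_dom M T =
     (THE D. \<forall>\<^sub>F E::real in at_top.
        m_accretive M (shift_op (of_real E) T) \<and>
        Domain (sqrt_op M (shift_op (of_real E) T)) = D)"

record 'a l2_form =
  form_dom :: "('a \<Rightarrow> complex) set"
  form_val :: "('a \<Rightarrow> complex) \<Rightarrow> ('a \<Rightarrow> complex) \<Rightarrow> complex"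

definition form_op :: "'a measure \<Rightarrow> 'a l2_form \<Rightarrow> 'a l2_op" where
  "form_op M \<qq> =
     (THE T. m_sectorial M T \<and> Domain T \<subseteq> form_dom \<qq> \<and>
        (\<forall>(f, u)\<in>T. \<forall>g\<in>form_dom \<qq>. form_val \<qq> g f = l2_inner M g u))"

definition abs_cont :: "real \<Rightarrow> real \<Rightarrow> (real \<Rightarrow> complex) \<Rightarrow> bool" where
  "abs_cont a b h \<longleftrightarrow>
     (\<forall>\<epsilon>>0. \<exists>\<delta>>0. \<forall>(n::nat) l r.
        (\<forall>k<n. a \<le> l k \<and> l k \<le> r k \<and> r k \<le> b) \<and>
        disjoint_family_on (\<lambda>k. {l k<..<r k}) {..<n} \<and>
        (\<Sum>k<n. r k - l k) < \<delta>
        \<longrightarrow> (\<Sum>k<n. cmod (h (r k) - h (l k))) < \<epsilon>)"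

abbreviation Leb :: "real \<Rightarrow> real \<Rightarrow> real measure" where
  "Leb a b \<equiv> lebesgue_on {a<..<b}"

text \<open>
  The absolutely continuous representative of a class; it is unique on \<open>{a..b}\<close>, and its values
  elsewhere are never used. Point values and derivatives of a class are those of this
  representative. The latter exist almost everywhere; \<open>vector_derivative\<close> is arbitrary on the
  remaining null set.
\<close>

definition ac_rep :: "real \<Rightarrow> real \<Rightarrow> (real \<Rightarrow> complex) \<Rightarrow> real \<Rightarrow> complex" where
  "ac_rep a b f = (SOME h. abs_cont a b h \<and> (AE x in Leb a b. f x = h x))"

definition ac_deriv :: "real \<Rightarrow> real \<Rightarrow> (real \<Rightarrow> complex) \<Rightarrow> real \<Rightarrow> complex" where
  "ac_deriv a b f x = vector_derivative (ac_rep a b f) (at x)"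

definition W12 :: "real \<Rightarrow> real \<Rightarrow> (real \<Rightarrow> complex) set" where
  "W12 a b =
     {f \<in> L2 (Leb a b).
        (\<exists>h. abs_cont a b h \<and> (AE x in Leb a b. f x = h x)) \<and>
        ac_deriv a b f \<in> L2 (Leb a b)}"

definition S_pi :: "complex set" where
  "S_pi = {z. 0 \<le> Re z \<and> Re z < pi}"

definition sl_form ::
  "real \<Rightarrow> real \<Rightarrow> complex \<Rightarrow> complex \<Rightarrow>
   (real \<Rightarrow> complex) \<Rightarrow> (real \<Rightarrow> complex) \<Rightarrow> (real \<Rightarrow> complex) \<Rightarrow> real l2_form" where
  "sl_form a b \<theta>a \<theta>b q r s =
     \<lparr> form_dom =
         {h \<in> W12 a b. (\<theta>a = 0 \<longrightarrow> ac_rep a b h a = 0) \<and> (\<theta>b = 0 \<longrightarrow> ac_rep a b h b = 0)},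
       form_val = (\<lambda>f g.
         (\<integral>x. cnj (ac_deriv a b f x) * ac_deriv a b g x
              + cnj (ac_rep a b f x) * r x * ac_deriv a b g x
              + cnj (ac_deriv a b f x) * s x * ac_rep a b g x
              + cnj (ac_rep a b f x) * q x * ac_rep a b g x \<partial>Leb a b)
         - (if \<theta>a = 0 then 0 else cot \<theta>a * cnj (ac_rep a b f a) * ac_rep a b g a)
         - (if \<theta>b = 0 then 0 else cot \<theta>b * cnj (ac_rep a b f b) * ac_rep a b g b)) \<rparr>"

end

theory Submission
  imports Defs
begin

text \<open>
  Let \<open>\<phi>\<^sub>n\<close> be the eigenfunctions of \<open>-d\<^sup>2/dx\<^sup>2\<close> with a Dirichlet condition wherever \<open>\<theta> = 0\<close> and a Neumann
  condition elsewhere, with eigenvalues \<open>\<kappa>\<^sub>n\<^sup>2\<close>, and let \<open>\<Lambda>\<close> be the diagonal operator with entries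
  \<open>\<lambda>\<^sub>n = (\<kappa>\<^sub>n\<^sup>2 + E)\<^sup>1\<^sup>/\<^sup>2\<close>, so that the form domain is the domain of \<open>\<Lambda>\<close>. In this basis the form plus \<open>E\<close> has
  matrix \<open>\<Lambda>\<^sup>2 + P\<close>. The derivatives of the \<open>\<phi>\<^sub>n\<close> are multiples \<open>\<kappa>\<^sub>n \<psi>\<^sub>n\<close> of an orthogonal system and the \<open>\<phi>\<^sub>n\<close> are
  uniformly bounded, so Bessel's inequality shows that \<open>P m n / ((\<lambda>\<^sub>m + \<lambda>\<^sub>n) min \<lambda>\<^sub>m \<lambda>\<^sub>n)\<close> has a Hilbert--Schmidt norm
  which tends to \<open>0\<close> as \<open>E\<close> grows. For large \<open>E\<close> a contraction argument then solves
  \<open>\<Lambda> Y + Y \<Lambda> + Y\<^sup>2 = P\<close>, that is, \<open>\<Lambda>\<^sup>2 + P = (\<Lambda> + Y)\<^sup>2\<close>, with \<open>Y \<Lambda>\<^sup>-\<^sup>1\<close> of norm at most \<open>1/4\<close>. Hence \<open>\<Lambda> + Y\<close> is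
  m-accretive on the domain of \<open>\<Lambda>\<close>, and by uniqueness of m-accretive roots it is the square root.
\<close>

section \<open>Square-summable families\<close>

text \<open>For an m-sectorial operator that is not self-adjoint, the domain of the root need not be
  the form domain, so the representation theorem does not settle the question and a root with the
  right domain has to be exhibited. The Hilbert--Schmidt norm is chosen because entrywise
  multiplication by numbers of modulus at most 1 does not increase it, which fails for the operator
  norm; all changes of weight below are such multiplications. Dimension one makes this affordable:
  the sum of \<lambda>_n^-2 converges, and tends to 0 as E grows. The weight min \<lambda>_m
  \<lambda>_n controls three operators at once. Y \<Lambda>^-1 fixes the domain of \<Lambda> + Y,
  \<Lambda>^-1 Y lets the factor 1 + \<Lambda>^-1 Y be cancelled when \<Lambda>^2 + P is compared
  with (\<Lambda> + Y)^2, and \<Lambda>^-1/2 Y \<Lambda>^-1/2 gives accretivity. The operator of the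
  form, the root and the root domain are all definite descriptions, so each of them also needs a
  uniqueness proof.\<close>

typedef 'a ell2 = "{x :: 'a \<Rightarrow> complex. (\<lambda>i. (cmod (x i))\<^sup>2) summable_on UNIV}"
  morphisms coord Ell2
  by (rule exI[of _ "\<lambda>_. 0"]) simp

setup_lifting type_definition_ell2

lemma ell2_eqI: "(\<And>i. coord x i = coord y i) \<Longrightarrow> x = y"
  by (metis coord_inject ext)

lemma coord_summable: "(\<lambda>i. (cmod (coord x i))\<^sup>2) summable_on UNIV"
  using coord by blast

lemma coord_Ell2: "(\<lambda>i. (cmod (x i))\<^sup>2) summable_on UNIV \<Longrightarrow> coord (Ell2 x) = x"
  by (simp add: Ell2_inverse)

lemma square_add_le: "(cmod (u + v))\<^sup>2 \<le> 2 * ((cmod u)\<^sup>2 + (cmod v)\<^sup>2)"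
proof -
  have "(cmod (u + v))\<^sup>2 \<le> (cmod u + cmod v)\<^sup>2"
    by (intro power_mono norm_triangle_ineq) auto
  also have "\<dots> \<le> 2 * ((cmod u)\<^sup>2 + (cmod v)\<^sup>2)"
    using sum_squares_bound[of "cmod u" "cmod v"] by (simp add: power2_eq_square algebra_simps)
  finally show ?thesis .
qed

lemma square_summable_add:
  assumes "(\<lambda>i. (cmod (x i))\<^sup>2) summable_on A" "(\<lambda>i. (cmod (y i))\<^sup>2) summable_on A"
  shows "(\<lambda>i. (cmod (x i + y i))\<^sup>2) summable_on A"
  by (rule summable_on_comparison_test[OF summable_on_cmult_right[OF summable_on_add[OF assms], of 2]])
     (use square_add_le in auto)

lemma square_summable_mult:
  assumes "(\<lambda>i. (cmod (x i))\<^sup>2) summable_on A" "\<And>i. i \<in> A \<Longrightarrow> cmod (d i) \<le> C"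
  shows "(\<lambda>i. (cmod (d i * x i))\<^sup>2) summable_on A"
proof (rule summable_on_comparison_test[OF summable_on_cmult_right[OF assms(1), of "C\<^sup>2"]])
  show "(cmod (d i * x i))\<^sup>2 \<le> C\<^sup>2 * (cmod (x i))\<^sup>2" if "i \<in> A" for i
    unfolding norm_mult power_mult_distrib
    using assms(2)[OF that] by (intro mult_right_mono power_mono) auto
qed auto

lemma inner_summable:
  assumes "(\<lambda>i. (cmod (x i))\<^sup>2) summable_on A" "(\<lambda>i. (cmod (y i))\<^sup>2) summable_on A"
  shows "(\<lambda>i. cmod (x i) * cmod (y i)) summable_on A"
proof (rule summable_on_comparison_test[OF summable_on_add[OF assms]])
  show "cmod (x i) * cmod (y i) \<le> (cmod (x i))\<^sup>2 + (cmod (y i))\<^sup>2" for i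
    using sum_squares_bound[of "cmod (x i)" "cmod (y i)"] mult_nonneg_nonneg[OF norm_ge_zero[of "x i"] norm_ge_zero[of "y i"]]
    by linarith
qed auto

text \<open>The real part of the inner product is enough to make Banach's fixed point theorem and
  bounded linear maps available; the complex structure comes back through \<open>cinner\<close> and
  \<open>scaleC\<close>.\<close>

instantiation ell2 :: (type) real_inner
begin

lift_definition zero_ell2 :: "'a ell2" is "\<lambda>_. 0" by simp
lift_definition plus_ell2 :: "'a ell2 \<Rightarrow> 'a ell2 \<Rightarrow> 'a ell2" is "\<lambda>x y i. x i + y i"
  by (rule square_summable_add)
lift_definition uminus_ell2 :: "'a ell2 \<Rightarrow> 'a ell2" is "\<lambda>x i. - x i" by simp
lift_definition minus_ell2 :: "'a ell2 \<Rightarrow> 'a ell2 \<Rightarrow> 'a ell2" is "\<lambda>x y i. x i - y i"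
  subgoal for x y using square_summable_add[of x UNIV "\<lambda>i. - y i"] by simp
  done
lift_definition scaleR_ell2 :: "real \<Rightarrow> 'a ell2 \<Rightarrow> 'a ell2" is "\<lambda>c x i. c *\<^sub>R x i"
  by (simp add: power_mult_distrib summable_on_cmult_right)
definition inner_ell2 :: "'a ell2 \<Rightarrow> 'a ell2 \<Rightarrow> real"
  where "inner_ell2 x y = (\<Sum>\<^sub>\<infinity>i. coord x i \<bullet> coord y i)"
definition norm_ell2 :: "'a ell2 \<Rightarrow> real" where "norm_ell2 x = sqrt (x \<bullet> x)"
definition dist_ell2 :: "'a ell2 \<Rightarrow> 'a ell2 \<Rightarrow> real" where "dist_ell2 x y = norm (x - y)"
definition sgn_ell2 :: "'a ell2 \<Rightarrow> 'a ell2" where "sgn_ell2 x = inverse (norm x) *\<^sub>R x"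
definition uniformity_ell2 :: "('a ell2 \<times> 'a ell2) filter"
  where "uniformity_ell2 = (INF e\<in>{0 <..}. principal {(x, y). dist x y < e})"
definition open_ell2 :: "'a ell2 set \<Rightarrow> bool"
  where "open_ell2 U = (\<forall>x\<in>U. eventually (\<lambda>(x', y). x' = x \<longrightarrow> y \<in> U) uniformity)"

instance
proof
  fix x y z :: "'a ell2" and r :: real and U :: "'a ell2 set"
  have s: "(\<lambda>i. coord x i \<bullet> coord y i) summable_on UNIV" for x y :: "'a ell2"
  proof (rule abs_summable_summable, rule Infinite_Sum.abs_summable_on_comparison_test')
    show "(\<lambda>i. cmod (coord x i) * cmod (coord y i)) summable_on UNIV"
      by (intro inner_summable coord_summable)
    show "norm (coord x i \<bullet> coord y i) \<le> cmod (coord x i) * cmod (coord y i)" for i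
      using Cauchy_Schwarz_ineq2 by (simp)
  qed
  show "x \<bullet> y = y \<bullet> x" by (simp add: inner_ell2_def inner_commute)
  show "(x + y) \<bullet> z = x \<bullet> z + y \<bullet> z"
    by (simp add: inner_ell2_def plus_ell2.rep_eq inner_add_left infsum_add s)
  show "(r *\<^sub>R x) \<bullet> y = r * (x \<bullet> y)"
    unfolding inner_ell2_def scaleR_ell2.rep_eq inner_scaleR_left by (rule infsum_cmult_right')
  show "0 \<le> x \<bullet> x" by (simp add: inner_ell2_def infsum_nonneg)
  show "(x \<bullet> x = 0) = (x = 0)"
  proof
    assume "x \<bullet> x = 0"
    then have "coord x i \<bullet> coord x i = 0" for i
      using nonneg_infsum_le_0D[of "\<lambda>i. coord x i \<bullet> coord x i" UNIV i] s[of x x]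
      by (simp add: inner_ell2_def)
    then show "x = 0" by (intro ell2_eqI) (simp add: zero_ell2.rep_eq)
  qed (simp add: inner_ell2_def zero_ell2.rep_eq)
  show "dist x y = norm (x - y)" by (simp add: dist_ell2_def)
  show "x + y + z = x + (y + z)" "x + y = y + x" "0 + x = x" "- x + x = 0" "x - y = x + - y"
    by (transfer; simp add: algebra_simps)+
  fix s :: real
  show "r *\<^sub>R (x + y) = r *\<^sub>R x + r *\<^sub>R y" "(r + s) *\<^sub>R x = r *\<^sub>R x + s *\<^sub>R x"
      "r *\<^sub>R s *\<^sub>R x = (r * s) *\<^sub>R x" "1 *\<^sub>R x = x"
    by (transfer; simp add: algebra_simps)+
  show "sgn x = inverse (norm x) *\<^sub>R x" by (fact sgn_ell2_def)
  show "norm x = sqrt (x \<bullet> x)" by (fact norm_ell2_def)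
  show "(uniformity :: ('a ell2 \<times> 'a ell2) filter) = (INF e\<in>{0 <..}. principal {(x, y). dist x y < e})"
    by (fact uniformity_ell2_def)
  show "open U = (\<forall>x\<in>U. \<forall>\<^sub>F (x', y) in uniformity. x' = x \<longrightarrow> y \<in> U)"
    by (fact open_ell2_def)
qed

end

lemmas coord_simps [simp] =
  zero_ell2.rep_eq plus_ell2.rep_eq uminus_ell2.rep_eq minus_ell2.rep_eq scaleR_ell2.rep_eq

lemma coord_inner_summable: "(\<lambda>i. cmod (coord x i) * cmod (coord y i)) summable_on UNIV"
  by (intro inner_summable coord_summable)

lemma norm_ell2_square: "(norm x)\<^sup>2 = (\<Sum>\<^sub>\<infinity>i. (cmod (coord x i))\<^sup>2)"
  by (simp only: power2_norm_eq_inner inner_ell2_def)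

lemma norm_ell2_square_has_sum: "((\<lambda>i. (cmod (coord x i))\<^sup>2) has_sum (norm x)\<^sup>2) UNIV"
  by (simp add: norm_ell2_square coord_summable)

lemma norm_ell2_le:
  assumes "((\<lambda>i. (cmod (coord x i))\<^sup>2) has_sum s) UNIV" "s \<le> C\<^sup>2" "0 \<le> C"
  shows "norm x \<le> C"
  using assms infsumI[OF assms(1)] by (auto simp: norm_ell2_square intro: power2_le_imp_le)

lemma coord_le_norm: "cmod (coord x i) \<le> norm x"
proof (rule power2_le_imp_le)
  show "(cmod (coord x i))\<^sup>2 \<le> (norm x)\<^sup>2"
    using finite_sum_le_infsum[OF coord_summable, of "{i}" x] by (simp add: norm_ell2_square)
qed simp

lemma norm_mono_ell2:
  assumes "\<And>i. cmod (coord x i) \<le> cmod (coord y i)"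
  shows "norm x \<le> norm y"
proof (rule power2_le_imp_le)
  show "(norm x)\<^sup>2 \<le> (norm y)\<^sup>2"
    unfolding norm_ell2_square by (intro infsum_mono coord_summable power_mono assms norm_ge_zero)
qed simp

text \<open>Fatou's lemma for sums: a bound on all finite partial sums survives the coordinatewise
  limit. Completeness uses it for membership of the limit and again for convergence in norm.\<close>

lemma square_summable_limit:
  fixes X :: "nat \<Rightarrow> 'a ell2"
  assumes lim: "\<And>i. (\<lambda>n. coord (X n) i) \<longlonglongrightarrow> f i"
    and bd: "\<forall>\<^sub>F n in sequentially. norm (X n) \<le> C"
  shows "(\<lambda>i. (cmod (f i))\<^sup>2) summable_on UNIV" "norm (Ell2 f) \<le> C"
proof -
  obtain n where "norm (X n) \<le> C"
    using eventually_happens[OF bd] by auto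
  then have C: "0 \<le> C" using norm_ge_zero[of "X n"] by linarith
  have fin: "(\<Sum>i\<in>F. (cmod (f i))\<^sup>2) \<le> C\<^sup>2" if "finite F" for F
  proof (rule tendsto_upperbound)
    show "(\<lambda>n. \<Sum>i\<in>F. (cmod (coord (X n) i))\<^sup>2) \<longlonglongrightarrow> (\<Sum>i\<in>F. (cmod (f i))\<^sup>2)"
      by (intro tendsto_intros lim)
    show "\<forall>\<^sub>F n in sequentially. (\<Sum>i\<in>F. (cmod (coord (X n) i))\<^sup>2) \<le> C\<^sup>2"
      using bd
    proof eventually_elim
      case (elim n)
      have "(\<Sum>i\<in>F. (cmod (coord (X n) i))\<^sup>2) \<le> (norm (X n))\<^sup>2"
        unfolding norm_ell2_square by (intro finite_sum_le_infsum coord_summable that) auto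
      also have "\<dots> \<le> C\<^sup>2" by (intro power_mono elim norm_ge_zero)
      finally show ?case .
    qed
  qed simp
  show 1: "(\<lambda>i. (cmod (f i))\<^sup>2) summable_on UNIV"
    using fin by (intro nonneg_bdd_above_summable_on bdd_aboveI2[where M = "C\<^sup>2"]) auto
  have "(\<Sum>\<^sub>\<infinity>i. (cmod (f i))\<^sup>2) \<le> C\<^sup>2"
    by (rule infsum_le_finite_sums[OF 1 fin])
  then show "norm (Ell2 f) \<le> C"
    using norm_ell2_le[of "Ell2 f" _ C] has_sum_infsum[OF 1] C by (simp add: coord_Ell2[OF 1])
qed

instance ell2 :: (type) complete_space
proof
  fix X :: "nat \<Rightarrow> 'a ell2" assume X: "Cauchy X"
  have "Cauchy (\<lambda>n. coord (X n) i)" for i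
  proof (rule CauchyI)
    fix e :: real assume "0 < e"
    then obtain N where N: "\<forall>m\<ge>N. \<forall>n\<ge>N. norm (X m - X n) < e"
      using CauchyD[OF X] by blast
    have "cmod (coord (X m) i - coord (X n) i) < e" if "m \<ge> N" "n \<ge> N" for m n
      using le_less_trans[OF coord_le_norm[of "X m - X n" i]] N that by simp
    then show "\<exists>N. \<forall>m\<ge>N. \<forall>n\<ge>N. cmod (coord (X m) i - coord (X n) i) < e" by blast
  qed
  then have "\<exists>l. (\<lambda>n. coord (X n) i) \<longlonglongrightarrow> l" for i
    using Cauchy_convergent[of "\<lambda>n. coord (X n) i"] by (simp add: convergent_def)
  then obtain f where f: "\<And>i. (\<lambda>n. coord (X n) i) \<longlonglongrightarrow> f i"
    by metis
  obtain N0 where N0: "\<forall>m\<ge>N0. \<forall>n\<ge>N0. norm (X m - X n) < 1"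
    using CauchyD[OF X zero_less_one] by blast
  have "\<forall>\<^sub>F n in sequentially. norm (X n) \<le> norm (X N0) + 1"
    using eventually_ge_at_top[of N0]
  proof eventually_elim
    case (elim n) then show ?case
      using N0[rule_format, of n N0] norm_triangle_ineq2[of "X n" "X N0"] by simp
  qed
  then have sf: "(\<lambda>i. (cmod (f i))\<^sup>2) summable_on UNIV"
    using square_summable_limit(1)[OF f] by blast
  have "X \<longlonglongrightarrow> Ell2 f"
  proof (rule LIMSEQ_I)
    fix e :: real assume e: "0 < e"
    obtain N where N: "\<forall>m\<ge>N. \<forall>n\<ge>N. norm (X m - X n) < e/2"
      using CauchyD[OF X, of "e/2"] e by auto
    have "norm (X n - Ell2 f) < e" if "n \<ge> N" for n
    proof -
      \<comment> \<open>\<open>n\<close> stays fixed while the second index of the Cauchy estimate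
        tends to infinity.\<close>
      have "norm (Ell2 (\<lambda>i. coord (X n) i - f i)) \<le> e/2"
      proof (rule square_summable_limit(2)[of "\<lambda>m. X n - X m"])
        show "(\<lambda>m. coord (X n - X m) i) \<longlonglongrightarrow> coord (X n) i - f i" for i
          by (auto intro!: tendsto_intros f)
        show "\<forall>\<^sub>F m in sequentially. norm (X n - X m) \<le> e/2"
          using eventually_ge_at_top[of N] by eventually_elim (use N that in force)
      qed
      moreover have "Ell2 (\<lambda>i. coord (X n) i - f i) = X n - Ell2 f"
        using coord_inverse[of "X n - Ell2 f"] by (simp add: coord_Ell2 sf)
      ultimately show ?thesis using e by simp
    qed
    then show "\<exists>N. \<forall>n\<ge>N. norm (X n - Ell2 f) < e" by blast
  qed
  then show "convergent X" by (auto simp: convergent_def)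
qed

instance ell2 :: (type) banach ..

section \<open>Complex scalars and the complex inner product\<close>

definition cinner :: "'a ell2 \<Rightarrow> 'a ell2 \<Rightarrow> complex"
  where "cinner x y = (\<Sum>\<^sub>\<infinity>i. cnj (coord x i) * coord y i)"

lift_definition scaleC :: "complex \<Rightarrow> 'a ell2 \<Rightarrow> 'a ell2" is "\<lambda>c x i. c * x i"
  subgoal for c x by (rule square_summable_mult[where C = "cmod c"]) auto
  done

declare scaleC.rep_eq [simp]

lemma cinner_abs_summable: "(\<lambda>i. cmod (cnj (coord x i) * coord y i)) summable_on UNIV"
  using coord_inner_summable[of x y] by (simp add: norm_mult)

lemma cinner_summable: "(\<lambda>i. cnj (coord x i) * coord y i) summable_on UNIV"
  by (rule abs_summable_summable[OF cinner_abs_summable])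

lemma Re_cinner: "Re (cinner x y) = x \<bullet> y"
  unfolding cinner_def inner_ell2_def
  by (subst infsum_Re[OF cinner_summable, symmetric]) (simp add: inner_complex_def)

lemma cinner_add_right: "cinner x (y + z) = cinner x y + cinner x z"
  by (simp add: cinner_def distrib_left infsum_add cinner_summable)

lemma cinner_scaleC_right: "cinner x (scaleC c y) = c * cinner x y"
  by (simp add: cinner_def infsum_cmult_right' mult.left_commute)

lemma cinner_commute: "cinner x y = cnj (cinner y x)"
  by (simp add: cinner_def infsum_cnj[symmetric] mult.commute del: infsum_cnj)

lemma cinner_self: "cinner x x = of_real ((norm x)\<^sup>2)"
proof -
  have "Im (cinner x x) = 0"
    using cinner_commute[of x x] by (metis cnj.simps(2) complex_eq_iff neg_equal_zero)
  then show ?thesis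
    by (simp add: complex_eq_iff Re_cinner dot_square_norm)
qed

lemma norm_scaleC: "norm (scaleC c x) = cmod c * norm x"
  by (rule power2_eq_imp_eq)
     (simp_all add: norm_ell2_square norm_mult power_mult_distrib infsum_cmult_right')

lemma cmod_cinner_le: "cmod (cinner x y) \<le> norm x * norm y"
proof (cases "cinner x y = 0")
  case False
  \<comment> \<open>Unimodular phase that turns \<open>cinner x y\<close> into its modulus, so that
    the real Cauchy--Schwarz inequality applies.\<close>
  define c where "c = cnj (cinner x y) / cmod (cinner x y)"
  have c: "cmod c = 1" using False by (simp add: c_def norm_divide)
  have "cnj (cinner x y) * cinner x y = of_real (cmod (cinner x y)) * of_real (cmod (cinner x y))"
    by (metis complex_norm_square mult.commute of_real_power power2_eq_square)
  then have "c * cinner x y = of_real (cmod (cinner x y))"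
    using False by (simp add: c_def)
  then have "cmod (cinner x y) = Re (cinner x (scaleC c y))"
    by (simp add: cinner_scaleC_right)
  also have "\<dots> \<le> norm x * norm (scaleC c y)"
    using Cauchy_Schwarz_ineq2[of x "scaleC c y"] by (simp add: Re_cinner)
  finally show ?thesis by (simp add: norm_scaleC c)
qed simp

section \<open>Uniqueness of accretive square roots\<close>

text \<open>With \<open>Q\<close> = 1 - t (X + e) of norm below 1, the ansatz B = (1 - y) / sqrt t
  turns B^2 = X + e into y = (Q + y^2) / 2, a contraction on a suitable ball. Solving it inside the
  closed set of operators that commute with \<open>B1\<close> and \<open>B2\<close> makes the root
  commute with both.\<close>

lemma blinfun_sqrt_shift:
  fixes X B1 B2 :: "'a::{real_inner, banach} \<Rightarrow>\<^sub>L 'a"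
  assumes acc: "\<And>u. 0 \<le> X u \<bullet> u" and e: "0 < e" "e \<le> 1"
    and c1: "\<And>u. X (B1 u) = B1 (X u)" and c2: "\<And>u. X (B2 u) = B2 (X u)"
  obtains B :: "'a \<Rightarrow>\<^sub>L 'a" where "\<And>u. B (B u) = X u + e *\<^sub>R u"
    "\<And>u. B (B1 u) = B1 (B u)" "\<And>u. B (B2 u) = B2 (B u)"
    "\<And>u. sqrt (e / 2) * (norm u)\<^sup>2 \<le> B u \<bullet> u"
proof -
  define M where "M = norm X + 1"
  have M: "1 \<le> M" by (simp add: M_def)
  \<comment> \<open>Minimises 1 - 2 t e + t^2 M^2, the bound for the square of the norm of
    \<open>Q\<close>; the minimum is 1 - e^2 / M^2.\<close>
  define t where "t = e / M\<^sup>2"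
  have t: "0 < t" using e M by (simp add: t_def)
  have eM: "0 < e\<^sup>2 / M\<^sup>2" "e\<^sup>2 / M\<^sup>2 \<le> 1"
    using e M by (auto simp: divide_le_eq_1 power_mono)
  define Q where "Q = id_blinfun - t *\<^sub>R (X + e *\<^sub>R id_blinfun)"
  define \<rho> where "\<rho> = sqrt (1 - e\<^sup>2 / M\<^sup>2)"
  have \<rho>: "0 \<le> \<rho>" "\<rho> < 1" and \<rho>2: "\<rho>\<^sup>2 = 1 - e\<^sup>2 / M\<^sup>2"
    using eM by (auto simp: \<rho>_def)
  \<comment> \<open>Smaller root of \<eta> = (\<rho> + \<eta>^2) / 2: the fixed point of the scalar
    majorant is the radius of an invariant ball.\<close>
  define \<eta> where "\<eta> = 1 - sqrt (1 - \<rho>)"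
  have \<eta>: "0 \<le> \<eta>" "\<eta> < 1" using \<rho> by (auto simp: \<eta>_def)
  have "(1 - \<eta>)\<^sup>2 = 1 - \<rho>" using \<rho> by (simp add: \<eta>_def)
  then have \<eta>\<rho>: "\<rho> + \<eta>\<^sup>2 = 2 * \<eta>" by (simp add: power2_eq_square algebra_simps)
  have Q: "norm Q \<le> \<rho>"
  proof (rule norm_blinfun_bound)
    fix u
    define w where "w = X u + e *\<^sub>R u"
    have "norm w \<le> norm (X u) + e * norm u"
      using norm_triangle_ineq[of "X u" "e *\<^sub>R u"] e by (simp add: w_def)
    also have "\<dots> \<le> norm X * norm u + 1 * norm u"
      using norm_blinfun[of X u] e by (intro add_mono mult_right_mono) auto
    also have "\<dots> = M * norm u" by (simp add: M_def algebra_simps)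
    finally have "(norm w)\<^sup>2 \<le> (M * norm u)\<^sup>2" by (intro power_mono) auto
    then have 1: "t\<^sup>2 * (norm w)\<^sup>2 \<le> t\<^sup>2 * (M * norm u)\<^sup>2" by (intro mult_left_mono) auto
    have 2: "e * (norm u)\<^sup>2 \<le> u \<bullet> w"
      using acc[of u] by (simp add: w_def inner_add_right inner_commute power2_norm_eq_inner)
    have "Q u = u - t *\<^sub>R w"
      by (simp add: Q_def w_def blinfun.diff_left blinfun.add_left blinfun.scaleR_left)
    then have "(norm (Q u))\<^sup>2 = (u - t *\<^sub>R w) \<bullet> (u - t *\<^sub>R w)"
      by (simp only: power2_norm_eq_inner)
    also have "\<dots> = (norm u)\<^sup>2 - 2 * t * (u \<bullet> w) + t\<^sup>2 * (norm w)\<^sup>2"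
      unfolding power2_norm_eq_inner
      by (simp add: inner_diff_left inner_diff_right inner_commute[of w u] power2_eq_square algebra_simps)
    also have "\<dots> \<le> (norm u)\<^sup>2 - 2 * t * (e * (norm u)\<^sup>2) + t\<^sup>2 * (M * norm u)\<^sup>2"
      using 1 mult_left_mono[OF 2, of "2 * t"] t by linarith
    also have "\<dots> = (norm u)\<^sup>2 * (1 - 2 * t * e + t\<^sup>2 * M\<^sup>2)"
      by (simp add: power_mult_distrib algebra_simps)
    also have "1 - 2 * t * e + t\<^sup>2 * M\<^sup>2 = 1 - 2 * t * e + t * (t * M\<^sup>2)"
      by (simp add: power2_eq_square)
    also have "\<dots> = \<rho>\<^sup>2"
      using M by (simp add: \<rho>2) (simp add: t_def power2_eq_square)
    finally have "(norm (Q u))\<^sup>2 \<le> (\<rho> * norm u)\<^sup>2" by (simp add: power_mult_distrib mult.commute)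
    then show "norm (Q u) \<le> \<rho> * norm u" by (rule power2_le_imp_le) (use \<rho> in simp)
  qed (use \<rho> in simp)
  have Q1: "Q (B1 u) = B1 (Q u)" and Q2: "Q (B2 u) = B2 (Q u)" for u
    by (simp_all add: Q_def blinfun.diff_left blinfun.add_left blinfun.scaleR_left blinfun.diff_right
        blinfun.add_right blinfun.scaleR_right c1 c2)
  define s where "s = {y :: 'a \<Rightarrow>\<^sub>L 'a. norm y \<le> \<eta> \<and> (\<forall>u. blinfun_apply y (B1 u) = B1 (blinfun_apply y u)) \<and>
    (\<forall>u. blinfun_apply y (B2 u) = B2 (blinfun_apply y u))}"
  define F where "F y = (1/2) *\<^sub>R (Q + (y o\<^sub>L y))" for y
  have "closed {y :: 'a \<Rightarrow>\<^sub>L 'a. norm y \<le> \<eta>}"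
    by (intro closed_Collect_le continuous_intros)
  moreover have "closed {y :: 'a \<Rightarrow>\<^sub>L 'a. \<forall>u. blinfun_apply y (C u) = C (blinfun_apply y u)}" for C :: "'a \<Rightarrow>\<^sub>L 'a"
    by (intro closed_Collect_all closed_Collect_eq continuous_intros)
  ultimately have "closed s"
    unfolding s_def by (intro closed_Collect_conj)
  then have cs: "complete s" using complete_eq_closed by blast
  have 0: "0 \<in> s" using \<eta> by (simp add: s_def)
  have "\<exists>!y\<in>s. F y = y"
  proof (rule Banach_fix[OF cs _ \<eta>])
    show "F ` s \<subseteq> s"
    proof (rule image_subsetI)
      fix y assume y: "y \<in> s"
      have "norm (F y) \<le> (norm Q + norm y * norm y) / 2"
        using norm_triangle_ineq[of Q "y o\<^sub>L y"] norm_blinfun_compose[of y y] by (simp add: F_def)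
      also have "\<dots> \<le> (\<rho> + \<eta> * \<eta>) / 2"
        using Q y \<eta> by (intro divide_right_mono add_mono mult_mono) (auto simp: s_def)
      also have "\<dots> = \<eta>" using \<eta>\<rho> by (simp add: power2_eq_square)
      finally show "F y \<in> s"
        using y by (simp add: s_def F_def blinfun.scaleR_left blinfun.add_left blinfun.scaleR_right
            blinfun.add_right Q1 Q2)
    qed
    fix y z assume yz: "y \<in> s" "z \<in> s"
    have "(y o\<^sub>L y) - (z o\<^sub>L z) = (y o\<^sub>L (y - z)) + ((y - z) o\<^sub>L z)"
      by (rule blinfun_eqI) (simp add: blinfun.diff_left blinfun.add_left blinfun.diff_right)
    then have "norm ((y o\<^sub>L y) - (z o\<^sub>L z)) \<le> norm y * norm (y - z) + norm (y - z) * norm z"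
      using norm_triangle_le[OF add_mono[OF norm_blinfun_compose norm_blinfun_compose]] by metis
    also have "\<dots> \<le> \<eta> * norm (y - z) + norm (y - z) * \<eta>"
      using yz by (intro add_mono mult_mono) (auto simp: s_def \<eta>)
    finally have "norm ((y o\<^sub>L y) - (z o\<^sub>L z)) \<le> 2 * (\<eta> * norm (y - z))" by simp
    moreover have "F y - F z = (1/2) *\<^sub>R ((y o\<^sub>L y) - (z o\<^sub>L z))"
      by (simp add: F_def algebra_simps)
    ultimately show "dist (F y) (F z) \<le> \<eta> * dist y z"
      by (simp add: dist_norm)
  qed (use 0 in auto)
  then obtain y where y: "y \<in> s" "F y = y" by blast
  have yy: "y (y u) = 2 *\<^sub>R y u - Q u" for u
    using arg_cong[OF y(2), of "\<lambda>f. 2 *\<^sub>R blinfun_apply f u"]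
    by (simp add: F_def blinfun.scaleR_left blinfun.add_left algebra_simps)
  define B where "B = (1 / sqrt t) *\<^sub>R (id_blinfun - y)"
  show ?thesis
  proof (rule that[of B])
    show "B (B u) = X u + e *\<^sub>R u" for u
    proof -
      have "B (B u) = (1 / t) *\<^sub>R (u - 2 *\<^sub>R y u + y (y u))"
        using t by (simp add: B_def blinfun.scaleR_left blinfun.diff_left blinfun.scaleR_right
            blinfun.diff_right algebra_simps scaleR_2)
      also have "\<dots> = (1 / t) *\<^sub>R (u - Q u)" by (simp add: yy)
      also have "\<dots> = X u + e *\<^sub>R u"
        using t by (simp add: Q_def blinfun.scaleR_left blinfun.diff_left blinfun.add_left)
      finally show ?thesis .
    qed
    show "B (B1 u) = B1 (B u)" "B (B2 u) = B2 (B u)" for u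
      using y(1) by (simp_all add: s_def B_def blinfun.scaleR_left blinfun.diff_left
          blinfun.scaleR_right blinfun.diff_right)
    show "sqrt (e / 2) * (norm u)\<^sup>2 \<le> B u \<bullet> u" for u
    proof -
      \<comment> \<open>Since \<rho> \<le> 1, the number 1 - \<rho> is at least half of 1 - \<rho>^2
        = e t; this is the origin of the lower bound \<open>sqrt (e / 2)\<close>.\<close>
      have "1 - \<rho>\<^sup>2 \<le> 2 * (1 - \<rho>)"
        using zero_le_power2[of "1 - \<rho>"] by (simp add: power2_eq_square algebra_simps)
      then have "e\<^sup>2 / M\<^sup>2 \<le> 2 * (1 - \<rho>)" by (simp add: \<rho>2)
      moreover have "e * t = e\<^sup>2 / M\<^sup>2" by (simp add: t_def power2_eq_square)
      ultimately have "e / 2 * t \<le> 1 - \<rho>" by simp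
      then have "sqrt (e / 2) * sqrt t \<le> 1 - \<eta>"
        unfolding \<eta>_def real_sqrt_mult[symmetric] by simp
      then have 1: "sqrt (e / 2) \<le> (1 - \<eta>) / sqrt t" using t by (simp add: field_simps)
      have "y u \<bullet> u \<le> norm (y u) * norm u" by (rule norm_cauchy_schwarz)
      also have "\<dots> \<le> (\<eta> * norm u) * norm u"
        using norm_blinfun[of y u] y(1) mult_right_mono[of "norm y" \<eta> "norm u"]
        by (intro mult_right_mono) (auto simp: s_def)
      finally have "(1 - \<eta>) * (norm u)\<^sup>2 \<le> (u - y u) \<bullet> u"
        by (simp add: inner_diff_left power2_norm_eq_inner[symmetric] algebra_simps power2_eq_square)
      then have "(1 - \<eta>) * (norm u)\<^sup>2 / sqrt t \<le> (u - y u) \<bullet> u / sqrt t"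
        using t by (intro divide_right_mono) auto
      also have "\<dots> = B u \<bullet> u"
        by (simp add: B_def blinfun.scaleR_left blinfun.diff_left)
      finally show ?thesis
        using mult_right_mono[OF 1, of "(norm u)\<^sup>2"] by simp
    qed
  qed
qed

text \<open>Both roots are within \<open>O(sqrt e)\<close> of a root of \<open>X + e\<close> that commutes with each of them.\<close>
lemma accretive_sqrt_unique_blinfun:
  fixes B1 B2 :: "'a::{real_inner, banach} \<Rightarrow>\<^sub>L 'a"
  assumes sq: "\<And>u. B1 (B1 u) = B2 (B2 u)"
    and acc1: "\<And>u. 0 \<le> B1 u \<bullet> u" and acc2: "\<And>u. 0 \<le> B2 u \<bullet> u"
    and acc: "\<And>u. 0 \<le> B1 (B1 u) \<bullet> u"
  shows "B1 = B2"
proof (rule blinfun_eqI)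
  fix u
  define X where "X = B1 o\<^sub>L B1"
  have X1: "X u = B1 (B1 u)" and X2: "X u = B2 (B2 u)" for u by (simp_all add: X_def sq)
  have est: "norm (B1 u - B2 u) \<le> 2 * (sqrt (2 * e) * norm u)" if e: "0 < e" "e \<le> 1" for e
  proof -
    obtain B :: "'a \<Rightarrow>\<^sub>L 'a" where B: "\<And>u. B (B u) = X u + e *\<^sub>R u"
        "\<And>u. B (B1 u) = B1 (B u)" "\<And>u. B (B2 u) = B2 (B u)"
        "\<And>u. sqrt (e / 2) * (norm u)\<^sup>2 \<le> B u \<bullet> u"
    proof (rule blinfun_sqrt_shift[of X e B1 B2])
      show "0 \<le> X u \<bullet> u" for u using acc by (simp add: X1)
      show "X (B1 u) = B1 (X u)" for u by (simp add: X1)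
      show "X (B2 u) = B2 (X u)" for u by (simp add: X2)
    qed (use e in auto)
    have half: "norm (C u - B u) \<le> sqrt (2 * e) * norm u"
      if C: "\<And>u. C (C u) = X u" "\<And>u. 0 \<le> C u \<bullet> u" "\<And>u. B (C u) = C (B u)" for C :: "'a \<Rightarrow>\<^sub>L 'a"
    proof -
      define d where "d = C u - B u"
      \<comment> \<open>Commutation gives (C + B)(C - B) u = C^2 u - B^2 u = - e u. Pairing with
        \<open>d\<close>, where \<open>C\<close> contributes a nonnegative term, bounds
        \<open>d\<close> through the coercivity of \<open>B\<close>.\<close>
      have "C d + B d = - (e *\<^sub>R u)"
        by (simp add: d_def blinfun.diff_right C(1,3) B(1))
      then have "C d \<bullet> d + B d \<bullet> d = - (e *\<^sub>R u) \<bullet> d"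
        by (simp only: inner_add_left[symmetric])
      then have "sqrt (e / 2) * (norm d)\<^sup>2 \<le> - (e *\<^sub>R u) \<bullet> d"
        using C(2)[of d] B(4)[of d] by linarith
      also have "\<dots> \<le> norm (- (e *\<^sub>R u)) * norm d" by (rule norm_cauchy_schwarz)
      also have "\<dots> = e * norm u * norm d" using e by simp
      finally have 1: "(sqrt (e / 2) * norm d) * norm d \<le> (e * norm u) * norm d"
        by (simp add: power2_eq_square mult.assoc)
      have "sqrt (e / 2) * norm d \<le> e * norm u"
      proof (cases "norm d = 0")
        case False
        then show ?thesis using 1 by (simp only: mult_le_cancel_right) auto
      qed (use e in simp)
      also have "e * norm u = (sqrt (e / 2) * sqrt (2 * e)) * norm u"
        using e by (simp add: real_sqrt_mult[symmetric])
      finally have "sqrt (e / 2) * norm d \<le> sqrt (e / 2) * (sqrt (2 * e) * norm u)" by (simp only: mult.assoc)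
      moreover have "0 < sqrt (e / 2)" using e by simp
      ultimately show ?thesis by (simp only: mult_le_cancel_left_pos d_def)
    qed
    have "norm (B1 u - B2 u) \<le> norm (B1 u - B u) + norm (B2 u - B u)"
        using norm_triangle_ineq4[of "B1 u - B u" "B2 u - B u"] by simp
    then show ?thesis
      using half[of B1] half[of B2] X1 X2 acc1 acc2 B by fastforce
  qed
  have "(\<lambda>n. 2 * (sqrt (2 * (1 / real (Suc n))) * norm u)) \<longlonglongrightarrow> 2 * (sqrt (2 * 0) * norm u)"
    by (intro tendsto_intros LIMSEQ_Suc[OF lim_1_over_n])
  moreover have "norm (B1 u - B2 u) \<le> 2 * (sqrt (2 * (1 / real (Suc n))) * norm u)" for n
    by (rule est) auto
  ultimately have "norm (B1 u - B2 u) \<le> 2 * (sqrt (2 * 0) * norm u)"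
    using LIMSEQ_le_const by blast
  then show "B1 u = B2 u" by simp
qed

text \<open>Accretivity tested on the pair (y - x, z - y) bounds |y|^2 by y.z - x.z + x.y. The
  estimate makes the inverse of a root bounded without any closedness assumption on the
  root.\<close>

lemma accretive_relation_bound:
  fixes x y z :: "'a::real_inner"
  assumes R: "subspace R" "\<And>f u. (f, u) \<in> R \<Longrightarrow> 0 \<le> f \<bullet> u"
    and xyz: "(x, y) \<in> R" "(y, z) \<in> R" and C: "norm x \<le> C * norm z" "0 \<le> C"
  shows "norm y \<le> (1 + 2 * C) * norm z"
proof (cases "norm y \<le> norm z")
  case True
  also have "norm z \<le> (1 + 2 * C) * norm z" using C by (simp add: algebra_simps)
  finally show ?thesis .
next
  case False
  have "(y, z) - (x, y) \<in> R" using subspace_diff[OF R(1) xyz(2,1)] .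
  then have "0 \<le> (y - x) \<bullet> (z - y)" using R(2) by simp
  then have "(norm y)\<^sup>2 \<le> y \<bullet> z + (- x) \<bullet> z + x \<bullet> y"
    by (simp add: inner_diff inner_commute power2_norm_eq_inner)
  also have "\<dots> \<le> norm y * norm z + norm x * norm z + norm x * norm y"
    using norm_cauchy_schwarz[of y z] norm_cauchy_schwarz[of "-x" z] norm_cauchy_schwarz[of x y] by simp
  also have "\<dots> \<le> norm y * norm z + (C * norm z) * norm y + (C * norm z) * norm y"
    using C False by (intro add_mono mult_mono) auto
  finally have "norm y * norm y \<le> ((1 + 2 * C) * norm z) * norm y"
    by (simp add: power2_eq_square algebra_simps)
  moreover have "0 < norm y" using False norm_ge_zero[of z] by linarith
  ultimately show ?thesis by (simp only: mult_le_cancel_right_pos)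
qed

text \<open>\<open>R\<close> is onto because its square is, and injective because (x, 0) in
  \<open>R\<close> puts (x, 0) into \<open>R O R\<close>. Inverting trades an unbounded root for a
  bounded operator.\<close>

lemma accretive_root_inverse:
  fixes R :: "('a::{real_inner, banach} \<times> 'a) set"
  assumes R: "subspace R" "\<And>f u. (f, u) \<in> R \<Longrightarrow> 0 \<le> f \<bullet> u"
    and onto: "\<And>u. \<exists>f. (f, u) \<in> R O R" and C: "\<And>f u. (f, u) \<in> R O R \<Longrightarrow> norm f \<le> C * norm u"
  obtains B :: "'a \<Rightarrow>\<^sub>L 'a" where "R = {(B u, u) | u. True}"
proof -
  have z: "(0, 0) \<in> R" using subspace_0[OF R(1)] by (simp add: zero_prod_def)
  have inj: "x = 0" if "(x, 0) \<in> R" for x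
    using C[of x 0] that z by auto
  have inj': "x = x'" if "(x, u) \<in> R" "(x', u) \<in> R" for x x' u
    using inj[of "x - x'"] subspace_diff[OF R(1) that] by simp
  have "\<exists>x. (x, u) \<in> R" for u using onto[of u] by auto
  then obtain b where b: "\<And>u. (b u, u) \<in> R" by metis
  have beq: "b u = x" if "(x, u) \<in> R" for x u using inj'[OF b that] .
  define K where "K = \<bar>C\<bar>"
  have "bounded_linear b"
  proof (rule bounded_linear_intro)
    show "b (u + v) = b u + b v" for u v
      using subspace_add[OF R(1) b[of u] b[of v]] by (intro beq) simp
    show "b (r *\<^sub>R u) = r *\<^sub>R b u" for r u
      using subspace_scale[OF R(1) b[of u], of r] by (intro beq) simp
    show "norm (b u) \<le> norm u * (1 + 2 * K)" for u
    proof -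
      have "norm (b (b u)) \<le> C * norm u" using C b by blast
      also have "\<dots> \<le> K * norm u" by (intro mult_right_mono) (auto simp: K_def)
      finally show ?thesis
        using accretive_relation_bound[OF R b b, of u K] by (simp add: K_def mult.commute)
    qed
  qed
  then have "blinfun_apply (Blinfun b) = b" by (rule bounded_linear_Blinfun_apply)
  then have "R = {(Blinfun b u, u) | u. True}" using b beq by auto
  then show ?thesis by (rule that)
qed

text \<open>The inverses of both relations are bounded accretive roots of the same bounded operator,
  the inverse of the common square.\<close>

lemma accretive_root_unique:
  fixes R1 R2 :: "('a::{real_inner, banach} \<times> 'a) set"
  assumes R1: "subspace R1" "\<And>f u. (f, u) \<in> R1 \<Longrightarrow> 0 \<le> f \<bullet> u"
    and R2: "subspace R2" "\<And>f u. (f, u) \<in> R2 \<Longrightarrow> 0 \<le> f \<bullet> u"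
    and eq: "R1 O R1 = R2 O R2"
    and T: "\<And>u. \<exists>f. (f, u) \<in> R1 O R1" "\<And>f u. (f, u) \<in> R1 O R1 \<Longrightarrow> norm f \<le> C * norm u"
      "\<And>f u. (f, u) \<in> R1 O R1 \<Longrightarrow> 0 \<le> f \<bullet> u"
  shows "R1 = R2"
proof -
  obtain B1 :: "'a \<Rightarrow>\<^sub>L 'a" where B1: "R1 = {(B1 u, u) | u. True}"
    using accretive_root_inverse[OF R1 T(1,2)] by blast
  obtain B2 :: "'a \<Rightarrow>\<^sub>L 'a" where B2: "R2 = {(B2 u, u) | u. True}"
    using accretive_root_inverse[OF R2, of C] T(1,2) unfolding eq by blast
  have "(B1 (B1 u), u) \<in> R1 O R1" for u unfolding B1 by auto
  moreover from this have "(B1 (B1 u), u) \<in> R2 O R2" for u unfolding eq .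
  then have "B1 (B1 u) = B2 (B2 u)" for u unfolding B2 by auto
  ultimately have "B1 = B2"
    using R1(2) R2(2) T(3) by (intro accretive_sqrt_unique_blinfun) (auto simp: B1 B2)
  then show ?thesis by (simp add: B1 B2)
qed

section \<open>A Riccati equation for Hilbert--Schmidt perturbations\<close>

text \<open>On vectors a diagonal operator; on families indexed by pairs the Schur (entrywise)
  product with a bounded matrix.\<close>

definition dmul :: "('a \<Rightarrow> complex) \<Rightarrow> 'a ell2 \<Rightarrow> 'a ell2"
  where "dmul d x = Ell2 (\<lambda>i. d i * coord x i)"

lemma coord_dmul:
  assumes "\<And>i. cmod (d i) \<le> C"
  shows "coord (dmul d x) i = d i * coord x i"
  by (simp add: dmul_def coord_Ell2[OF square_summable_mult[OF coord_summable assms]])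

lemma norm_dmul_le:
  assumes d: "\<And>i. cmod (d i) \<le> C"
  shows "norm (dmul d x) \<le> C * norm x"
proof -
  have C: "0 \<le> C" using d[of undefined] norm_ge_zero[of "d undefined"] by linarith
  have "norm (dmul d x) \<le> norm (C *\<^sub>R x)"
    using d C by (intro norm_mono_ell2) (auto simp: coord_dmul[OF d] norm_mult intro: mult_right_mono)
  then show ?thesis using C by simp
qed

lemma dmul_diff:
  assumes d: "\<And>i. cmod (d i) \<le> C"
  shows "dmul d x - dmul d y = dmul d (x - y)"
  by (rule ell2_eqI) (simp add: coord_dmul[OF d] algebra_simps)

text \<open>Conjugated in advance, since \<open>cinner\<close> conjugates its first argument: row
  \<open>i\<close> applied to \<open>v\<close> is \<open>cinner (crow Z i) v\<close>.\<close>

definition crow :: "('a \<times> 'b) ell2 \<Rightarrow> 'a \<Rightarrow> 'b ell2"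
  where "crow Z i = Ell2 (\<lambda>j. cnj (coord Z (i, j)))"

definition col :: "('a \<times> 'b) ell2 \<Rightarrow> 'b \<Rightarrow> 'a ell2"
  where "col Z j = Ell2 (\<lambda>i. coord Z (i, j))"

lemma square_summable_row: "(\<lambda>j. (cmod (coord Z (i, j)))\<^sup>2) summable_on UNIV"
proof -
  have "(\<lambda>(i, j). (cmod (coord Z (i, j)))\<^sup>2) summable_on (UNIV \<times> UNIV)"
    using coord_summable[of Z] by (simp add: case_prod_unfold)
  then show ?thesis by (rule summable_on_SigmaD1) auto
qed

lemma square_summable_col: "(\<lambda>i. (cmod (coord Z (i, j)))\<^sup>2) summable_on UNIV"
proof -
  have "(\<lambda>(j, i). (cmod (coord Z (i, j)))\<^sup>2) summable_on (UNIV \<times> UNIV)"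
    using summable_on_swap[of "\<lambda>p. (cmod (coord Z p))\<^sup>2" UNIV UNIV] coord_summable[of Z] by simp
  then show ?thesis by (rule summable_on_SigmaD1) auto
qed

lemma coord_crow [simp]: "coord (crow Z i) j = cnj (coord Z (i, j))"
  unfolding crow_def by (subst coord_Ell2) (simp_all add: square_summable_row)

lemma coord_col [simp]: "coord (col Z j) i = coord Z (i, j)"
  unfolding col_def by (subst coord_Ell2) (simp_all add: square_summable_col)

lemma crow_norm_has_sum: "((\<lambda>i. (norm (crow Z i))\<^sup>2) has_sum (norm Z)\<^sup>2) UNIV"
proof (rule has_sum_SigmaD)
  show "((\<lambda>p. (cmod (coord Z p))\<^sup>2) has_sum (norm Z)\<^sup>2) (UNIV \<times> UNIV)"
    using norm_ell2_square_has_sum[of Z] by simp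
  show "((\<lambda>j. (cmod (coord Z (i, j)))\<^sup>2) has_sum (norm (crow Z i))\<^sup>2) UNIV" for i
    using norm_ell2_square_has_sum[of "crow Z i"] by simp
qed

lemma col_norm_has_sum: "((\<lambda>j. (norm (col Z j))\<^sup>2) has_sum (norm Z)\<^sup>2) UNIV"
proof (rule has_sum_SigmaD)
  show "((\<lambda>(j, i). (cmod (coord Z (i, j)))\<^sup>2) has_sum (norm Z)\<^sup>2) (UNIV \<times> UNIV)"
    using norm_ell2_square_has_sum[of Z] has_sum_swap[where f = "\<lambda>p. (cmod (coord Z p))\<^sup>2" and A = UNIV and B = UNIV] by simp
  show "((\<lambda>i. case (j, i) of (j, i) \<Rightarrow> (cmod (coord Z (i, j)))\<^sup>2) has_sum (norm (col Z j))\<^sup>2) UNIV" for j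
    using norm_ell2_square_has_sum[of "col Z j"] by simp
qed

text \<open>A square-summable matrix acts as a Hilbert--Schmidt operator; its \<open>ell2\<close>
  norm dominates the operator norm and is submultiplicative.\<close>

definition mat_app :: "('a \<times> 'b) ell2 \<Rightarrow> 'b ell2 \<Rightarrow> 'a ell2"
  where "mat_app Z v = Ell2 (\<lambda>i. cinner (crow Z i) v)"

definition mat_mul :: "('a \<times> 'b) ell2 \<Rightarrow> ('b \<times> 'c) ell2 \<Rightarrow> ('a \<times> 'c) ell2"
  where "mat_mul Z W = Ell2 (\<lambda>(i, k). cinner (crow Z i) (col W k))"

lemma cmod_cinner_square_le: "(cmod (cinner x y))\<^sup>2 \<le> (norm x)\<^sup>2 * (norm y)\<^sup>2"
  unfolding power_mult_distrib[symmetric] by (intro power_mono cmod_cinner_le) auto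

lemma square_summable_mat_app: "(\<lambda>i. (cmod (cinner (crow Z i) v))\<^sup>2) summable_on UNIV"
  by (rule summable_on_comparison_test[OF summable_on_cmult_left[OF has_sum_imp_summable[OF crow_norm_has_sum]]])
     (use cmod_cinner_square_le in auto)

lemma coord_mat_app: "coord (mat_app Z v) i = cinner (crow Z i) v"
  by (simp add: mat_app_def coord_Ell2 square_summable_mat_app)

lemma norm_mat_app_le: "norm (mat_app Z v) \<le> norm Z * norm v"
proof (rule power2_le_imp_le)
  have "(norm (mat_app Z v))\<^sup>2 \<le> (norm Z)\<^sup>2 * (norm v)\<^sup>2"
    by (rule has_sum_mono[OF norm_ell2_square_has_sum has_sum_cmult_left[OF crow_norm_has_sum]])
       (simp add: coord_mat_app cmod_cinner_square_le)
  then show "(norm (mat_app Z v))\<^sup>2 \<le> (norm Z * norm v)\<^sup>2" by (simp add: power_mult_distrib)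
qed simp

lemma mat_app_add: "mat_app Z (v + w) = mat_app Z v + mat_app Z w"
  by (rule ell2_eqI) (simp add: coord_mat_app cinner_add_right)

lemma mat_app_scaleC: "mat_app Z (scaleC c v) = scaleC c (mat_app Z v)"
  by (rule ell2_eqI) (simp add: coord_mat_app cinner_scaleC_right)

lemma scaleC_minus_one: "scaleC (-1) v = - v"
  by (rule ell2_eqI) simp

lemma mat_app_diff: "mat_app Z (v - w) = mat_app Z v - mat_app Z w"
  using mat_app_add[of Z v "scaleC (-1) w"] by (simp add: mat_app_scaleC) (simp add: scaleC_minus_one)

lemma square_summable_product:
  assumes "(\<lambda>i. (cmod (x i))\<^sup>2) summable_on UNIV" "(\<lambda>j. (cmod (y j))\<^sup>2) summable_on UNIV"
  shows "(\<lambda>p. (cmod (x (fst p) * y (snd p)))\<^sup>2) summable_on UNIV"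
proof -
  have "(\<lambda>p. (cmod (x (fst p) * y (snd p)))\<^sup>2) summable_on UNIV \<times> UNIV"
  proof (rule summable_on_SigmaI)
    show "((\<lambda>j. (cmod (x (fst (i, j)) * y (snd (i, j))))\<^sup>2) has_sum
        (cmod (x i))\<^sup>2 * (\<Sum>\<^sub>\<infinity>j. (cmod (y j))\<^sup>2)) UNIV" for i
      using has_sum_cmult_right[OF has_sum_infsum[OF assms(2)]] by (simp add: norm_mult power_mult_distrib)
    show "(\<lambda>i. (cmod (x i))\<^sup>2 * (\<Sum>\<^sub>\<infinity>j. (cmod (y j))\<^sup>2)) summable_on UNIV"
      by (rule summable_on_cmult_left[OF assms(1)])
  qed simp
  then show ?thesis by simp
qed

text \<open>Majorants for the entries of a product: entry (i, k) is at most the norm of row i times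
  the norm of column k, and the squares of these numbers sum exactly to the product of the squared
  norms.\<close>

lemma mat_mul_bound:
  "(\<lambda>p. (norm (crow Z (fst p)) * norm (col W (snd p)))\<^sup>2) summable_on UNIV"
  "((\<lambda>p. (norm (crow Z (fst p)) * norm (col W (snd p)))\<^sup>2) has_sum (norm Z * norm W)\<^sup>2) UNIV"
proof -
  show 1: "(\<lambda>p. (norm (crow Z (fst p)) * norm (col W (snd p)))\<^sup>2) summable_on UNIV"
    using square_summable_product[of "\<lambda>i. of_real (norm (crow Z i))" "\<lambda>k. of_real (norm (col W k))"]
      has_sum_imp_summable[OF crow_norm_has_sum, of Z] has_sum_imp_summable[OF col_norm_has_sum, of W]
    by (simp add: norm_mult del: of_real_mult)
  have "((\<lambda>p. (norm (crow Z (fst p)) * norm (col W (snd p)))\<^sup>2) has_sum (norm Z * norm W)\<^sup>2) (UNIV \<times> UNIV)"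
  proof (rule has_sum_SigmaI)
    show "((\<lambda>k. (norm (crow Z (fst (i, k))) * norm (col W (snd (i, k))))\<^sup>2) has_sum
        ((norm (crow Z i))\<^sup>2 * (norm W)\<^sup>2)) UNIV" for i
      using has_sum_cmult_right[OF col_norm_has_sum] by (simp add: power_mult_distrib)
    show "((\<lambda>i. (norm (crow Z i))\<^sup>2 * (norm W)\<^sup>2) has_sum (norm Z * norm W)\<^sup>2) UNIV"
      using has_sum_cmult_left[OF crow_norm_has_sum] by (simp add: power_mult_distrib)
  qed (use 1 in simp)
  then show "((\<lambda>p. (norm (crow Z (fst p)) * norm (col W (snd p)))\<^sup>2) has_sum (norm Z * norm W)\<^sup>2) UNIV"
    by simp
qed

lemma coord_mat_mul: "coord (mat_mul Z W) (i, k) = cinner (crow Z i) (col W k)"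
proof -
  have "(\<lambda>p. (cmod (case p of (i, k) \<Rightarrow> cinner (crow Z i) (col W k)))\<^sup>2) summable_on UNIV"
    by (rule summable_on_comparison_test[OF mat_mul_bound(1)[of Z W]])
       (auto simp: cmod_cinner_square_le power_mult_distrib)
  then show ?thesis by (simp add: mat_mul_def coord_Ell2)
qed

lemma norm_mat_mul_le: "norm (mat_mul Z W) \<le> norm Z * norm W"
proof (rule power2_le_imp_le)
  show "(norm (mat_mul Z W))\<^sup>2 \<le> (norm Z * norm W)\<^sup>2"
    by (rule has_sum_mono[OF norm_ell2_square_has_sum mat_mul_bound(2)])
       (auto simp: coord_mat_mul cmod_cinner_square_le power_mult_distrib)
qed simp

lemma cinner_diff_right: "cinner x (y - z) = cinner x y - cinner x z"
  using cinner_add_right[of x "y - z" z] by (simp add: algebra_simps)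

lemma cinner_diff_left: "cinner (x - y) z = cinner x z - cinner y z"
  by (metis cinner_commute cinner_diff_right complex_cnj_diff)

lemma cinner_add_left: "cinner (x + y) z = cinner x z + cinner y z"
  by (metis cinner_commute cinner_add_right complex_cnj_add)

lemma mat_mul_diff_left: "mat_mul (Z - Z') W = mat_mul Z W - mat_mul Z' W"
proof (rule ell2_eqI)
  have "crow (Z - Z') i = crow Z i - crow Z' i" for i by (rule ell2_eqI) simp
  then show "coord (mat_mul (Z - Z') W) p = coord (mat_mul Z W - mat_mul Z' W) p" for p
    by (cases p) (simp add: coord_mat_mul cinner_diff_left)
qed

lemma mat_mul_diff_right: "mat_mul Z (W - W') = mat_mul Z W - mat_mul Z W'"
proof (rule ell2_eqI)
  have "col (W - W') i = col W i - col W' i" for i by (rule ell2_eqI) simp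
  then show "coord (mat_mul Z (W - W')) p = coord (mat_mul Z W - mat_mul Z W') p" for p
    by (cases p) (simp add: coord_mat_mul cinner_diff_right)
qed

lemma mat_mul_app: "mat_app (mat_mul Z W) v = mat_app Z (mat_app W v)"
proof (rule ell2_eqI)
  fix i
  define h where "h = (\<lambda>j k. coord Z (i, j) * coord W (j, k) * coord v k)"
  \<comment> \<open>For fixed \<open>i\<close> the rank-one matrix with entries Z_ij v_k is
    square-summable, so its pairing with \<open>W\<close> converges absolutely and the two sums may
    be exchanged.\<close>
  have "(\<lambda>p. (cmod (coord Z (i, fst p) * coord v (snd p)))\<^sup>2) summable_on UNIV"
    by (intro square_summable_product square_summable_row coord_summable)
  then have "(\<lambda>p. cmod (coord Z (i, fst p) * coord v (snd p)) * cmod (coord W p)) summable_on UNIV"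
    by (intro inner_summable coord_summable)
  then have "(\<lambda>p. norm (case p of (j, k) \<Rightarrow> h j k)) summable_on UNIV"
    by (simp add: h_def case_prod_unfold norm_mult mult_ac)
  then have s: "(\<lambda>(j, k). h j k) summable_on UNIV \<times> UNIV"
    using abs_summable_summable by simp
  have "coord (mat_app (mat_mul Z W) v) i = (\<Sum>\<^sub>\<infinity>k. \<Sum>\<^sub>\<infinity>j. h j k)"
    by (simp add: coord_mat_app cinner_def coord_mat_mul h_def infsum_cmult_left')
  also have "\<dots> = (\<Sum>\<^sub>\<infinity>j. \<Sum>\<^sub>\<infinity>k. h j k)"
    by (rule infsum_swap_banach[OF s, symmetric])
  also have "\<dots> = coord (mat_app Z (mat_app W v)) i"
    by (simp add: coord_mat_app cinner_def h_def infsum_cmult_right' mult.assoc)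
  finally show "coord (mat_app (mat_mul Z W) v) i = coord (mat_app Z (mat_app W v)) i" .
qed

text \<open>All multipliers being contractions, the quadratic term is at most the square of the norm
  of \<open>W\<close>. On the ball of radius 1/4 this is 1/16, so 1/8 + 1/16 stays inside, and the
  Lipschitz constant is 1/2.\<close>

lemma quadratic_matrix_equation:
  fixes W0 :: "('a \<times> 'a) ell2" and \<alpha> \<beta> \<kappa> :: "'a \<times> 'a \<Rightarrow> complex"
  assumes W0: "norm W0 \<le> 1/8"
    and a: "\<And>p. cmod (\<alpha> p) \<le> 1" and b: "\<And>p. cmod (\<beta> p) \<le> 1" and k: "\<And>p. cmod (\<kappa> p) \<le> 1"
  obtains W where "norm W \<le> 1/4" "W = W0 - dmul \<kappa> (mat_mul (dmul \<alpha> W) (dmul \<beta> W))"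
proof -
  define G where "G W = dmul \<kappa> (mat_mul (dmul \<alpha> W) (dmul \<beta> W))" for W
  have lip: "norm (G W - G V) \<le> (norm W + norm V) * norm (W - V)" for W V
  proof -
    have "mat_mul (dmul \<alpha> W) (dmul \<beta> W) - mat_mul (dmul \<alpha> V) (dmul \<beta> V)
        = mat_mul (dmul \<alpha> W) (dmul \<beta> (W - V)) + mat_mul (dmul \<alpha> (W - V)) (dmul \<beta> V)"
      by (simp add: dmul_diff[of \<alpha> 1, OF a, symmetric] dmul_diff[of \<beta> 1, OF b, symmetric] mat_mul_diff_left mat_mul_diff_right)
    then have "norm (G W - G V) \<le> norm (mat_mul (dmul \<alpha> W) (dmul \<beta> (W - V)) + mat_mul (dmul \<alpha> (W - V)) (dmul \<beta> V))"
      using norm_dmul_le[of \<kappa> 1, OF k] by (simp add: G_def dmul_diff[of \<kappa> 1, OF k])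
    also have "\<dots> \<le> norm (dmul \<alpha> W) * norm (dmul \<beta> (W - V)) + norm (dmul \<alpha> (W - V)) * norm (dmul \<beta> V)"
      by (intro norm_triangle_le add_mono norm_mat_mul_le)
    also have "\<dots> \<le> norm W * norm (W - V) + norm (W - V) * norm V"
      using norm_dmul_le[of \<alpha> 1, OF a] norm_dmul_le[of \<beta> 1, OF b] by (intro add_mono mult_mono) auto
    finally show ?thesis by (simp add: algebra_simps)
  qed
  have G0: "norm (G W) \<le> norm W * norm W" for W
  proof -
    have "norm (G W) \<le> norm (mat_mul (dmul \<alpha> W) (dmul \<beta> W))"
      using norm_dmul_le[of \<kappa> 1, OF k] by (simp add: G_def)
    also have "\<dots> \<le> norm (dmul \<alpha> W) * norm (dmul \<beta> W)" by (rule norm_mat_mul_le)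
    also have "\<dots> \<le> norm W * norm W"
      using norm_dmul_le[of \<alpha> 1, OF a] norm_dmul_le[of \<beta> 1, OF b] by (intro mult_mono) auto
    finally show ?thesis .
  qed
  have "\<exists>!W\<in>cball 0 (1/4). W0 - G W = W"
  proof (rule Banach_fix[of _ "1/2"])
    show "complete (cball (0 :: ('a \<times> 'a) ell2) (1/4))" using complete_eq_closed by blast
    show "(\<lambda>W. W0 - G W) ` cball 0 (1/4) \<subseteq> cball 0 (1/4)"
    proof (rule image_subsetI)
      fix W :: "('a \<times> 'a) ell2" assume "W \<in> cball 0 (1/4)"
      then have "norm W * norm W \<le> 1/4 * (1/4)" by (intro mult_mono) auto
      then show "W0 - G W \<in> cball 0 (1/4)"
        using W0 G0[of W] norm_triangle_ineq4[of W0 "G W"] by simp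
    qed
    fix W V :: "('a \<times> 'a) ell2" assume "W \<in> cball 0 (1/4)" "V \<in> cball 0 (1/4)"
    then have "(norm W + norm V) * norm (W - V) \<le> 1/2 * norm (W - V)"
      by (intro mult_right_mono) auto
    then show "dist (W0 - G W) (W0 - G V) \<le> 1/2 * dist W V"
      using lip[of W V] by (simp add: dist_norm norm_minus_commute)
  qed auto
  then show ?thesis using that by (metis G_def mem_cball_0)
qed

text \<open>Three normalisations of one matrix: \<open>Zl\<close> is \<Lambda>^-1 Y,
  \<open>Zr\<close> is Y \<Lambda>^-1, and \<open>H\<close> is \<Lambda>^-1/2 Y \<Lambda>^-1/2.
  \<open>Y\<close> itself is only a family of entries, as it need not define a bounded
  operator.\<close>

locale diag_perturbation =
  fixes lam :: "nat \<Rightarrow> real" and Y :: "nat \<Rightarrow> nat \<Rightarrow> complex" and Zl Zr H :: "(nat \<times> nat) ell2"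
  assumes lam: "\<And>n. 1 \<le> lam n"
    and Zl: "\<And>m n. coord Zl (m, n) = Y m n / lam m" "norm Zl \<le> 1/4"
    and Zr: "\<And>m n. coord Zr (m, n) = Y m n / lam n" "norm Zr \<le> 1/4"
    and H: "\<And>m n. coord H (m, n) = Y m n / sqrt (lam m * lam n)" "norm H \<le> 1/4"

text \<open>Factorises \<open>\<Lambda>\<^sup>2 + P\<close> as \<open>(\<Lambda> + Y)\<^sup>2\<close>, where \<open>\<Lambda>\<close> is the diagonal matrix of \<open>lam\<close>. The unknown of the
  fixed point equation is \<open>Y m n / min (lam m) (lam n)\<close>.\<close>
lemma riccati_solution:
  fixes lam :: "nat \<Rightarrow> real" and P :: "nat \<Rightarrow> nat \<Rightarrow> complex"
  assumes lam: "\<And>n. 1 \<le> lam n"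
    and W0: "\<And>m n. coord W0 (m, n) = P m n / ((lam m + lam n) * min (lam m) (lam n))" "norm W0 \<le> 1/8"
  obtains Y Zl Zr H where "diag_perturbation lam Y Zl Zr H"
    "\<And>m n. of_real (lam m + lam n) * Y m n + of_real (lam m * lam n) * coord (mat_mul Zl Zr) (m, n) = P m n"
proof -
  have pos: "0 < lam n" for n using lam[of n] by linarith
  define mn where "mn m n = min (lam m) (lam n)" for m n
  have mnpos: "0 < mn m n" for m n by (simp add: mn_def pos)
  \<comment> \<open>These ratios, each at most 1, turn W = Y / min into \<open>Zl\<close>,
    \<open>Zr\<close> and \<open>H\<close>.\<close>
  define \<alpha> where "\<alpha> = (\<lambda>(m, n). of_real (mn m n / lam m) :: complex)"
  define \<beta> where "\<beta> = (\<lambda>(m, n). of_real (mn m n / lam n) :: complex)"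
  define \<gamma> where "\<gamma> = (\<lambda>(m, n). of_real (mn m n / sqrt (lam m * lam n)) :: complex)"
  \<comment> \<open>The numbers lam m lam n (Zl Zr)_mn are the entries of Y^2. Since lam m lam n is
    the product of minimum and maximum, division of the Riccati equation by lam m + lam n and by the
    minimum leaves this factor in front of Zl Zr.\<close>
  define \<kappa> where "\<kappa> = (\<lambda>(m, n). of_real (max (lam m) (lam n) / (lam m + lam n)) :: complex)"
  have a: "cmod (\<alpha> p) \<le> 1" and b: "cmod (\<beta> p) \<le> 1" and k: "cmod (\<kappa> p) \<le> 1" and c: "cmod (\<gamma> p) \<le> 1" for p
  proof -
    obtain m n where p: "p = (m, n)" by (cases p)
    have 1: "mn m n \<le> lam m" "mn m n \<le> lam n" "max (lam m) (lam n) \<le> lam m + lam n"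
      using pos[of m] pos[of n] by (auto simp: mn_def)
    have "mn m n = sqrt (mn m n * mn m n)" using mnpos[of m n] by simp
    also have "\<dots> \<le> sqrt (lam m * lam n)"
      using 1 mnpos[of m n] pos[of m] by (intro real_sqrt_le_mono mult_mono) auto
    finally have 2: "mn m n \<le> sqrt (lam m * lam n)" .
    have nn: "0 < lam m * lam n" using pos by simp
    have q: "cmod (of_real (x / y)) \<le> 1" if "0 < x" "x \<le> y" for x y :: real
      using that by (simp add: norm_divide)
    have "0 < max (lam m) (lam n)" using pos[of m] by (simp add: max_def pos)
    then show "cmod (\<alpha> p) \<le> 1" "cmod (\<beta> p) \<le> 1" "cmod (\<kappa> p) \<le> 1" "cmod (\<gamma> p) \<le> 1"
      unfolding p \<alpha>_def \<beta>_def \<kappa>_def \<gamma>_def prod.case by (intro q 1 2 mnpos; assumption)+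
  qed
  obtain W where W: "norm W \<le> 1/4" "W = W0 - dmul \<kappa> (mat_mul (dmul \<alpha> W) (dmul \<beta> W))"
    by (rule quadratic_matrix_equation[of W0 \<alpha> \<beta> \<kappa>, OF W0(2) a b k])
  define Y where "Y m n = coord W (m, n) * mn m n" for m n
  have "diag_perturbation lam Y (dmul \<alpha> W) (dmul \<beta> W) (dmul \<gamma> W)"
  proof (rule diag_perturbation.intro)
    show "norm (dmul \<alpha> W) \<le> 1/4" by (rule order_trans[OF norm_dmul_le[of \<alpha> 1 W, OF a]]) (use W(1) in simp)
    show "norm (dmul \<beta> W) \<le> 1/4" by (rule order_trans[OF norm_dmul_le[of \<beta> 1 W, OF b]]) (use W(1) in simp)
    show "norm (dmul \<gamma> W) \<le> 1/4" by (rule order_trans[OF norm_dmul_le[of \<gamma> 1 W, OF c]]) (use W(1) in simp)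
    show "coord (dmul \<alpha> W) (m, n) = Y m n / lam m" "coord (dmul \<beta> W) (m, n) = Y m n / lam n"
      "coord (dmul \<gamma> W) (m, n) = Y m n / sqrt (lam m * lam n)" for m n
      unfolding coord_dmul[of \<alpha> 1, OF a] coord_dmul[of \<beta> 1, OF b] coord_dmul[of \<gamma> 1, OF c]
      by (simp_all add: \<alpha>_def \<beta>_def \<gamma>_def Y_def)
  qed (rule lam)
  moreover have "of_real (lam m + lam n) * Y m n + of_real (lam m * lam n) * coord (mat_mul (dmul \<alpha> W) (dmul \<beta> W)) (m, n) = P m n" for m n
  proof -
    define q where "q = coord (mat_mul (dmul \<alpha> W) (dmul \<beta> W)) (m, n)"
    define s where "s = lam m + lam n"
    have s: "0 < s" using pos[of m] pos[of n] by (simp add: s_def)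
    have "coord W (m, n) = coord W0 (m, n) - \<kappa> (m, n) * q"
      using arg_cong[OF W(2), of "\<lambda>w. coord w (m, n)"] by (simp add: coord_dmul[of \<kappa> 1, OF k] q_def)
    also have "\<dots> = P m n / (s * mn m n) - of_real (max (lam m) (lam n) / s) * q"
      by (simp add: W0(1) \<kappa>_def mn_def s_def)
    finally have "s * mn m n * coord W (m, n) = P m n - of_real (mn m n * max (lam m) (lam n)) * q"
      using s mnpos[of m n] by (simp add: field_simps)
    moreover have "mn m n * max (lam m) (lam n) = lam m * lam n"
      by (auto simp: mn_def min_def max_def)
    ultimately show ?thesis unfolding q_def[symmetric] Y_def s_def by (simp add: mult_ac)
  qed
  ultimately show ?thesis by (rule that)
qed

section \<open>Perturbed diagonal operators and their roots\<close>

lemma mat_app_add_mat: "mat_app (Z + W) v = mat_app Z v + mat_app W v"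
proof (rule ell2_eqI)
  have "crow (Z + W) i = crow Z i + crow W i" for i by (rule ell2_eqI) simp
  then show "coord (mat_app (Z + W) v) i = coord (mat_app Z v + mat_app W v) i" for i
    by (simp add: coord_mat_app cinner_add_left)
qed

lemma scaleC_one [simp]: "scaleC 1 x = x"
  by (rule ell2_eqI) simp

text \<open>The perturbation of the identity has norm at most 2/4 = 1/2. The allowance 2 for
  \<open>d\<close> is made for the resolvent factors lam / (lam + z).\<close>

lemma contraction_onto:
  fixes Z :: "('a \<times> 'a) ell2"
  assumes Z: "norm Z \<le> 1/4" and d: "\<And>i. cmod (d i) \<le> 2"
  obtains y where "y + mat_app Z (dmul d y) = u"
proof -
  have "\<exists>!y\<in>UNIV. u - mat_app Z (dmul d y) = y"
  proof (rule Banach_fix[of _ "1/2"])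
    show "complete (UNIV :: 'a ell2 set)" by (rule complete_UNIV)
    fix x y :: "'a ell2"
    have "norm (mat_app Z (dmul d y) - mat_app Z (dmul d x)) = norm (mat_app Z (dmul d (y - x)))"
      by (simp add: mat_app_diff[symmetric] dmul_diff[of d 2, OF d])
    also have "\<dots> \<le> norm Z * norm (dmul d (y - x))" by (rule norm_mat_app_le)
    also have "\<dots> \<le> 1/4 * (2 * norm (y - x))"
      using Z norm_dmul_le[of d 2, OF d] by (intro mult_mono) auto
    finally show "dist (u - mat_app Z (dmul d x)) (u - mat_app Z (dmul d y)) \<le> 1/2 * dist x y"
      by (simp add: dist_norm norm_minus_commute)
  qed auto
  then obtain y where "u - mat_app Z (dmul d y) = y" by auto
  then have "y + mat_app Z (dmul d y) = u" by (metis diff_add_cancel)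
  then show ?thesis by (rule that)
qed

section \<open>The diagonal operator, the root and its square\<close>

context diag_perturbation
begin

lemma lam_pos: "0 < lam n" using lam[of n] by linarith

definition LamI :: "nat ell2 \<Rightarrow> nat ell2" where "LamI y = dmul (\<lambda>n. of_real (1 / lam n)) y"

lemma cmod_inv_lam: "cmod (of_real (1 / lam n)) \<le> 1"
  using lam[of n] lam_pos[of n] by (simp add: norm_divide divide_le_eq_1)

lemma coord_LamI [simp]: "coord (LamI y) n = coord y n / lam n"
  unfolding LamI_def by (subst coord_dmul[of "\<lambda>n. of_real (1 / lam n)" 1, OF cmod_inv_lam]) simp

lemma norm_LamI_le: "norm (LamI y) \<le> norm y"
  unfolding LamI_def using norm_dmul_le[of "\<lambda>n. of_real (1 / lam n)" 1 y, OF cmod_inv_lam] by simp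

lemma LamI_add: "LamI (x + y) = LamI x + LamI y"
  by (rule ell2_eqI) (simp add: add_divide_distrib)

lemma LamI_scaleC: "LamI (scaleC c x) = scaleC c (LamI x)"
  by (rule ell2_eqI) simp

lemma LamI_inj: "LamI x = LamI y \<longleftrightarrow> x = y"
proof
  assume "LamI x = LamI y"
  then have "coord x n / lam n = coord y n / lam n" for n
    using coord_LamI by metis
  then show "x = y" using lam_pos by (intro ell2_eqI) (metis divide_cancel_right less_irrefl of_real_eq_0_iff)
qed simp

lemma range_LamI: "x \<in> range LamI \<longleftrightarrow> (\<lambda>n. (cmod (lam n * coord x n))\<^sup>2) summable_on UNIV"
proof
  assume "x \<in> range LamI"
  then obtain y where "x = LamI y" by blast
  then have "(\<lambda>n. (cmod (lam n * coord x n))\<^sup>2) = (\<lambda>n. (cmod (coord y n))\<^sup>2)"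
    using lam_pos by (simp add: fun_eq_iff less_imp_neq[symmetric])
  then show "(\<lambda>n. (cmod (lam n * coord x n))\<^sup>2) summable_on UNIV" by (simp only: coord_summable)
next
  assume s: "(\<lambda>n. (cmod (lam n * coord x n))\<^sup>2) summable_on UNIV"
  have "x = LamI (Ell2 (\<lambda>n. lam n * coord x n))"
    using lam_pos by (intro ell2_eqI) (simp add: coord_Ell2[OF s] less_imp_neq[symmetric])
  then show "x \<in> range LamI" by blast
qed

lemma cinner_LamI: "cinner (LamI x) y = cinner x (LamI y)"
  by (simp add: cinner_def)

text \<open>Both sides are \<Lambda>^-1 Y \<Lambda>^-1 y.\<close>

lemma LamI_Zr: "LamI (mat_app Zr y) = mat_app Zl (LamI y)"
proof (rule ell2_eqI)
  fix m
  have "coord (LamI (mat_app Zr y)) m = (\<Sum>\<^sub>\<infinity>n. Y m n / lam n * coord y n) * (1 / lam m)"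
    by (simp add: coord_mat_app cinner_def Zr)
  also have "\<dots> = (\<Sum>\<^sub>\<infinity>n. Y m n / lam n * coord y n * (1 / lam m))"
    by (rule infsum_cmult_left'[symmetric])
  also have "\<dots> = coord (mat_app Zl (LamI y)) m"
    by (simp add: coord_mat_app cinner_def Zl mult_ac)
  finally show "coord (LamI (mat_app Zr y)) m = coord (mat_app Zl (LamI y)) m" .
qed

text \<open>Graph of \<Lambda> + Y, parametrised by y = \<Lambda> f so that only bounded matrices
  are applied.\<close>

definition root_rel :: "(nat ell2 \<times> nat ell2) set"
  where "root_rel = {(LamI y, y + mat_app Zr y) | y. True}"

text \<open>Makes 1 + N = (1 + \<Lambda>^-1 Y)(1 + Y \<Lambda>^-1), so that formally \<Lambda> (1 +
  N) \<Lambda> = (\<Lambda> + Y)^2.\<close>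

definition N :: "(nat \<times> nat) ell2" where "N = Zl + Zr + mat_mul Zl Zr"

text \<open>Graph of \<Lambda> (1 + N) \<Lambda>. The equation for \<open>LamI u\<close> says at
  once that (1 + N) y lies in the domain of \<Lambda> and that \<open>u\<close> is its
  image.\<close>

definition op_rel :: "(nat ell2 \<times> nat ell2) set"
  where "op_rel = {(LamI y, u) | y u. LamI u = y + mat_app N y}"

lemma one_plus_N: "y + mat_app N y = (y + mat_app Zr y) + mat_app Zl (y + mat_app Zr y)"
  by (simp add: N_def mat_app_add_mat mat_app_add mat_mul_app)

lemma Domain_root_rel: "Domain root_rel = range LamI"
  by (auto simp: root_rel_def)

lemma root_rel_lin:
  assumes "(f, u) \<in> root_rel" "(g, v) \<in> root_rel"
  shows "(f + scaleC c g, u + scaleC c v) \<in> root_rel"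
proof -
  obtain x y where xy: "f = LamI x" "u = x + mat_app Zr x" "g = LamI y" "v = y + mat_app Zr y"
    using assms by (auto simp: root_rel_def)
  have "scaleC c (y + mat_app Zr y) = scaleC c y + scaleC c (mat_app Zr y)"
    by (rule ell2_eqI) (simp add: algebra_simps)
  then have "f + scaleC c g = LamI (x + scaleC c y) \<and>
      u + scaleC c v = (x + scaleC c y) + mat_app Zr (x + scaleC c y)"
    by (simp add: xy LamI_add LamI_scaleC mat_app_add mat_app_scaleC)
  then show ?thesis unfolding root_rel_def by blast
qed

lemma scaleC_of_real: "scaleC (of_real r) x = r *\<^sub>R x"
  by (rule ell2_eqI) (simp add: scaleR_conv_of_real)

lemma root_rel_0: "(0, 0) \<in> root_rel"
proof -
  have "LamI 0 = 0" by (rule ell2_eqI) simp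
  moreover have "mat_app Zr 0 = 0" using mat_app_diff[of Zr 0 0] by simp
  ultimately have "(LamI 0, 0 + mat_app Zr 0) = (0, 0)" by simp
  then show ?thesis unfolding root_rel_def by (intro CollectI exI[of _ 0]) simp
qed

lemma subspace_root_rel: "subspace root_rel"
proof (rule subspaceI)
  show "0 \<in> root_rel" using root_rel_0 by (simp add: zero_prod_def)
  show "x + y \<in> root_rel" if "x \<in> root_rel" "y \<in> root_rel" for x y
    using root_rel_lin[of "fst x" "snd x" "fst y" "snd y" 1] that
    by (simp add: plus_prod_def)
  show "c *\<^sub>R x \<in> root_rel" if "x \<in> root_rel" for c x
    using root_rel_lin[OF root_rel_0, of "fst x" "snd x" "of_real c"] that
    by (simp add: scaleC_of_real scaleR_prod_def)
qed

text \<open>With \<eta> = \<Lambda>^-1/2 y the product becomes the real part of the pairing of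
  \<eta> with (1 + H) \<eta>, and \<open>H\<close> has norm at most 1/4.\<close>

lemma root_rel_accretive:
  assumes "(f, u) \<in> root_rel"
  shows "0 \<le> f \<bullet> u"
proof -
  obtain y where y: "f = LamI y" "u = y + mat_app Zr y" using assms by (auto simp: root_rel_def)
  define d :: "nat \<Rightarrow> complex" where "d n = of_real (1 / sqrt (lam n))" for n
  have d: "cmod (d n) \<le> 1" for n
    using lam[of n] by (simp add: d_def norm_divide divide_le_eq_1)
  have dd: "d n * d n = 1 / lam n" for n
    using lam_pos[of n] by (simp add: d_def flip: of_real_mult)
  have cd: "cnj (d n) = d n" for n by (simp add: d_def)
  have Hd: "coord H (m, n) = Y m n * (d m * d n)" for m n
    by (simp add: H d_def real_sqrt_mult)
  define \<eta> where "\<eta> = dmul d y"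
  have c\<eta>: "coord \<eta> n = d n * coord y n" for n by (simp add: \<eta>_def coord_dmul[of d 1, OF d])
  have 1: "cinner (LamI y) y = cinner \<eta> \<eta>"
    unfolding cinner_def
  proof (rule infsum_cong)
    fix n
    have "cnj (coord \<eta> n) * coord \<eta> n = cnj (coord y n) * coord y n * (d n * d n)"
      by (simp add: c\<eta> cd mult_ac)
    then show "cnj (coord (LamI y) n) * coord y n = cnj (coord \<eta> n) * coord \<eta> n"
      by (simp add: dd)
  qed
  have 2: "cinner (LamI y) (mat_app Zr y) = cinner \<eta> (mat_app H \<eta>)"
    unfolding cinner_def
  proof (rule infsum_cong)
    fix m
    have "cnj (coord \<eta> m) * coord (mat_app H \<eta>) m
        = (\<Sum>\<^sub>\<infinity>n. cnj (coord \<eta> m) * (coord H (m, n) * coord \<eta> n))"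
      by (simp add: coord_mat_app cinner_def infsum_cmult_right')
    also have "\<dots> = (\<Sum>\<^sub>\<infinity>n. cnj (coord y m) / lam m * (Y m n / lam n * coord y n))"
    proof (rule infsum_cong)
      fix n
      have "cnj (coord \<eta> m) * (coord H (m, n) * coord \<eta> n)
          = cnj (coord y m) * (d m * d m) * (Y m n * (d n * d n) * coord y n)"
        by (simp add: c\<eta> cd Hd mult_ac)
      then show "cnj (coord \<eta> m) * (coord H (m, n) * coord \<eta> n)
          = cnj (coord y m) / lam m * (Y m n / lam n * coord y n)"
        by (simp add: dd)
    qed
    also have "\<dots> = cnj (coord y m) / lam m * (\<Sum>\<^sub>\<infinity>n. Y m n / lam n * coord y n)"
      by (rule infsum_cmult_right')
    also have "\<dots> = cnj (coord (LamI y) m) * coord (mat_app Zr y) m"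
      by (simp add: coord_mat_app cinner_def Zr)
    finally show "cnj (coord (LamI y) m) * coord (mat_app Zr y) m
        = cnj (coord \<eta> m) * coord (mat_app H \<eta>) m" by simp
  qed
  have "norm (mat_app H \<eta>) \<le> 1/4 * norm \<eta>"
    using norm_mat_app_le[of H \<eta>] mult_right_mono[OF H(2) norm_ge_zero[of \<eta>]] by linarith
  then have "cmod (cinner \<eta> (mat_app H \<eta>)) \<le> norm \<eta> * (1/4 * norm \<eta>)"
    by (rule order_trans[OF cmod_cinner_le mult_left_mono]) simp
  then have "- (norm \<eta> * (1/4 * norm \<eta>)) \<le> Re (cinner \<eta> (mat_app H \<eta>))"
    using abs_Re_le_cmod[of "cinner \<eta> (mat_app H \<eta>)"] by linarith
  moreover have "Re (cinner \<eta> \<eta>) = norm \<eta> * norm \<eta>"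
    by (simp add: cinner_self power2_eq_square)
  moreover have "f \<bullet> u = Re (cinner \<eta> \<eta>) + Re (cinner \<eta> (mat_app H \<eta>))"
    unfolding y inner_add_right 1[symmetric] 2[symmetric] by (simp only: Re_cinner)
  moreover have "0 \<le> norm \<eta> * norm \<eta>" by simp
  ultimately show ?thesis by linarith
qed

text \<open>The hypothesis covers Re z \<ge> 0 and also the square roots of numbers with nonpositive
  real part, into which a resolvent of the square factors.\<close>

lemma root_rel_onto:
  fixes z :: complex
  assumes z: "\<And>n. lam n \<le> 2 * cmod (lam n + z)"
  obtains g v where "(g, v) \<in> root_rel" "v + scaleC z g = u"
proof -
  \<comment> \<open>The new unknown is v = (\<Lambda> + z) g; then \<Lambda> g = d v with
    \<open>d\<close> bounded by 2, and the equation becomes v + Zr (d v) = u.\<close>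
  define d where "d n = lam n / (lam n + z)" for n
  have nz: "lam n + z \<noteq> 0" for n using z[of n] lam_pos[of n] by auto
  have d: "cmod (d n) \<le> 2" for n
  proof -
    have "0 < cmod (lam n + z)" using nz by simp
    then show ?thesis using z[of n] lam_pos[of n] by (simp add: d_def norm_divide field_simps)
  qed
  obtain v where v: "v + mat_app Zr (dmul d v) = u"
    by (rule contraction_onto[of Zr d u, OF Zr(2) d])
  define y where "y = dmul d v"
  have "y + scaleC z (LamI y) = v"
  proof (rule ell2_eqI)
    fix n
    have "coord (y + scaleC z (LamI y)) n = d n * coord v n + z * (d n * coord v n) / lam n"
      by (simp add: y_def coord_dmul[of d 2, OF d])
    also have "\<dots> = d n * (lam n + z) / lam n * coord v n"
      using lam_pos[of n] by (simp add: field_simps)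
    also have "d n * (lam n + z) / lam n = 1" using nz[of n] lam_pos[of n] by (simp add: d_def)
    finally show "coord (y + scaleC z (LamI y)) n = coord v n" by simp
  qed
  then have "y + mat_app Zr y + scaleC z (LamI y) = u"
    using v by (metis y_def add.assoc add.commute)
  moreover have "(LamI y, y + mat_app Zr y) \<in> root_rel" unfolding root_rel_def by blast
  ultimately show ?thesis using that by blast
qed

lemma one_plus_Zl_inj:
  assumes "x + mat_app Zl x = x' + mat_app Zl x'"
  shows "x = x'"
proof -
  have "x - x' = mat_app Zl (x' - x)"
    using assms by (simp add: mat_app_diff algebra_simps)
  then have "norm (x - x') \<le> norm Zl * norm (x' - x)" using norm_mat_app_le by metis
  also have "\<dots> \<le> 1/4 * norm (x - x')"
    using mult_right_mono[OF Zl(2), of "norm (x - x')"] by (simp add: norm_minus_commute)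
  finally show ?thesis by simp
qed

text \<open>The inclusion of \<open>op_rel\<close> is a regularity statement: (1 + Zr) y must be
  shown to lie in the domain of \<Lambda>. If y0 solves (1 + Zr) y0 = u, moving \<Lambda>^-1 through
  gives (1 + Zl) \<Lambda>^-1 y0 = \<Lambda>^-1 u = (1 + Zl)(1 + Zr) y, and 1 + Zl may be
  cancelled.\<close>

lemma root_rel_square: "root_rel O root_rel = op_rel"
proof (intro equalityI subrelI)
  fix f w assume "(f, w) \<in> root_rel O root_rel"
  then obtain y y' where y: "f = LamI y" "y + mat_app Zr y = LamI y'" "w = y' + mat_app Zr y'"
    by (auto simp: root_rel_def)
  have "LamI w = y + mat_app N y"
    by (simp add: y(3) LamI_add LamI_Zr one_plus_N y(2)[symmetric])
  then show "(f, w) \<in> op_rel" using y(1) unfolding op_rel_def by blast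
next
  fix f u assume "(f, u) \<in> op_rel"
  then obtain y where y: "f = LamI y" "LamI u = y + mat_app N y" by (auto simp: op_rel_def)
  have "cmod 1 \<le> 2" by simp
  then obtain y0 where y0: "y0 + mat_app Zr (dmul (\<lambda>_. 1) y0) = u"
    by (rule contraction_onto[of Zr "\<lambda>_. 1" u, OF Zr(2)])
  have "dmul (\<lambda>_. 1) y0 = y0" by (rule ell2_eqI) (simp add: coord_dmul[of _ 1])
  with y0 have y0: "y0 + mat_app Zr y0 = u" by simp
  have "LamI y0 + mat_app Zl (LamI y0) = (y + mat_app Zr y) + mat_app Zl (y + mat_app Zr y)"
    using y(2) by (simp add: y0[symmetric] LamI_add LamI_Zr one_plus_N)
  then have "LamI y0 = y + mat_app Zr y" by (rule one_plus_Zl_inj)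
  moreover have "(LamI y, y + mat_app Zr y) \<in> root_rel" "(LamI y0, y0 + mat_app Zr y0) \<in> root_rel"
    unfolding root_rel_def by blast+
  ultimately have "(f, LamI y0) \<in> root_rel" "(LamI y0, u) \<in> root_rel"
    using y(1) y0 by auto
  then show "(f, u) \<in> root_rel O root_rel" by blast
qed

text \<open>Factorisation (\<Lambda> + Y)^2 + z = (\<Lambda> + Y + w)(\<Lambda> + Y - w) with w^2 =
  -z. As w^2 has nonpositive real part, |Re w| \<le> |Im w|, and there |lam + w| is at least lam /
  sqrt 2; the same holds for -w.\<close>

lemma op_rel_onto:
  assumes z: "0 \<le> Re z"
  obtains f v where "(f, v) \<in> op_rel" "v + scaleC z f = u"
proof -
  obtain w :: complex where ww: "w * w = - z"
    by (metis power2_csqrt power2_eq_square)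
  have w2: "(Re w)\<^sup>2 \<le> (Im w)\<^sup>2"
    using arg_cong[OF ww, of Re] z by (simp add: power2_eq_square)
  have half: "lam n \<le> 2 * cmod (lam n + v)" if v: "(Re v)\<^sup>2 \<le> (Im v)\<^sup>2" for n and v :: complex
  proof -
    have "0 \<le> (lam n + 2 * Re v)\<^sup>2" by simp
    then have "(lam n)\<^sup>2 / 2 \<le> (lam n + Re v)\<^sup>2 + (Re v)\<^sup>2"
      by (simp add: power2_eq_square algebra_simps)
    also have "\<dots> \<le> (cmod (lam n + v))\<^sup>2" using v by (simp add: cmod_power2)
    moreover have "(2 * cmod (lam n + v))\<^sup>2 = 4 * (cmod (lam n + v))\<^sup>2"
      by (simp add: power_mult_distrib)
    ultimately have "(lam n)\<^sup>2 \<le> (2 * cmod (lam n + v))\<^sup>2"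
      using zero_le_power2[of "cmod (lam n + v)"] by linarith
    then show ?thesis by (rule power2_le_imp_le) simp
  qed
  obtain g v1 where g: "(g, v1) \<in> root_rel" "v1 + scaleC w g = u"
    by (rule root_rel_onto[OF half[OF w2]])
  have "(Re (- w))\<^sup>2 \<le> (Im (- w))\<^sup>2" using w2 by simp
  then obtain f v2 where f: "(f, v2) \<in> root_rel" "v2 + scaleC (- w) f = g"
    by (rule root_rel_onto[OF half])
  have v2: "v2 = g + scaleC w f"
    by (rule ell2_eqI) (simp add: f(2)[symmetric])
  have "(v2, v1 + scaleC w v2) \<in> root_rel"
    using root_rel_lin[OF g(1) f(1), of w] by (simp add: v2)
  then have "(f, v1 + scaleC w v2) \<in> op_rel"
    using f(1) by (auto simp: root_rel_square[symmetric])
  moreover have "v1 + scaleC w v2 + scaleC z f = u"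
  proof (rule ell2_eqI)
    fix n
    have "coord (v1 + scaleC w v2 + scaleC z f) n
        = coord v1 n + w * coord g n + (w * w + z) * coord f n"
      by (simp add: v2 algebra_simps)
    then show "coord (v1 + scaleC w v2 + scaleC z f) n = coord u n"
      by (simp add: ww g(2)[symmetric])
  qed
  ultimately show ?thesis by (rule that)
qed

text \<open>The value is 1/4 + 1/4 + 1/16. It produces the bounds 7/16 and 25/16 for the quadratic
  form below, and their quotient 7/25 is the cosine of the semi-angle of the sector.\<close>

lemma norm_N: "norm N \<le> 9/16"
proof -
  have "norm N \<le> norm Zl + norm Zr + norm (mat_mul Zl Zr)"
    unfolding N_def by (intro norm_triangle_le add_right_mono norm_triangle_ineq)
  also have "norm (mat_mul Zl Zr) \<le> 1/4 * (1/4)"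
    using norm_mat_mul_le[of Zl Zr] mult_mono[OF Zl(2) Zr(2)] by simp
  finally show ?thesis using Zl(2) Zr(2) by simp
qed

lemma quadratic_form_bound: "cmod (cinner y (y + mat_app N y) - of_real ((norm y)\<^sup>2)) \<le> 9/16 * (norm y)\<^sup>2"
proof -
  have "cmod (cinner y (mat_app N y)) \<le> norm y * (norm N * norm y)"
    by (rule order_trans[OF cmod_cinner_le mult_left_mono[OF norm_mat_app_le]]) simp
  also have "\<dots> \<le> norm y * (9/16 * norm y)"
    by (intro mult_left_mono mult_right_mono norm_N) auto
  finally show ?thesis by (simp add: cinner_add_right cinner_self power2_eq_square)
qed

lemma Re_quadratic_form: "7/16 * (norm y)\<^sup>2 \<le> Re (cinner y (y + mat_app N y))"
  using quadratic_form_bound[of y] abs_Re_le_cmod[of "cinner y (y + mat_app N y) - of_real ((norm y)\<^sup>2)"]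
  by simp

lemma cmod_quadratic_form: "cmod (cinner y (y + mat_app N y)) \<le> 25/16 * (norm y)\<^sup>2"
  using quadratic_form_bound[of y] norm_triangle_sub[of "cinner y (y + mat_app N y)" "of_real ((norm y)\<^sup>2)"]
  by (simp add: norm_power)

lemma op_rel_cinner:
  assumes "(f, u) \<in> op_rel"
  obtains y where "f = LamI y" "cinner f u = cinner y (y + mat_app N y)"
  using assms by (auto simp: op_rel_def cinner_LamI)

lemma op_rel_accretive: "(f, u) \<in> op_rel \<Longrightarrow> 0 \<le> f \<bullet> u"
proof (rule op_rel_cinner)
  fix y assume "f = LamI y" "cinner f u = cinner y (y + mat_app N y)"
  then have "7/16 * (norm y)\<^sup>2 \<le> f \<bullet> u"
    using Re_quadratic_form[of y] by (simp flip: Re_cinner)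
  then show "0 \<le> f \<bullet> u" by (rule order_trans[rotated]) simp
qed

lemma op_rel_bound:
  assumes "(f, u) \<in> op_rel"
  shows "norm f \<le> 16/7 * norm u"
proof -
  obtain y where y: "f = LamI y" "cinner f u = cinner y (y + mat_app N y)"
    using op_rel_cinner[OF assms] .
  have "7/16 * (norm y)\<^sup>2 \<le> Re (cinner f u)" using Re_quadratic_form[of y] y by simp
  also have "\<dots> \<le> norm f * norm u"
    using complex_Re_le_cmod[of "cinner f u"] cmod_cinner_le[of f u] by linarith
  also have "\<dots> \<le> norm y * norm u" using norm_LamI_le[of y] by (simp add: y(1) mult_right_mono)
  finally have "norm y * (7/16 * norm y) \<le> norm y * norm u" by (simp add: power2_eq_square)
  then have "7/16 * norm y \<le> norm u"
    by (cases "norm y = 0") (auto simp: mult_le_cancel_left)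
  then show ?thesis using norm_LamI_le[of y] by (simp add: y(1))
qed

lemma root_unique:
  assumes R: "subspace R" "\<And>f u. (f, u) \<in> R \<Longrightarrow> 0 \<le> f \<bullet> u" "R O R = op_rel"
  shows "R = root_rel"
proof (rule accretive_root_unique[where C = "16/7", OF R(1,2) subspace_root_rel root_rel_accretive])
  show "\<exists>f. (f, u) \<in> R O R" for u
  proof -
    obtain f v where "(f, v) \<in> op_rel" "v + scaleC 0 f = u" by (rule op_rel_onto[of 0 u]) auto
    moreover have "scaleC 0 f = 0" by (rule ell2_eqI) simp
    ultimately show ?thesis unfolding R(3) by auto
  qed
qed (use R op_rel_bound op_rel_accretive root_rel_square in auto)

text \<open>The right-hand side is the weak equation that defines the operator of a form, with
  \<Lambda>^-1 w as test vectors. Testing with the residual recovers the strong equation.\<close>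

lemma op_rel_iff: "(LamI y, u) \<in> op_rel \<longleftrightarrow> (\<forall>w. cinner w (y + mat_app N y) = cinner (LamI w) u)"
proof
  assume "(LamI y, u) \<in> op_rel"
  then obtain y' where "LamI y = LamI y'" "LamI u = y' + mat_app N y'" unfolding op_rel_def by blast
  then show "\<forall>w. cinner w (y + mat_app N y) = cinner (LamI w) u"
    by (simp add: LamI_inj cinner_LamI)
next
  assume a: "\<forall>w. cinner w (y + mat_app N y) = cinner (LamI w) u"
  define r where "r = y + mat_app N y - LamI u"
  have "cinner r r = 0" using a by (simp add: r_def cinner_diff_right cinner_LamI)
  then have "r = 0" by (simp add: cinner_self)
  then show "(LamI y, u) \<in> op_rel" unfolding op_rel_def r_def by auto
qed

lemma op_rel_0: "(0, 0) \<in> op_rel"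
  using root_rel_0 by (auto simp flip: root_rel_square)

lemma op_rel_lin:
  assumes fu: "(f, u) \<in> op_rel" and gv: "(g, v) \<in> op_rel"
  shows "(f + scaleC c g, u + scaleC c v) \<in> op_rel"
proof -
  obtain h where h: "(f, h) \<in> root_rel" "(h, u) \<in> root_rel" using fu by (auto simp flip: root_rel_square)
  obtain k where k: "(g, k) \<in> root_rel" "(k, v) \<in> root_rel" using gv by (auto simp flip: root_rel_square)
  show ?thesis
    using root_rel_lin[OF h(1) k(1), of c] root_rel_lin[OF h(2) k(2), of c] by (auto simp flip: root_rel_square)
qed

lemma root_rel_single: "(0, u) \<in> root_rel \<Longrightarrow> u = 0"
proof -
  assume "(0, u) \<in> root_rel"
  then obtain y where y: "LamI y = 0" "u = y + mat_app Zr y" by (auto simp: root_rel_def)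
  have "y = 0" using root_rel_0 y(1) LamI_inj[of y 0] LamI_add[of 0 0] by simp
  then show "u = 0" using y(2) mat_app_add[of Zr 0 0] by simp
qed

lemma op_rel_single: "(0, u) \<in> op_rel \<Longrightarrow> u = 0"
  by (auto simp flip: root_rel_square dest!: root_rel_single)

end

section \<open>Square-integrable functions\<close>

lemma L2_measurable [measurable_dest]: "f \<in> L2 M \<Longrightarrow> f \<in> borel_measurable M"
  by (simp add: L2_def)

lemma L2_integrable: "f \<in> L2 M \<Longrightarrow> integrable M (\<lambda>x. (cmod (f x))\<^sup>2)"
  by (simp add: L2_def)

lemma L2_I:
  assumes "f \<in> borel_measurable M" "integrable M g" "AE x in M. (cmod (f x))\<^sup>2 \<le> g x"
  shows "f \<in> L2 M"
proof -
  have "integrable M (\<lambda>x. (cmod (f x))\<^sup>2)"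
    by (rule Bochner_Integration.integrable_bound[OF assms(2)]) (use assms(1,3) in auto)
  then show ?thesis using assms(1) by (simp add: L2_def)
qed

lemma L2_mult_integrable:
  assumes "f \<in> L2 M" "g \<in> L2 M"
  shows "integrable M (\<lambda>x. f x * g x)"
proof (rule Bochner_Integration.integrable_bound)
  show "integrable M (\<lambda>x. (cmod (f x))\<^sup>2 + (cmod (g x))\<^sup>2)" using assms by (simp add: L2_integrable)
  have "cmod u * cmod v \<le> (cmod u)\<^sup>2 + (cmod v)\<^sup>2" for u v
    using sum_squares_bound[of "cmod u" "cmod v"] mult_nonneg_nonneg[OF norm_ge_zero[of u] norm_ge_zero[of v]]
    by linarith
  then show "AE x in M. norm (f x * g x) \<le> norm ((cmod (f x))\<^sup>2 + (cmod (g x))\<^sup>2)"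
    by (simp add: norm_mult)
  show "(\<lambda>x. f x * g x) \<in> borel_measurable M" using assms by measurable
qed

lemma borel_measurable_cnj [measurable (raw)]:
  "f \<in> borel_measurable M \<Longrightarrow> (\<lambda>x. cnj (f x)) \<in> borel_measurable M"
  by (rule borel_measurable_continuous_on[of cnj]) (intro continuous_intros)

lemma L2_cnj: "f \<in> L2 M \<Longrightarrow> (\<lambda>x. cnj (f x)) \<in> L2 M"
  unfolding L2_def by (auto intro: borel_measurable_cnj)

lemma L2_inner_integrable:
  assumes "f \<in> L2 M" "g \<in> L2 M"
  shows "integrable M (\<lambda>x. cnj (f x) * g x)"
  by (rule L2_mult_integrable[OF L2_cnj[OF assms(1)] assms(2)])

lemma L2_cmult: "f \<in> L2 M \<Longrightarrow> (\<lambda>x. c * f x) \<in> L2 M"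
  by (auto simp: L2_def norm_mult power_mult_distrib)

lemma L2_add:
  assumes "f \<in> L2 M" "g \<in> L2 M"
  shows "(\<lambda>x. f x + g x) \<in> L2 M"
proof (rule L2_I)
  show "integrable M (\<lambda>x. 2 * ((cmod (f x))\<^sup>2 + (cmod (g x))\<^sup>2))" using assms by (simp add: L2_integrable)
qed (use assms square_add_le in auto)

lemma L2_uminus: "f \<in> L2 M \<Longrightarrow> (\<lambda>x. - f x) \<in> L2 M"
  by (simp add: L2_def)

lemma L2_diff:
  assumes "f \<in> L2 M" "g \<in> L2 M"
  shows "(\<lambda>x. f x - g x) \<in> L2 M"
  using L2_add[OF assms(1) L2_uminus[OF assms(2)]] by simp

lemma L2_zero: "(\<lambda>x. 0) \<in> L2 M"
  by (simp add: L2_def)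

lemma L2_sum: "(\<And>i. i \<in> I \<Longrightarrow> f i \<in> L2 M) \<Longrightarrow> (\<lambda>x. \<Sum>i\<in>I. f i x) \<in> L2 M"
  by (induction I rule: infinite_finite_induct) (auto simp: L2_zero intro: L2_add)

lemma L2_cong_AE:
  assumes "f \<in> L2 M" "g \<in> borel_measurable M" "AE x in M. g x = f x"
  shows "g \<in> L2 M"
  by (rule L2_I[OF assms(2) L2_integrable[OF assms(1)]]) (use assms(3) in auto)

lemma l2_inner_add_right:
  assumes "f \<in> L2 M" "g \<in> L2 M" "h \<in> L2 M"
  shows "l2_inner M f (\<lambda>x. g x + h x) = l2_inner M f g + l2_inner M f h"
  by (simp add: l2_inner_def distrib_left L2_inner_integrable assms)

lemma l2_inner_cmult_right: "l2_inner M f (\<lambda>x. c * g x) = c * l2_inner M f g"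
  by (simp add: l2_inner_def mult.left_commute)

lemma l2_inner_commute: "l2_inner M f g = cnj (l2_inner M g f)"
proof -
  have "cnj (l2_inner M g f) = (\<integral>x. cnj (cnj (g x) * f x) \<partial>M)"
    unfolding l2_inner_def
    by (rule integral_bounded_linear'[OF bounded_linear_cnj bounded_linear_cnj, symmetric]) simp
  then show ?thesis by (simp add: l2_inner_def mult.commute)
qed

lemma l2_inner_diff_right:
  assumes "f \<in> L2 M" "g \<in> L2 M" "h \<in> L2 M"
  shows "l2_inner M f (\<lambda>x. g x - h x) = l2_inner M f g - l2_inner M f h"
  using l2_inner_add_right[OF assms(1,2) L2_cmult[OF assms(3), of "-1"]]
  by (simp add: l2_inner_cmult_right[of M f "-1" h, simplified])

lemma l2_inner_add_left:
  assumes "f \<in> L2 M" "g \<in> L2 M" "h \<in> L2 M"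
  shows "l2_inner M (\<lambda>x. g x + h x) f = l2_inner M g f + l2_inner M h f"
  using assms by (subst (1 2 3) l2_inner_commute) (simp add: l2_inner_add_right)

lemma l2_inner_cmult_left: "l2_inner M (\<lambda>x. c * g x) f = cnj c * l2_inner M g f"
  by (subst (1 2) l2_inner_commute) (simp add: l2_inner_cmult_right)

lemma l2_inner_diff_left:
  assumes "f \<in> L2 M" "g \<in> L2 M" "h \<in> L2 M"
  shows "l2_inner M (\<lambda>x. g x - h x) f = l2_inner M g f - l2_inner M h f"
  using assms by (subst (1 2 3) l2_inner_commute) (simp add: l2_inner_diff_right)

lemma l2_inner_zero [simp]: "l2_inner M f (\<lambda>_. 0) = 0" "l2_inner M (\<lambda>_. 0) f = 0"
  by (simp_all add: l2_inner_def)

lemma l2_inner_sum_right: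
  assumes "f \<in> L2 M" "\<And>i. i \<in> I \<Longrightarrow> g i \<in> L2 M"
  shows "l2_inner M f (\<lambda>x. \<Sum>i\<in>I. g i x) = (\<Sum>i\<in>I. l2_inner M f (g i))"
  using assms(2)
proof (induction I rule: infinite_finite_induct)
  case (insert i I)
  then show ?case
    using l2_inner_add_right[OF assms(1), of "g i" "\<lambda>x. \<Sum>i\<in>I. g i x"] L2_sum[of I g M] by simp
qed auto

lemma l2_inner_sum_left:
  assumes "f \<in> L2 M" "\<And>i. i \<in> I \<Longrightarrow> g i \<in> L2 M"
  shows "l2_inner M (\<lambda>x. \<Sum>i\<in>I. g i x) f = (\<Sum>i\<in>I. l2_inner M (g i) f)"
proof -
  have "l2_inner M (\<lambda>x. \<Sum>i\<in>I. g i x) f = cnj (\<Sum>i\<in>I. l2_inner M f (g i))"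
    by (subst l2_inner_commute) (simp only: l2_inner_sum_right[of f M I g, OF assms])
  also have "\<dots> = (\<Sum>i\<in>I. l2_inner M (g i) f)"
    unfolding cnj_sum by (intro sum.cong refl l2_inner_commute[symmetric])
  finally show ?thesis .
qed

lemma l2_inner_cong_AE:
  assumes "AE x in M. f x = f' x" "AE x in M. g x = g' x"
    "f \<in> borel_measurable M" "f' \<in> borel_measurable M" "g \<in> borel_measurable M" "g' \<in> borel_measurable M"
  shows "l2_inner M f g = l2_inner M f' g'"
proof -
  note [measurable] = assms(3-6)
  have "AE x in M. cnj (f x) * g x = cnj (f' x) * g' x" using assms(1,2) by eventually_elim simp
  then show ?thesis unfolding l2_inner_def by (intro integral_cong_AE) measurable
qed

lemma l2_norm_nonneg: "0 \<le> l2_norm M f"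
  by (simp add: l2_norm_def)

lemma l2_norm_square: "(l2_norm M f)\<^sup>2 = (\<integral>x. (cmod (f x))\<^sup>2 \<partial>M)"
  by (simp add: l2_norm_def)

lemma l2_inner_self: "l2_inner M f f = of_real ((l2_norm M f)\<^sup>2)"
proof -
  have "cnj (f x) * f x = of_real ((cmod (f x))\<^sup>2)" for x
    using complex_norm_square[of "f x"] by (simp add: mult.commute)
  then show ?thesis by (simp add: l2_inner_def l2_norm_square integral_complex_of_real del: of_real_power)
qed

lemma l2_norm_eq_0:
  assumes "f \<in> L2 M"
  shows "l2_norm M f = 0 \<longleftrightarrow> (AE x in M. f x = 0)"
proof -
  have "l2_norm M f = 0 \<longleftrightarrow> (\<integral>x. (cmod (f x))\<^sup>2 \<partial>M) = 0"
    by (simp add: l2_norm_def)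
  also have "\<dots> \<longleftrightarrow> (AE x in M. f x = 0)"
    by (subst integral_nonneg_eq_0_iff_AE[OF L2_integrable[OF assms]]) auto
  finally show ?thesis .
qed

text \<open>Integrates 2 |f g| \<le> t |f|^2 + |g|^2 / t and takes for \<open>t\<close> the quotient
  of the norms; a vanishing norm makes the integrand vanish almost everywhere and is treated
  apart.\<close>

lemma integral_abs_mult_le:
  assumes f: "f \<in> L2 M" and g: "g \<in> L2 M"
  shows "(\<integral>x. cmod (f x * g x) \<partial>M) \<le> l2_norm M f * l2_norm M g"
proof -
  have fg: "integrable M (\<lambda>x. cmod (f x * g x))"
    by (rule integrable_norm[OF L2_mult_integrable[OF f g]])
  have amgm: "2 * (\<integral>x. cmod (f x * g x) \<partial>M) \<le> t * (l2_norm M f)\<^sup>2 + (l2_norm M g)\<^sup>2 / t" if t: "0 < t" for t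
  proof -
    have "2 * cmod (u * v) \<le> t * (cmod u)\<^sup>2 + (cmod v)\<^sup>2 / t" for u v
    proof -
      have "0 \<le> (t * cmod u - cmod v)\<^sup>2" by simp
      then have "2 * (cmod u * cmod v) * t \<le> (t * (cmod u)\<^sup>2 + (cmod v)\<^sup>2 / t) * t"
        using t by (simp add: power2_eq_square algebra_simps)
      then show ?thesis using t by (simp only: mult_le_cancel_right_pos norm_mult)
    qed
    then have "(\<integral>x. 2 * cmod (f x * g x) \<partial>M) \<le> (\<integral>x. t * (cmod (f x))\<^sup>2 + (cmod (g x))\<^sup>2 / t \<partial>M)"
      using f g fg by (intro integral_mono) (auto simp: L2_integrable)
    also have "\<dots> = t * (l2_norm M f)\<^sup>2 + (l2_norm M g)\<^sup>2 / t"
      using f g by (simp add: l2_norm_square L2_integrable)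
    finally show ?thesis by simp
  qed
  define p where "p = l2_norm M f"
  define q where "q = l2_norm M g"
  consider "p = 0" | "q = 0" | "0 < p" "0 < q"
    using l2_norm_nonneg[of M f] l2_norm_nonneg[of M g] unfolding p_def q_def by fastforce
  then show ?thesis
  proof cases
    case 1
    then have "AE x in M. f x = 0" using l2_norm_eq_0[OF f] by (simp add: p_def)
    then have "(\<integral>x. cmod (f x * g x) \<partial>M) = (\<integral>x. 0 \<partial>M)"
      using f g by (intro integral_cong_AE) auto
    then show ?thesis using 1 by (simp add: p_def)
  next
    case 2
    then have "AE x in M. g x = 0" using l2_norm_eq_0[OF g] by (simp add: q_def)
    then have "(\<integral>x. cmod (f x * g x) \<partial>M) = (\<integral>x. 0 \<partial>M)"
      using f g by (intro integral_cong_AE) auto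
    then show ?thesis using 2 by (simp add: q_def)
  next
    case 3
    have "2 * (\<integral>x. cmod (f x * g x) \<partial>M) \<le> (q / p) * p\<^sup>2 + q\<^sup>2 / (q / p)"
      unfolding p_def q_def by (rule amgm) (use 3 in \<open>simp add: p_def q_def\<close>)
    also have "\<dots> = 2 * (p * q)" using 3 by (simp add: power2_eq_square)
    finally show ?thesis by (simp add: p_def q_def)
  qed
qed

lemma cmod_l2_inner_le:
  assumes "f \<in> L2 M" "g \<in> L2 M"
  shows "cmod (l2_inner M f g) \<le> l2_norm M f * l2_norm M g"
proof -
  have "cmod (l2_inner M f g) \<le> (\<integral>x. cmod (cnj (f x) * g x) \<partial>M)"
    unfolding l2_inner_def by (rule integral_norm_bound)
  also have "\<dots> \<le> l2_norm M (\<lambda>x. cnj (f x)) * l2_norm M g"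
    by (rule integral_abs_mult_le[OF L2_cnj[OF assms(1)] assms(2)])
  finally show ?thesis by (simp add: l2_norm_def)
qed

lemma nn_integral_L2:
  assumes "f \<in> L2 M"
  shows "(\<integral>\<^sup>+x. ennreal ((cmod (f x))\<^sup>2) \<partial>M) = ennreal ((l2_norm M f)\<^sup>2)"
  unfolding l2_norm_square by (rule nn_integral_eq_integral[OF L2_integrable[OF assms]]) simp

text \<open>Almost everywhere, \<open>2\<^sup>k \<bar>F (k+1) - F k\<bar>\<^sup>2\<close> is summable in \<open>k\<close>, hence so is \<open>\<bar>F (k+1) - F k\<bar>\<close>.\<close>
lemma L2_fast_Cauchy_converges:
  assumes F: "\<And>k. F k \<in> L2 M" and fast: "\<And>k. l2_norm M (\<lambda>x. F (Suc k) x - F k x) \<le> (1/2) ^ k"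
  shows "AE x in M. convergent (\<lambda>k. F k x)"
proof -
  define d where "d = (\<lambda>k x. F (Suc k) x - F k x)"
  have d: "d k \<in> L2 M" for k unfolding d_def by (intro L2_diff F)
  have [measurable]: "d k \<in> borel_measurable M" for k using d[of k] by measurable
  have "(\<integral>\<^sup>+x. (\<Sum>k. ennreal (2 ^ k * (cmod (d k x))\<^sup>2)) \<partial>M)
      = (\<Sum>k. \<integral>\<^sup>+x. ennreal (2 ^ k * (cmod (d k x))\<^sup>2) \<partial>M)"
    by (rule nn_integral_suminf) measurable
  also have "\<dots> = (\<Sum>k. ennreal (2 ^ k * (l2_norm M (d k))\<^sup>2))"
  proof (rule suminf_cong)
    fix k
    have "(\<integral>\<^sup>+x. ennreal (2 ^ k) * ennreal ((cmod (d k x))\<^sup>2) \<partial>M) = ennreal (2 ^ k) * ennreal ((l2_norm M (d k))\<^sup>2)"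
      by (simp add: nn_integral_cmult nn_integral_L2[OF d])
    then show "(\<integral>\<^sup>+x. ennreal (2 ^ k * (cmod (d k x))\<^sup>2) \<partial>M) = ennreal (2 ^ k * (l2_norm M (d k))\<^sup>2)"
      by (simp add: ennreal_mult)
  qed
  also have "\<dots> \<le> (\<Sum>k. ennreal ((1/2) ^ k))"
  proof (intro suminf_le summableI ennreal_leI)
    fix k
    have "(l2_norm M (d k))\<^sup>2 \<le> ((1/2) ^ k)\<^sup>2"
      using fast[of k] by (intro power_mono) (auto simp: d_def l2_norm_nonneg)
    then have "2 ^ k * (l2_norm M (d k))\<^sup>2 \<le> 2 ^ k * ((1/2) ^ k)\<^sup>2" by (rule mult_left_mono) simp
    also have "\<dots> = (1/2) ^ k" by (simp add: power2_eq_square power_mult_distrib[symmetric] mult.assoc[symmetric])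
    finally show "2 ^ k * (l2_norm M (d k))\<^sup>2 \<le> (1/2) ^ k" .
  qed
  also have "\<dots> = ennreal (\<Sum>k. (1/2) ^ k)"
    by (rule suminf_ennreal2) (auto simp: summable_geometric)
  finally have "(\<integral>\<^sup>+x. (\<Sum>k. ennreal (2 ^ k * (cmod (d k x))\<^sup>2)) \<partial>M) \<noteq> \<infinity>"
    by (auto simp: top_unique)
  then have "AE x in M. (\<Sum>k. ennreal (2 ^ k * (cmod (d k x))\<^sup>2)) \<noteq> \<infinity>"
    by (intro nn_integral_PInf_AE) measurable
  then show ?thesis
  proof eventually_elim
    case (elim x)
    have 1: "summable (\<lambda>k. 2 ^ k * (cmod (d k x))\<^sup>2)"
      by (rule summable_suminf_not_top) (use elim in auto)
    have "summable (\<lambda>k. d k x)"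
    proof (rule summable_comparison_test)
      show "summable (\<lambda>k. 2 ^ k * (cmod (d k x))\<^sup>2 + (1/2) ^ k)"
        by (intro summable_add 1 summable_geometric) simp
      have "cmod (d k x) \<le> 2 ^ k * (cmod (d k x))\<^sup>2 + (1/2) ^ k" for k
      proof -
        define u where "u = 2 ^ k * cmod (d k x)"
        have "u \<le> u * u + 1"
          using zero_le_power2[of "u - 1/2"] by (simp add: power2_eq_square algebra_simps)
        then have "(1/2) ^ k * u \<le> (1/2) ^ k * (u * u + 1)" by (rule mult_left_mono) simp
        moreover have "(1/2) ^ k * u = cmod (d k x)"
        proof -
          have "(1/2) ^ k * 2 ^ k = (1::real)" by (simp add: power_mult_distrib[symmetric])
          then show ?thesis unfolding u_def mult.assoc[symmetric] by simp
        qed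
        moreover from this have "(1/2) ^ k * (u * u + 1) = cmod (d k x) * u + (1/2) ^ k"
          by (simp only: distrib_left mult.assoc[symmetric] mult_1_right)
        moreover have "cmod (d k x) * u = 2 ^ k * (cmod (d k x))\<^sup>2" by (simp add: u_def power2_eq_square)
        ultimately show ?thesis by linarith
      qed
      then show "\<exists>N. \<forall>n\<ge>N. norm (d n x) \<le> 2 ^ n * (cmod (d n x))\<^sup>2 + (1/2) ^ n" by blast
    qed
    then have "convergent (\<lambda>n. \<Sum>k<n. d k x)" by (simp add: summable_iff_convergent)
    then have "convergent (\<lambda>n. F 0 x + (\<Sum>k<n. d k x))"
      by (intro convergent_add convergent_const)
    moreover have "F 0 x + (\<Sum>k<n. d k x) = F n x" for n
      using sum_lessThan_telescope[of "\<lambda>k. F k x" n] by (simp add: d_def)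
    ultimately show ?case by simp
  qed
qed

text \<open>A rapidly Cauchy subsequence converges almost everywhere; Fatou's lemma along it turns
  the Cauchy estimate into an estimate of the distance to the pointwise limit.\<close>

lemma L2_complete:
  fixes F :: "nat \<Rightarrow> 'a \<Rightarrow> complex"
  assumes F: "\<And>k. F k \<in> L2 M"
    and Cauchy: "\<And>e. 0 < e \<Longrightarrow> \<exists>N. \<forall>m\<ge>N. \<forall>n\<ge>N. l2_norm M (\<lambda>x. F m x - F n x) < e"
  obtains f where "f \<in> L2 M" "(\<lambda>n. l2_norm M (\<lambda>x. F n x - f x)) \<longlonglongrightarrow> 0"
proof -
  have "\<exists>N. \<forall>m\<ge>N. \<forall>n\<ge>N. l2_norm M (\<lambda>x. F m x - F n x) < (1/2) ^ k" for k :: nat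
    by (rule Cauchy) simp
  then obtain N where N: "\<And>k m n. m \<ge> N k \<Longrightarrow> n \<ge> N k \<Longrightarrow> l2_norm M (\<lambda>x. F m x - F n x) < (1/2) ^ k"
    by metis
  \<comment> \<open>Summing the thresholds and adding \<open>k\<close> makes \<open>r\<close>
    monotone and at least as large as both \<open>N k\<close> and \<open>k\<close>.\<close>
  define r where "r k = (\<Sum>i\<le>k. N i) + k" for k
  have rN: "N k \<le> r k" "r k \<le> r (Suc k)" "k \<le> r k" for k
    by (auto simp: r_def intro: trans_le_add1 member_le_sum)
  have conv: "AE x in M. convergent (\<lambda>k. F (r k) x)"
  proof (rule L2_fast_Cauchy_converges[OF F])
    show "l2_norm M (\<lambda>x. F (r (Suc k)) x - F (r k) x) \<le> (1/2) ^ k" for k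
      using N[of k "r (Suc k)" "r k"] rN(1)[of k] rN(2)[of k] by simp
  qed
  define f where "f x = lim (\<lambda>k. F (r k) x)" for x
  have [measurable]: "F k \<in> borel_measurable M" for k using F[of k] by measurable
  have fm [measurable]: "f \<in> borel_measurable M" unfolding f_def by measurable
  have tend: "AE x in M. (\<lambda>k. F (r k) x) \<longlonglongrightarrow> f x"
    using conv by eventually_elim (simp add: f_def convergent_LIMSEQ_iff)
  have est: "(\<integral>\<^sup>+x. ennreal ((cmod (F n x - f x))\<^sup>2) \<partial>M) \<le> ennreal (e\<^sup>2)"
    if "0 < e" and n: "\<And>m. m \<ge> n0 \<Longrightarrow> l2_norm M (\<lambda>x. F n x - F m x) < e" for n n0 and e :: real
  proof -
    have "(\<integral>\<^sup>+x. ennreal ((cmod (F n x - f x))\<^sup>2) \<partial>M)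
        = (\<integral>\<^sup>+x. liminf (\<lambda>k. ennreal ((cmod (F n x - F (r k) x))\<^sup>2)) \<partial>M)"
    proof (rule nn_integral_cong_AE)
      show "AE x in M. ennreal ((cmod (F n x - f x))\<^sup>2) = liminf (\<lambda>k. ennreal ((cmod (F n x - F (r k) x))\<^sup>2))"
        using tend
      proof eventually_elim
        case (elim x)
        then have "(\<lambda>k. ennreal ((cmod (F n x - F (r k) x))\<^sup>2)) \<longlonglongrightarrow> ennreal ((cmod (F n x - f x))\<^sup>2)"
          by (intro tendsto_intros) auto
        from lim_imp_Liminf[OF _ this] show ?case by simp
      qed
    qed
    also have "\<dots> \<le> liminf (\<lambda>k. \<integral>\<^sup>+x. ennreal ((cmod (F n x - F (r k) x))\<^sup>2) \<partial>M)"
      by (rule nn_integral_liminf) measurable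
    also have "\<dots> \<le> ennreal (e\<^sup>2)"
    proof (rule Liminf_le)
      show "\<forall>\<^sub>F k in sequentially. (\<integral>\<^sup>+x. ennreal ((cmod (F n x - F (r k) x))\<^sup>2) \<partial>M) \<le> ennreal (e\<^sup>2)"
        using eventually_ge_at_top[of n0]
      proof eventually_elim
        case (elim k)
        then have "l2_norm M (\<lambda>x. F n x - F (r k) x) < e" using n rN(3)[of k] by simp
        then have "(l2_norm M (\<lambda>x. F n x - F (r k) x))\<^sup>2 \<le> e\<^sup>2"
          by (intro power_mono) (auto simp: l2_norm_nonneg)
        then show ?case by (simp add: nn_integral_L2 L2_diff F ennreal_leI)
      qed
    qed simp
    finally show ?thesis .
  qed
  have diffL2: "(\<lambda>x. F n x - f x) \<in> L2 M \<and> l2_norm M (\<lambda>x. F n x - f x) \<le> e"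
    if e: "0 < e" and n: "\<And>m. m \<ge> n0 \<Longrightarrow> l2_norm M (\<lambda>x. F n x - F m x) < e" for n n0 and e :: real
  proof -
    have "integrable M (\<lambda>x. (cmod (F n x - f x))\<^sup>2)"
      using le_less_trans[OF est[OF e n] ennreal_less_top] by (intro integrableI_bounded) auto
    then have 1: "(\<lambda>x. F n x - f x) \<in> L2 M" by (simp add: L2_def)
    have "(l2_norm M (\<lambda>x. F n x - f x))\<^sup>2 \<le> e\<^sup>2"
      using est[OF that] unfolding nn_integral_L2[OF 1] by simp
    then show ?thesis using 1 power2_le_imp_le[of _ e] e by auto
  qed
  have "(\<lambda>x. F (N 0) x - f x) \<in> L2 M"
    using diffL2[of 1 "N 0" "N 0"] N[of 0 "N 0"] by simp
  from L2_diff[OF F[of "N 0"] this] have "f \<in> L2 M" by simp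
  moreover have "(\<lambda>n. l2_norm M (\<lambda>x. F n x - f x)) \<longlonglongrightarrow> 0"
  proof (rule LIMSEQ_I)
    fix e :: real assume e: "0 < e"
    obtain n0 where n0: "\<forall>m\<ge>n0. \<forall>n\<ge>n0. l2_norm M (\<lambda>x. F m x - F n x) < e/2"
      using Cauchy[of "e/2"] e by auto
    have "norm (l2_norm M (\<lambda>x. F n x - f x) - 0) < e" if "n0 \<le> n" for n
    proof -
      have "l2_norm M (\<lambda>x. F n x - f x) \<le> e/2" using diffL2[of "e/2" n0 n] e n0 that by auto
      then show ?thesis using l2_norm_nonneg[of M "\<lambda>x. F n x - f x"] e by simp
    qed
    then show "\<exists>no. \<forall>n\<ge>no. norm (l2_norm M (\<lambda>x. F n x - f x) - 0) < e" by blast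
  qed
  ultimately show ?thesis by (rule that)
qed

lemma l2_inner_tendsto:
  assumes F: "\<And>n. F n \<in> L2 M" "f \<in> L2 M" "(\<lambda>n. l2_norm M (\<lambda>x. F n x - f x)) \<longlonglongrightarrow> 0" and g: "g \<in> L2 M"
  shows "(\<lambda>n. l2_inner M g (F n)) \<longlonglongrightarrow> l2_inner M g f"
proof (rule LIM_zero_cancel, rule tendsto_norm_zero_cancel, rule tendsto_sandwich[of "\<lambda>_. 0"])
  show "\<forall>\<^sub>F n in sequentially. norm (l2_inner M g (F n) - l2_inner M g f) \<le> l2_norm M g * l2_norm M (\<lambda>x. F n x - f x)"
    using cmod_l2_inner_le[OF g L2_diff[OF F(1,2)]] l2_inner_diff_right[OF g F(1,2)] by simp
  show "(\<lambda>n. l2_norm M g * l2_norm M (\<lambda>x. F n x - f x)) \<longlonglongrightarrow> 0"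
    by (rule tendsto_mult_right_zero[OF F(3)])
qed auto

text \<open>Vectors of norm less than one are allowed: a sine system may contain the zero function.\<close>
locale orthogonal_system =
  fixes M :: "'a measure" and \<psi> :: "nat \<Rightarrow> 'a \<Rightarrow> complex" and \<nu> :: "nat \<Rightarrow> real"
  assumes psi: "\<And>n. \<psi> n \<in> L2 M"
    and orth: "\<And>m n. l2_inner M (\<psi> m) (\<psi> n) = (if m = n then of_real (\<nu> n) else 0)"
    and nu: "\<And>n. 0 \<le> \<nu> n" "\<And>n. \<nu> n \<le> 1"
begin

lemma partial_sum_L2: "(\<lambda>x. \<Sum>n\<in>I. c n * \<psi> n x) \<in> L2 M"
  by (intro L2_sum L2_cmult psi)

lemma inner_partial_sum:
  assumes "finite I"
  shows "l2_inner M (\<psi> m) (\<lambda>x. \<Sum>n\<in>I. c n * \<psi> n x) = (if m \<in> I then c m * \<nu> m else 0)"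
proof -
  have "l2_inner M (\<psi> m) (\<lambda>x. \<Sum>n\<in>I. c n * \<psi> n x) = (\<Sum>n\<in>I. if m = n then c n * \<nu> n else 0)"
    by (subst l2_inner_sum_right[OF psi L2_cmult[OF psi]])
       (auto simp: l2_inner_cmult_right orth intro!: sum.cong)
  then show ?thesis using assms by simp
qed

lemma norm_partial_sum:
  assumes "finite I"
  shows "(l2_norm M (\<lambda>x. \<Sum>n\<in>I. c n * \<psi> n x))\<^sup>2 = (\<Sum>n\<in>I. (cmod (c n))\<^sup>2 * \<nu> n)"
proof -
  have "l2_inner M (\<lambda>x. \<Sum>n\<in>I. c n * \<psi> n x) (\<lambda>x. \<Sum>n\<in>I. c n * \<psi> n x)
      = (\<Sum>n\<in>I. cnj (c n) * l2_inner M (\<psi> n) (\<lambda>x. \<Sum>n\<in>I. c n * \<psi> n x))"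
    by (subst l2_inner_sum_left[OF partial_sum_L2 L2_cmult[OF psi]]) (auto simp: l2_inner_cmult_left)
  also have "\<dots> = (\<Sum>n\<in>I. of_real ((cmod (c n))\<^sup>2 * \<nu> n))"
  proof (rule sum.cong[OF refl])
    fix n assume "n \<in> I"
    have "cnj (c n) * c n = of_real ((cmod (c n))\<^sup>2)"
      using complex_norm_square[of "c n"] by (simp add: mult.commute)
    then show "cnj (c n) * l2_inner M (\<psi> n) (\<lambda>x. \<Sum>n\<in>I. c n * \<psi> n x) = of_real ((cmod (c n))\<^sup>2 * \<nu> n)"
      unfolding inner_partial_sum[OF assms] using \<open>n \<in> I\<close> by (simp add: mult.assoc[symmetric])
  qed
  finally show ?thesis
    unfolding l2_inner_self of_real_sum[symmetric] by (simp only: of_real_eq_iff)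
qed

text \<open>For the partial sum \<open>s\<close>, the squared norm of f - s is |f|^2 - 2 sum |c|^2 +
  |s|^2, and \<open>\<nu> n \<le> 1\<close> bounds the last term by sum |c|^2; shorter vectors do no
  harm.\<close>

lemma Bessel:
  assumes f: "f \<in> L2 M" and I: "finite I"
  shows "(\<Sum>n\<in>I. (cmod (l2_inner M (\<psi> n) f))\<^sup>2) \<le> (l2_norm M f)\<^sup>2"
proof -
  define c where "c n = l2_inner M (\<psi> n) f" for n
  define s where "s x = (\<Sum>n\<in>I. c n * \<psi> n x)" for x
  have s: "s \<in> L2 M" unfolding s_def by (rule partial_sum_L2)
  have cc: "cnj (c n) * c n = of_real ((cmod (c n))\<^sup>2)" for n
    using complex_norm_square[of "c n"] by (simp add: mult.commute)
  have sf: "l2_inner M s f = of_real (\<Sum>n\<in>I. (cmod (c n))\<^sup>2)"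
    unfolding s_def by (subst l2_inner_sum_left[OF f L2_cmult[OF psi]])
      (auto simp: l2_inner_cmult_left c_def[symmetric] cc simp del: of_real_power)
  have ss: "(l2_norm M s)\<^sup>2 \<le> (\<Sum>n\<in>I. (cmod (c n))\<^sup>2)"
    unfolding s_def norm_partial_sum[OF I] by (intro sum_mono mult_right_le_one_le nu) auto
  have "l2_inner M (\<lambda>x. f x - s x) (\<lambda>x. f x - s x)
      = l2_inner M f f - l2_inner M s f - (l2_inner M f s - l2_inner M s s)"
    using f s L2_diff[OF f s] by (simp add: l2_inner_diff_left l2_inner_diff_right)
  also have "l2_inner M f s = of_real (\<Sum>n\<in>I. (cmod (c n))\<^sup>2)"
    by (subst l2_inner_commute) (simp add: sf)
  finally have "of_real ((l2_norm M (\<lambda>x. f x - s x))\<^sup>2)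
      = (of_real ((l2_norm M f)\<^sup>2 - 2 * (\<Sum>n\<in>I. (cmod (c n))\<^sup>2) + (l2_norm M s)\<^sup>2) :: complex)"
    unfolding sf l2_inner_self by simp
  then have "(l2_norm M (\<lambda>x. f x - s x))\<^sup>2 = (l2_norm M f)\<^sup>2 - 2 * (\<Sum>n\<in>I. (cmod (c n))\<^sup>2) + (l2_norm M s)\<^sup>2"
    by (simp only: of_real_eq_iff)
  then show ?thesis using ss zero_le_power2[of "l2_norm M (\<lambda>x. f x - s x)"] by (simp add: c_def)
qed

lemma Bessel_summable:
  assumes "f \<in> L2 M"
  shows "(\<lambda>n. (cmod (l2_inner M (\<psi> n) f))\<^sup>2) summable_on UNIV"
    "(\<Sum>\<^sub>\<infinity>n. (cmod (l2_inner M (\<psi> n) f))\<^sup>2) \<le> (l2_norm M f)\<^sup>2"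
proof -
  show 1: "(\<lambda>n. (cmod (l2_inner M (\<psi> n) f))\<^sup>2) summable_on UNIV"
    using Bessel[OF assms] by (intro nonneg_bdd_above_summable_on bdd_aboveI2[where M = "(l2_norm M f)\<^sup>2"]) auto
  show "(\<Sum>\<^sub>\<infinity>n. (cmod (l2_inner M (\<psi> n) f))\<^sup>2) \<le> (l2_norm M f)\<^sup>2"
    by (rule infsum_le_finite_sums[OF 1]) (rule Bessel[OF assms])
qed

lemma Riesz_Fischer:
  assumes c: "(\<lambda>n. (cmod (c n))\<^sup>2) summable_on UNIV"
  obtains f where "f \<in> L2 M" "(\<lambda>N. l2_norm M (\<lambda>x. (\<Sum>n<N. c n * \<psi> n x) - f x)) \<longlonglongrightarrow> 0"
proof -
  have sm: "summable (\<lambda>n. (cmod (c n))\<^sup>2)" by (rule summable_on_imp_summable[OF c])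
  have diff: "(l2_norm M (\<lambda>x. (\<Sum>n<m. c n * \<psi> n x) - (\<Sum>n<k. c n * \<psi> n x)))\<^sup>2 \<le> (\<Sum>n\<in>{k..<m}. (cmod (c n))\<^sup>2)"
    if "k \<le> m" for m k
  proof -
    have "(\<Sum>n<m. c n * \<psi> n x) - (\<Sum>n<k. c n * \<psi> n x) = (\<Sum>n\<in>{k..<m}. c n * \<psi> n x)" for x
      using sum.atLeastLessThan_concat[of 0 k m "\<lambda>n. c n * \<psi> n x"] that by (simp add: atLeast0LessThan) (metis add_diff_cancel_left')
    then have "(l2_norm M (\<lambda>x. (\<Sum>n<m. c n * \<psi> n x) - (\<Sum>n<k. c n * \<psi> n x)))\<^sup>2 = (\<Sum>n\<in>{k..<m}. (cmod (c n))\<^sup>2 * \<nu> n)"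
      by (simp add: norm_partial_sum)
    also have "\<dots> \<le> (\<Sum>n\<in>{k..<m}. (cmod (c n))\<^sup>2)"
      by (intro sum_mono mult_right_le_one_le nu) auto
    finally show ?thesis .
  qed
  show ?thesis
  proof (rule L2_complete[of "\<lambda>N x. \<Sum>n<N. c n * \<psi> n x" M])
    show "(\<lambda>x. \<Sum>n<N. c n * \<psi> n x) \<in> L2 M" for N by (rule partial_sum_L2)
    fix e :: real assume e: "0 < e"
    have "0 < e\<^sup>2" using e by simp
    then obtain N where N: "\<forall>m\<ge>N. \<forall>n. norm (\<Sum>n\<in>{m..<n}. (cmod (c n))\<^sup>2) < e\<^sup>2"
      using sm unfolding summable_Cauchy by blast
    have lt: "l2_norm M (\<lambda>x. (\<Sum>n<m. c n * \<psi> n x) - (\<Sum>n<k. c n * \<psi> n x)) < e" if "N \<le> k" "k \<le> m" for m k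
    proof -
      have "norm (\<Sum>n\<in>{k..<m}. (cmod (c n))\<^sup>2) < e\<^sup>2" using N that(1) by blast
      then have "(\<Sum>n\<in>{k..<m}. (cmod (c n))\<^sup>2) < e\<^sup>2" by simp
      then show ?thesis using power2_less_imp_less[OF le_less_trans[OF diff[OF that(2)]]] e by auto
    qed
    have sym: "l2_norm M (\<lambda>x. p x - q x) = l2_norm M (\<lambda>x. q x - p x)" for p q :: "'a \<Rightarrow> complex"
      by (simp add: l2_norm_def norm_minus_commute)
    show "\<exists>N. \<forall>m\<ge>N. \<forall>k\<ge>N. l2_norm M (\<lambda>x. (\<Sum>n<m. c n * \<psi> n x) - (\<Sum>n<k. c n * \<psi> n x)) < e"
    proof (intro exI allI impI)
      fix m k assume "N \<le> m" "N \<le> k"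
      then show "l2_norm M (\<lambda>x. (\<Sum>n<m. c n * \<psi> n x) - (\<Sum>n<k. c n * \<psi> n x)) < e"
      proof (cases "k \<le> m")
        case False
        then show ?thesis using lt[OF \<open>N \<le> m\<close>, of k] by (subst sym) simp
      qed (rule lt)
    qed
  qed (rule that)
qed

end

section \<open>Transfer to sequence space\<close>

locale onb = orthogonal_system M \<phi> "\<lambda>_. 1" for M :: "'a measure" and \<phi> +
  assumes complete: "\<And>f. f \<in> L2 M \<Longrightarrow> (\<And>n. l2_inner M (\<phi> n) f = 0) \<Longrightarrow> AE x in M. f x = 0"
begin

definition U :: "('a \<Rightarrow> complex) \<Rightarrow> nat ell2" where "U f = Ell2 (\<lambda>n. l2_inner M (\<phi> n) f)"

lemma coord_U: "f \<in> L2 M \<Longrightarrow> coord (U f) n = l2_inner M (\<phi> n) f"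
  unfolding U_def by (simp add: coord_Ell2 Bessel_summable(1))

lemma coefficients_of_limit:
  assumes f: "f \<in> L2 M" "(\<lambda>N. l2_norm M (\<lambda>x. (\<Sum>n<N. c n * \<phi> n x) - f x)) \<longlonglongrightarrow> 0"
  shows "l2_inner M (\<phi> m) f = c m"
proof (rule LIMSEQ_unique)
  show "(\<lambda>N. l2_inner M (\<phi> m) (\<lambda>x. \<Sum>n<N. c n * \<phi> n x)) \<longlonglongrightarrow> l2_inner M (\<phi> m) f"
    by (rule l2_inner_tendsto[OF partial_sum_L2 f psi])
  have "\<forall>\<^sub>F N in sequentially. l2_inner M (\<phi> m) (\<lambda>x. \<Sum>n<N. c n * \<phi> n x) = c m"
    using eventually_gt_at_top[of m] by eventually_elim (simp add: inner_partial_sum)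
  then show "(\<lambda>N. l2_inner M (\<phi> m) (\<lambda>x. \<Sum>n<N. c n * \<phi> n x)) \<longlonglongrightarrow> c m"
    by (rule tendsto_eventually)
qed

lemma U_onto: obtains f where "f \<in> L2 M" "U f = x"
proof (rule Riesz_Fischer[OF coord_summable[of x]])
  fix f assume f: "f \<in> L2 M" "(\<lambda>N. l2_norm M (\<lambda>t. (\<Sum>n<N. coord x n * \<phi> n t) - f t)) \<longlonglongrightarrow> 0"
  have "U f = x" by (rule ell2_eqI) (simp add: coord_U[OF f(1)] coefficients_of_limit[OF f])
  with f(1) show ?thesis by (rule that)
qed

lemma equal_coefficients:
  assumes "f \<in> L2 M" "g \<in> L2 M" "\<And>n. l2_inner M (\<phi> n) f = l2_inner M (\<phi> n) g"
  shows "AE x in M. f x = g x"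
proof -
  have "AE x in M. f x - g x = 0"
    by (rule complete[OF L2_diff[OF assms(1,2)]]) (simp add: l2_inner_diff_right psi assms)
  then show ?thesis by simp
qed

lemma U_eq_iff:
  assumes "f \<in> L2 M" "g \<in> L2 M"
  shows "U f = U g \<longleftrightarrow> (AE x in M. f x = g x)"
proof
  assume a: "U f = U g"
  show "AE x in M. f x = g x"
    by (rule equal_coefficients[OF assms]) (use coord_U[OF assms(1)] coord_U[OF assms(2)] a in metis)
next
  assume "AE x in M. f x = g x"
  then show "U f = U g"
    unfolding U_def using assms psi by (intro arg_cong[of _ _ Ell2] ext l2_inner_cong_AE) auto
qed

text \<open>The series converges to some function with the right coefficients, and completeness of
  the system identifies it with \<open>f\<close>.\<close>

lemma expansion:
  assumes f: "f \<in> L2 M"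
  shows "(\<lambda>N. l2_norm M (\<lambda>x. (\<Sum>n<N. coord (U f) n * \<phi> n x) - f x)) \<longlonglongrightarrow> 0"
proof (rule Riesz_Fischer[OF coord_summable[of "U f"]])
  fix g assume g: "g \<in> L2 M" "(\<lambda>N. l2_norm M (\<lambda>x. (\<Sum>n<N. coord (U f) n * \<phi> n x) - g x)) \<longlonglongrightarrow> 0"
  have "AE x in M. g x = f x"
    by (rule equal_coefficients[OF g(1) f]) (simp add: coefficients_of_limit[OF g] coord_U[OF f])
  then have ae: "AE x in M. (cmod ((\<Sum>n<N. coord (U f) n * \<phi> n x) - g x))\<^sup>2
      = (cmod ((\<Sum>n<N. coord (U f) n * \<phi> n x) - f x))\<^sup>2" for N
    by eventually_elim simp
  have "l2_norm M (\<lambda>x. (\<Sum>n<N. coord (U f) n * \<phi> n x) - g x)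
      = l2_norm M (\<lambda>x. (\<Sum>n<N. coord (U f) n * \<phi> n x) - f x)" for N
    unfolding l2_norm_def
    using L2_integrable[OF L2_diff[OF partial_sum_L2 g(1)]] L2_integrable[OF L2_diff[OF partial_sum_L2 f]]
    by (intro arg_cong[of _ _ sqrt] integral_cong_AE ae borel_measurable_integrable) auto
  then show ?thesis using g(2) by simp
qed

lemma cinner_U:
  assumes f: "f \<in> L2 M" and g: "g \<in> L2 M"
  shows "cinner (U g) (U f) = l2_inner M g f"
proof (rule LIMSEQ_unique)
  define s where "s N x = (\<Sum>n<N. coord (U f) n * \<phi> n x)" for N x
  have "l2_inner M g (s N) = (\<Sum>n<N. cnj (coord (U g) n) * coord (U f) n)" for N
  proof -
    have "l2_inner M g (s N) = (\<Sum>n<N. l2_inner M g (\<lambda>x. coord (U f) n * \<phi> n x))"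
      unfolding s_def by (rule l2_inner_sum_right[OF g L2_cmult[OF psi]])
    also have "\<dots> = (\<Sum>n<N. cnj (coord (U g) n) * coord (U f) n)"
      unfolding l2_inner_cmult_right coord_U[OF g] l2_inner_commute[of M g]
      by (simp add: mult.commute)
    finally show ?thesis .
  qed
  moreover have "(\<lambda>N. l2_inner M g (s N)) \<longlonglongrightarrow> l2_inner M g f"
    unfolding s_def by (rule l2_inner_tendsto[OF partial_sum_L2 f expansion[OF f] g])
  ultimately show "(\<lambda>N. \<Sum>n<N. cnj (coord (U g) n) * coord (U f) n) \<longlonglongrightarrow> l2_inner M g f" by simp
  show "(\<lambda>N. \<Sum>n<N. cnj (coord (U g) n) * coord (U f) n) \<longlonglongrightarrow> cinner (U g) (U f)"
    using has_sum_imp_sums[OF has_sum_infsum[OF cinner_summable[of "U g" "U f"]]]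
    unfolding cinner_def sums_def .
qed

lemma U_add_cmult:
  assumes "f \<in> L2 M" "g \<in> L2 M"
  shows "U (\<lambda>x. f x + c * g x) = U f + scaleC c (U g)"
  by (rule ell2_eqI)
     (simp add: coord_U assms L2_add L2_cmult l2_inner_add_right psi l2_inner_cmult_right)

lemma U_zero: "U (\<lambda>_. 0) = 0"
  by (rule ell2_eqI) (simp add: coord_U L2_zero)

text \<open>Preimage under \<open>U\<close>, which sees only the class of a function; hence all
  representatives are included, as \<open>linear_op\<close> demands.\<close>

definition lift :: "(nat ell2 \<times> nat ell2) set \<Rightarrow> 'a l2_op"
  where "lift R = {(f, u). f \<in> L2 M \<and> u \<in> L2 M \<and> (U f, U u) \<in> R}"

definition push :: "'a l2_op \<Rightarrow> (nat ell2 \<times> nat ell2) set"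
  where "push S = (\<lambda>(f, u). (U f, U u)) ` S"

lemma lift_comp: "lift R O lift R' = lift (R O R')"
proof (intro equalityI subrelI)
  fix f w assume "(f, w) \<in> lift (R O R')"
  then obtain y where y: "f \<in> L2 M" "w \<in> L2 M" "(U f, y) \<in> R" "(y, U w) \<in> R'"
    by (auto simp: lift_def)
  obtain u where "u \<in> L2 M" "U u = y" by (rule U_onto)
  then show "(f, w) \<in> lift R O lift R'" using y by (auto simp: lift_def intro!: relcompI[of f u])
qed (auto simp: lift_def)

lemma push_lift: "push (lift R) = R"
proof (intro equalityI subrelI)
  fix x y assume "(x, y) \<in> R"
  obtain f where f: "f \<in> L2 M" "U f = x" by (rule U_onto)
  obtain u where u: "u \<in> L2 M" "U u = y" by (rule U_onto)
  have "(f, u) \<in> lift R" using f u \<open>(x, y) \<in> R\<close> by (simp add: lift_def)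
  then show "(x, y) \<in> push (lift R)" unfolding push_def using f u by force
qed (auto simp: lift_def push_def)

lemma lift_push:
  assumes "linear_op M S"
  shows "lift (push S) = S"
proof (intro equalityI subrelI)
  fix f u assume "(f, u) \<in> lift (push S)"
  then obtain f' u' where fu: "f \<in> L2 M" "u \<in> L2 M" "(f', u') \<in> S" "U f = U f'" "U u = U u'"
    by (auto simp: lift_def push_def)
  have "f' \<in> L2 M" "u' \<in> L2 M" using assms fu(3) unfolding linear_op_def by blast+
  then have "AE x in M. f x = f' x" "AE x in M. u x = u' x" using U_eq_iff fu by metis+
  then show "(f, u) \<in> S" using assms fu(1-3) unfolding linear_op_def by blast
next
  fix f u assume S: "(f, u) \<in> S"
  then have "f \<in> L2 M" "u \<in> L2 M" using assms unfolding linear_op_def by blast+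
  moreover have "(U f, U u) \<in> push S" using S unfolding push_def by force
  ultimately show "(f, u) \<in> lift (push S)" by (simp add: lift_def)
qed

lemma linear_op_lift:
  assumes R0: "(0, 0) \<in> R"
    and lin: "\<And>f u g v c. (f, u) \<in> R \<Longrightarrow> (g, v) \<in> R \<Longrightarrow> (f + scaleC c g, u + scaleC c v) \<in> R"
    and sv: "\<And>u. (0, u) \<in> R \<Longrightarrow> u = 0"
  shows "linear_op M (lift R)"
  unfolding linear_op_def
proof (intro conjI)
  have "((\<lambda>_. 0), (\<lambda>_. 0)) \<in> lift R" using R0 by (simp add: lift_def L2_zero U_zero)
  then show "lift R \<noteq> {}" by blast
  show "lift R \<subseteq> L2 M \<times> L2 M" by (auto simp: lift_def)
  show "\<forall>(f, u)\<in>lift R. \<forall>(g, v)\<in>lift R. \<forall>c. (\<lambda>x. f x + c * g x, \<lambda>x. u x + c * v x) \<in> lift R"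
    using lin by (auto simp: lift_def U_add_cmult L2_add L2_cmult)
  show "\<forall>(f, u)\<in>lift R. \<forall>g\<in>L2 M. \<forall>v\<in>L2 M. (AE x in M. g x = f x) \<and> (AE x in M. v x = u x) \<longrightarrow> (g, v) \<in> lift R"
  proof (clarsimp simp: lift_def)
    fix f u g v assume a: "g \<in> L2 M" "v \<in> L2 M" "AE x in M. g x = f x" "AE x in M. v x = u x"
      "f \<in> L2 M" "u \<in> L2 M" "(U f, U u) \<in> R"
    then have "U g = U f" "U v = U u" using U_eq_iff by blast+
    then show "(U g, U v) \<in> R" using a by simp
  qed
  show "\<forall>(f, u)\<in>lift R. (AE x in M. f x = 0) \<longrightarrow> (AE x in M. u x = 0)"
  proof (intro ballI, unfold split_beta, intro impI)
    fix p assume "p \<in> lift R" and ae: "AE x in M. fst p x = 0"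
    then have a: "fst p \<in> L2 M" "snd p \<in> L2 M" "(U (fst p), U (snd p)) \<in> R" by (auto simp: lift_def)
    have "U (fst p) = 0" using U_eq_iff[OF a(1) L2_zero] ae U_zero by simp
    then have "U (snd p) = 0" using sv a(3) by simp
    then show "AE x in M. snd p x = 0" using U_eq_iff[OF a(2) L2_zero] U_zero by simp
  qed
qed

lemma m_accretive_lift:
  assumes R0: "(0, 0) \<in> R"
    and lin: "\<And>f u g v c. (f, u) \<in> R \<Longrightarrow> (g, v) \<in> R \<Longrightarrow> (f + scaleC c g, u + scaleC c v) \<in> R"
    and sv: "\<And>u. (0, u) \<in> R \<Longrightarrow> u = 0"
    and acc: "\<And>f u. (f, u) \<in> R \<Longrightarrow> 0 \<le> f \<bullet> u"
    and onto: "\<And>z u. 0 < Re z \<Longrightarrow> \<exists>f v. (f, v) \<in> R \<and> v + scaleC z f = u"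
  shows "m_accretive M (lift R)"
  unfolding m_accretive_def
proof (intro conjI allI impI)
  show "linear_op M (lift R)" by (rule linear_op_lift[OF R0 lin sv])
  show "accretive M (lift R)"
    using acc by (auto simp: accretive_def numerical_range_def lift_def cinner_U[symmetric] Re_cinner)
  fix z :: complex assume z: "0 < Re z"
  show "Range (shift_op z (lift R)) = L2 M"
  proof (intro equalityI subsetI)
    fix w assume w: "w \<in> L2 M"
    obtain f v where fv: "(f, v) \<in> R" "v + scaleC z f = U w" using onto[OF z] by blast
    obtain f' where f': "f' \<in> L2 M" "U f' = f" by (rule U_onto)
    have v': "(\<lambda>x. w x + (- z) * f' x) \<in> L2 M" by (intro L2_add L2_cmult w f')
    have "U (\<lambda>x. w x + (- z) * f' x) = v"
      unfolding U_add_cmult[OF w f'(1)] fv(2)[symmetric] f'(2) by (rule ell2_eqI) simp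
    then have "(f', \<lambda>x. w x + (- z) * f' x) \<in> lift R" using fv(1) f' v' by (simp add: lift_def)
    then have "(f', \<lambda>x. (w x + (- z) * f' x) + z * f' x) \<in> shift_op z (lift R)"
      unfolding shift_op_def by force
    then show "w \<in> Range (shift_op z (lift R))" by auto
  qed (auto simp: shift_op_def lift_def intro!: L2_add L2_cmult)
qed

text \<open>The numerical range speaks of unit vectors only, so a pair is first scaled to norm 1; if
  the first component is null, its image is 0 and nothing is to be shown.\<close>

lemma accretive_push:
  assumes "m_accretive M S" "(x, y) \<in> push S"
  shows "0 \<le> x \<bullet> y"
proof -
  have S: "linear_op M S" "accretive M S" using assms(1) by (auto simp: m_accretive_def)
  obtain f u where fu: "(f, u) \<in> S" "x = U f" "y = U u" using assms(2) by (auto simp: push_def)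
  have L2: "f \<in> L2 M" "u \<in> L2 M" using S(1) fu(1) unfolding linear_op_def by blast+
  have xy: "x \<bullet> y = Re (l2_inner M f u)"
    using cinner_U[OF L2(2,1)] by (simp add: fu Re_cinner[symmetric])
  show ?thesis
  proof (cases "l2_norm M f = 0")
    case True
    then have "U f = U (\<lambda>_. 0)" using l2_norm_eq_0[OF L2(1)] U_eq_iff[OF L2(1) L2_zero] by simp
    then show ?thesis by (simp add: fu U_zero)
  next
    case False
    define t where "t = 1 / l2_norm M f"
    have t: "0 < t" using False l2_norm_nonneg[of M f] by (simp add: t_def)
    \<comment> \<open>Scaling by t is written as f + (t - 1) f, the shape in which
      \<open>linear_op\<close> provides linearity.\<close>
    have "((\<lambda>x. f x + (of_real t - 1) * f x), (\<lambda>x. u x + (of_real t - 1) * u x)) \<in> S"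
      using S(1) fu(1) unfolding linear_op_def by blast
    then have tS: "((\<lambda>x. of_real t * f x), (\<lambda>x. of_real t * u x)) \<in> S"
      by (simp add: algebra_simps)
    have "(l2_norm M (\<lambda>x. of_real t * f x))\<^sup>2 = t\<^sup>2 * (l2_norm M f)\<^sup>2"
      by (simp add: l2_norm_square norm_mult power_mult_distrib)
    also have "\<dots> = 1" using False by (simp add: t_def power_mult_distrib[symmetric])
    finally have "l2_norm M (\<lambda>x. of_real t * f x) = 1"
      using l2_norm_nonneg[of M "\<lambda>x. of_real t * f x"] by (simp add: power2_eq_1_iff)
    then have "l2_inner M (\<lambda>x. of_real t * f x) (\<lambda>x. of_real t * u x) \<in> numerical_range M S"
      using tS unfolding numerical_range_def by blast
    then have "0 \<le> Re (l2_inner M (\<lambda>x. of_real t * f x) (\<lambda>x. of_real t * u x))"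
      using S(2) unfolding accretive_def by auto
    also have "\<dots> = t * t * Re (l2_inner M f u)"
      by (simp add: l2_inner_cmult_left l2_inner_cmult_right)
    finally show ?thesis using mult_pos_pos[OF t t] by (auto simp: xy zero_le_mult_iff)
  qed
qed

lemma subspace_push:
  assumes S: "linear_op M S"
  shows "subspace (push S)"
proof (rule subspaceI)
  have SL: "f \<in> L2 M" "u \<in> L2 M" if "(f, u) \<in> S" for f u using S that unfolding linear_op_def by blast+
  have lin: "((\<lambda>x. f x + c * g x), (\<lambda>x. u x + c * v x)) \<in> S" if "(f, u) \<in> S" "(g, v) \<in> S" for f u g v c
    using S that unfolding linear_op_def by blast
  have pl: "(x + scaleC c x', y + scaleC c y') \<in> push S" if "(x, y) \<in> push S" "(x', y') \<in> push S" for x y x' y' c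
  proof -
    obtain f u where fu: "(f, u) \<in> S" "x = U f" "y = U u"
      using \<open>(x, y) \<in> push S\<close> by (auto simp: push_def)
    obtain g v where gv: "(g, v) \<in> S" "x' = U g" "y' = U v"
      using \<open>(x', y') \<in> push S\<close> by (auto simp: push_def)
    have "(U (\<lambda>x. f x + c * g x), U (\<lambda>x. u x + c * v x)) \<in> push S"
      using lin[OF fu(1) gv(1), of c] unfolding push_def by force
    then show ?thesis by (simp add: U_add_cmult SL[OF fu(1)] SL[OF gv(1)] fu gv)
  qed
  obtain f u where "(f, u) \<in> S" using S unfolding linear_op_def by auto
  then have "(U f, U u) \<in> push S" unfolding push_def by force
  from pl[OF this this, of "-1"] show 0: "0 \<in> push S"
    by (simp add: scaleC_minus_one zero_prod_def)
  show "x + y \<in> push S" if "x \<in> push S" "y \<in> push S" for x y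
    using pl[of "fst x" "snd x" "fst y" "snd y" 1] that by (simp add: plus_prod_def)
  show "c *\<^sub>R x \<in> push S" if "x \<in> push S" for c x
    using pl[of 0 0 "fst x" "snd x" "of_real c"] that 0 
    by (simp add: scaleR_prod_def zero_prod_def) (metis ell2_eqI scaleC.rep_eq scaleR_conv_of_real scaleR_ell2.rep_eq)
qed

lemma push_comp:
  assumes S: "linear_op M S"
  shows "push S O push S = push (S O S)"
proof -
  have "push S O push S = push (lift (push S O push S))" by (simp add: push_lift)
  also have "\<dots> = push (S O S)" by (simp add: lift_comp[symmetric] lift_push[OF S])
  finally show ?thesis .
qed

text \<open>Every competing m-accretive root is carried by \<open>push\<close> to sequence space,
  where uniqueness for accretive subspaces applies, and brought back by \<open>lift\<close>.\<close>

lemma sqrt_op_lift: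
  assumes "m_accretive M (lift R)"
    and unique: "\<And>R'. subspace R' \<Longrightarrow> (\<And>f u. (f, u) \<in> R' \<Longrightarrow> 0 \<le> f \<bullet> u) \<Longrightarrow> R' O R' = R O R \<Longrightarrow> R' = R"
  shows "sqrt_op M (lift (R O R)) = lift R"
  unfolding sqrt_op_def
proof (rule the_equality)
  show "m_accretive M (lift R) \<and> lift R O lift R = lift (R O R)"
    using assms(1) by (simp add: lift_comp)
  fix S assume S: "m_accretive M S \<and> S O S = lift (R O R)"
  then have lin: "linear_op M S" by (simp add: m_accretive_def)
  have "push S = R"
  proof (rule unique[OF subspace_push[OF lin]])
    show "push S O push S = R O R" using S by (simp add: push_comp[OF lin] push_lift)
  qed (use accretive_push S in blast)
  then show "S = lift R" using lift_push[OF lin] by simp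
qed

end

section \<open>Shifted operators and sectors\<close>

lemma shift_op_iff: "(f, u) \<in> shift_op z T \<longleftrightarrow> (f, \<lambda>x. u x - z * f x) \<in> T"
proof
  assume "(f, u) \<in> shift_op z T"
  then obtain v where "(f, v) \<in> T" "u = (\<lambda>x. v x + z * f x)" unfolding shift_op_def by auto
  then show "(f, \<lambda>x. u x - z * f x) \<in> T" by simp
next
  assume "(f, \<lambda>x. u x - z * f x) \<in> T"
  then show "(f, u) \<in> shift_op z T" unfolding shift_op_def by (force intro: image_eqI)
qed

lemma shift_op_shift_op: "shift_op z (shift_op w T) = shift_op (z + w) T"
proof (intro set_eqI)
  fix p :: "('a \<Rightarrow> complex) \<times> ('a \<Rightarrow> complex)"
  obtain f u where p: "p = (f, u)" by (cases p)
  have "(\<lambda>x. u x - z * f x - w * f x) = (\<lambda>x. u x - (z + w) * f x)" by (simp add: algebra_simps)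
  then show "p \<in> shift_op z (shift_op w T) \<longleftrightarrow> p \<in> shift_op (z + w) T" by (simp only: p shift_op_iff)
qed

lemma shift_op_0: "shift_op 0 T = T"
  by (auto simp: set_eq_iff shift_op_iff)

lemma linear_op_shift:
  assumes T: "linear_op M T"
  shows "linear_op M (shift_op z T)"
proof -
  have L: "T \<subseteq> L2 M \<times> L2 M" using T by (simp add: linear_op_def)
  have lin: "(\<lambda>x. f x + c * g x, \<lambda>x. u x + c * v x) \<in> T" if "(f, u) \<in> T" "(g, v) \<in> T" for f u g v c
    using T that unfolding linear_op_def by blast
  have cl: "(g, v) \<in> T" if "(f, u) \<in> T" "g \<in> L2 M" "v \<in> L2 M" "AE x in M. g x = f x" "AE x in M. v x = u x" for f u g v
    using T that unfolding linear_op_def by blast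
  have sv: "AE x in M. u x = 0" if "(f, u) \<in> T" "AE x in M. f x = 0" for f u
    using T that unfolding linear_op_def by blast
  have SL: "f \<in> L2 M \<and> u \<in> L2 M" if "(f, u) \<in> shift_op z T" for f u
  proof -
    have f: "f \<in> L2 M" "(\<lambda>x. u x - z * f x) \<in> L2 M" using that L by (auto simp: shift_op_iff)
    have "(\<lambda>x. (u x - z * f x) + z * f x) \<in> L2 M" by (intro L2_add L2_cmult f)
    then show ?thesis using f by simp
  qed
  show ?thesis
    unfolding linear_op_def
  proof (intro conjI)
    show "shift_op z T \<noteq> {}" using T by (simp add: linear_op_def shift_op_def)
    show "shift_op z T \<subseteq> L2 M \<times> L2 M" using SL by auto
    show "\<forall>(f, u)\<in>shift_op z T. \<forall>(g, v)\<in>shift_op z T. \<forall>c. (\<lambda>x. f x + c * g x, \<lambda>x. u x + c * v x) \<in> shift_op z T"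
    proof clarify
      fix f u g v c assume "(f, u) \<in> shift_op z T" "(g, v) \<in> shift_op z T"
      then have "(\<lambda>x. f x + c * g x, \<lambda>x. (u x - z * f x) + c * (v x - z * g x)) \<in> T"
        unfolding shift_op_iff by (rule lin)
      moreover have "(\<lambda>x. (u x - z * f x) + c * (v x - z * g x)) = (\<lambda>x. u x + c * v x - z * (f x + c * g x))"
        by (simp add: algebra_simps)
      ultimately show "(\<lambda>x. f x + c * g x, \<lambda>x. u x + c * v x) \<in> shift_op z T" by (simp only: shift_op_iff)
    qed
    show "\<forall>(f, u)\<in>shift_op z T. \<forall>g\<in>L2 M. \<forall>v\<in>L2 M. (AE x in M. g x = f x) \<and> (AE x in M. v x = u x) \<longrightarrow> (g, v) \<in> shift_op z T"
    proof clarify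
      fix f u g v
      assume fu: "(f, u) \<in> shift_op z T" and gv: "g \<in> L2 M" "v \<in> L2 M" "AE x in M. g x = f x" "AE x in M. v x = u x"
      have "(g, \<lambda>x. v x - z * g x) \<in> T"
      proof (rule cl[OF fu[unfolded shift_op_iff] gv(1) _ gv(3)])
        show "(\<lambda>x. v x - z * g x) \<in> L2 M" by (intro L2_diff L2_cmult gv)
        show "AE x in M. v x - z * g x = u x - z * f x" using gv(3,4) by eventually_elim simp
      qed
      then show "(g, v) \<in> shift_op z T" by (simp only: shift_op_iff)
    qed
    show "\<forall>(f, u)\<in>shift_op z T. (AE x in M. f x = 0) \<longrightarrow> (AE x in M. u x = 0)"
    proof (intro ballI case_prodI2 impI)
      fix p f u assume "p \<in> shift_op z T" "p = (f, u)" and f: "AE x in M. f x = 0"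
      then have fu: "(f, u) \<in> shift_op z T" by simp
      show "AE x in M. u x = 0"
        using sv[OF fu[unfolded shift_op_iff] f] f by eventually_elim simp
    qed
  qed
qed

text \<open>The cosine of |Arg z| is Re z / |z|; at z = 0 the convention Arg 0 = 0 gives the
  claim.\<close>

lemma abs_Arg_le_arccos:
  assumes c: "0 < c" "c \<le> 1" and z: "c * cmod z \<le> Re z"
  shows "\<bar>Arg z\<bar> \<le> arccos c"
proof (cases "z = 0")
  case True
  then show ?thesis using arccos_lbound[of c] c by (simp add: Arg_zero)
next
  case False
  have "c \<le> Re z / cmod z" using z False by (simp add: field_simps)
  also have "Re z / cmod z = cos \<bar>Arg z\<bar>" using cos_Arg[OF False] by (simp add: abs_if)
  finally have "arccos (cos \<bar>Arg z\<bar>) \<le> arccos c" using c by (intro arccos_le_arccos) auto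
  moreover have "\<bar>Arg z\<bar> \<le> pi" using Arg_bounded[of z] by linarith
  ultimately show ?thesis using arccos_cos[of "\<bar>Arg z\<bar>"] by linarith
qed

section \<open>Absolutely continuous functions\<close>

definition ac_modulus :: "real \<Rightarrow> real \<Rightarrow> (real \<Rightarrow> complex) \<Rightarrow> real \<Rightarrow> real \<Rightarrow> bool" where
  "ac_modulus a b h \<epsilon> \<delta> \<longleftrightarrow>
     (\<forall>(n::nat) l r. (\<forall>k<n. a \<le> l k \<and> l k \<le> r k \<and> r k \<le> b) \<and>
        disjoint_family_on (\<lambda>k. {l k<..<r k}) {..<n} \<and> (\<Sum>k<n. r k - l k) < \<delta>
        \<longrightarrow> (\<Sum>k<n. cmod (h (r k) - h (l k))) < \<epsilon>)"

lemma abs_cont_iff_modulus: "abs_cont a b h \<longleftrightarrow> (\<forall>\<epsilon>>0. \<exists>\<delta>>0. ac_modulus a b h \<epsilon> \<delta>)"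
  unfolding abs_cont_def ac_modulus_def ..

text \<open>Allows arbitrary finite index sets in place of initial segments of the naturals, for
  dyadic intervals and for families of families of intervals.\<close>

lemma ac_modulusD:
  assumes h: "ac_modulus a b h \<epsilon> \<delta>" and I: "finite I"
    and lr: "\<And>k. k \<in> I \<Longrightarrow> a \<le> l k \<and> l k \<le> r k \<and> r k \<le> b"
    and dis: "disjoint_family_on (\<lambda>k. {l k<..<r k}) I" and small: "(\<Sum>k\<in>I. r k - l k) < \<delta>"
  shows "(\<Sum>k\<in>I. cmod (h (r k) - h (l k))) < \<epsilon>"
proof -
  obtain e where e: "bij_betw e {..<card I} I"
    using ex_bij_betw_nat_finite[OF I] by (auto simp: atLeast0LessThan)
  have eI: "e k \<in> I" if "k < card I" for k using e that by (auto simp: bij_betw_def)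
  have "(\<Sum>k<card I. cmod (h (r (e k)) - h (l (e k)))) < \<epsilon>"
  proof (rule h[unfolded ac_modulus_def, rule_format], intro conjI allI impI)
    show "disjoint_family_on (\<lambda>k. {l (e k)<..<r (e k)}) {..<card I}"
      using dis e unfolding disjoint_family_on_def bij_betw_def inj_on_def by blast
    show "(\<Sum>k<card I. r (e k) - l (e k)) < \<delta>"
      using small sum.reindex_bij_betw[OF e, of "\<lambda>k. r k - l k"] by simp
  qed (use lr eI in auto)
  then show ?thesis
    using sum.reindex_bij_betw[OF e, of "\<lambda>k. cmod (h (r k) - h (l k))"] by simp
qed

text \<open>One criterion that serves for differences as well as for products of bounded
  functions.\<close>

lemma abs_cont_dominated:
  assumes f1: "abs_cont a b f1" and f2: "abs_cont a b f2" and C: "0 \<le> C"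
    and dom: "\<And>x y. a \<le> x \<Longrightarrow> x \<le> y \<Longrightarrow> y \<le> b \<Longrightarrow>
      cmod (g y - g x) \<le> C * (cmod (f1 y - f1 x) + cmod (f2 y - f2 x))"
  shows "abs_cont a b g"
  unfolding abs_cont_iff_modulus
proof (intro allI impI)
  fix \<epsilon> :: real assume \<epsilon>: "0 < \<epsilon>"
  \<comment> \<open>\<open>C + 1\<close> instead of \<open>C\<close> covers C = 0 and makes the
    final inequality strict.\<close>
  define \<eta> where "\<eta> = \<epsilon> / (2 * (C + 1))"
  have \<eta>: "0 < \<eta>" using \<epsilon> C by (simp add: \<eta>_def)
  obtain d1 where d1: "0 < d1" "ac_modulus a b f1 \<eta> d1" using f1 \<eta> unfolding abs_cont_iff_modulus by blast
  obtain d2 where d2: "0 < d2" "ac_modulus a b f2 \<eta> d2" using f2 \<eta> unfolding abs_cont_iff_modulus by blast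
  have "ac_modulus a b g \<epsilon> (min d1 d2)"
    unfolding ac_modulus_def
  proof (intro allI impI; elim conjE)
    fix n :: nat and l r :: "nat \<Rightarrow> real"
    assume lr: "\<forall>k<n. a \<le> l k \<and> l k \<le> r k \<and> r k \<le> b"
      and dis: "disjoint_family_on (\<lambda>k. {l k<..<r k}) {..<n}" and small: "(\<Sum>k<n. r k - l k) < min d1 d2"
    have s1: "(\<Sum>k<n. cmod (f1 (r k) - f1 (l k))) < \<eta>"
      by (rule ac_modulusD[OF d1(2)]) (use lr dis small in auto)
    have s2: "(\<Sum>k<n. cmod (f2 (r k) - f2 (l k))) < \<eta>"
      by (rule ac_modulusD[OF d2(2)]) (use lr dis small in auto)
    have "(\<Sum>k<n. cmod (g (r k) - g (l k)))
        \<le> (\<Sum>k<n. C * (cmod (f1 (r k) - f1 (l k)) + cmod (f2 (r k) - f2 (l k))))"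
      using lr by (intro sum_mono dom) auto
    also have "\<dots> = C * ((\<Sum>k<n. cmod (f1 (r k) - f1 (l k))) + (\<Sum>k<n. cmod (f2 (r k) - f2 (l k))))"
      by (simp only: sum_distrib_left[symmetric] sum.distrib)
    also have "\<dots> \<le> C * (\<eta> + \<eta>)" using s1 s2 C by (intro mult_left_mono) auto
    also have "\<dots> < (C + 1) * (\<eta> + \<eta>)" using \<eta> by (intro mult_strict_right_mono) auto
    also have "\<dots> = (2 * (C + 1)) * \<eta>" by (simp add: algebra_simps)
    also have "\<dots> = \<epsilon>"
    proof -
      have "2 * (C + 1) \<noteq> 0" using C by simp
      then show ?thesis unfolding \<eta>_def unfolding times_divide_eq_right by (rule nonzero_mult_div_cancel_left)
    qed
    finally show "(\<Sum>k<n. cmod (g (r k) - g (l k))) < \<epsilon>" .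
  qed
  then show "\<exists>\<delta>>0. ac_modulus a b g \<epsilon> \<delta>" using d1(1) d2(1) by (intro exI[of _ "min d1 d2"]) auto
qed

lemma abs_cont_uniform:
  assumes "abs_cont a b h" "0 < \<epsilon>"
  obtains \<delta> where "0 < \<delta>" "\<And>x y. a \<le> x \<Longrightarrow> x \<le> y \<Longrightarrow> y \<le> b \<Longrightarrow> y - x < \<delta> \<Longrightarrow> cmod (h y - h x) < \<epsilon>"
proof -
  obtain \<delta> where \<delta>: "0 < \<delta>" "ac_modulus a b h \<epsilon> \<delta>" using assms unfolding abs_cont_iff_modulus by blast
  show ?thesis
  proof (rule that[OF \<delta>(1)])
    fix x y assume "a \<le> x" "x \<le> y" "y \<le> b" "y - x < \<delta>"
    then show "cmod (h y - h x) < \<epsilon>"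
      using ac_modulusD[OF \<delta>(2), of "{()}" "\<lambda>_. x" "\<lambda>_. y"] by (simp add: disjoint_family_on_def)
  qed
qed

lemma abs_cont_continuous_on:
  assumes "abs_cont a b h"
  shows "continuous_on {a..b} h"
  unfolding continuous_on_iff
proof (intro ballI allI impI)
  fix x e :: real assume x: "x \<in> {a..b}" and e: "0 < e"
  obtain \<delta> where \<delta>: "0 < \<delta>"
    "\<And>x y. a \<le> x \<Longrightarrow> x \<le> y \<Longrightarrow> y \<le> b \<Longrightarrow> y - x < \<delta> \<Longrightarrow> cmod (h y - h x) < e"
    using abs_cont_uniform[OF assms e] by blast
  have "dist (h y) (h x) < e" if "y \<in> {a..b}" "dist y x < \<delta>" for y
    using that x \<delta>(2)[of x y] \<delta>(2)[of y x]
    by (cases "x \<le> y") (auto simp: dist_norm norm_minus_commute)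
  then show "\<exists>d>0. \<forall>y\<in>{a..b}. dist y x < d \<longrightarrow> dist (h y) (h x) < e" using \<delta>(1) by blast
qed

text \<open>The disjoint subintervals may leave gaps, as in absolute continuity; filling the gaps
  only increases a sum, so the supremum is the usual total variation.\<close>

definition var_sums :: "(real \<Rightarrow> complex) \<Rightarrow> real \<Rightarrow> real \<Rightarrow> real set" where
  "var_sums h x y = {\<Sum>k<n. cmod (h (r k) - h (l k)) | (n::nat) l r.
     (\<forall>k<n. x \<le> l k \<and> l k \<le> r k \<and> r k \<le> y) \<and> disjoint_family_on (\<lambda>k. {l k<..<r k}) {..<n}}"

lemma var_sumsI:
  fixes l r :: "nat \<Rightarrow> real"
  assumes "\<forall>k<n. x \<le> l k \<and> l k \<le> r k \<and> r k \<le> y" "disjoint_family_on (\<lambda>k. {l k<..<r k}) {..<n}"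
  shows "(\<Sum>k<n. cmod (h (r k) - h (l k))) \<in> var_sums h x y"
  unfolding var_sums_def using assms by (intro CollectI exI conjI) (rule refl, assumption+)

lemma var_sums_0: "0 \<in> var_sums h x y"
  unfolding var_sums_def by (intro CollectI exI[of _ 0]) (simp add: disjoint_family_on_def)

text \<open>Every interval is cut at \<open>y\<close> by minimum and maximum: on the wrong side it
  shrinks to a point and contributes 0, and if \<open>y\<close> lies inside it the triangle
  inequality applies.\<close>

lemma var_sums_split:
  assumes "s \<in> var_sums h x z" "x \<le> y" "y \<le> z"
  obtains s1 s2 where "s1 \<in> var_sums h x y" "s2 \<in> var_sums h y z" "s \<le> s1 + s2"
proof -
  obtain n :: nat and l r where s: "s = (\<Sum>k<n. cmod (h (r k) - h (l k)))"
    and lr: "\<And>k. k < n \<Longrightarrow> x \<le> l k \<and> l k \<le> r k \<and> r k \<le> z"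
    and dis: "disjoint_family_on (\<lambda>k. {l k<..<r k}) {..<n}"
    using assms(1) unfolding var_sums_def by blast
  define s1 where "s1 = (\<Sum>k<n. cmod (h (min (r k) y) - h (min (l k) y)))"
  define s2 where "s2 = (\<Sum>k<n. cmod (h (max (r k) y) - h (max (l k) y)))"
  have sub: "{min (l k) y<..<min (r k) y} \<subseteq> {l k<..<r k}" "{max (l k) y<..<max (r k) y} \<subseteq> {l k<..<r k}" for k
    by auto
  have "disjoint_family_on (\<lambda>k. {min (l k) y<..<min (r k) y}) {..<n}"
    using dis sub(1) unfolding disjoint_family_on_def by blast
  moreover have "\<forall>k<n. x \<le> min (l k) y \<and> min (l k) y \<le> min (r k) y \<and> min (r k) y \<le> y"
  proof (intro allI impI)
    fix k assume "k < n"
    from lr[OF this] show "x \<le> min (l k) y \<and> min (l k) y \<le> min (r k) y \<and> min (r k) y \<le> y"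
      using assms(2) by (auto simp: min_def)
  qed
  ultimately have 1: "s1 \<in> var_sums h x y" unfolding s1_def by (intro var_sumsI)
  have "disjoint_family_on (\<lambda>k. {max (l k) y<..<max (r k) y}) {..<n}"
    using dis sub(2) unfolding disjoint_family_on_def by blast
  moreover have "\<forall>k<n. y \<le> max (l k) y \<and> max (l k) y \<le> max (r k) y \<and> max (r k) y \<le> z"
  proof (intro allI impI)
    fix k assume "k < n"
    from lr[OF this] show "y \<le> max (l k) y \<and> max (l k) y \<le> max (r k) y \<and> max (r k) y \<le> z"
      using assms(3) by (auto simp: max_def)
  qed
  ultimately have 2: "s2 \<in> var_sums h y z" unfolding s2_def by (intro var_sumsI)
  have "cmod (h (r k) - h (l k)) \<le> cmod (h (min (r k) y) - h (min (l k) y)) + cmod (h (max (r k) y) - h (max (l k) y))"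
    if "k < n" for k
    using lr[OF that] norm_triangle_ineq[of "h (r k) - h y" "h y - h (l k)"]
    by (auto simp: min_def max_def)
  then have "s \<le> s1 + s2" unfolding s s1_def s2_def sum.distrib[symmetric] by (intro sum_mono) auto
  with 1 2 show ?thesis by (rule that)
qed

lemma var_sums_append:
  assumes "s \<in> var_sums h x y" "x \<le> y" "y \<le> z"
  shows "s + cmod (h z - h y) \<in> var_sums h x z"
proof -
  obtain n :: nat and l r where s: "s = (\<Sum>k<n. cmod (h (r k) - h (l k)))"
    and lr: "\<And>k. k < n \<Longrightarrow> x \<le> l k \<and> l k \<le> r k \<and> r k \<le> y"
    and dis: "disjoint_family_on (\<lambda>k. {l k<..<r k}) {..<n}"
    using assms(1) unfolding var_sums_def by blast
  define l' where "l' = l(n := y)"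
  define r' where "r' = r(n := z)"
  have "s + cmod (h z - h y) = (\<Sum>k<Suc n. cmod (h (r' k) - h (l' k)))"
    by (simp add: s l'_def r'_def)
  moreover have "\<forall>k<Suc n. x \<le> l' k \<and> l' k \<le> r' k \<and> r' k \<le> z"
  proof (intro allI impI)
    fix k assume "k < Suc n"
    then consider "k < n" | "k = n" by linarith
    then show "x \<le> l' k \<and> l' k \<le> r' k \<and> r' k \<le> z"
    proof cases
      case 1
      then show ?thesis using lr[OF 1] assms(2,3) by (auto simp: l'_def r'_def)
    qed (use assms(2,3) in \<open>auto simp: l'_def r'_def\<close>)
  qed
  moreover have "disjoint_family_on (\<lambda>k. {l' k<..<r' k}) {..<Suc n}"
  proof -
    have 1: "{l i<..<r i} \<inter> {y<..<z} = {}" if "i < n" for i using lr[OF that] by auto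
    have 2: "{l i<..<r i} \<inter> {l j<..<r j} = {}" if "i < n" "j < n" "i \<noteq> j" for i j
      using dis that unfolding disjoint_family_on_def by blast
    show ?thesis
      unfolding disjoint_family_on_def
    proof (intro ballI impI)
      fix i j assume ij: "i \<in> {..<Suc n}" "j \<in> {..<Suc n}" "i \<noteq> j"
      then consider "i < n" "j < n" | "i = n" "j < n" | "i < n" "j = n" by force
      then show "{l' i<..<r' i} \<inter> {l' j<..<r' j} = {}"
      proof cases
        case 1
        then show ?thesis using 2[of i j] ij by (simp add: l'_def r'_def)
      next
        case 2
        then show ?thesis using 1[of j] by (simp add: l'_def r'_def Int_commute)
      next
        case 3
        then show ?thesis using 1[of i] by (simp add: l'_def r'_def)
      qed
    qed
  qed
  ultimately show ?thesis using var_sumsI[of "Suc n" x l' r' z h] by simp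
qed

lemma sum_length_le:
  fixes l r :: "'i \<Rightarrow> real"
  assumes I: "finite I" and lr: "\<And>k. k \<in> I \<Longrightarrow> x \<le> l k \<and> l k \<le> r k \<and> r k \<le> y"
    and dis: "disjoint_family_on (\<lambda>k. {l k<..<r k}) I" and xy: "x \<le> y"
  shows "(\<Sum>k\<in>I. r k - l k) \<le> y - x"
proof -
  have "(\<Sum>k\<in>I. r k - l k) = (\<Sum>k\<in>I. measure lborel {l k<..<r k})"
    using lr by (intro sum.cong) auto
  also have "\<dots> = measure lborel (\<Union>k\<in>I. {l k<..<r k})"
    using lr by (intro measure_finite_Union[symmetric] I dis) auto
  also have "\<dots> \<le> measure lborel {x..y}"
  proof (rule measure_mono_fmeasurable)
    show "(\<Union>k\<in>I. {l k<..<r k}) \<subseteq> {x..y}" using lr by fastforce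
    show "(\<Union>k\<in>I. {l k<..<r k}) \<in> sets lborel" by (simp, intro borel_open open_UN) auto
    show "{x..y} \<in> fmeasurable lborel" using xy by (intro fmeasurableI) (simp_all add: emeasure_lborel_Icc)
  qed
  finally show ?thesis using xy by simp
qed

definition variation :: "(real \<Rightarrow> complex) \<Rightarrow> real \<Rightarrow> real \<Rightarrow> real" where
  "variation h a x = Sup (var_sums h a x)"

text \<open>An interval shorter than the \<delta> belonging to 1 carries variation at most 1, and
  finitely many steps of length \<delta>/2 exhaust the whole interval.\<close>

lemma var_sums_bounded:
  assumes h: "abs_cont a b h"
  shows "\<exists>C. \<forall>x\<in>{a..b}. \<forall>s\<in>var_sums h a x. s \<le> C"
proof -
  obtain \<delta> where \<delta>: "0 < \<delta>" "ac_modulus a b h 1 \<delta>"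
    using h zero_less_one unfolding abs_cont_iff_modulus by blast
  have small: "s \<le> 1" if s: "s \<in> var_sums h x y" and xy: "a \<le> x" "x \<le> y" "y \<le> b" "y - x < \<delta>" for s x y
  proof -
    obtain n :: nat and l r where s: "s = (\<Sum>k<n. cmod (h (r k) - h (l k)))"
      and lr: "\<And>k. k < n \<Longrightarrow> x \<le> l k \<and> l k \<le> r k \<and> r k \<le> y"
      and dis: "disjoint_family_on (\<lambda>k. {l k<..<r k}) {..<n}"
      using s unfolding var_sums_def by blast
    have "(\<Sum>k<n. r k - l k) \<le> y - x"
      using lr by (intro sum_length_le dis xy) auto
    then have "s < 1" unfolding s
      by (intro ac_modulusD[OF \<delta>(2)] dis) (use lr xy in force)+
    then show ?thesis by simp
  qed
  have step: "\<forall>x\<in>{a..b}. x \<le> a + real n * (\<delta>/2) \<longrightarrow> (\<forall>s\<in>var_sums h a x. s \<le> real n + 1)" for n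
  proof (induction n)
    case 0
    show ?case using small[of _ a] \<delta>(1) by force
  next
    case (Suc n)
    show ?case
    proof (intro ballI impI)
      fix x s assume x: "x \<in> {a..b}" "x \<le> a + real (Suc n) * (\<delta>/2)" and s: "s \<in> var_sums h a x"
      define x0 where "x0 = max a (x - \<delta>/2)"
      have x0: "a \<le> x0" "x0 \<le> x" "x - x0 < \<delta>" "x0 \<in> {a..b}"
        using x \<delta>(1) by (auto simp: x0_def)
      have x1: "x0 \<le> a + real n * (\<delta>/2)"
      proof -
        have "real (Suc n) * (\<delta>/2) = real n * (\<delta>/2) + \<delta>/2" by (simp add: distrib_right add_divide_distrib)
        moreover have "0 \<le> real n * (\<delta>/2)" using \<delta>(1) by simp
        ultimately show ?thesis using x(2) unfolding x0_def by linarith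
      qed
      obtain s1 s2 where s12: "s1 \<in> var_sums h a x0" "s2 \<in> var_sums h x0 x" "s \<le> s1 + s2"
        using var_sums_split[OF s x0(1,2)] .
      have "s1 \<le> real n + 1" using Suc.IH x0(4) x1 s12(1) by blast
      moreover have "s2 \<le> 1" using small[OF s12(2)] x0 x by auto
      ultimately show "s \<le> real (Suc n) + 1" using s12(3) by simp
    qed
  qed
  obtain n where "(b - a) / (\<delta>/2) \<le> real n" using real_arch_simple by blast
  then have "b \<le> a + real n * (\<delta>/2)" using \<delta>(1) by (simp add: field_simps)
  then have "\<forall>x\<in>{a..b}. \<forall>s\<in>var_sums h a x. s \<le> real n + 1" using step[of n] by fastforce
  then show ?thesis by blast
qed

section \<open>The variation function\<close>

context
  fixes a b :: real and h :: "real \<Rightarrow> complex"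
  assumes h: "abs_cont a b h"
begin

lemma variation_bdd: "x \<in> {a..b} \<Longrightarrow> bdd_above (var_sums h a x)"
  using var_sums_bounded[OF h] unfolding bdd_above_def by blast

lemma variation_upper: "x \<in> {a..b} \<Longrightarrow> s \<in> var_sums h a x \<Longrightarrow> s \<le> variation h a x"
  unfolding variation_def by (intro cSup_upper variation_bdd)

lemma variation_increment:
  assumes "a \<le> x" "x \<le> y" "y \<le> b"
  shows "cmod (h y - h x) \<le> variation h a y - variation h a x"
proof -
  have "variation h a x \<le> variation h a y - cmod (h y - h x)"
    unfolding variation_def[of h a x]
  proof (rule cSup_least)
    show "var_sums h a x \<noteq> {}" using var_sums_0 by blast
    fix s assume "s \<in> var_sums h a x"
    from var_sums_append[OF this assms(1,2)] show "s \<le> variation h a y - cmod (h y - h x)"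
      using variation_upper[of y] assms by fastforce
  qed
  then show ?thesis by simp
qed

lemma variation_approx:
  assumes "a \<le> x" "x \<le> y" "y \<le> b" "0 < \<eta>"
  obtains s where "s \<in> var_sums h x y" "variation h a y - variation h a x \<le> s + \<eta>"
proof -
  have "variation h a y - \<eta> < Sup (var_sums h a y)" using assms(4) by (simp add: variation_def)
  then obtain s where s: "s \<in> var_sums h a y" "variation h a y - \<eta> < s"
    using less_cSupE[of _ "var_sums h a y"] var_sums_0[of h a y] by blast
  obtain s1 s2 where s12: "s1 \<in> var_sums h a x" "s2 \<in> var_sums h x y" "s \<le> s1 + s2"
    using var_sums_split[OF s(1) assms(1,2)] .
  have "s1 \<le> variation h a x" using variation_upper[of x s1] s12(1) assms by auto
  then show ?thesis using that[OF s12(2)] s(2) s12(3) by linarith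
qed

text \<open>The \<delta> that serves \<open>h\<close> for \<epsilon>/2 serves the variation for
  \<epsilon>: each increment of the variation is nearly attained by a finite family inside its
  interval, and all these families together are again disjoint with total length below
  \<delta>.\<close>

lemma abs_cont_variation: "abs_cont a b (\<lambda>x. of_real (variation h a x))"
  unfolding abs_cont_iff_modulus
proof (intro allI impI)
  fix \<epsilon> :: real assume \<epsilon>: "0 < \<epsilon>"
  obtain \<delta> where \<delta>: "0 < \<delta>" "ac_modulus a b h (\<epsilon>/2) \<delta>"
    using h \<epsilon> unfolding abs_cont_iff_modulus by (meson half_gt_zero)
  have "ac_modulus a b (\<lambda>x. of_real (variation h a x)) \<epsilon> \<delta>"
    unfolding ac_modulus_def
  proof (intro allI impI; elim conjE)
    fix n :: nat and l r :: "nat \<Rightarrow> real"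
    assume lr: "\<forall>k<n. a \<le> l k \<and> l k \<le> r k \<and> r k \<le> b"
      and dis: "disjoint_family_on (\<lambda>k. {l k<..<r k}) {..<n}" and small: "(\<Sum>k<n. r k - l k) < \<delta>"
    \<comment> \<open>Error allowed on each interval; the \<open>n\<close> errors together are at
      most \<epsilon>/2.\<close>
    define \<eta> where "\<eta> = \<epsilon> / (2 * (real n + 1))"
    have \<eta>: "0 < \<eta>" using \<epsilon> by (simp add: \<eta>_def)
    define P :: "nat \<Rightarrow> nat \<times> (nat \<Rightarrow> real) \<times> (nat \<Rightarrow> real) \<Rightarrow> bool" where
      "P j = (\<lambda>(m, L, R). variation h a (r j) - variation h a (l j) \<le> (\<Sum>k<m. cmod (h (R k) - h (L k))) + \<eta> \<and>
        (\<forall>k<m. l j \<le> L k \<and> L k \<le> R k \<and> R k \<le> r j) \<and> disjoint_family_on (\<lambda>k. {L k<..<R k}) {..<m})" for j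
    have "\<exists>q. P j q" if "j < n" for j
    proof -
      have "a \<le> l j" "l j \<le> r j" "r j \<le> b" using lr that by auto
      then obtain s where s: "s \<in> var_sums h (l j) (r j)" "variation h a (r j) - variation h a (l j) \<le> s + \<eta>"
        by (rule variation_approx[OF _ _ _ \<eta>])
      from s(1) obtain m :: nat and L R where "s = (\<Sum>k<m. cmod (h (R k) - h (L k)))"
        "\<forall>k<m. l j \<le> L k \<and> L k \<le> R k \<and> R k \<le> r j" "disjoint_family_on (\<lambda>k. {L k<..<R k}) {..<m}"
        unfolding var_sums_def mem_Collect_eq by (elim exE conjE)
      then have "P j (m, L, R)" using s(2) unfolding P_def by simp
      then show ?thesis ..
    qed
    then obtain q where q: "\<And>j. j < n \<Longrightarrow> P j (q j)" by metis
    define m where "m j = fst (q j)" for j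
    define L where "L j = fst (snd (q j))" for j
    define R where "R j = snd (snd (q j))" for j
    have P: "P j (m j, L j, R j)" if "j < n" for j using q[OF that] by (simp add: m_def L_def R_def)
    have m: "variation h a (r j) - variation h a (l j) \<le> (\<Sum>k<m j. cmod (h (R j k) - h (L j k))) + \<eta>"
      and LR: "\<And>k. k < m j \<Longrightarrow> l j \<le> L j k \<and> L j k \<le> R j k \<and> R j k \<le> r j"
      and Ldis: "disjoint_family_on (\<lambda>k. {L j k<..<R j k}) {..<m j}" if "j < n" for j
      using P[OF that] unfolding P_def by auto
    define I where "I = (SIGMA j:{..<n}. {..<m j})"
    have fI: "finite I" by (simp add: I_def)
    have "(\<Sum>p\<in>I. cmod (h (R (fst p) (snd p)) - h (L (fst p) (snd p)))) < \<epsilon>/2"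
    proof (rule ac_modulusD[OF \<delta>(2) fI])
      show "a \<le> L (fst p) (snd p) \<and> L (fst p) (snd p) \<le> R (fst p) (snd p) \<and> R (fst p) (snd p) \<le> b" if "p \<in> I" for p
        using that LR[of "fst p" "snd p"] lr[rule_format, of "fst p"] by (auto simp: I_def)
      show "disjoint_family_on (\<lambda>p. {L (fst p) (snd p)<..<R (fst p) (snd p)}) I"
        unfolding disjoint_family_on_def
      proof (intro ballI impI)
        fix p p' assume p: "p \<in> I" "p' \<in> I" "p \<noteq> p'"
        obtain j k j' k' where pp: "p = (j, k)" "p' = (j', k')" by (cases p, cases p') 
        have jk: "j < n" "k < m j" "j' < n" "k' < m j'" using p pp by (auto simp: I_def)
        show "{L (fst p) (snd p)<..<R (fst p) (snd p)} \<inter> {L (fst p') (snd p')<..<R (fst p') (snd p')} = {}"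
        proof (cases "j = j'")
          case True
          then have "k \<noteq> k'" using p pp by auto
          then have "{L j k<..<R j k} \<inter> {L j k'<..<R j k'} = {}"
            using Ldis[OF jk(1)] jk True unfolding disjoint_family_on_def by blast
          then show ?thesis using True pp by simp
        next
          case False
          then have "{l j<..<r j} \<inter> {l j'<..<r j'} = {}"
            using dis jk unfolding disjoint_family_on_def by blast
          moreover have "{L j k<..<R j k} \<subseteq> {l j<..<r j}" "{L j' k'<..<R j' k'} \<subseteq> {l j'<..<r j'}"
            using LR[OF jk(1,2)] LR[OF jk(3,4)] by auto
          ultimately show ?thesis unfolding pp fst_conv snd_conv by blast
        qed
      qed
      have "(\<Sum>p\<in>I. R (fst p) (snd p) - L (fst p) (snd p)) = (\<Sum>j<n. \<Sum>k<m j. R j k - L j k)"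
        unfolding I_def by (simp add: sum.Sigma case_prod_unfold)
      also have "\<dots> \<le> (\<Sum>j<n. r j - l j)"
        using LR Ldis lr by (intro sum_mono sum_length_le) auto
      finally show "(\<Sum>p\<in>I. R (fst p) (snd p) - L (fst p) (snd p)) < \<delta>" using small by simp
    qed
    moreover have "(\<Sum>p\<in>I. cmod (h (R (fst p) (snd p)) - h (L (fst p) (snd p))))
        = (\<Sum>j<n. \<Sum>k<m j. cmod (h (R j k) - h (L j k)))"
      unfolding I_def by (simp add: sum.Sigma case_prod_unfold)
    moreover have "(\<Sum>j<n. variation h a (r j) - variation h a (l j))
        \<le> (\<Sum>j<n. (\<Sum>k<m j. cmod (h (R j k) - h (L j k))) + \<eta>)"
      by (intro sum_mono m) auto
    moreover have "real n * \<eta> \<le> \<epsilon>/2" using \<epsilon> by (simp add: \<eta>_def field_simps)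
    ultimately have "(\<Sum>j<n. variation h a (r j) - variation h a (l j)) < \<epsilon>"
      by (simp add: sum.distrib)
    moreover have "cmod (of_real (variation h a (r j)) - of_real (variation h a (l j)))
        = variation h a (r j) - variation h a (l j)" if "j < n" for j
    proof -
      have "cmod (h (r j) - h (l j)) \<le> variation h a (r j) - variation h a (l j)"
        by (rule variation_increment) (use lr that in auto)
      from order_trans[OF norm_ge_zero this] have "0 \<le> variation h a (r j) - variation h a (l j)" .
      then show ?thesis by (simp flip: of_real_diff)
    qed
    ultimately show "(\<Sum>k<n. cmod (of_real (variation h a (r k)) - of_real (variation h a (l k)))) < \<epsilon>"
      by simp
  qed
  then show "\<exists>\<delta>>0. ac_modulus a b (\<lambda>x. of_real (variation h a x)) \<epsilon> \<delta>" using \<delta>(1) by blast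
qed

end

text \<open>An open set is exhausted by finite unions of half-open dyadic intervals, on which the
  Stieltjes measure is a finite sum of increments of \<open>F\<close> and is controlled by the
  modulus of absolute continuity. \<open>G\<close> continues \<open>F\<close> by constants outside
  the interval.\<close>

lemma interval_measure_open_le:
  fixes F :: "real \<Rightarrow> real"
  assumes ab: "a \<le> b" and mono: "\<And>x y. a \<le> x \<Longrightarrow> x \<le> y \<Longrightarrow> y \<le> b \<Longrightarrow> F x \<le> F y"
    and ac: "ac_modulus a b (\<lambda>x. of_real (F x)) \<epsilon> \<delta>"
    and G: "\<And>x. G x = F (max a (min b x))" and cont: "continuous_on UNIV G"
    and U: "open U" "emeasure lborel U < ennreal \<delta>" and \<epsilon>: "0 < \<epsilon>"
  shows "emeasure (interval_measure G) U \<le> ennreal \<epsilon>"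
proof -
  define c where "c x = max a (min b x)" for x
  have c: "a \<le> c x" "c x \<le> b" "x \<le> y \<Longrightarrow> c x \<le> c y" "x \<le> y \<Longrightarrow> c y - c x \<le> y - x"
    "{c x<..<c y} \<subseteq> {x<..<y}" for x y
    using ab by (auto simp: c_def max_def min_def)
  have Gm: "G x \<le> G y" if "x \<le> y" for x y unfolding G using that c mono by (simp add: c_def)
  have Gr: "continuous (at_right x) G" for x
    using cont by (simp add: continuous_on_eq_continuous_at continuous_at_imp_continuous_at_within)
  define M where "M = interval_measure G"
  have sM [simp]: "sets M = sets borel" by (simp add: M_def)
  have MI: "emeasure M {x<..y} = ennreal (G y - G x)" if "x \<le> y" for x y
    unfolding M_def by (rule emeasure_interval_measure_Ioc[OF that Gm Gr])
  define L where "L m k = real_of_int k / 2 ^ m" for m :: nat and k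
  define R where "R m k = (real_of_int k + 1) / 2 ^ m" for m :: nat and k
  define D where "D m k = {L m k<..R m k}" for m k
  have LR: "L m k \<le> R m k" for m k by (simp add: L_def R_def divide_right_mono)
  \<comment> \<open>Membership is read off from a ceiling, so disjointness within one level is
    immediate.\<close>
  have D: "x \<in> D m k \<longleftrightarrow> \<lceil>x * 2 ^ m\<rceil> = k + 1" for x m k
    by (simp add: D_def L_def R_def ceiling_eq_iff field_simps)
  have Ddis: "disjoint_family_on (D m) I" for m I
    unfolding disjoint_family_on_def by (auto simp: D)
  \<comment> \<open>The bound 4^m keeps the family finite; with mesh 2^-m it reaches up to modulus
    about 2^m.\<close>
  define K where "K m = {k. \<bar>k\<bar> \<le> 4 ^ m \<and> D m k \<subseteq> U}" for m :: nat
  define A where "A m = (\<Union>k\<in>K m. D m k)" for m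
  have fK: "finite (K m)" for m
    by (rule finite_subset[of _ "{- (4 ^ m)..4 ^ m}"]) (auto simp: K_def)
  have sD: "D m k \<in> sets borel" for m k by (simp add: D_def)
  have sA: "A m \<in> sets borel" for m unfolding A_def using fK sD by blast
  have AU: "A m \<subseteq> U" for m by (auto simp: A_def K_def)
  have MA: "emeasure M (A m) \<le> ennreal \<epsilon>" for m
  proof -
    have "ennreal (\<Sum>k\<in>K m. R m k - L m k) = (\<Sum>k\<in>K m. emeasure lborel (D m k))"
      using LR by (simp add: D_def sum_ennreal)
    also have "\<dots> = emeasure lborel (A m)"
      unfolding A_def using sD fK by (intro sum_emeasure Ddis) auto
    also have "\<dots> \<le> emeasure lborel U" using AU U(1) by (intro emeasure_mono) auto
    also have "\<dots> < ennreal \<delta>" by (rule U(2))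
    finally have "(\<Sum>k\<in>K m. R m k - L m k) < \<delta>"
      using LR by (subst (asm) ennreal_less_iff) (auto intro!: sum_nonneg)
    moreover have "(\<Sum>k\<in>K m. c (R m k) - c (L m k)) \<le> (\<Sum>k\<in>K m. R m k - L m k)"
      by (intro sum_mono c LR)
    ultimately have "(\<Sum>k\<in>K m. cmod (of_real (F (c (R m k))) - of_real (F (c (L m k))))) < \<epsilon>"
    proof (intro ac_modulusD[OF ac fK])
      have "{c (L m k)<..<c (R m k)} \<subseteq> D m k" for k
        using c(5)[of "L m k" "R m k"] unfolding D_def by force
      then show "disjoint_family_on (\<lambda>k. {c (L m k)<..<c (R m k)}) (K m)"
        using Ddis[of m "K m"] unfolding disjoint_family_on_def by blast
    qed (use c LR in auto)
    moreover have "cmod (of_real (F (c (R m k))) - of_real (F (c (L m k)))) = G (R m k) - G (L m k)" for k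
      using Gm[OF LR, of m k] by (simp add: G c_def flip: of_real_diff)
    ultimately have "(\<Sum>k\<in>K m. G (R m k) - G (L m k)) < \<epsilon>" by simp
    moreover have "emeasure M (A m) = ennreal (\<Sum>k\<in>K m. G (R m k) - G (L m k))"
    proof -
      have "emeasure M (A m) = (\<Sum>k\<in>K m. emeasure M (D m k))"
        unfolding A_def using sD fK by (intro sum_emeasure[symmetric] Ddis) auto
      also have "\<dots> = (\<Sum>k\<in>K m. ennreal (G (R m k) - G (L m k)))"
        unfolding D_def by (intro sum.cong MI LR refl)
      also have "\<dots> = ennreal (\<Sum>k\<in>K m. G (R m k) - G (L m k))"
        using Gm[OF LR] by (intro sum_ennreal) auto
      finally show ?thesis .
    qed
    ultimately show ?thesis by (simp add: ennreal_leI)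
  qed
  \<comment> \<open>Increasing in \<open>n\<close> by construction, so continuity from below applies
    without comparing the levels \<open>A m\<close>.\<close>
  define B where "B n = (\<Inter>m\<in>{n..}. A m)" for n
  have sB: "B n \<in> sets borel" for n
    unfolding B_def using sA by (intro sets.countable_INT') auto
  have "U = (\<Union>n. B n)"
  proof (intro equalityI subsetI)
    fix x assume x: "x \<in> U"
    obtain e where e: "0 < e" "ball x e \<subseteq> U" using U(1) x open_contains_ball by blast
    obtain n0 :: nat where n0: "\<bar>x\<bar> + 1 + 1 / e < 2 ^ n0"
      using real_arch_pow[of 2 "\<bar>x\<bar> + 1 + 1 / e"] by auto
    have "x \<in> A m" if m: "n0 \<le> m" for m
    proof -
      define k where "k = \<lceil>x * 2 ^ m\<rceil> - 1"
      have xD: "x \<in> D m k" by (simp add: D k_def)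
      have big: "\<bar>x\<bar> + 1 + 1 / e < 2 ^ m"
        using n0 power_increasing[OF m, of "2::real"] by linarith
      have p: "(0::real) < 2 ^ m" by simp
      have "1 / e < 2 ^ m" using big abs_ge_zero[of x] by linarith
      then have small: "1 / 2 ^ m < e" using e(1) by (simp add: field_simps)
      have RL: "R m k = L m k + 1 / 2 ^ m" by (simp add: R_def L_def add_divide_distrib)
      have "D m k \<subseteq> ball x e"
        using xD small unfolding D_def RL by (auto simp: dist_real_def)
      then have 1: "D m k \<subseteq> U" using e(2) by blast
      have "\<bar>real_of_int k\<bar> \<le> \<bar>x * 2 ^ m\<bar> + 1"
        unfolding k_def by linarith
      also have "\<dots> \<le> (\<bar>x\<bar> + 1) * 2 ^ m" by (simp add: abs_mult distrib_right)
      also have "\<dots> \<le> 2 ^ m * 2 ^ m"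
      proof (rule mult_right_mono)
        have "0 < 1 / e" using e(1) by simp
        then show "\<bar>x\<bar> + 1 \<le> 2 ^ m" using big by linarith
      qed simp
      also have "\<dots> = real_of_int (4 ^ m)" by (simp add: power_mult_distrib[symmetric])
      finally have "\<bar>k\<bar> \<le> 4 ^ m" by linarith
      with 1 have "k \<in> K m" by (simp add: K_def)
      then show ?thesis using xD unfolding A_def by blast
    qed
    then show "x \<in> (\<Union>n. B n)" unfolding B_def by blast
  next
    fix x assume "x \<in> (\<Union>n. B n)"
    then obtain n where "x \<in> B n" by blast
    then have "x \<in> A n" unfolding B_def by blast
    then show "x \<in> U" using AU by blast
  qed
  moreover have "(SUP n. emeasure M (B n)) = emeasure M (\<Union>n. B n)"
  proof (rule SUP_emeasure_incseq)
    show "range B \<subseteq> sets M" using sB by auto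
    show "incseq B" unfolding incseq_def B_def by fastforce
  qed
  moreover have "emeasure M (B n) \<le> ennreal \<epsilon>" for n
  proof -
    have "emeasure M (B n) \<le> emeasure M (A n)"
      by (rule emeasure_mono) (use sA in \<open>auto simp: B_def\<close>)
    then show ?thesis using MA[of n] by (rule order_trans)
  qed
  ultimately show ?thesis unfolding M_def[symmetric] by (metis SUP_least)
qed

text \<open>\<open>g\<close> is the Radon--Nikodym density of the Stieltjes measure of
  \<open>F\<close>. A null set is covered by an open set of small Lebesgue measure, whose Stieltjes
  measure is then small as well.\<close>

lemma mono_abs_cont_integral:
  fixes F :: "real \<Rightarrow> real"
  assumes ab: "a \<le> b" and mono: "\<And>x y. a \<le> x \<Longrightarrow> x \<le> y \<Longrightarrow> y \<le> b \<Longrightarrow> F x \<le> F y"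
    and ac: "abs_cont a b (\<lambda>x. of_real (F x))"
  obtains g where "set_integrable lborel {a..b} g"
    "\<And>x. x \<in> {a..b} \<Longrightarrow> (g has_integral F x - F a) {a..x}"
proof -
  define G where "G x = F (max a (min b x))" for x
  have "continuous_on {a..b} (\<lambda>x. Re (of_real (F x)))"
    by (intro continuous_intros abs_cont_continuous_on[OF ac])
  then have F: "continuous_on {a..b} F" by simp
  have cont: "continuous_on UNIV G"
    unfolding G_def by (rule continuous_on_compose2[OF F]) (use ab in \<open>auto intro!: continuous_intros\<close>)
  have Gm: "G x \<le> G y" if "x \<le> y" for x y unfolding G_def using that ab by (intro mono) auto
  define M where "M = interval_measure G"
  have "absolutely_continuous lborel M"
    unfolding absolutely_continuous_def
  proof
    fix Z assume Z: "Z \<in> null_sets (lborel :: real measure)"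
    have "emeasure M Z \<le> 0"
    proof (rule ennreal_le_epsilon)
      fix \<epsilon> :: real assume \<epsilon>: "0 < \<epsilon>"
      obtain \<delta> where \<delta>: "0 < \<delta>" "ac_modulus a b (\<lambda>x. of_real (F x)) \<epsilon> \<delta>"
        using ac \<epsilon> unfolding abs_cont_iff_modulus by blast
      have Zb: "Z \<in> sets borel" using Z by auto
      obtain U where U: "open U" "Z \<subseteq> U" "emeasure lborel (U - Z) < ennreal \<delta>"
        using outer_regular_lborel[OF Zb \<delta>(1)] .
      have "emeasure lborel (U - Z) = emeasure lborel U"
        using Z U(1) by (intro emeasure_Diff_null_set) auto
      then have "emeasure M U \<le> ennreal \<epsilon>"
        unfolding M_def using U \<epsilon>
        by (intro interval_measure_open_le[OF ab mono \<delta>(2) G_def cont]) auto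
      moreover have "emeasure M Z \<le> emeasure M U"
        using U by (intro emeasure_mono) (auto simp: M_def)
      ultimately show "emeasure M Z \<le> 0 + ennreal \<epsilon>" by simp
    qed
    then show "Z \<in> null_sets M" using Z by (auto simp: null_sets_def M_def)
  qed
  then have "\<exists>f\<in>borel_measurable lborel. density lborel f = M"
    by (intro sigma_finite_measure.Radon_Nikodym[OF sigma_finite_lborel]) (simp_all add: M_def)
  then obtain f where f [measurable]: "f \<in> borel_measurable borel" and M: "density lborel f = M"
    by auto
  have nn: "(\<integral>\<^sup>+t. f t * indicator {a..x} t \<partial>lborel) = ennreal (F x - F a)" if "x \<in> {a..b}" for x
  proof -
    have "(\<integral>\<^sup>+t. f t * indicator {a..x} t \<partial>lborel) = emeasure M {a..x}"
      by (simp add: M[symmetric] emeasure_density)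
    also have "\<dots> = ennreal (G x - G a)"
      unfolding M_def by (rule emeasure_interval_measure_Icc) (use that Gm cont in auto)
    finally show ?thesis using that ab by (simp add: G_def)
  qed
  have fin: "AE t in lborel. f t * indicator {a..b} t \<noteq> \<infinity>"
    by (rule nn_integral_PInf_AE) (use nn[of b] ab in auto)
  define g where "g t = enn2real (f t)" for t
  have g: "has_bochner_integral lborel (\<lambda>t. indicator {a..x} t *\<^sub>R g t) (F x - F a)" if x: "x \<in> {a..b}" for x
  proof (rule has_bochner_integral_nn_integral)
    have "AE t in lborel. ennreal (indicator {a..x} t *\<^sub>R g t) = f t * indicator {a..x} t"
      using fin
    proof eventually_elim
      case (elim t)
      then show ?case using x by (auto simp: g_def indicator_def less_top[symmetric] split: if_splits)
    qed
    then show "(\<integral>\<^sup>+t. ennreal (indicator {a..x} t *\<^sub>R g t) \<partial>lborel) = ennreal (F x - F a)"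
      using nn_integral_cong_AE nn[OF x] by metis
    show "0 \<le> F x - F a" using mono[of a x] x by auto
  qed (auto simp: g_def)
  show ?thesis
  proof (rule that)
    show "set_integrable lborel {a..b} g"
      using g[of b] ab unfolding set_integrable_def by (auto dest: integrable.intros)
    fix x assume x: "x \<in> {a..b}"
    have "((\<lambda>t. indicator {a..x} t *\<^sub>R g t) has_integral (F x - F a)) UNIV"
      using has_integral_integral_lborel[OF integrable.intros[OF g[OF x]]]
        has_bochner_integral_integral_eq[OF g[OF x]] by simp
    moreover have "(\<lambda>t. indicator {a..x} t *\<^sub>R g t) = (\<lambda>t. if t \<in> {a..x} then g t else 0)"
      by (auto simp: indicator_def)
    ultimately show "(g has_integral F x - F a) {a..x}"
      by (simp only: has_integral_restrict_UNIV)
  qed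
qed

text \<open>Jordan decomposition: real and imaginary part are written as V minus (V minus the part),
  where both terms are increasing and absolutely continuous.\<close>

lemma abs_cont_integral:
  fixes h :: "real \<Rightarrow> complex"
  assumes ab: "a \<le> b" and h: "abs_cont a b h"
  obtains g where "set_integrable lborel {a..b} g"
    "\<And>x. x \<in> {a..b} \<Longrightarrow> (g has_integral h x - h a) {a..x}"
proof -
  define V where "V = variation h a"
  have V: "cmod (h y - h x) \<le> V y - V x" if "a \<le> x" "x \<le> y" "y \<le> b" for x y
    unfolding V_def by (rule variation_increment[OF h that])
  have acV: "abs_cont a b (\<lambda>x. of_real (V x))" unfolding V_def by (rule abs_cont_variation[OF h])
  have part: "\<exists>g. set_integrable lborel {a..b} g \<and> (\<forall>x\<in>{a..b}. (g has_integral p (h x) - p (h a)) {a..x})"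
    if p: "p = Re \<or> p = Im" for p
  proof -
    have pd: "p u - p v = p (u - v)" "\<bar>p u\<bar> \<le> cmod u" for u v
      using p abs_Re_le_cmod abs_Im_le_cmod by auto
    have inc: "\<bar>p (h y) - p (h x)\<bar> \<le> V y - V x" if "a \<le> x" "x \<le> y" "y \<le> b" for x y
      using V[OF that] pd(2)[of "h y - h x"] pd(1)[of "h y" "h x"] by simp
    obtain g0 where g0: "set_integrable lborel {a..b} g0"
        "\<And>x. x \<in> {a..b} \<Longrightarrow> (g0 has_integral V x - V a) {a..x}"
    proof (rule mono_abs_cont_integral[OF ab _ acV])
      show "V x \<le> V y" if "a \<le> x" "x \<le> y" "y \<le> b" for x y
        using order_trans[OF norm_ge_zero V[OF that]] by simp
    qed blast
    have acW: "abs_cont a b (\<lambda>x. of_real (V x - p (h x)))"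
    proof (rule abs_cont_dominated[OF acV h, of 1])
      fix x y assume xy: "a \<le> x" "x \<le> y" "y \<le> b"
      have "cmod (of_real (V y - p (h y)) - of_real (V x - p (h x))) = \<bar>(V y - V x) - p (h y - h x)\<bar>"
        unfolding of_real_diff[symmetric] norm_of_real by (simp add: pd(1)[symmetric])
      also have "\<dots> \<le> \<bar>V y - V x\<bar> + \<bar>p (h y - h x)\<bar>" by (rule abs_triangle_ineq4)
      also have "\<dots> \<le> cmod (of_real (V y) - of_real (V x)) + cmod (h y - h x)"
        unfolding of_real_diff[symmetric] norm_of_real by (intro add_mono order_refl pd(2))
      finally show "cmod (of_real (V y - p (h y)) - of_real (V x - p (h x)))
          \<le> 1 * (cmod (of_real (V y) - of_real (V x)) + cmod (h y - h x))" by simp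
    qed simp
    obtain g1 where g1: "set_integrable lborel {a..b} g1"
        "\<And>x. x \<in> {a..b} \<Longrightarrow> (g1 has_integral (V x - p (h x)) - (V a - p (h a))) {a..x}"
    proof (rule mono_abs_cont_integral[OF ab _ acW])
      show "V x - p (h x) \<le> V y - p (h y)" if "a \<le> x" "x \<le> y" "y \<le> b" for x y
        using inc[OF that] by linarith
    qed blast
    have "((\<lambda>t. g0 t - g1 t) has_integral p (h x) - p (h a)) {a..x}" if "x \<in> {a..b}" for x
      using has_integral_diff[OF g0(2)[OF that] g1(2)[OF that]] by (simp add: algebra_simps)
    moreover have "set_integrable lborel {a..b} (\<lambda>t. g0 t - g1 t)"
      by (intro set_integral_diff g0 g1)
    ultimately show ?thesis by blast
  qed
  obtain gR where gR: "set_integrable lborel {a..b} gR"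
      "\<And>x. x \<in> {a..b} \<Longrightarrow> (gR has_integral Re (h x) - Re (h a)) {a..x}" using part[of Re] by auto
  obtain gI where gI: "set_integrable lborel {a..b} gI"
      "\<And>x. x \<in> {a..b} \<Longrightarrow> (gI has_integral Im (h x) - Im (h a)) {a..x}" using part[of Im] by auto
  show ?thesis
  proof (rule that)
    have "set_integrable lborel {a..b} (\<lambda>t. complex_of_real (gR t))"
      "set_integrable lborel {a..b} (\<lambda>t. complex_of_real (gI t))"
      using gR(1) gI(1) unfolding set_integrable_def
      by (auto simp: scaleR_conv_of_real simp flip: of_real_mult)
    then show "set_integrable lborel {a..b} (\<lambda>t. complex_of_real (gR t) + \<i> * complex_of_real (gI t))"
      by (intro set_integral_add set_integrable_mult_right) auto
    fix x assume x: "x \<in> {a..b}"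
    have "((\<lambda>t. complex_of_real (gR t) + \<i> * complex_of_real (gI t)) has_integral
        of_real (Re (h x) - Re (h a)) + \<i> * of_real (Im (h x) - Im (h a))) {a..x}"
      using has_integral_linear[OF gR(2)[OF x] bounded_linear_of_real[where 'a = complex]]
        has_integral_linear[OF gI(2)[OF x] bounded_linear_of_real[where 'a = complex]]
      by (intro has_integral_add has_integral_mult_right) (auto simp: o_def)
    moreover have "of_real (Re (h x) - Re (h a)) + \<i> * of_real (Im (h x) - Im (h a)) = h x - h a"
      by (simp add: complex_eq_iff)
    ultimately show "((\<lambda>t. complex_of_real (gR t) + \<i> * complex_of_real (gI t)) has_integral h x - h a) {a..x}"
      by simp
  qed
qed

section \<open>Differentiation of indefinite integrals\<close>

lemma negligible_uminus:
  fixes N :: "real set"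
  assumes "negligible N"
  shows "negligible (uminus ` N)"
proof (rule negligible_differentiable_image_negligible[OF _ assms])
  have "(\<lambda>x::real. - x) differentiable (at x within N)" for x by simp
  then show "uminus differentiable_on N" by (simp add: differentiable_on_def)
qed simp

text \<open>Right difference quotients converge off a null set; the left ones are right difference
  quotients of the reflected function, which contributes a reflected exceptional set.\<close>

lemma indefinite_integral_derivative_AE:
  fixes g :: "real \<Rightarrow> complex"
  assumes g: "g absolutely_integrable_on {a..b}"
  obtains N where "negligible N"
    "\<And>x. x \<in> {a<..<b} - N \<Longrightarrow> ((\<lambda>y. integral {a..y} g) has_vector_derivative g x) (at x)"
proof -
  define f where "f = (\<lambda>x. indicator {a..b} x *\<^sub>R g x)"
  have "f integrable_on UNIV"
    using g has_integral_integral_lebesgue unfolding set_integrable_def f_def by blast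
  then have fi: "f integrable_on cbox x y" for x y
    by (rule integrable_on_subcbox) simp
  have fi': "(\<lambda>x. f (- x)) integrable_on cbox x y" for x y
    using Henstock_Kurzweil_Integration.integrable_reflect_real[where f = f and a = "- y" and b = "- x"] fi[of "- y" "- x"] by simp
  obtain N1 where N1: "negligible N1" "\<And>x e. \<lbrakk>x \<notin> N1; 0 < e\<rbrakk> \<Longrightarrow>
      \<exists>d>0. \<forall>h. 0 < h \<and> h < d \<longrightarrow> norm (integral (cbox x (x + h *\<^sub>R One)) f /\<^sub>R h ^ DIM(real) - f x) < e"
    using integrable_ccontinuous_explicit[of f, OF fi] by metis
  obtain N2 where N2: "negligible N2" "\<And>x e. \<lbrakk>x \<notin> N2; 0 < e\<rbrakk> \<Longrightarrow>
      \<exists>d>0. \<forall>h. 0 < h \<and> h < d \<longrightarrow> norm (integral (cbox x (x + h *\<^sub>R One)) (\<lambda>x. f (- x)) /\<^sub>R h ^ DIM(real) - f (- x)) < e"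
    using integrable_ccontinuous_explicit[of "\<lambda>x. f (- x)", OF fi'] by metis
  show ?thesis
  proof (rule that)
    show "negligible (N1 \<union> uminus ` N2)" using N1(1) N2(1) by (simp add: negligible_uminus)
    fix x assume x: "x \<in> {a<..<b} - (N1 \<union> uminus ` N2)"
    have n2: "- x \<notin> N2" using x by force
    have fx: "f x = g x" using x by (simp add: f_def)
    have gi: "g integrable_on {u..v}" if "a \<le> u" "v \<le> b" for u v
    proof -
      have "f integrable_on {u..v}" using fi[of u v] by simp
      then show ?thesis by (rule integrable_eq) (use that in \<open>auto simp: f_def\<close>)
    qed
    have diff: "integral {a..v} g - integral {a..u} g = integral {u..v} f" if "a \<le> u" "u \<le> v" "v \<le> b" for u v
    proof -
      have "integral {u..v} g = integral {u..v} f"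
        by (rule integral_cong) (use that in \<open>auto simp: f_def\<close>)
      moreover have "integral {a..u} g + integral {u..v} g = integral {a..v} g"
        using Henstock_Kurzweil_Integration.integral_combine[OF that(1,2) gi] that by simp
      ultimately show ?thesis by (metis add_diff_cancel_left')
    qed
    have est: "norm (I - h *\<^sub>R c) \<le> e * h" if "0 < h" "norm (I /\<^sub>R h - c) < e" for h e and I c :: complex
    proof -
      have "I - h *\<^sub>R c = h *\<^sub>R (I /\<^sub>R h - c)" using that(1) by (simp add: scaleR_diff_right)
      then have "norm (I - h *\<^sub>R c) = h * norm (I /\<^sub>R h - c)" using that(1) by simp
      also have "\<dots> \<le> h * e" using that by (intro mult_left_mono) auto
      finally show ?thesis by (simp add: mult.commute)
    qed
    show "((\<lambda>y. integral {a..y} g) has_vector_derivative g x) (at x)"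
      unfolding has_vector_derivative_def has_derivative_at_alt
    proof (intro conjI allI impI bounded_linear_scaleR_left)
      fix e :: real assume e: "0 < e"
      obtain d1 where d1: "0 < d1" "\<And>h. 0 < h \<Longrightarrow> h < d1 \<Longrightarrow> norm (integral {x..x + h} f /\<^sub>R h - f x) < e"
        using N1(2)[of x e] x e by auto
      obtain d2 where d2: "0 < d2" "\<And>h. 0 < h \<Longrightarrow> h < d2 \<Longrightarrow>
          norm (integral {- x..- x + h} (\<lambda>x. f (- x)) /\<^sub>R h - f x) < e"
        using N2(2)[of "- x" e] n2 e by auto
      define d where "d = min (min d1 d2) (min (x - a) (b - x))"
      have d: "0 < d" "d \<le> d1" "d \<le> d2" "d \<le> x - a" "d \<le> b - x" using d1 d2 x by (auto simp: d_def)
      have "norm (integral {a..y} g - integral {a..x} g - (y - x) *\<^sub>R g x) \<le> e * norm (y - x)"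
        if y: "norm (y - x) < d" for y
      proof -
        consider "y = x" | "x < y" | "y < x" by linarith
        then show ?thesis
        proof cases
          case 2
          then have 3: "0 < y - x" "y - x < d" "y - x < d1" "y \<le> b" using y d by auto
          have "integral {a..y} g - integral {a..x} g = integral {x..x + (y - x)} f"
            using diff[of x y] 2 3 x by simp
          then show ?thesis using est[OF 3(1) d1(2)[OF 3(1,3)]] 3 fx by simp
        next
          case 3
          then have 4: "0 < x - y" "x - y < d2" "a \<le> y" using y d by auto
          have "integral {- x..- x + (x - y)} (\<lambda>x. f (- x)) = integral {y..x} f"
            using Henstock_Kurzweil_Integration.integral_reflect_real[of x y f] by simp
          then have "integral {a..x} g - integral {a..y} g = integral {- x..- x + (x - y)} (\<lambda>x. f (- x))"
            using diff[of y x] 3 4 x by simp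
          then have "norm (integral {a..x} g - integral {a..y} g - (x - y) *\<^sub>R g x) \<le> e * (x - y)"
            using est[OF 4(1) d2(2)[OF 4(1,2)]] fx by simp
          moreover have "integral {a..y} g - integral {a..x} g - (y - x) *\<^sub>R g x
              = - (integral {a..x} g - integral {a..y} g - (x - y) *\<^sub>R g x)"
            by (simp add: algebra_simps)
          ultimately show ?thesis using 3 by (simp only: norm_minus_cancel) simp
        qed (use e in simp)
      qed
      then show "\<exists>d>0. \<forall>y. norm (y - x) < d \<longrightarrow>
          norm (integral {a..y} g - integral {a..x} g - (y - x) *\<^sub>R g x) \<le> e * norm (y - x)"
        using d(1) by blast
    qed
  qed
qed

lemma negligible_imp_AE_Leb:
  assumes "negligible N" "\<And>x. x \<in> {a<..<b} - N \<Longrightarrow> P x"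
  shows "AE x in Leb a b. P x"
proof -
  have "AE x in lebesgue. x \<notin> N"
    using assms(1) by (simp add: negligible_iff_null_sets AE_not_in)
  then have "AE x in lebesgue. x \<in> {a<..<b} \<longrightarrow> P x"
    by eventually_elim (use assms(2) in blast)
  then show ?thesis by (subst AE_restrict_space_iff) auto
qed

text \<open>The Radon--Nikodym density is identified with the pointwise derivative, the one that
  \<open>ac_deriv\<close> refers to.\<close>

theorem abs_cont_derivative:
  assumes ab: "a \<le> b" and h: "abs_cont a b h"
  obtains g where "g absolutely_integrable_on {a..b}"
    "\<And>x. x \<in> {a..b} \<Longrightarrow> (g has_integral h x - h a) {a..x}"
    "AE x in Leb a b. (h has_vector_derivative g x) (at x)"
proof -
  obtain g where g0: "set_integrable lborel {a..b} g" and g: "\<And>x. x \<in> {a..b} \<Longrightarrow> (g has_integral h x - h a) {a..x}"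
    by (rule abs_cont_integral[OF ab h]) (rule that)
  have g1: "g absolutely_integrable_on {a..b}"
    using g0 unfolding set_integrable_def by (intro integrable_completion[THEN iffD2] borel_measurable_integrable)
  obtain N where N: "negligible N"
    "\<And>x. x \<in> {a<..<b} - N \<Longrightarrow> ((\<lambda>y. integral {a..y} g) has_vector_derivative g x) (at x)"
    by (rule indefinite_integral_derivative_AE[OF g1]) (rule that)
  have "(h has_vector_derivative g x) (at x)" if x: "x \<in> {a<..<b} - N" for x
  proof (rule has_vector_derivative_transform_within_open)
    show "((\<lambda>y. h a + integral {a..y} g) has_vector_derivative g x) (at x)"
      using has_vector_derivative_add[OF has_vector_derivative_const N(2)[OF x]] by simp
    show "h a + integral {a..y} g = h y" if "y \<in> {a<..<b}" for y
      using integral_unique[OF g[of y]] that by simp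
  qed (use x in auto)
  then have "AE x in Leb a b. (h has_vector_derivative g x) (at x)"
    by (rule negligible_imp_AE_Leb[OF N(1)])
  with g1 g show ?thesis by (rule that)
qed

section \<open>Trigonometric orthonormal bases\<close>

lemma integrable_Leb_iff:
  fixes f :: "real \<Rightarrow> 'b::euclidean_space"
  shows "integrable (Leb a b) f \<longleftrightarrow> f absolutely_integrable_on {a..b}"
proof -
  have "integrable (Leb a b) f \<longleftrightarrow> f absolutely_integrable_on {a<..<b}"
    unfolding set_integrable_def by (subst integrable_restrict_space) auto
  also have "\<dots> \<longleftrightarrow> f absolutely_integrable_on {a..b}"
  proof (rule absolutely_integrable_spike_set_eq)
    have "{a<..<b} - {a..b} \<union> ({a..b} - {a<..<b}) \<subseteq> {a, b}" by auto
    then show "negligible {x \<in> {a<..<b} - {a..b}. f x \<noteq> 0}" "negligible {x \<in> {a..b} - {a<..<b}. f x \<noteq> 0}"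
      by (auto intro: negligible_subset[of "{a, b}"])
  qed
  finally show ?thesis .
qed

lemma integral_Leb:
  fixes f :: "real \<Rightarrow> 'b::euclidean_space"
  assumes "integrable (Leb a b) f"
  shows "integral\<^sup>L (Leb a b) f = integral {a..b} f"
  using lebesgue_integral_eq_integral[OF assms] by (simp add: integral_open_interval_real)

lemma borel_measurable_Leb: "f \<in> borel_measurable borel \<Longrightarrow> f \<in> borel_measurable (Leb a b)"
  by (intro measurable_restrict_space1 measurable_completion) simp

lemma continuous_integrable_Leb:
  fixes f :: "real \<Rightarrow> 'b::euclidean_space"
  assumes "continuous_on {a..b} f"
  shows "integrable (Leb a b) f"
  unfolding integrable_Leb_iff using absolutely_integrable_continuous[of a b f] assms by simp

lemma continuous_measurable_Leb:
  fixes f :: "real \<Rightarrow> 'b::euclidean_space"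
  shows "continuous_on {a..b} f \<Longrightarrow> f \<in> borel_measurable (Leb a b)"
  by (rule borel_measurable_integrable[OF continuous_integrable_Leb])

lemma continuous_L2_Leb:
  assumes "continuous_on {a..b} f"
  shows "f \<in> L2 (Leb a b)"
  unfolding L2_def using assms
  by (auto intro!: continuous_measurable_Leb continuous_integrable_Leb continuous_intros)

lemma L2_bounded_mult:
  assumes f: "f \<in> L2 M" and w: "w \<in> borel_measurable M" "AE x in M. cmod (w x) \<le> C"
  shows "(\<lambda>x. w x * f x) \<in> L2 M"
proof (rule L2_I)
  show "integrable M (\<lambda>x. C\<^sup>2 * (cmod (f x))\<^sup>2)" using f by (simp add: L2_integrable)
  show "(\<lambda>x. w x * f x) \<in> borel_measurable M" using w(1) L2_measurable[OF f] by measurable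
  show "AE x in M. (cmod (w x * f x))\<^sup>2 \<le> C\<^sup>2 * (cmod (f x))\<^sup>2"
    using w(2)
  proof eventually_elim
    case (elim x)
    then have "(cmod (w x))\<^sup>2 \<le> C\<^sup>2" by (intro power_mono) auto
    then show ?case by (simp add: norm_mult power_mult_distrib mult_right_mono)
  qed
qed

lemma AE_Leb_in: "AE x in Leb a b. x \<in> {a<..<b}"
  by (subst AE_restrict_space_iff) auto

text \<open>Polynomials in cos \<theta> are combinations of the functions cos (n \<theta>), and cos
  \<theta> is injective on the interval, so by Stone--Weierstrass \<open>g\<close> annihilates all
  continuous functions. Hence it annihilates indicators of half-lines, and all its interval
  integrals vanish.\<close>

lemma cos_system_complete:
  fixes g :: "real \<Rightarrow> complex"
  assumes ab: "a < b" and g: "integrable (Leb a b) g"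
    and orth: "\<And>n::nat. (\<integral>x. g x * of_real (cos (n * (pi * (x - a) / (b - a)))) \<partial>Leb a b) = 0"
  shows "AE x in Leb a b. g x = 0"
proof -
  define \<theta> where "\<theta> x = pi * (x - a) / (b - a)" for x
  have orth: "(\<integral>x. g x * of_real (cos (n * \<theta> x)) \<partial>Leb a b) = 0" for n :: nat
    using orth[of n] by (simp add: \<theta>_def)
  have c\<theta>: "continuous_on S \<theta>" for S unfolding \<theta>_def using ab by (intro continuous_intros) auto
  have prod: "integrable (Leb a b) (\<lambda>x. g x * of_real (w x))" if "continuous_on {a..b} w" for w :: "real \<Rightarrow> real"
  proof -
    have "bounded (w ` {a..b})" using compact_continuous_image[OF that] compact_imp_bounded by blast
    then obtain C where "\<forall>y\<in>w ` {a..b}. norm y \<le> C" unfolding bounded_iff by blast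
    then have C: "\<bar>w x\<bar> \<le> C" if "x \<in> {a..b}" for x using that by auto
    have [measurable]: "w \<in> borel_measurable (Leb a b)" by (rule continuous_measurable_Leb[OF that])
    have [measurable]: "g \<in> borel_measurable (Leb a b)" using g by (rule borel_measurable_integrable)
    show ?thesis
    proof (rule Bochner_Integration.integrable_bound)
      show "integrable (Leb a b) (\<lambda>x. C * cmod (g x))" using g by simp
      show "AE x in Leb a b. norm (g x * of_real (w x)) \<le> norm (C * cmod (g x))"
        using AE_Leb_in
      proof eventually_elim
        case (elim x)
        then have "\<bar>w x\<bar> \<le> \<bar>C\<bar>" using C[of x] by auto
        then have "cmod (g x) * \<bar>w x\<bar> \<le> \<bar>C\<bar> * cmod (g x)"
          by (subst mult.commute) (rule mult_right_mono, auto)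
        then show ?case by (simp add: norm_mult abs_mult)
      qed
    qed measurable
  qed
  have cont_poly: "continuous_on S (\<lambda>x. poly p (cos (\<theta> x)))" for p S
    by (intro continuous_intros c\<theta>)
  \<comment> \<open>The index \<open>n\<close> varies in the induction: multiplication by cos
    \<theta> shifts it by one in both directions.\<close>
  have poly: "(\<integral>x. g x * of_real (poly p (cos (\<theta> x)) * cos (n * \<theta> x)) \<partial>Leb a b) = 0" for p and n :: nat
  proof (induction p arbitrary: n)
    case (pCons c p)
    define I where "I = (\<lambda>(m::nat) x. g x * of_real (poly p (cos (\<theta> x)) * cos (m * \<theta> x)))"
    define J where "J = (\<lambda>x. g x * of_real (cos (n * \<theta> x)))"
    \<comment> \<open>For n = 0 the product formula produces cos (-\<theta>) = cos \<theta>, so the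
      index is 1 and not the truncated difference 0.\<close>
    define m where "m = (if n = 0 then 1 else n - 1)"
    have int: "integrable (Leb a b) (I k)" "integrable (Leb a b) J" for k
      unfolding I_def J_def by (intro prod continuous_intros cont_poly c\<theta>)+
    have *: "g x * of_real (poly (pCons c p) (cos (\<theta> x)) * cos (n * \<theta> x))
        = of_real c * J x + of_real (1/2) * (I (n + 1) x + I m x)" for x
    proof -
      define A where "A = cos (real (n + 1) * \<theta> x)"
      define B where "B = cos (real m * \<theta> x)"
      define c1 where "c1 = cos (\<theta> x)"
      define cn where "cn = cos (real n * \<theta> x)"
      have "B = cos (real n * \<theta> x - \<theta> x)"
        unfolding B_def m_def by (cases n) (simp_all add: algebra_simps)
      moreover have "A = cos (real n * \<theta> x + \<theta> x)" by (simp add: A_def algebra_simps)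
      ultimately have AB: "c1 * cn = 1/2 * (A + B)"
        by (simp add: cos_add cos_diff c1_def cn_def)
      have "poly (pCons c p) c1 * cn = c * cn + poly p c1 * (c1 * cn)" by (simp add: algebra_simps)
      also have "\<dots> = c * cn + 1/2 * (poly p c1 * A + poly p c1 * B)"
        unfolding AB by (simp add: algebra_simps)
      finally have "poly (pCons c p) c1 * cn = c * cn + 1/2 * (poly p c1 * A + poly p c1 * B)" .
      then show ?thesis unfolding I_def J_def A_def[symmetric] B_def[symmetric] c1_def[symmetric] cn_def[symmetric]
        by (simp only: of_real_add of_real_mult distrib_left mult_ac)
    qed
    have I0: "integral\<^sup>L (Leb a b) (I k) = 0" for k unfolding I_def by (rule pCons.IH)
    have J0: "integral\<^sup>L (Leb a b) J = 0" unfolding J_def by (rule orth)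
    have "(\<integral>x. of_real c * J x + of_real (1/2) * (I (n + 1) x + I m x) \<partial>Leb a b) = 0"
      using int I0 J0 by simp
    then show ?case unfolding * .
  qed simp
  have cont0: "(\<integral>x. g x * of_real (G x) \<partial>Leb a b) = 0" if G: "continuous_on {a..b} G" for G
  proof (rule ccontr)
    assume nz: "(\<integral>x. g x * of_real (G x) \<partial>Leb a b) \<noteq> 0"
    define C where "C = (\<integral>x. cmod (g x) \<partial>Leb a b)"
    have C: "0 \<le> C" by (simp add: C_def)
    \<comment> \<open>Approximation within \<open>e\<close> changes the integral by at most e C,
      less than the modulus of the integral itself.\<close>
    define e where "e = cmod (\<integral>x. g x * of_real (G x) \<partial>Leb a b) / (C + 1)"
    have e: "0 < e" using nz C by (simp add: e_def)
    have "\<exists>F. (\<exists>p. F = (\<lambda>x. poly p (cos (\<theta> x)))) \<and> (\<forall>x\<in>{a..b}. \<bar>G x - F x\<bar> < e)"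
    proof (rule Stone_Weierstrass_HOL[of "{a..b}" "\<lambda>F. \<exists>p. F = (\<lambda>x. poly p (cos (\<theta> x)))" G e])
      show "\<exists>p. (\<lambda>x. c) = (\<lambda>x. poly p (cos (\<theta> x)))" for c by (rule exI[of _ "[:c:]"]) simp
      show "continuous_on {a..b} f" if "\<exists>p. f = (\<lambda>x. poly p (cos (\<theta> x)))" for f
        using that cont_poly by blast
      show "\<exists>p. (\<lambda>x. f x + h x) = (\<lambda>x. poly p (cos (\<theta> x)))"
        if fh: "(\<exists>p. f = (\<lambda>x. poly p (cos (\<theta> x)))) \<and> (\<exists>p. h = (\<lambda>x. poly p (cos (\<theta> x))))" for f h
      proof -
        obtain p q where "f = (\<lambda>x. poly p (cos (\<theta> x)))" "h = (\<lambda>x. poly q (cos (\<theta> x)))" using fh by blast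
        then show ?thesis by (intro exI[of _ "p + q"]) simp
      qed
      show "\<exists>p. (\<lambda>x. f x * h x) = (\<lambda>x. poly p (cos (\<theta> x)))"
        if fh: "(\<exists>p. f = (\<lambda>x. poly p (cos (\<theta> x)))) \<and> (\<exists>p. h = (\<lambda>x. poly p (cos (\<theta> x))))" for f h
      proof -
        obtain p q where "f = (\<lambda>x. poly p (cos (\<theta> x)))" "h = (\<lambda>x. poly q (cos (\<theta> x)))" using fh by blast
        then show ?thesis by (intro exI[of _ "p * q"]) simp
      qed
      show "\<exists>f. (\<exists>p. f = (\<lambda>x. poly p (cos (\<theta> x)))) \<and> f x \<noteq> f y"
        if xy: "x \<in> {a..b} \<and> y \<in> {a..b} \<and> x \<noteq> y" for x y
      proof (intro exI conjI)
        have "0 \<le> \<theta> z \<and> \<theta> z \<le> pi" if "z \<in> {a..b}" for z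
        proof -
          have "\<theta> z = pi * ((z - a) / (b - a))" by (simp add: \<theta>_def)
          moreover have "0 \<le> (z - a) / (b - a)" "(z - a) / (b - a) \<le> 1" using that ab by auto
          moreover from this have "0 \<le> pi * ((z - a) / (b - a))" by (intro mult_nonneg_nonneg) auto
          moreover from calculation have "pi * ((z - a) / (b - a)) \<le> pi * 1" by (intro mult_left_mono) auto
          ultimately show ?thesis by simp
        qed
        moreover have "\<theta> x \<noteq> \<theta> y" using xy ab by (simp add: \<theta>_def)
        ultimately show "poly [:0, 1:] (cos (\<theta> x)) \<noteq> poly [:0, 1:] (cos (\<theta> y))"
          using xy cos_inj_pi[of "\<theta> x" "\<theta> y"] by auto
      qed (rule refl)
    qed (use G e in auto)
    then obtain F p where F: "F = (\<lambda>x. poly p (cos (\<theta> x)))" "\<forall>x\<in>{a..b}. \<bar>G x - F x\<bar> < e" by blast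
    then have p: "\<bar>G x - poly p (cos (\<theta> x))\<bar> < e" if "x \<in> {a..b}" for x using that by blast
    have "(\<integral>x. g x * of_real (G x) \<partial>Leb a b)
        = (\<integral>x. g x * of_real (G x) - g x * of_real (poly p (cos (\<theta> x))) \<partial>Leb a b)"
      using poly[of p 0] by (subst Bochner_Integration.integral_diff) (auto intro!: prod G cont_poly)
    also have "cmod \<dots> \<le> (\<integral>x. e * cmod (g x) \<partial>Leb a b)"
    proof (rule Bochner_Integration.integral_norm_bound_integral)
      show "integrable (Leb a b) (\<lambda>x. g x * of_real (G x) - g x * of_real (poly p (cos (\<theta> x))))"
        by (intro Bochner_Integration.integrable_diff prod G cont_poly)
      show "integrable (Leb a b) (\<lambda>x. e * cmod (g x))" using g by simp
      fix x assume "x \<in> space (Leb a b)"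
      then have x: "x \<in> {a..b}" by auto
      have "g x * of_real (G x) - g x * of_real (poly p (cos (\<theta> x))) = g x * of_real (G x - poly p (cos (\<theta> x)))"
        by (simp add: right_diff_distrib)
      then show "norm (g x * of_real (G x) - g x * of_real (poly p (cos (\<theta> x)))) \<le> e * cmod (g x)"
        using p[OF x] by (simp only: norm_mult norm_of_real mult.commute[of e]) (simp add: mult_left_mono)
    qed
    also have "\<dots> = e * C" by (simp add: C_def)
    also have "\<dots> < e * (C + 1)" using e by simp
    also have "\<dots> = cmod (\<integral>x. g x * of_real (G x) \<partial>Leb a b)" using C by (simp add: e_def)
    finally show False by simp
  qed
  have ind0: "(\<integral>t. g t * of_real (if t < x then 1 else 0) \<partial>Leb a b) = 0" for x
  proof (rule LIMSEQ_unique)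
    \<comment> \<open>Continuous ramps that converge to the indicator of the half-line left of
      \<open>x\<close>; being bounded by 1, they leave \<open>cmod (g t)\<close> as a
      majorant.\<close>
    define G where "G n t = max 0 (min 1 (real n * (x - t)))" for n t
    have cG: "continuous_on S (G n)" for n S unfolding G_def by (intro continuous_intros)
    show "(\<lambda>n. \<integral>t. g t * of_real (G n t) \<partial>Leb a b) \<longlonglongrightarrow> 0" by (simp add: cont0 cG)
    have [measurable]: "g \<in> borel_measurable (Leb a b)" using g by (rule borel_measurable_integrable)
    show "(\<lambda>n. \<integral>t. g t * of_real (G n t) \<partial>Leb a b) \<longlonglongrightarrow> (\<integral>t. g t * of_real (if t < x then 1 else 0) \<partial>Leb a b)"
    proof (rule integral_dominated_convergence)
      show "integrable (Leb a b) (\<lambda>t. cmod (g t))" using g by simp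
      have "(\<lambda>n. G n t) \<longlonglongrightarrow> (if t < x then 1 else 0)" for t
      proof (cases "t < x")
        case True
        obtain N :: nat where N: "1 / (x - t) < real N" using reals_Archimedean2 by blast
        have "G n t = 1" if "N \<le> n" for n
        proof -
          have "1 / (x - t) < real n" using N that by linarith
          then have "1 < real n * (x - t)" using True by (simp add: field_simps)
          then show ?thesis by (simp add: G_def)
        qed
        then have "\<forall>\<^sub>F n in sequentially. G n t = 1" by (auto simp: eventually_sequentially)
        then show ?thesis using True by (simp add: tendsto_eventually)
      next
        case False
        then have neg: "real n * (x - t) \<le> 0" for n :: nat by (simp add: mult_nonneg_nonpos)
        have "G n t = 0" for n using neg[of n] by (simp add: G_def)
        then show ?thesis using False by simp
      qed
      then show "AE t in Leb a b. (\<lambda>n. g t * of_real (G n t)) \<longlonglongrightarrow> g t * of_real (if t < x then 1 else 0)"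
        by (intro AE_I2 tendsto_intros)
      show "AE t in Leb a b. norm (g t * of_real (G n t)) \<le> cmod (g t)" for n
        by (auto simp: norm_mult G_def intro!: mult_left_le)
      have [measurable]: "(\<lambda>t. complex_of_real (if t < x then 1 else 0)) \<in> borel_measurable (Leb a b)"
        by (intro borel_measurable_Leb) measurable
      show "(\<lambda>t. g t * of_real (if t < x then 1 else 0)) \<in> borel_measurable (Leb a b)"
        by measurable
      show "(\<lambda>t. g t * of_real (G n t)) \<in> borel_measurable (Leb a b)" for n
      proof -
        have [measurable]: "G n \<in> borel_measurable (Leb a b)" by (rule continuous_measurable_Leb[OF cG])
        show ?thesis by measurable
      qed
    qed
  qed
  define f where "f t = indicator {a<..<b} t *\<^sub>R g t" for t
  have fint: "integrable lebesgue f"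
    unfolding f_def using g by (subst (asm) integrable_restrict_space) auto
  have fint': "integrable lebesgue (\<lambda>t. f t * of_real (if t < x then 1 else 0))" for x
  proof (rule Bochner_Integration.integrable_bound[OF fint])
    have [measurable]: "f \<in> borel_measurable lebesgue" using fint by (rule borel_measurable_integrable)
    have "{..<x} \<in> sets lebesgue" by auto
    then show "(\<lambda>t. f t * of_real (if t < x then 1 else 0)) \<in> borel_measurable lebesgue" by measurable
  qed auto
  have fUN: "((\<lambda>t. f t * of_real (if t < x then 1 else 0)) has_integral 0) UNIV" for x
  proof -
    have "(\<integral>t. f t * of_real (if t < x then 1 else 0) \<partial>lebesgue) = (\<integral>t. g t * of_real (if t < x then 1 else 0) \<partial>Leb a b)"
      by (subst integral_restrict_space) (auto simp: f_def)
    then show ?thesis using has_integral_integral_lebesgue[OF fint', of x] ind0 by simp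
  qed
  have f0: "integral {x..y} f = 0" if "x \<le> y" for x y
  proof -
    have "((\<lambda>t. f t * of_real (if t < y then 1 else 0) - f t * of_real (if t < x then 1 else 0)) has_integral 0 - 0) UNIV"
      by (intro has_integral_diff fUN)
    moreover have "(\<lambda>t. f t * of_real (if t < y then 1 else 0) - f t * of_real (if t < x then 1 else 0))
        = (\<lambda>t. if t \<in> {x..<y} then f t else 0)"
      using that by (intro ext) auto
    ultimately have "(f has_integral 0) {x..<y}" by (simp only: has_integral_restrict_UNIV diff_self)
    moreover have "(f has_integral 0) {x..<y} \<longleftrightarrow> (f has_integral 0) {x..y}"
      by (rule has_integral_spike_set_eq) (auto intro: negligible_subset[of "{y}"])
    ultimately show ?thesis by (simp add: integral_unique)
  qed
  have "f integrable_on UNIV" using has_integral_integral_lebesgue[OF fint] by blast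
  then have "f integrable_on cbox x y" for x y by (rule integrable_on_subcbox) simp
  then obtain N where N: "negligible N" "\<And>x e. \<lbrakk>x \<notin> N; 0 < e\<rbrakk> \<Longrightarrow>
      \<exists>d>0. \<forall>h. 0 < h \<and> h < d \<longrightarrow> norm (integral (cbox x (x + h *\<^sub>R One)) f /\<^sub>R h ^ DIM(real) - f x) < e"
    using integrable_ccontinuous_explicit[of f] by metis
  have "f x = 0" if xN: "x \<notin> N" for x
  proof (rule ccontr)
    assume "f x \<noteq> 0"
    then obtain d where d: "0 < d" "\<forall>h. 0 < h \<and> h < d \<longrightarrow> norm (integral (cbox x (x + h *\<^sub>R One)) f /\<^sub>R h ^ DIM(real) - f x) < norm (f x)"
      using N(2)[OF xN, of "norm (f x)"] by auto
    have "norm (integral {x..x + d/2} f /\<^sub>R (d/2) - f x) < norm (f x)" using d(2)[rule_format, of "d/2"] d(1) by simp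
    then show False using f0[of x "x + d/2"] d(1) by simp
  qed
  then have fN: "f x = 0" if "x \<notin> N" for x using that .
  show ?thesis
  proof (rule negligible_imp_AE_Leb[OF N(1)])
    fix x assume x: "x \<in> {a<..<b} - N"
    then show "g x = 0" using fN[of x] by (simp add: f_def)
  qed
qed

section \<open>Eigenfunctions for Dirichlet and Neumann conditions\<close>

lemma cos_has_integral:
  fixes j :: int
  assumes ab: "a < b"
  shows "((\<lambda>x. cos (j * pi * (x - a) / (b - a))) has_integral (if j = 0 then b - a else 0)) {a..b}"
proof (cases "j = 0")
  case True
  then show ?thesis using has_integral_const_real[of "1::real" a b] ab by simp
next
  case False
  define \<omega> where "\<omega> = j * pi / (b - a)"
  have \<omega>: "\<omega> \<noteq> 0" using False ab by (simp add: \<omega>_def)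
  have "((\<lambda>x. cos (\<omega> * (x - a))) has_integral sin (\<omega> * (b - a)) / \<omega> - sin (\<omega> * (a - a)) / \<omega>) {a..b}"
  proof (rule fundamental_theorem_of_calculus)
    fix x
    have "((\<lambda>x. sin (\<omega> * (x - a)) / \<omega>) has_real_derivative cos (\<omega> * (x - a))) (at x within {a..b})"
      by (rule derivative_eq_intros refl | use \<omega> in simp)+
    then show "((\<lambda>x. sin (\<omega> * (x - a)) / \<omega>) has_vector_derivative cos (\<omega> * (x - a))) (at x within {a..b})"
      by (simp add: has_real_derivative_iff_has_vector_derivative)
  qed (use ab in simp)
  moreover have "\<omega> * (b - a) = pi * j" using ab by (simp add: \<omega>_def)
  ultimately show ?thesis using False by (simp add: \<omega>_def sin_npi_int)
qed

text \<open>\<open>da\<close> and \<open>db\<close> mark a Dirichlet condition at the left and at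
  the right end; otherwise the end carries a Neumann condition.\<close>

locale interval_bc =
  fixes a b :: real and da db :: bool
  assumes ab: "a < b"
begin

text \<open>Copies of the parameters: the simplifier would substitute an assumption \<open>da\<close> into every
  constant of this locale.\<close>
definition DA :: bool where "DA = da"
definition DB :: bool where "DB = db"

definition len :: real where "len = b - a"

lemma len_pos: "0 < len" using ab by (simp add: len_def)

text \<open>Twice the offset of the frequencies (n + o2/2) \<pi> / len: the offset is 1 for two
  Dirichlet ends, 1/2 for mixed ends and 0 for two Neumann ends.\<close>

definition o2 :: nat where "o2 = (if DA \<and> DB then 2 else if DA \<or> DB then 1 else 0)"
definition kap :: "nat \<Rightarrow> real" where "kap n = real (2 * n + o2) * (pi / 2) / len"
text \<open>The constant function, which occurs only for two Neumann ends, needs a normalisation of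
  its own.\<close>

definition amp :: "nat \<Rightarrow> real" where "amp n = (if 2 * n + o2 = 0 then 1 / sqrt len else sqrt (2 / len))"
definition phi :: "nat \<Rightarrow> real \<Rightarrow> complex" where
  "phi n x = of_real (amp n * (if DA then sin (kap n * (x - a)) else cos (kap n * (x - a))))"
text \<open>The derivative of \<open>phi n\<close> divided by \<open>kap n\<close>; for frequency 0
  it is the zero function.\<close>

definition psi :: "nat \<Rightarrow> real \<Rightarrow> complex" where
  "psi n x = of_real (amp n * (if DA then cos (kap n * (x - a)) else - sin (kap n * (x - a))))"
definition bnd :: real where "bnd = sqrt (2 / len)"

lemma kap_nonneg: "0 \<le> kap n" using len_pos by (simp add: kap_def)

lemma amp_le: "0 \<le> amp n" "amp n \<le> bnd"
proof -
  show "0 \<le> amp n" using len_pos by (simp add: amp_def)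
  have "1 / sqrt len = sqrt (1 / len)" by (simp add: real_sqrt_divide)
  also have "\<dots> \<le> sqrt (2 / len)" using len_pos by (intro real_sqrt_le_mono divide_right_mono) auto
  finally show "amp n \<le> bnd" by (simp add: amp_def bnd_def)
qed

lemma bnd_nonneg: "0 \<le> bnd" using amp_le[of 0] by linarith

lemma phi_le: "cmod (phi n x) \<le> bnd" and psi_le: "cmod (psi n x) \<le> bnd"
proof -
  have "amp n * \<bar>t\<bar> \<le> bnd" if "\<bar>t\<bar> \<le> 1" for t
    using mult_left_mono[OF that amp_le(1), of n] amp_le(2)[of n] by simp
  then show "cmod (phi n x) \<le> bnd" "cmod (psi n x) \<le> bnd"
    using amp_le(1)[of n] unfolding phi_def psi_def norm_of_real abs_mult by auto
qed

lemma has_vector_derivative_complex_of_real: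
  assumes "(f has_real_derivative d) (at x)"
  shows "((\<lambda>x. complex_of_real (f x)) has_vector_derivative of_real d) (at x)"
  using has_vector_derivative_of_real[of f d "at x"] assms
  by (simp add: has_real_derivative_iff_has_vector_derivative)

lemma phi_deriv: "(phi n has_vector_derivative of_real (kap n) * psi n x) (at x)"
proof -
  have "((\<lambda>x. amp n * (if DA then sin (kap n * (x - a)) else cos (kap n * (x - a)))) has_real_derivative
      kap n * (amp n * (if DA then cos (kap n * (x - a)) else - sin (kap n * (x - a))))) (at x)"
    by (cases DA) (auto intro!: derivative_eq_intros)
  from has_vector_derivative_complex_of_real[OF this] show ?thesis
    unfolding phi_def psi_def by (simp only: of_real_mult)
qed

lemma psi_deriv: "(psi n has_vector_derivative - of_real (kap n) * phi n x) (at x)"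
proof -
  have "((\<lambda>x. amp n * (if DA then cos (kap n * (x - a)) else - sin (kap n * (x - a)))) has_real_derivative
      (- kap n) * (amp n * (if DA then sin (kap n * (x - a)) else cos (kap n * (x - a))))) (at x)"
    by (cases DA) (auto intro!: derivative_eq_intros)
  from has_vector_derivative_complex_of_real[OF this] show ?thesis
    unfolding phi_def psi_def by (simp only: of_real_mult of_real_minus)
qed

lemma continuous_phi: "continuous_on S (phi n)" and continuous_psi: "continuous_on S (psi n)"
  by (meson continuous_at_imp_continuous_on has_vector_derivative_continuous phi_deriv psi_deriv)+

lemma boundary_a: "DA \<Longrightarrow> phi n a = 0" "\<not> DA \<Longrightarrow> psi n a = 0"
  by (simp_all add: phi_def psi_def)

lemma boundary_b: "DB \<Longrightarrow> phi n b = 0" "\<not> DB \<Longrightarrow> psi n b = 0"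
proof -
  have k: "kap n * len = real (2 * n + o2) * (pi / 2)" using len_pos by (simp add: kap_def)
  have c: "cos (real (2 * n + 1) * (pi / 2)) = 0"
  proof -
    have "real (2 * n + 1) * (pi / 2) = real n * pi + pi / 2" by (simp add: algebra_simps)
    then show ?thesis by (simp only: cos_add sin_npi cos_pi_half mult_zero_right mult_zero_left diff_self)
  qed
  have s: "sin (real (2 * m) * (pi / 2)) = 0" for m
  proof -
    have "real (2 * m) * (pi / 2) = real m * pi" by simp
    then show ?thesis by (simp only: sin_npi)
  qed
  show "phi n b = 0" if DB
  proof (cases DA)
    case True
    then have "2 * n + o2 = 2 * (n + 1)" using that by (simp add: o2_def)
    then show ?thesis unfolding phi_def len_def[symmetric] k using s[of "n + 1"] True by (simp only: if_True mult_zero_right of_real_0)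
  next
    case False
    then have "2 * n + o2 = 2 * n + 1" using that by (simp add: o2_def)
    then show ?thesis unfolding phi_def len_def[symmetric] k using c False by (simp only: if_False mult_zero_right of_real_0)
  qed
  show "psi n b = 0" if "\<not> DB"
  proof (cases DA)
    case True
    then have "2 * n + o2 = 2 * n + 1" using that by (simp add: o2_def)
    then show ?thesis unfolding psi_def len_def[symmetric] k using c True by (simp only: if_True mult_zero_right of_real_0)
  next
    case False
    then have "2 * n + o2 = 2 * n" using that by (simp add: o2_def)
    then show ?thesis unfolding psi_def len_def[symmetric] k using s[of n] False by (simp only: if_False mult_zero_right of_real_0 neg_equal_0_iff_equal minus_zero)
  qed
qed

lemma phi_L2: "phi n \<in> L2 (Leb a b)" and psi_L2: "psi n \<in> L2 (Leb a b)"
  by (rule continuous_L2_Leb, rule continuous_phi, rule continuous_L2_Leb, rule continuous_psi)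

definition C :: "int \<Rightarrow> real \<Rightarrow> real" where "C j x = cos (j * pi * (x - a) / len)"

lemma product_integral:
  assumes fg: "\<And>x. cnj (f x) * g x = of_real (c * (C j x + s * C k x))" and c: "continuous_on UNIV f" "continuous_on UNIV g"
  shows "l2_inner (Leb a b) f g = of_real (c * ((if j = 0 then len else 0) + s * (if k = 0 then len else 0)))"
proof -
  have C: "(C j has_integral (if j = 0 then len else 0)) {a..b}" for j
    unfolding C_def len_def by (rule cos_has_integral[OF ab])
  have "((\<lambda>x. c * (C j x + s * C k x)) has_integral c * ((if j = 0 then len else 0) + s * (if k = 0 then len else 0))) {a..b}"
    by (intro has_integral_mult_right has_integral_add C)
  then have 1: "integral {a..b} (\<lambda>x. c * (C j x + s * C k x)) = c * ((if j = 0 then len else 0) + s * (if k = 0 then len else 0))"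
    by (rule integral_unique)
  have "l2_inner (Leb a b) f g = (\<integral>x. of_real (c * (C j x + s * C k x)) \<partial>Leb a b)"
    by (simp only: l2_inner_def fg)
  also have "\<dots> = of_real (\<integral>x. c * (C j x + s * C k x) \<partial>Leb a b)" by (rule integral_complex_of_real)
  also have "(\<integral>x. c * (C j x + s * C k x) \<partial>Leb a b) = integral {a..b} (\<lambda>x. c * (C j x + s * C k x))"
    unfolding C_def using len_pos by (intro integral_Leb continuous_integrable_Leb continuous_intros) auto
  finally show ?thesis unfolding 1 .
qed

lemma kap_diff: "kap m * (x - a) - kap n * (x - a) = (int m - int n) * pi * (x - a) / len"
  and kap_sum: "kap m * (x - a) + kap n * (x - a) = int (m + n + o2) * pi * (x - a) / len"
  using len_pos by (simp_all add: kap_def field_simps)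

definition sg :: real where "sg = (if DA then -1 else 1)"

lemma phi_product: "cnj (phi m x) * phi n x = of_real (amp m * amp n / 2 * (C (int m - int n) x + sg * C (int (m + n + o2)) x))"
  and psi_product: "cnj (psi m x) * psi n x = of_real (amp m * amp n / 2 * (C (int m - int n) x + (- sg) * C (int (m + n + o2)) x))"
proof -
  define u where "u = kap m * (x - a)"
  define v where "v = kap n * (x - a)"
  have "C (int m - int n) x = cos (u - v)" "C (int (m + n + o2)) x = cos (u + v)"
    unfolding C_def u_def v_def kap_diff kap_sum by simp_all
  then have CC: "C (int m - int n) x = cos u * cos v + sin u * sin v" "C (int (m + n + o2)) x = cos u * cos v - sin u * sin v"
    by (simp_all add: cos_diff cos_add)
  show "cnj (phi m x) * phi n x = of_real (amp m * amp n / 2 * (C (int m - int n) x + sg * C (int (m + n + o2)) x))"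
    unfolding CC phi_def u_def[symmetric] v_def[symmetric] complex_cnj_complex_of_real of_real_mult[symmetric] of_real_eq_iff
    by (simp add: sg_def)
  show "cnj (psi m x) * psi n x = of_real (amp m * amp n / 2 * (C (int m - int n) x + (- sg) * C (int (m + n + o2)) x))"
    unfolding CC psi_def u_def[symmetric] v_def[symmetric] complex_cnj_complex_of_real of_real_mult[symmetric] of_real_eq_iff
    by (simp add: sg_def)
qed

lemma amp_square: "amp n * amp n * len = (if 2 * n + o2 = 0 then 1 else 2)"
  using len_pos by (auto simp: amp_def power_divide simp flip: power2_eq_square)

lemma phi_orthonormal: "l2_inner (Leb a b) (phi m) (phi n) = (if m = n then of_real 1 else 0)"
proof -
  have "l2_inner (Leb a b) (phi m) (phi n) = of_real (amp m * amp n / 2 *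
      ((if int m - int n = 0 then len else 0) + sg * (if int (m + n + o2) = 0 then len else 0)))"
    by (rule product_integral[OF phi_product continuous_phi continuous_phi])
  also have "amp m * amp n / 2 * ((if int m - int n = 0 then len else 0) + sg * (if int (m + n + o2) = 0 then len else 0))
      = (if m = n then 1 else 0)"
  proof (cases "m = n")
    case mn: True
    show ?thesis
    proof (cases "2 * n + o2 = 0")
      case True
      then have "sg = 1" by (auto simp: o2_def sg_def split: if_splits)
      then show ?thesis using amp_square[of n] True mn by simp
    next
      case False
      then have z: "(if int (n + n + o2) = 0 then len else 0) = 0" by (intro if_not_P) linarith
      have "amp n * amp n * len = 2" using amp_square[of n] False by (simp only: if_False)
      then show ?thesis unfolding mn z by simp
    qed
  qed auto
  finally show ?thesis by simp
qed

definition nu :: "nat \<Rightarrow> real" where "nu n = (if 2 * n + o2 = 0 then 0 else 1)"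

lemma psi_orthogonal: "l2_inner (Leb a b) (psi m) (psi n) = (if m = n then of_real (nu n) else 0)"
proof -
  have "l2_inner (Leb a b) (psi m) (psi n) = of_real (amp m * amp n / 2 *
      ((if int m - int n = 0 then len else 0) + (- sg) * (if int (m + n + o2) = 0 then len else 0)))"
    by (rule product_integral[OF psi_product continuous_psi continuous_psi])
  also have "amp m * amp n / 2 * ((if int m - int n = 0 then len else 0) + (- sg) * (if int (m + n + o2) = 0 then len else 0))
      = (if m = n then nu n else 0)"
  proof (cases "m = n")
    case mn: True
    show ?thesis
    proof (cases "2 * n + o2 = 0")
      case True
      then have "sg = 1" by (auto simp: o2_def sg_def split: if_splits)
      then show ?thesis using True mn by (simp add: nu_def)
    next
      case False
      then have z: "(if int (n + n + o2) = 0 then len else 0) = 0" by (intro if_not_P) linarith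
      have "amp n * amp n * len = 2" using amp_square[of n] False by (simp only: if_False)
      moreover have "nu n = 1" using False by (simp only: nu_def if_False)
      ultimately show ?thesis unfolding mn z by simp
    qed
  qed auto
  finally show ?thesis by simp
qed

text \<open>Reduction to the cosine system. \<open>w\<close> is the lowest eigenfunction up to a
  factor, and its product with cos (n \<pi> (x - a) / len) is the mean of the functions
  \<open>T\<close> with frequencies o2 + 2n and o2 - 2n. So f w is orthogonal to all these cosines,
  and \<open>w\<close> has no zero inside the interval.\<close>

lemma phi_complete:
  assumes f: "f \<in> L2 (Leb a b)" and orth: "\<And>n. l2_inner (Leb a b) (phi n) f = 0"
  shows "AE x in Leb a b. f x = 0"
proof -
  define T where "T u = (if DA then sin u else cos u)" for u :: real
  define h where "h x = pi * (x - a) / (2 * len)" for x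
  have ch: "continuous_on S h" for S unfolding h_def using len_pos by (intro continuous_intros) auto
  have cT: "continuous_on S (\<lambda>x. complex_of_real (T (c * h x)))" for S c
    unfolding T_def by (cases DA) (auto intro!: continuous_intros ch)
  have int: "integrable (Leb a b) (\<lambda>x. f x * of_real (T (c * h x)))" for c
    by (rule L2_mult_integrable[OF f continuous_L2_Leb[OF cT]])
  have J0: "(\<integral>x. f x * of_real (T (real (2 * n + o2) * h x)) \<partial>Leb a b) = 0" for n
  proof -
    have amp: "amp n \<noteq> 0" using amp_square[of n] by (auto split: if_splits)
    have "kap n * (x - a) = real (2 * n + o2) * h x" for x by (simp add: kap_def h_def)
    then have "cnj (phi n x) * f x = of_real (amp n) * (f x * of_real (T (real (2 * n + o2) * h x)))" for x
      by (simp add: phi_def T_def mult_ac)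
    then have "(\<lambda>x. cnj (phi n x) * f x) = (\<lambda>x. of_real (amp n) * (f x * of_real (T (real (2 * n + o2) * h x))))"
      by (rule ext)
    then have "l2_inner (Leb a b) (phi n) f = of_real (amp n) * (\<integral>x. f x * of_real (T (real (2 * n + o2) * h x)) \<partial>Leb a b)"
      unfolding l2_inner_def by (simp only: integral_mult_right_zero)
    then show ?thesis using orth[of n] amp by simp
  qed
  have J1: "(\<integral>x. f x * of_real (T (of_int j * h x)) \<partial>Leb a b) = 0" if j: "int o2 \<le> j" "even (j - int o2)" for j
  proof -
    obtain m where m: "j - int o2 = 2 * m" using j(2) by (elim evenE)
    then have "real (2 * nat m + o2) = of_int j" using j(1) by (simp add: nat_0_le)
    then show ?thesis using J0[of "nat m"] by simp
  qed
  \<comment> \<open>Negative frequencies reduce to positive ones by the parity of \<open>T\<close>.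
    The only frequency of the right parity strictly between -o2 and o2 is 0 with o2 = 2, where
    \<open>T\<close> is the sine and vanishes.\<close>
  have J: "(\<integral>x. f x * of_real (T (of_int j * h x)) \<partial>Leb a b) = 0" if j: "even (j - int o2)" for j
  proof -
    consider "int o2 \<le> j" | "int o2 \<le> - j" | "\<bar>j\<bar> < int o2" by linarith
    then show ?thesis
    proof cases
      case 2
      have "even (- j - int o2)" using j by (metis dvd_diff_commute even_minus uminus_add_conv_diff minus_diff_eq diff_minus_eq_add even_add)
      then have "(\<integral>x. f x * of_real (T (of_int (- j) * h x)) \<partial>Leb a b) = 0" using J1[OF 2] by blast
      moreover have "f x * of_real (T (of_int j * h x)) = (if DA then -1 else 1) * (f x * of_real (T (of_int (- j) * h x)))" for x
        by (simp add: T_def)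
      ultimately show ?thesis by (simp only: integral_mult_right_zero mult_zero_right)
    next
      case 3
      have "o2 \<le> 2" by (simp add: o2_def)
      then have "int o2 = 1 \<or> int o2 = 2" using 3 by linarith
      then have "j = 0 \<and> o2 = 2" using 3 j by presburger
      then have "j = 0" "DA" by (auto simp: o2_def split: if_splits)
      then show ?thesis by (simp add: T_def)
    qed (use J1 j in blast)
  qed
  define w where "w x = T (real o2 * h x)" for x
  have "AE x in Leb a b. f x * of_real (w x) = 0"
  proof (rule cos_system_complete[OF ab], unfold len_def[symmetric])
    show "integrable (Leb a b) (\<lambda>x. f x * of_real (w x))" unfolding w_def by (rule int)
    fix n :: nat
    have TT: "w x * cos (n * (pi * (x - a) / len)) = 1/2 * (T (of_int (int o2 + 2 * int n) * h x) + T (of_int (int o2 - 2 * int n) * h x))" for x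
    proof -
      define A where "A = real o2 * h x"
      define B where "B = n * (pi * (x - a) / len)"
      have "of_int (int o2 + 2 * int n) * h x = A + B" "of_int (int o2 - 2 * int n) * h x = A - B"
        using len_pos by (simp_all add: A_def B_def h_def field_simps)
      then show ?thesis
        unfolding w_def A_def[symmetric] B_def[symmetric] T_def
        by (simp add: sin_add sin_diff cos_add cos_diff)
    qed
    have "f x * of_real (w x) * of_real (cos (n * (pi * (x - a) / len)))
        = of_real (1/2) * (f x * of_real (T (of_int (int o2 + 2 * int n) * h x)) + f x * of_real (T (of_int (int o2 - 2 * int n) * h x)))" for x
      unfolding mult.assoc of_real_mult[symmetric] TT
      by (simp only: of_real_mult of_real_add distrib_left mult_ac)
    moreover have "(\<integral>x. of_real (1/2) * (f x * of_real (T (of_int (int o2 + 2 * int n) * h x)) + f x * of_real (T (of_int (int o2 - 2 * int n) * h x))) \<partial>Leb a b) = 0"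
      using J[of "int o2 + 2 * int n"] J[of "int o2 - 2 * int n"] int
      by (simp only: integral_mult_right_zero Bochner_Integration.integral_add) simp
    ultimately show "(\<integral>x. f x * of_real (w x) * of_real (cos (n * (pi * (x - a) / len))) \<partial>Leb a b) = 0"
      by (simp only:)
  qed
  then show ?thesis
    using AE_Leb_in
  proof eventually_elim
    case (elim x)
    have "0 < h x" "h x < pi / 2"
    proof -
      define q where "q = (x - a) / len"
      have q: "0 < q" "q < 1" using elim len_pos by (auto simp: q_def len_def)
      have "h x = pi / 2 * q" by (simp add: h_def q_def)
      moreover have "0 < pi / 2 * q" using q by simp
      moreover have "pi / 2 * q < pi / 2 * 1" using q by (intro mult_strict_left_mono) auto
      ultimately show "0 < h x" "h x < pi / 2" by simp_all
    qed
    then have "w x \<noteq> 0"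
      using sin_gt_zero[of "h x"] sin_gt_zero[of "2 * h x"] cos_gt_zero[of "h x"]
      by (auto simp: w_def T_def o2_def)
    then show ?case using elim(1) by simp
  qed
qed

sublocale phi: onb "Leb a b" phi
  by unfold_locales (simp_all add: phi_L2 phi_orthonormal phi_complete)

sublocale psi: orthogonal_system "Leb a b" psi nu
  by unfold_locales (simp_all add: psi_L2 psi_orthogonal nu_def)

lemma kap_ge: "real n * (pi / len) \<le> kap n"
proof -
  have "real n * (pi / len) = real (2 * n) * (pi / 2) / len" by simp
  also have "\<dots> \<le> kap n" unfolding kap_def using len_pos by (intro divide_right_mono mult_right_mono) auto
  finally show ?thesis .
qed

end

section \<open>Sobolev functions on an interval\<close>

lemma AE_Leb_negligible:
  assumes "AE x in Leb a b. P x"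
  obtains N where "negligible N" "\<And>x. x \<in> {a<..<b} - N \<Longrightarrow> P x"
proof -
  have "AE x in lebesgue. x \<in> {a<..<b} \<longrightarrow> P x"
    using assms by (subst (asm) AE_restrict_space_iff) auto
  then obtain N where "{x \<in> space lebesgue. \<not> (x \<in> {a<..<b} \<longrightarrow> P x)} \<subseteq> N" "emeasure lebesgue N = 0" "N \<in> sets lebesgue"
    by (rule AE_E)
  then show ?thesis by (intro that[of N]) (auto simp: negligible_iff_null_sets null_sets_def)
qed

lemma has_integral_cong_AE_Leb:
  assumes f: "(f has_integral I) {x..y}" and ae: "AE t in Leb a b. f t = g t" and xy: "a \<le> x" "y \<le> b"
  shows "(g has_integral I) {x..y}"
proof -
  obtain N where N: "negligible N" "\<And>t. t \<in> {a<..<b} - N \<Longrightarrow> f t = g t"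
    using ae by (rule AE_Leb_negligible) (rule that)
  show ?thesis
  proof (rule has_integral_spike[OF _ _ f])
    show "negligible (N \<union> {a, b})" using N(1) by (simp add: negligible_insert)
    show "g t = f t" if "t \<in> {x..y} - (N \<union> {a, b})" for t using N(2)[of t] that xy by force
  qed
qed

lemma integrable_cong_AE_Leb:
  fixes f g :: "real \<Rightarrow> 'b::euclidean_space"
  assumes f: "integrable (Leb a b) f" and ae: "AE t in Leb a b. g t = f t"
  shows "integrable (Leb a b) g"
proof -
  obtain N where N: "negligible N" "\<And>t. t \<in> {a<..<b} - N \<Longrightarrow> g t = f t"
    using ae by (rule AE_Leb_negligible) (rule that)
  have "g absolutely_integrable_on {a..b}"
  proof (rule absolutely_integrable_spike)
    show "f absolutely_integrable_on {a..b}" using f by (simp add: integrable_Leb_iff)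
    show "negligible (N \<union> {a, b})" using N(1) by (simp add: negligible_insert)
    show "g t = f t" if "t \<in> {a..b} - (N \<union> {a, b})" for t using N(2)[of t] that by force
  qed
  then show ?thesis by (simp add: integrable_Leb_iff)
qed

lemma measure_Leb:
  assumes "a \<le> b"
  shows "measure (Leb a b) (space (Leb a b)) = b - a"
proof -
  have sp: "space (Leb a b) = {a<..<b}" by simp
  have "measure (Leb a b) {a<..<b} = measure lebesgue {a<..<b}" by (rule measure_restrict_space) auto
  moreover have "measure lebesgue {a<..<b} = b - a" using assms by simp
  ultimately show ?thesis unfolding sp by (rule trans)
qed

lemma L2_const: "(\<lambda>_. c) \<in> L2 (Leb a b)"
  by (intro continuous_L2_Leb continuous_intros)

lemma L2_imp_integrable_Leb:
  assumes "f \<in> L2 (Leb a b)"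
  shows "integrable (Leb a b) f"
  using L2_mult_integrable[OF L2_const[of 1] assms] by simp

lemma l2_norm_one:
  assumes "a \<le> b"
  shows "l2_norm (Leb a b) (\<lambda>_. 1) = sqrt (b - a)"
proof -
  have "(\<integral>x. (cmod 1)\<^sup>2 \<partial>Leb a b) = measure (Leb a b) (space (Leb a b))" by simp
  then show ?thesis unfolding measure_Leb[OF assms] l2_norm_def by simp
qed

lemma integral_abs_le_l2_norm:
  assumes "a \<le> b" "f \<in> L2 (Leb a b)"
  shows "(\<integral>x. cmod (f x) \<partial>Leb a b) \<le> sqrt (b - a) * l2_norm (Leb a b) f"
  using integral_abs_mult_le[OF L2_const[of 1] assms(2)] by (simp add: l2_norm_one[OF assms(1)])

lemma integral_subinterval:
  fixes g :: "real \<Rightarrow> complex"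
  assumes g: "integrable (Leb a b) g" and xy: "a \<le> x" "y \<le> b"
  shows "integrable (Leb a b) (\<lambda>t. indicator {x<..<y} t *\<^sub>R g t)"
    "(\<integral>t. indicator {x<..<y} t *\<^sub>R g t \<partial>Leb a b) = integral {x..y} g"
proof -
  have g': "integrable (Leb x y) g"
  proof -
    have "g absolutely_integrable_on {a..b}" using g by (simp add: integrable_Leb_iff)
    then have "g absolutely_integrable_on {x..y}"
      by (rule set_integrable_subset) (use xy in auto)
    then show ?thesis by (simp add: integrable_Leb_iff)
  qed
  have eq: "(indicator {a<..<b} t * indicator {x<..<y} t :: real) *\<^sub>R g t = indicator {x<..<y} t *\<^sub>R g t" for t
    using xy by (auto simp: indicator_def)
  show "integrable (Leb a b) (\<lambda>t. indicator {x<..<y} t *\<^sub>R g t)"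
    using g' by (simp add: integrable_restrict_space eq)
  have "(\<integral>t. indicator {x<..<y} t *\<^sub>R g t \<partial>Leb a b) = (\<integral>t. g t \<partial>Leb x y)"
    by (simp add: integral_restrict_space eq)
  then show "(\<integral>t. indicator {x<..<y} t *\<^sub>R g t \<partial>Leb a b) = integral {x..y} g"
    by (simp add: integral_Leb[OF g'])
qed

text \<open>Carries a function with values at all points together with its derivative in the
  integral sense; this avoids the choices hidden in \<open>ac_rep\<close> and
  \<open>vector_derivative\<close>.\<close>

definition h1 :: "real \<Rightarrow> real \<Rightarrow> (real \<Rightarrow> complex) \<Rightarrow> (real \<Rightarrow> complex) \<Rightarrow> bool" where
  "h1 a b u g \<longleftrightarrow> g \<in> L2 (Leb a b) \<and> (\<forall>x\<in>{a..b}. (g has_integral u x - u a) {a..x})"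

lemma h1_L2: "h1 a b u g \<Longrightarrow> g \<in> L2 (Leb a b)"
  by (simp add: h1_def)

lemma h1_integrable: "h1 a b u g \<Longrightarrow> integrable (Leb a b) g"
  by (rule L2_imp_integrable_Leb[OF h1_L2])

lemma h1_increment:
  assumes h: "h1 a b u g" and xy: "a \<le> x" "x \<le> y" "y \<le> b"
  shows "integral {x..y} g = u y - u x"
proof -
  have 1: "integral {a..x} g = u x - u a" "integral {a..y} g = u y - u a" "g integrable_on {a..y}"
    using h xy unfolding h1_def by (auto intro: integral_unique has_integral_integrable)
  have "integral {a..x} g + integral {x..y} g = integral {a..y} g"
    by (rule Henstock_Kurzweil_Integration.integral_combine[OF xy(1,2) 1(3)])
  then show ?thesis using 1 by (simp add: algebra_simps)
qed

lemma h1_lin: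
  assumes "h1 a b u g" "h1 a b v k"
  shows "h1 a b (\<lambda>x. u x + c * v x) (\<lambda>x. g x + c * k x)"
  unfolding h1_def
proof (intro conjI ballI)
  show "(\<lambda>x. g x + c * k x) \<in> L2 (Leb a b)" using assms by (intro L2_add L2_cmult h1_L2)
  fix x assume x: "x \<in> {a..b}"
  have "((\<lambda>t. g t + c * k t) has_integral (u x - u a) + c * (v x - v a)) {a..x}"
    using assms x unfolding h1_def by (intro has_integral_add has_integral_mult_right) auto
  then show "((\<lambda>t. g t + c * k t) has_integral u x + c * v x - (u a + c * v a)) {a..x}"
    by (simp add: algebra_simps)
qed

text \<open>Cauchy--Schwarz on the union A of the intervals bounds the sum of increments by the root
  of the length of A times the norm of \<open>g\<close>, whence the square in \<delta>.\<close>

lemma h1_abs_cont: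
  assumes ab: "a < b" and h: "h1 a b u g"
  shows "abs_cont a b u"
  unfolding abs_cont_iff_modulus
proof (intro allI impI)
  fix \<epsilon> :: real assume \<epsilon>: "0 < \<epsilon>"
  define K where "K = l2_norm (Leb a b) g"
  have K: "0 \<le> K" by (simp add: K_def l2_norm_nonneg)
  define \<delta> where "\<delta> = (\<epsilon> / (K + 1))\<^sup>2"
  have g: "integrable (Leb a b) g" by (rule h1_integrable[OF h])
  have "ac_modulus a b u \<epsilon> \<delta>"
    unfolding ac_modulus_def
  proof (intro allI impI; elim conjE)
    fix n :: nat and l r :: "nat \<Rightarrow> real"
    assume lr: "\<forall>k<n. a \<le> l k \<and> l k \<le> r k \<and> r k \<le> b"
      and dis: "disjoint_family_on (\<lambda>k. {l k<..<r k}) {..<n}" and small: "(\<Sum>k<n. r k - l k) < \<delta>"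
    define A where "A = (\<Union>k<n. {l k<..<r k})"
    have Ab: "A \<in> sets borel" unfolding A_def by auto
    have ind: "indicator A t = (\<Sum>k<n. indicator {l k<..<r k} t :: real)" for t
      unfolding A_def by (rule indicator_UN_disjoint[OF _ dis]) simp
    have incr: "cmod (u (r k) - u (l k)) \<le> (\<integral>t. indicator {l k<..<r k} t * cmod (g t) \<partial>Leb a b)" if "k < n" for k
    proof -
      have lrk: "a \<le> l k" "l k \<le> r k" "r k \<le> b" using lr that by auto
      have "u (r k) - u (l k) = (\<integral>t. indicator {l k<..<r k} t *\<^sub>R g t \<partial>Leb a b)"
        using integral_subinterval(2)[OF g lrk(1,3)] h1_increment[OF h lrk] by simp
      also have "cmod \<dots> \<le> (\<integral>t. cmod (indicator {l k<..<r k} t *\<^sub>R g t) \<partial>Leb a b)"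
        by (rule integral_norm_bound)
      finally show ?thesis by simp
    qed
    have int: "integrable (Leb a b) (\<lambda>t. indicator {l k<..<r k} t * cmod (g t))" if "k < n" for k
    proof -
      have lrk: "a \<le> l k" "r k \<le> b" using lr that by auto
      show ?thesis using integrable_norm[OF integral_subinterval(1)[OF g lrk]] by simp
    qed
    have iA: "(\<lambda>t. indicator A t :: complex) \<in> L2 (Leb a b)"
    proof (rule L2_I[where g = "\<lambda>_. 1"])
      show "(indicator A :: real \<Rightarrow> complex) \<in> borel_measurable (Leb a b)"
        using Ab by (intro borel_measurable_Leb) simp
      show "integrable (Leb a b) (\<lambda>_. 1 :: real)" by (intro continuous_integrable_Leb continuous_intros)
    qed (auto simp: indicator_def)
    have "(l2_norm (Leb a b) (\<lambda>t. indicator A t))\<^sup>2 = (\<integral>t. indicator A t \<partial>Leb a b)"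
      unfolding l2_norm_square by (intro Bochner_Integration.integral_cong) (auto simp: indicator_def)
    also have "\<dots> = (\<Sum>k<n. \<integral>t. indicator {l k<..<r k} t \<partial>Leb a b)"
      unfolding ind
    proof (rule Bochner_Integration.integral_sum)
      fix k assume "k \<in> {..<n}"
      have "integrable (Leb a b) (\<lambda>_. 1 :: real)" by (intro continuous_integrable_Leb continuous_intros)
      moreover have "(indicator {l k<..<r k} :: real \<Rightarrow> real) \<in> borel_measurable (Leb a b)"
        by (intro borel_measurable_Leb) simp
      ultimately show "integrable (Leb a b) (indicator {l k<..<r k} :: real \<Rightarrow> real)"
        by (rule Bochner_Integration.integrable_bound) (auto simp: indicator_def)
    qed
    also have "\<dots> \<le> (\<Sum>k<n. r k - l k)"
    proof (rule sum_mono)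
      fix k assume "k \<in> {..<n}"
      then have lrk: "a \<le> l k" "l k \<le> r k" "r k \<le> b" using lr by auto
      define I :: "real \<Rightarrow> real" where "I = indicator {l k<..<r k}"
      have "integral\<^sup>L (Leb a b) I = (\<integral>t. indicator {a<..<b} t *\<^sub>R I t \<partial>lebesgue)"
        by (rule integral_restrict_space) simp
      also have "(\<lambda>t. indicator {a<..<b} t *\<^sub>R I t) = I"
        using lrk by (auto simp: indicator_def I_def)
      also have "integral\<^sup>L lebesgue I = r k - l k" using lrk by (simp add: I_def)
      finally show "(\<integral>t. indicator {l k<..<r k} t \<partial>Leb a b) \<le> r k - l k" by (simp only: I_def)
    qed
    also have "\<dots> \<le> \<delta>" using small by simp
    finally have nA: "l2_norm (Leb a b) (\<lambda>t. indicator A t) \<le> \<epsilon> / (K + 1)"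
      unfolding \<delta>_def by (rule power2_le_imp_le) (use \<epsilon> K in simp)
    have "(\<Sum>k<n. cmod (u (r k) - u (l k))) \<le> (\<Sum>k<n. \<integral>t. indicator {l k<..<r k} t * cmod (g t) \<partial>Leb a b)"
      by (intro sum_mono incr) auto
    also have "\<dots> = (\<integral>t. (\<Sum>k<n. indicator {l k<..<r k} t * cmod (g t)) \<partial>Leb a b)"
      by (rule Bochner_Integration.integral_sum[symmetric]) (use int in auto)
    also have "\<dots> = (\<integral>t. cmod (indicator A t * g t) \<partial>Leb a b)"
      unfolding sum_distrib_right[symmetric] ind[symmetric]
      by (intro Bochner_Integration.integral_cong) (auto simp: indicator_def)
    also have "\<dots> \<le> l2_norm (Leb a b) (\<lambda>t. indicator A t) * K"
      unfolding K_def by (rule integral_abs_mult_le[OF iA h1_L2[OF h]])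
    also have "\<dots> \<le> \<epsilon> / (K + 1) * K" using nA K by (rule mult_right_mono)
    also have "\<dots> < \<epsilon>" using \<epsilon> K by (simp add: field_simps)
    finally show "(\<Sum>k<n. cmod (u (r k) - u (l k))) < \<epsilon>" .
  qed
  moreover have "0 < \<delta>" using \<epsilon> K by (simp add: \<delta>_def)
  ultimately show "\<exists>\<delta>>0. ac_modulus a b u \<epsilon> \<delta>" by blast
qed

lemma h1_continuous: "a < b \<Longrightarrow> h1 a b u g \<Longrightarrow> continuous_on {a..b} u"
  by (rule abs_cont_continuous_on[OF h1_abs_cont])

lemma h1_fun_L2: "a < b \<Longrightarrow> h1 a b u g \<Longrightarrow> u \<in> L2 (Leb a b)"
  by (rule continuous_L2_Leb[OF h1_continuous])

lemma h1_derivative: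
  assumes ab: "a < b" and h: "h1 a b u g"
  shows "AE x in Leb a b. (u has_vector_derivative g x) (at x)"
proof -
  have "g absolutely_integrable_on {a..b}" using h1_integrable[OF h] by (simp add: integrable_Leb_iff)
  then obtain N where N: "negligible N"
    "\<And>x. x \<in> {a<..<b} - N \<Longrightarrow> ((\<lambda>y. integral {a..y} g) has_vector_derivative g x) (at x)"
    by (rule indefinite_integral_derivative_AE) (rule that)
  have "(u has_vector_derivative g x) (at x)" if x: "x \<in> {a<..<b} - N" for x
  proof (rule has_vector_derivative_transform_within_open)
    show "((\<lambda>y. u a + integral {a..y} g) has_vector_derivative g x) (at x)"
      using has_vector_derivative_add[OF has_vector_derivative_const N(2)[OF x]] by simp
    show "u a + integral {a..y} g = u y" if "y \<in> {a<..<b}" for y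
      using h1_increment[OF h, of a y] that by simp
  qed (use x in auto)
  then show ?thesis by (rule negligible_imp_AE_Leb[OF N(1)])
qed

lemma h1_of_abs_cont:
  assumes ab: "a < b" and u: "abs_cont a b u" and g: "AE x in Leb a b. (u has_vector_derivative g x) (at x)"
    and L2: "g \<in> L2 (Leb a b)"
  shows "h1 a b u g"
  unfolding h1_def
proof (intro conjI L2 ballI)
  obtain k where k: "\<And>x. x \<in> {a..b} \<Longrightarrow> (k has_integral u x - u a) {a..x}"
    "AE x in Leb a b. (u has_vector_derivative k x) (at x)"
    by (rule abs_cont_derivative[OF less_imp_le[OF ab] u]) (rule that)
  have "AE x in Leb a b. k x = g x"
    using g k(2) by eventually_elim (rule vector_derivative_unique_at)
  then show "(g has_integral u x - u a) {a..x}" if "x \<in> {a..b}" for x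
    using has_integral_cong_AE_Leb[OF k(1)[OF that]] that by auto
qed

lemma continuous_AE_eq:
  fixes u v :: "real \<Rightarrow> complex"
  assumes ab: "a < b" and u: "continuous_on {a..b} u" and v: "continuous_on {a..b} v"
    and ae: "AE x in Leb a b. u x = v x" and x: "x \<in> {a..b}"
  shows "u x = v x"
proof (rule ccontr)
  assume ne: "u x \<noteq> v x"
  obtain N where N: "negligible N" "\<And>t. t \<in> {a<..<b} - N \<Longrightarrow> u t = v t"
    using ae by (rule AE_Leb_negligible) (rule that)
  have "continuous_on {a..b} (\<lambda>t. u t - v t)" by (intro continuous_intros u v)
  then obtain d where d: "0 < d" "\<And>t. t \<in> {a..b} \<Longrightarrow> dist t x < d \<Longrightarrow> dist (u t - v t) (u x - v x) < norm (u x - v x)"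
    using x ne unfolding continuous_on_iff by (metis right_minus_eq zero_less_norm_iff)
  define S where "S = {a<..<b} \<inter> ball x d"
  have "S \<subseteq> N"
  proof
    fix t assume t: "t \<in> S"
    then have "u t \<noteq> v t" using d(2)[of t] by (force simp: S_def dist_commute)
    then show "t \<in> N" using N(2)[of t] t by (auto simp: S_def)
  qed
  then have neg: "negligible S" using N(1) negligible_subset by blast
  have "open S" by (simp add: S_def open_Int)
  moreover have "S \<noteq> {}"
  proof -
    have "x \<in> closure {a<..<b}" using x ab by simp
    then show ?thesis using d(1) unfolding S_def by (metis closure_approachable disjoint_iff dist_commute mem_ball)
  qed
  ultimately show False using open_not_negligible neg by blast
qed

text \<open>Whatever representative the choice returns is continuous and almost everywhere equal to
  \<open>u\<close>; so it equals \<open>u\<close> at every point of the closed interval, and has the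
  same derivative inside.\<close>

lemma ac_rep_eq:
  assumes ab: "a < b" and h: "h1 a b u g" and f: "AE x in Leb a b. f x = u x"
  shows "x \<in> {a..b} \<Longrightarrow> ac_rep a b f x = u x" and "AE x in Leb a b. ac_deriv a b f x = g x"
proof -
  define v where "v = ac_rep a b f"
  have "abs_cont a b v \<and> (AE x in Leb a b. f x = v x)"
    unfolding v_def ac_rep_def by (rule someI[of _ u]) (use h1_abs_cont[OF ab h] f in blast)
  then have v: "abs_cont a b v" "AE x in Leb a b. f x = v x" by auto
  have "AE x in Leb a b. v x = u x" using v(2) f by eventually_elim simp
  then have eq: "v x = u x" if "x \<in> {a..b}" for x
    using continuous_AE_eq[OF ab abs_cont_continuous_on[OF v(1)] h1_continuous[OF ab h] _ that] by blast
  then show "x \<in> {a..b} \<Longrightarrow> ac_rep a b f x = u x" by (simp add: v_def)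
  show "AE x in Leb a b. ac_deriv a b f x = g x"
    using h1_derivative[OF ab h] AE_Leb_in
  proof eventually_elim
    case (elim x)
    have "(v has_vector_derivative g x) (at x)"
    proof (rule has_vector_derivative_transform_within_open[OF elim(1), of "{a<..<b}"])
      show "u y = v y" if "y \<in> {a<..<b}" for y using eq[of y] that by simp
    qed (use elim(2) in auto)
    then show ?case unfolding ac_deriv_def v_def[symmetric] by (rule vector_derivative_at)
  qed
qed

lemma W12_iff:
  assumes ab: "a < b"
  shows "f \<in> W12 a b \<longleftrightarrow> f \<in> L2 (Leb a b) \<and> (\<exists>u g. h1 a b u g \<and> (AE x in Leb a b. f x = u x))"
proof
  assume f: "f \<in> W12 a b"
  then obtain h where h: "abs_cont a b h \<and> (AE x in Leb a b. f x = h x)" by (auto simp: W12_def)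
  define v where "v = ac_rep a b f"
  have v: "abs_cont a b v \<and> (AE x in Leb a b. f x = v x)"
    unfolding v_def ac_rep_def by (rule someI[of _ h]) (rule h)
  obtain k where k: "AE x in Leb a b. (v has_vector_derivative k x) (at x)"
    by (rule abs_cont_derivative[OF less_imp_le[OF ab] conjunct1[OF v]]) (rule that)
  have "AE x in Leb a b. (v has_vector_derivative ac_deriv a b f x) (at x)"
    using k unfolding ac_deriv_def v_def[symmetric]
    by eventually_elim (auto simp: vector_derivative_at)
  then have "h1 a b v (ac_deriv a b f)"
    using f v by (intro h1_of_abs_cont[OF ab]) (auto simp: W12_def)
  then show "f \<in> L2 (Leb a b) \<and> (\<exists>u g. h1 a b u g \<and> (AE x in Leb a b. f x = u x))"
    using f v by (auto simp: W12_def)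
next
  assume "f \<in> L2 (Leb a b) \<and> (\<exists>u g. h1 a b u g \<and> (AE x in Leb a b. f x = u x))"
  then obtain u g where f: "f \<in> L2 (Leb a b)" and h: "h1 a b u g" "AE x in Leb a b. f x = u x" by blast
  have d: "AE x in Leb a b. ac_deriv a b f x = g x" by (rule ac_rep_eq(2)[OF ab h])
  have "ac_deriv a b f \<in> L2 (Leb a b)"
    by (rule L2_cong_AE[OF h1_L2[OF h(1)] borel_measurable_integrable[OF integrable_cong_AE_Leb[OF h1_integrable[OF h(1)] d]] d])
  then show "f \<in> W12 a b" using f h h1_abs_cont[OF ab h(1)] by (auto simp: W12_def)
qed

lemma h1_smooth:
  assumes ab: "a < b" and p: "\<And>x. (p has_vector_derivative p' x) (at x)" and c: "continuous_on UNIV p'"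
  shows "h1 a b p p'"
  unfolding h1_def
proof (intro conjI ballI)
  show "p' \<in> L2 (Leb a b)" by (rule continuous_L2_Leb[OF continuous_on_subset[OF c]]) simp
  show "(p' has_integral p x - p a) {a..x}" if "x \<in> {a..b}" for x
    by (rule fundamental_theorem_of_calculus) (use that has_vector_derivative_at_within[OF p] in auto)
qed

text \<open>The product is absolutely continuous because both factors are bounded and absolutely
  continuous, so it is the integral of its almost everywhere derivative, which the product rule
  supplies.\<close>

lemma h1_parts:
  assumes ab: "a < b" and u: "h1 a b u g" and p: "\<And>x. (p has_vector_derivative p' x) (at x)" and c: "continuous_on UNIV p'"
  shows "(\<integral>x. p x * g x \<partial>Leb a b) + (\<integral>x. p' x * u x \<partial>Leb a b) = p b * u b - p a * u a"
proof -
  have hp: "h1 a b p p'" by (rule h1_smooth[OF ab p c])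
  have cu: "continuous_on {a..b} u" and cp: "continuous_on {a..b} p"
    using h1_continuous[OF ab] u hp by blast+
  have "bounded (u ` {a..b})" "bounded (p ` {a..b})"
    using compact_continuous_image[OF cu] compact_continuous_image[OF cp] compact_imp_bounded by blast+
  then obtain K1 K2 where K: "\<forall>z\<in>u ` {a..b}. norm z \<le> K1" "\<forall>z\<in>p ` {a..b}. norm z \<le> K2"
    unfolding bounded_iff by blast
  define K where "K = max 0 (max K1 K2)"
  have Ku: "cmod (u x) \<le> K" and Kp: "cmod (p x) \<le> K" if "x \<in> {a..b}" for x
    using K that unfolding K_def by (simp_all add: le_max_iff_disj)
  have ac: "abs_cont a b (\<lambda>x. p x * u x)"
  proof (rule abs_cont_dominated[OF h1_abs_cont[OF ab hp] h1_abs_cont[OF ab u], of K])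
    fix x y assume xy: "a \<le> x" "x \<le> y" "y \<le> b"
    have "p y * u y - p x * u x = (p y - p x) * u y + p x * (u y - u x)" by (simp add: algebra_simps)
    then have "cmod (p y * u y - p x * u x) \<le> cmod (p y - p x) * cmod (u y) + cmod (p x) * cmod (u y - u x)"
      using norm_triangle_ineq[of "(p y - p x) * u y" "p x * (u y - u x)"] by (simp add: norm_mult)
    also have "\<dots> \<le> cmod (p y - p x) * K + K * cmod (u y - u x)"
      using Ku[of y] Kp[of x] xy by (intro add_mono mult_left_mono mult_right_mono) auto
    finally show "cmod (p y * u y - p x * u x) \<le> K * (cmod (p y - p x) + cmod (u y - u x))"
      by (simp add: algebra_simps)
  qed (simp add: K_def)
  have p'L2: "p' \<in> L2 (Leb a b)" using h1_L2[OF hp] .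
  have gL2: "g \<in> L2 (Leb a b)" using h1_L2[OF u] .
  have uL2: "u \<in> L2 (Leb a b)" and pL2: "p \<in> L2 (Leb a b)" using h1_fun_L2[OF ab] u hp by blast+
  have int: "integrable (Leb a b) (\<lambda>x. p x * g x)" "integrable (Leb a b) (\<lambda>x. p' x * u x)"
    by (intro L2_mult_integrable p'L2 gL2 uL2 pL2)+
  obtain k where k: "\<And>x. x \<in> {a..b} \<Longrightarrow> (k has_integral p x * u x - p a * u a) {a..x}"
    "AE x in Leb a b. ((\<lambda>x. p x * u x) has_vector_derivative k x) (at x)"
    by (rule abs_cont_derivative[OF less_imp_le[OF ab] ac]) (rule that)
  have "AE x in Leb a b. k x = p x * g x + p' x * u x"
    using k(2) h1_derivative[OF ab u]
  proof eventually_elim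
    case (elim x)
    have "((\<lambda>x. p x * u x) has_vector_derivative (p x * g x + p' x * u x)) (at x)"
      by (rule has_vector_derivative_mult[OF p elim(2)])
    then show ?case using elim(1) vector_derivative_unique_at by blast
  qed
  then have "((\<lambda>x. p x * g x + p' x * u x) has_integral p b * u b - p a * u a) {a..b}"
    using has_integral_cong_AE_Leb[OF k(1)[of b]] ab by auto
  then have "p b * u b - p a * u a = integral {a..b} (\<lambda>x. p x * g x + p' x * u x)" by (simp add: integral_unique)
  also have "\<dots> = (\<integral>x. p x * g x + p' x * u x \<partial>Leb a b)"
    using int by (intro integral_Leb[symmetric]) simp
  finally show ?thesis using int by simp
qed

text \<open>Increments of \<open>u\<close> are at most sqrt (b - a) times the norm of
  \<open>g\<close>; averaging |u x| \<le> |u y| + |u x - u y| over \<open>y\<close> produces the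
  first term.\<close>

lemma h1_sup_bound:
  assumes ab: "a < b" and u: "h1 a b u g" and x: "x \<in> {a..b}"
  shows "cmod (u x) \<le> l2_norm (Leb a b) u / sqrt (b - a) + sqrt (b - a) * l2_norm (Leb a b) g"
proof -
  define s where "s = sqrt (b - a)"
  have s: "0 < s" "s * s = b - a" using ab by (auto simp: s_def)
  define p where "p = l2_norm (Leb a b) u"
  define q where "q = l2_norm (Leb a b) g"
  have gi: "integrable (Leb a b) g" by (rule h1_integrable[OF u])
  have uL2: "u \<in> L2 (Leb a b)" by (rule h1_fun_L2[OF ab u])
  have mono: "cmod (u y - u z) \<le> s * q" if "a \<le> z" "z \<le> y" "y \<le> b" for y z
  proof -
    have "u y - u z = (\<integral>t. indicator {z<..<y} t *\<^sub>R g t \<partial>Leb a b)"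
      using integral_subinterval(2)[OF gi that(1,3)] h1_increment[OF u that] by simp
    also have "cmod \<dots> \<le> (\<integral>t. cmod (g t) \<partial>Leb a b)"
      by (rule Bochner_Integration.integral_norm_bound_integral)
         (use integral_subinterval(1)[OF gi that(1,3)] gi in \<open>auto simp: indicator_def\<close>)
    also have "\<dots> \<le> s * q" unfolding s_def q_def using ab by (intro integral_abs_le_l2_norm h1_L2[OF u]) auto
    finally show ?thesis .
  qed
  have le: "cmod (u x) \<le> cmod (u y) + s * q" if y: "y \<in> {a..b}" for y
  proof -
    have "cmod (u x - u y) \<le> s * q"
      using mono[of y x] mono[of x y] x y by (cases "y \<le> x") (auto simp: norm_minus_commute)
    then show ?thesis using norm_triangle_sub[of "u x" "u y"] by linarith
  qed
  have c1: "integrable (Leb a b) (\<lambda>_. c :: real)" for c by (intro continuous_integrable_Leb continuous_intros)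
  have cst: "(\<integral>y. c \<partial>Leb a b) = (b - a) * c" for c :: real
    using measure_Leb[OF less_imp_le[OF ab]] by (simp del: space_restrict_space)
  have uint: "integrable (Leb a b) (\<lambda>y. cmod (u y))"
    by (rule integrable_norm[OF L2_imp_integrable_Leb[OF uL2]])
  have "(\<integral>y. cmod (u x) \<partial>Leb a b) \<le> (\<integral>y. cmod (u y) + s * q \<partial>Leb a b)"
    using c1 uint le by (intro integral_mono) auto
  also have "\<dots> = (\<integral>y. cmod (u y) \<partial>Leb a b) + (b - a) * (s * q)" using uint c1 cst by simp
  also have "\<dots> \<le> s * p + (b - a) * (s * q)"
    unfolding s_def p_def using ab by (intro add_right_mono integral_abs_le_l2_norm uL2) auto
  finally have "s * s * cmod (u x) \<le> s * p + s * s * (s * q)" unfolding cst s(2) .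
  then have "(s * s) * cmod (u x) \<le> (s * s) * (p / s + s * q)"
    using s(1) by (simp add: distrib_left)
  then show ?thesis using s(1) by (simp add: p_def q_def s_def)
qed

section \<open>Form domains in terms of Fourier coefficients\<close>

lemma l2_norm_triangle:
  assumes f: "f \<in> L2 M" and g: "g \<in> L2 M"
  shows "l2_norm M (\<lambda>x. f x + g x) \<le> l2_norm M f + l2_norm M g"
proof (rule power2_le_imp_le)
  have "l2_inner M (\<lambda>x. f x + g x) (\<lambda>x. f x + g x)
      = (l2_inner M f f + l2_inner M g g) + (l2_inner M f g + l2_inner M g f)"
    using f g L2_add[OF f g] by (simp add: l2_inner_add_left l2_inner_add_right)
  then have "(l2_norm M (\<lambda>x. f x + g x))\<^sup>2 = Re ((l2_inner M f f + l2_inner M g g) + (l2_inner M f g + l2_inner M g f))"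
    unfolding l2_inner_self by (metis Re_complex_of_real)
  also have "\<dots> = (l2_norm M f)\<^sup>2 + (l2_norm M g)\<^sup>2 + (Re (l2_inner M f g) + Re (l2_inner M g f))"
    by (simp add: l2_inner_self)
  also have "\<dots> \<le> (l2_norm M f)\<^sup>2 + (l2_norm M g)\<^sup>2 + (l2_norm M f * l2_norm M g + l2_norm M f * l2_norm M g)"
    using order_trans[OF complex_Re_le_cmod cmod_l2_inner_le[OF f g]]
      order_trans[OF complex_Re_le_cmod cmod_l2_inner_le[OF g f]] by (simp add: mult.commute)
  also have "\<dots> = (l2_norm M f + l2_norm M g)\<^sup>2" by (simp add: power2_eq_square algebra_simps)
  finally show "(l2_norm M (\<lambda>x. f x + g x))\<^sup>2 \<le> (l2_norm M f + l2_norm M g)\<^sup>2" .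
qed (simp add: l2_norm_nonneg)

lemma l2_norm_minus: "l2_norm M (\<lambda>x. f x - g x) = l2_norm M (\<lambda>x. g x - f x)"
  by (simp add: l2_norm_def norm_minus_commute)

lemma l2_norm_diff_triangle:
  assumes "f \<in> L2 M" "g \<in> L2 M" "h \<in> L2 M"
  shows "l2_norm M (\<lambda>x. f x - g x) \<le> l2_norm M (\<lambda>x. f x - h x) + l2_norm M (\<lambda>x. g x - h x)"
  using l2_norm_triangle[OF L2_diff[OF assms(1,3)] L2_diff[OF assms(3,2)]] by (simp add: l2_norm_minus[of M h g])

lemma l2_norm_bounded_mult:
  assumes f: "f \<in> L2 M" and w: "w \<in> borel_measurable M" "AE x in M. cmod (w x) \<le> C" and C: "0 \<le> C"
  shows "l2_norm M (\<lambda>x. w x * f x) \<le> C * l2_norm M f"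
proof (rule power2_le_imp_le)
  have "(l2_norm M (\<lambda>x. w x * f x))\<^sup>2 \<le> (\<integral>x. C\<^sup>2 * (cmod (f x))\<^sup>2 \<partial>M)"
    unfolding l2_norm_square
  proof (rule integral_mono_AE)
    show "integrable M (\<lambda>x. (cmod (w x * f x))\<^sup>2)" by (rule L2_integrable[OF L2_bounded_mult[OF f w]])
    show "integrable M (\<lambda>x. C\<^sup>2 * (cmod (f x))\<^sup>2)" using f by (simp add: L2_integrable)
    show "AE x in M. (cmod (w x * f x))\<^sup>2 \<le> C\<^sup>2 * (cmod (f x))\<^sup>2"
      using w(2)
    proof eventually_elim
      case (elim x)
      then have "(cmod (w x))\<^sup>2 \<le> C\<^sup>2" by (intro power_mono) auto
      then show ?case by (simp add: norm_mult power_mult_distrib mult_right_mono)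
    qed
  qed
  also have "\<dots> = (C * l2_norm M f)\<^sup>2" by (simp add: power_mult_distrib l2_norm_square)
  finally show "(l2_norm M (\<lambda>x. w x * f x))\<^sup>2 \<le> (C * l2_norm M f)\<^sup>2" .
qed (use C in \<open>simp add: l2_norm_nonneg\<close>)

lemma W12_h1:
  assumes ab: "a < b" and f: "f \<in> W12 a b"
  shows "h1 a b (ac_rep a b f) (ac_deriv a b f)" "AE x in Leb a b. f x = ac_rep a b f x"
proof -
  obtain u g where u: "h1 a b u g" "AE x in Leb a b. f x = u x" using f W12_iff[OF ab] by blast
  have r: "ac_rep a b f x = u x" if "x \<in> {a..b}" for x by (rule ac_rep_eq(1)[OF ab u that])
  have d: "AE x in Leb a b. g x = ac_deriv a b f x" using ac_rep_eq(2)[OF ab u] by eventually_elim simp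
  have "ac_deriv a b f \<in> L2 (Leb a b)" using f by (simp add: W12_def)
  moreover have "(ac_deriv a b f has_integral ac_rep a b f x - ac_rep a b f a) {a..x}" if x: "x \<in> {a..b}" for x
  proof -
    have "(g has_integral u x - u a) {a..x}" using u(1) x by (simp add: h1_def)
    from has_integral_cong_AE_Leb[OF this d] show ?thesis using r[of x] r[of a] x by auto
  qed
  ultimately show "h1 a b (ac_rep a b f) (ac_deriv a b f)" by (simp add: h1_def)
  show "AE x in Leb a b. f x = ac_rep a b f x"
    using u(2) AE_Leb_in by eventually_elim (use r in auto)
qed

section \<open>Fourier coefficients of functions in the form domain\<close>

context interval_bc
begin

abbreviation "\<mu> \<equiv> Leb a b"

text \<open>The form domain on the level of pairs: a Neumann end is left free, since only Dirichlet
  conditions are seen by a form.\<close>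

definition Vp :: "(real \<Rightarrow> complex) \<Rightarrow> (real \<Rightarrow> complex) \<Rightarrow> bool" where
  "Vp u g \<longleftrightarrow> h1 a b u g \<and> (DA \<longrightarrow> u a = 0) \<and> (DB \<longrightarrow> u b = 0)"

lemma Vp_h1: "Vp u g \<Longrightarrow> h1 a b u g" by (simp add: Vp_def)

lemma Vp_L2:
  assumes "Vp u g"
  shows "u \<in> L2 \<mu>" "g \<in> L2 \<mu>"
  using h1_fun_L2[OF ab] h1_L2 Vp_h1[OF assms] by blast+

lemma phi_Vp: "Vp (phi n) (\<lambda>x. of_real (kap n) * psi n x)"
  unfolding Vp_def using boundary_a(1) boundary_b(1)
  by (auto intro!: h1_smooth[OF ab phi_deriv] continuous_intros continuous_psi)

lemma cnj_phi [simp]: "cnj (phi n x) = phi n x" and cnj_psi [simp]: "cnj (psi n x) = psi n x"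
  by (simp_all only: phi_def psi_def complex_cnj_complex_of_real)

text \<open>Integration by parts without boundary terms: at a Dirichlet end \<open>u\<close>
  vanishes, at any other end \<open>psi n\<close> does.\<close>

lemma Vp_coeff:
  assumes v: "Vp u g"
  shows "l2_inner \<mu> (psi n) g = of_real (kap n) * l2_inner \<mu> (phi n) u"
proof -
  have "(\<integral>x. psi n x * g x \<partial>\<mu>) + (\<integral>x. (- of_real (kap n) * phi n x) * u x \<partial>\<mu>) = psi n b * u b - psi n a * u a"
    by (rule h1_parts[OF ab Vp_h1[OF v] psi_deriv]) (intro continuous_intros continuous_phi)
  also have "\<dots> = 0"
    using v boundary_a(2)[of n] boundary_b(2)[of n] unfolding Vp_def by (cases DA; cases DB) auto
  also have "(\<integral>x. (- of_real (kap n) * phi n x) * u x \<partial>\<mu>) = - of_real (kap n) * (\<integral>x. phi n x * u x \<partial>\<mu>)"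
    by (simp only: mult.assoc integral_mult_right_zero)
  finally show ?thesis by (simp add: l2_inner_def)
qed

definition fsum :: "(nat \<Rightarrow> complex) \<Rightarrow> nat \<Rightarrow> real \<Rightarrow> complex" where
  "fsum c N x = (\<Sum>n<N. c n * phi n x)"
definition dsum :: "(nat \<Rightarrow> complex) \<Rightarrow> nat \<Rightarrow> real \<Rightarrow> complex" where
  "dsum c N x = (\<Sum>n<N. (of_real (kap n) * c n) * psi n x)"

lemma Vp_lin:
  assumes "Vp u g" "Vp v k"
  shows "Vp (\<lambda>x. u x + c * v x) (\<lambda>x. g x + c * k x)"
  using assms unfolding Vp_def by (auto intro: h1_lin)

lemma fsum_Suc: "fsum c (Suc N) = (\<lambda>x. fsum c N x + c N * phi N x)"
  and dsum_Suc: "dsum c (Suc N) = (\<lambda>x. dsum c N x + c N * (of_real (kap N) * psi N x))"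
  by (auto simp: fsum_def dsum_def)

lemma fsum_0: "fsum c 0 = (\<lambda>_. 0)" and dsum_0: "dsum c 0 = (\<lambda>_. 0)"
  by (auto simp: fsum_def dsum_def)

lemma fsum_Vp: "Vp (fsum c N) (dsum c N)"
proof (induction N)
  case 0
  show ?case unfolding fsum_0 dsum_0 Vp_def by (auto simp: h1_def L2_zero)
next
  case (Suc N)
  show ?case unfolding fsum_Suc dsum_Suc by (rule Vp_lin[OF Suc phi_Vp])
qed

lemma sup_bound:
  assumes "h1 a b u g" "x \<in> {a..b}"
  shows "cmod (u x) \<le> (1 / sqrt len + sqrt len) * (l2_norm \<mu> u + l2_norm \<mu> g)"
proof -
  have "cmod (u x) \<le> l2_norm \<mu> u / sqrt len + sqrt len * l2_norm \<mu> g"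
    unfolding len_def by (rule h1_sup_bound[OF ab assms])
  also have "\<dots> \<le> (1 / sqrt len + sqrt len) * (l2_norm \<mu> u + l2_norm \<mu> g)"
    using len_pos l2_norm_nonneg[of \<mu> u] l2_norm_nonneg[of \<mu> g] by (simp add: algebra_simps)
  finally show ?thesis .
qed

text \<open>Riesz--Fischer for \<open>psi\<close> supplies the derivative. The sup bound makes the
  partial sums converge uniformly on the closed interval, so point values and with them the boundary
  conditions pass to the limit.\<close>

lemma Vp_converse:
  assumes f: "f \<in> L2 \<mu>" and c: "\<And>n. c n = l2_inner \<mu> (phi n) f"
    and w: "(\<lambda>n. (cmod (of_real (kap n) * c n))\<^sup>2) summable_on UNIV"
  obtains u g where "Vp u g" "AE x in \<mu>. f x = u x" "(\<lambda>N. l2_norm \<mu> (\<lambda>x. dsum c N x - g x)) \<longlonglongrightarrow> 0"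
proof -
  obtain g where g: "g \<in> L2 \<mu>" "(\<lambda>N. l2_norm \<mu> (\<lambda>x. dsum c N x - g x)) \<longlonglongrightarrow> 0"
    using psi.Riesz_Fischer[OF w] unfolding dsum_def by blast
  have fc: "(\<lambda>N. l2_norm \<mu> (\<lambda>x. fsum c N x - f x)) \<longlonglongrightarrow> 0"
    using phi.expansion[OF f] unfolding fsum_def c phi.coord_U[OF f] .
  have L2s: "fsum c N \<in> L2 \<mu>" "dsum c N \<in> L2 \<mu>" for N using Vp_L2[OF fsum_Vp] by blast+
  define K where "K = 1 / sqrt len + sqrt len"
  have K: "0 < K" using len_pos by (simp add: K_def add_pos_pos)
  have "\<exists>u. \<forall>e>0. \<exists>N. \<forall>n x. N \<le> n \<and> x \<in> {a..b} \<longrightarrow> dist (fsum c n x) (u x) < e"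
    unfolding uniformly_convergent_eq_cauchy
  proof (intro allI impI)
    fix e :: real assume e: "0 < e"
    \<comment> \<open>Four norms, each below \<open>d\<close>, bound the difference of two partial
      sums, and K (4 d) = e.\<close>
    define d where "d = e / (4 * K)"
    have d: "0 < d" using e K by (simp add: d_def)
    have "\<forall>\<^sub>F N in sequentially. l2_norm \<mu> (\<lambda>x. fsum c N x - f x) < d \<and> l2_norm \<mu> (\<lambda>x. dsum c N x - g x) < d"
      using order_tendstoD(2)[OF fc d] order_tendstoD(2)[OF g(2) d] by eventually_elim simp
    then obtain N where N: "\<And>n. n \<ge> N \<Longrightarrow> l2_norm \<mu> (\<lambda>x. fsum c n x - f x) < d \<and> l2_norm \<mu> (\<lambda>x. dsum c n x - g x) < d"
      unfolding eventually_sequentially by blast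
    have "dist (fsum c m x) (fsum c n x) < e" if mn: "N \<le> m" "N \<le> n" and x: "x \<in> {a..b}" for m n x
    proof -
      have h: "h1 a b (\<lambda>x. fsum c m x - fsum c n x) (\<lambda>x. dsum c m x - dsum c n x)"
        using h1_lin[OF Vp_h1[OF fsum_Vp] Vp_h1[OF fsum_Vp], of c m "-1" c n] by simp
      have "cmod (fsum c m x - fsum c n x)
          \<le> K * (l2_norm \<mu> (\<lambda>x. fsum c m x - fsum c n x) + l2_norm \<mu> (\<lambda>x. dsum c m x - dsum c n x))"
        using sup_bound[OF h x] by (simp add: K_def)
      also have "\<dots> < K * (4 * d)"
      proof (rule mult_strict_left_mono[OF _ K])
        show "l2_norm \<mu> (\<lambda>x. fsum c m x - fsum c n x) + l2_norm \<mu> (\<lambda>x. dsum c m x - dsum c n x) < 4 * d"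
          using l2_norm_diff_triangle[OF L2s(1)[of m] L2s(1)[of n] f] l2_norm_diff_triangle[OF L2s(2)[of m] L2s(2)[of n] g(1)]
            N[OF mn(1)] N[OF mn(2)] by linarith
      qed
      also have "\<dots> = e" using K by (simp add: d_def)
      finally show ?thesis by (simp add: dist_norm)
    qed
    then show "\<exists>N. \<forall>m n x. N \<le> m \<and> N \<le> n \<and> x \<in> {a..b} \<longrightarrow> dist (fsum c m x) (fsum c n x) < e" by blast
  qed
  then obtain u where u: "\<And>e. 0 < e \<Longrightarrow> \<exists>N. \<forall>n x. N \<le> n \<and> x \<in> {a..b} \<longrightarrow> dist (fsum c n x) (u x) < e" by blast
  have lim: "(\<lambda>n. fsum c n x) \<longlonglongrightarrow> u x" if "x \<in> {a..b}" for x
    unfolding lim_sequentially using u that by meson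
  have h1u: "h1 a b u g"
    unfolding h1_def
  proof (intro conjI g(1) ballI)
    fix x assume x: "x \<in> {a..b}"
    \<comment> \<open>Pairing with this indicator is integration from \<open>a\<close> to
      \<open>x\<close>, which makes that integral continuous in the norm.\<close>
    define I :: "real \<Rightarrow> complex" where "I = indicator {a<..<x}"
    have I: "I \<in> L2 \<mu>"
    proof (rule L2_I[where g = "\<lambda>_. 1"])
      show "I \<in> borel_measurable \<mu>" unfolding I_def by (intro borel_measurable_Leb) simp
      show "integrable \<mu> (\<lambda>_. 1 :: real)" by (intro continuous_integrable_Leb continuous_intros)
    qed (auto simp: indicator_def I_def)
    have inner: "l2_inner \<mu> I k = integral {a..x} k" if "k \<in> L2 \<mu>" for k
    proof -
      have "cnj (I t) * k t = indicator {a<..<x} t *\<^sub>R k t" for t by (simp add: I_def indicator_def)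
      then show ?thesis
        using integral_subinterval(2)[OF L2_imp_integrable_Leb[OF that], of a x] x by (simp add: l2_inner_def)
    qed
    have "(\<lambda>N. l2_inner \<mu> I (dsum c N)) \<longlonglongrightarrow> l2_inner \<mu> I g"
      by (rule l2_inner_tendsto[OF L2s(2) g I])
    moreover have "l2_inner \<mu> I (dsum c N) = fsum c N x - fsum c N a" for N
      using inner[OF L2s(2)] h1_increment[OF Vp_h1[OF fsum_Vp], of a x c N] x by simp
    moreover have "(\<lambda>N. fsum c N x - fsum c N a) \<longlonglongrightarrow> u x - u a"
      using ab x by (intro tendsto_diff lim) auto
    ultimately have "l2_inner \<mu> I g = u x - u a" using LIMSEQ_unique by (simp only:) blast
    then have 1: "integral {a..x} g = u x - u a" using inner[OF g(1)] by simp
    have "g integrable_on {a..x}"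
    proof -
      have "g absolutely_integrable_on {a..b}" using L2_imp_integrable_Leb[OF g(1)] by (simp add: integrable_Leb_iff)
      then have "g integrable_on {a..b}" by (rule set_lebesgue_integral_eq_integral(1))
      then show ?thesis by (rule integrable_on_subinterval) (use x in auto)
    qed
    then show "(g has_integral u x - u a) {a..x}" using 1 by (metis integrable_integral)
  qed
  have Vu: "Vp u g"
    unfolding Vp_def
  proof (intro conjI h1u impI)
    have "fsum c N a = 0" if DA for N using fsum_Vp[of c N] that by (simp add: Vp_def)
    then show "u a = 0" if DA using lim[of a] ab that by (simp add: LIMSEQ_const_iff)
    have "fsum c N b = 0" if DB for N using fsum_Vp[of c N] that by (simp add: Vp_def)
    then show "u b = 0" if DB using lim[of b] ab that by (simp add: LIMSEQ_const_iff)
  qed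
  have uL2: "u \<in> L2 \<mu>" using Vp_L2[OF Vu] by blast
  have "(\<lambda>N. l2_norm \<mu> (\<lambda>x. fsum c N x - u x)) \<longlonglongrightarrow> 0"
  proof (rule LIMSEQ_I)
    fix e :: real assume e: "0 < e"
    define d where "d = e / (2 * sqrt len)"
    have d: "0 < d" using e len_pos by (simp add: d_def)
    obtain N where N: "\<And>n x. N \<le> n \<Longrightarrow> x \<in> {a..b} \<Longrightarrow> dist (fsum c n x) (u x) < d" using u[OF d] by blast
    have "norm (l2_norm \<mu> (\<lambda>x. fsum c n x - u x) - 0) < e" if n: "N \<le> n" for n
    proof -
      have m: "(\<lambda>x. fsum c n x - u x) \<in> borel_measurable \<mu>" using L2_diff[OF L2s(1) uL2] by (rule L2_measurable)
      have ae: "AE x in \<mu>. cmod (fsum c n x - u x) \<le> d"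
        using AE_Leb_in
      proof eventually_elim
        case (elim x)
        then show ?case using N[OF n, of x] by (simp add: dist_norm)
      qed
      have "l2_norm \<mu> (\<lambda>x. (fsum c n x - u x) * 1) \<le> d * l2_norm \<mu> (\<lambda>_. 1)"
        by (rule l2_norm_bounded_mult[OF L2_const m ae]) (use d in simp)
      also have "\<dots> = d * sqrt len" using ab by (simp add: l2_norm_one len_def)
      also have "\<dots> < e" using e len_pos by (simp add: d_def)
      finally show ?thesis using l2_norm_nonneg[of \<mu>] by simp
    qed
    then show "\<exists>N. \<forall>n\<ge>N. norm (l2_norm \<mu> (\<lambda>x. fsum c n x - u x) - 0) < e" by blast
  qed
  then have "l2_inner \<mu> (phi n) u = c n" for n
    unfolding fsum_def by (rule phi.coefficients_of_limit[OF uL2])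
  then have "AE x in \<mu>. f x = u x"
    by (intro phi.equal_coefficients f uL2) (simp add: c)
  then show ?thesis using that Vu g(2) by blast
qed

lemma Vp_weights:
  assumes "Vp u g"
  shows "(\<lambda>n. (cmod (of_real (kap n) * l2_inner \<mu> (phi n) u))\<^sup>2) summable_on UNIV"
  using psi.Bessel_summable(1)[OF Vp_L2(2)[OF assms]] by (simp only: Vp_coeff[OF assms])

text \<open>For the function rebuilt from the coefficients of \<open>u\<close>, the differentiated
  series converges by construction; that function agrees with \<open>u\<close> on the interval,
  hence so do the derivatives almost everywhere.\<close>

lemma Vp_expansion:
  assumes v: "Vp u g" and c: "\<And>n. c n = l2_inner \<mu> (phi n) u"
  shows "(\<lambda>N. l2_norm \<mu> (\<lambda>x. fsum c N x - u x)) \<longlonglongrightarrow> 0" "(\<lambda>N. l2_norm \<mu> (\<lambda>x. dsum c N x - g x)) \<longlonglongrightarrow> 0"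
proof -
  have uL2: "u \<in> L2 \<mu>" using Vp_L2[OF v] by blast
  show "(\<lambda>N. l2_norm \<mu> (\<lambda>x. fsum c N x - u x)) \<longlonglongrightarrow> 0"
    using phi.expansion[OF uL2] unfolding fsum_def c phi.coord_U[OF uL2] .
  have w: "(\<lambda>n. (cmod (of_real (kap n) * c n))\<^sup>2) summable_on UNIV" using Vp_weights[OF v] by (simp add: c)
  obtain u' g' where u': "Vp u' g'" "AE x in \<mu>. u x = u' x" "(\<lambda>N. l2_norm \<mu> (\<lambda>x. dsum c N x - g' x)) \<longlonglongrightarrow> 0"
    by (rule Vp_converse[OF uL2 c w])
  have eq: "u x = u' x" if "x \<in> {a..b}" for x
    using continuous_AE_eq[OF ab h1_continuous[OF ab Vp_h1[OF v]] h1_continuous[OF ab Vp_h1[OF u'(1)]] u'(2) that] .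
  have gg: "AE x in \<mu>. g' x = g x"
    using h1_derivative[OF ab Vp_h1[OF v]] h1_derivative[OF ab Vp_h1[OF u'(1)]] AE_Leb_in
  proof eventually_elim
    case (elim x)
    have "(u' has_vector_derivative g x) (at x)"
      by (rule has_vector_derivative_transform_within_open[OF elim(1), of "{a<..<b}"]) (use elim(3) eq in auto)
    then show ?case using elim(2) vector_derivative_unique_at by blast
  qed
  have "l2_norm \<mu> (\<lambda>x. dsum c N x - g' x) = l2_norm \<mu> (\<lambda>x. dsum c N x - g x)" for N
  proof -
    have d: "dsum c N \<in> L2 \<mu>" using Vp_L2[OF fsum_Vp] by blast
    have "AE x in \<mu>. (cmod (dsum c N x - g' x))\<^sup>2 = (cmod (dsum c N x - g x))\<^sup>2"
      using gg by eventually_elim simp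
    then show ?thesis
      unfolding l2_norm_def
      using L2_integrable[OF L2_diff[OF d Vp_L2(2)[OF v]]] L2_integrable[OF L2_diff[OF d Vp_L2(2)[OF u'(1)]]]
      by (intro arg_cong[of _ _ sqrt] integral_cong_AE borel_measurable_integrable)
  qed
  then show "(\<lambda>N. l2_norm \<mu> (\<lambda>x. dsum c N x - g x)) \<longlonglongrightarrow> 0" using u'(3) by simp
qed

end

section \<open>The Sturm--Liouville form\<close>

lemma bounded_mult_integral:
  fixes f w :: "'a \<Rightarrow> complex"
  assumes f: "integrable M f" and w: "w \<in> borel_measurable M" "AE x in M. cmod (w x) \<le> C"
  shows "integrable M (\<lambda>x. w x * f x)" "cmod (\<integral>x. w x * f x \<partial>M) \<le> C * (\<integral>x. cmod (f x) \<partial>M)"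
proof -
  have ae: "AE x in M. cmod (w x * f x) \<le> C * cmod (f x)"
    using w(2) by eventually_elim (simp add: norm_mult mult_right_mono)
  have C: "integrable M (\<lambda>x. C * cmod (f x))" using f by simp
  show i: "integrable M (\<lambda>x. w x * f x)"
  proof (rule Bochner_Integration.integrable_bound[OF C])
    show "(\<lambda>x. w x * f x) \<in> borel_measurable M" using f w(1) by measurable
    show "AE x in M. cmod (w x * f x) \<le> norm (C * cmod (f x))"
      using ae by eventually_elim simp
  qed
  have "cmod (\<integral>x. w x * f x \<partial>M) \<le> (\<integral>x. cmod (w x * f x) \<partial>M)" by (rule integral_norm_bound)
  also have "\<dots> \<le> (\<integral>x. C * cmod (f x) \<partial>M)" using i C ae by (intro integral_mono_AE) auto
  finally show "cmod (\<integral>x. w x * f x \<partial>M) \<le> C * (\<integral>x. cmod (f x) \<partial>M)" by simp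
qed

text \<open>Each term is at most 2 / (n d + e)^2, hence at most 2 / (x (x + d)) with x = n d + e -
  d, which telescopes. What matters is that the bound tends to 0 as \<open>e\<close> grows.\<close>

lemma sum_inverse_square_le:
  fixes d e :: real
  assumes d: "0 < d" and e: "d < e"
  shows "(\<Sum>n<M. 1 / ((real n * d)\<^sup>2 + e\<^sup>2)) \<le> 2 / d * (1 / (e - d))"
proof -
  have "(\<Sum>n<M. 1 / ((real n * d)\<^sup>2 + e\<^sup>2)) \<le> 2 / d * (1 / (e - d) - 1 / (real M * d + (e - d)))"
  proof (induction M)
    case (Suc M)
    define x where "x = real M * d + (e - d)"
    have x: "0 < x" using d e by (simp add: x_def add_nonneg_pos)
    have xd: "real M * d + e = x + d" by (simp add: x_def)
    have "x * (x + d) \<le> (x + d) * (x + d)" using x d by (intro mult_right_mono) auto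
    then have "x * (x + d) \<le> (real M * d + e)\<^sup>2" by (simp only: xd power2_eq_square)
    also have "\<dots> \<le> 2 * ((real M * d)\<^sup>2 + e\<^sup>2)"
      using zero_le_power2[of "real M * d - e"] by (simp add: power2_eq_square algebra_simps)
    finally have le: "x * (x + d) \<le> 2 * ((real M * d)\<^sup>2 + e\<^sup>2)" .
    have "1 / ((real M * d)\<^sup>2 + e\<^sup>2) \<le> 2 / (x * (x + d))"
    proof -
      define y where "y = x * (x + d)"
      define z where "z = (real M * d)\<^sup>2 + e\<^sup>2"
      have "0 < y" "y \<le> 2 * z" using le x d by (simp_all only: y_def z_def) simp
      then have "1 / z \<le> 2 / y" by (simp add: field_simps)
      then show ?thesis by (simp only: y_def z_def)
    qed
    also have "\<dots> = 2 / d * (1 / x - 1 / (x + d))" using x d by (simp add: field_simps)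
    finally have "(\<Sum>n<Suc M. 1 / ((real n * d)\<^sup>2 + e\<^sup>2))
        \<le> 2 / d * (1 / (e - d) - 1 / x) + 2 / d * (1 / x - 1 / (x + d))"
      using Suc by (simp add: x_def)
    also have "\<dots> = 2 / d * (1 / (e - d) - 1 / (x + d))" by (simp add: algebra_simps)
    also have "x + d = real (Suc M) * d + (e - d)" by (simp add: x_def algebra_simps)
    finally show ?case .
  qed simp
  also have "\<dots> \<le> 2 / d * (1 / (e - d))"
    using d e by (intro mult_left_mono) auto
  finally show ?thesis .
qed

text \<open>\<open>ca\<close> and \<open>cb\<close> stand for the cotangents, with 0 in place of an
  omitted boundary term.\<close>

locale sl_coefficients = interval_bc a b da db for a b da db +
  fixes q r s :: "real \<Rightarrow> complex" and ca cb :: complex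
  assumes q: "integrable (Leb a b) q" and r: "r \<in> L2 (Leb a b)" and s: "s \<in> L2 (Leb a b)"
begin

definition B :: "(real \<Rightarrow> complex) \<Rightarrow> (real \<Rightarrow> complex) \<Rightarrow> (real \<Rightarrow> complex) \<Rightarrow> (real \<Rightarrow> complex) \<Rightarrow> complex" where
  "B u g v k = (\<integral>x. cnj (g x) * k x + cnj (u x) * r x * k x + cnj (g x) * s x * v x + cnj (u x) * q x * v x \<partial>\<mu>)
     - ca * cnj (u a) * v a - cb * cnj (u b) * v b"

definition K0 :: real where "K0 = 1 / sqrt len + sqrt len"

lemma K0_pos: "0 < K0" using len_pos by (simp add: K0_def add_pos_pos)

lemma h1_measurable:
  assumes "h1 a b u g"
  shows "u \<in> borel_measurable \<mu>" "g \<in> borel_measurable \<mu>"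
  using h1_fun_L2[OF ab assms] h1_L2[OF assms] L2_measurable by blast+

lemma h1_AE_bound:
  assumes "h1 a b u g"
  shows "AE x in \<mu>. cmod (u x) \<le> K0 * (l2_norm \<mu> u + l2_norm \<mu> g)"
  using AE_Leb_in
proof eventually_elim
  case (elim x)
  then show ?case using sup_bound[OF assms, of x] by (simp add: K0_def)
qed

lemma B_terms:
  assumes u: "h1 a b u g" and v: "h1 a b v k"
  defines "A \<equiv> l2_norm \<mu> u + l2_norm \<mu> g" and "D \<equiv> l2_norm \<mu> v + l2_norm \<mu> k"
  shows "integrable \<mu> (\<lambda>x. cnj (g x) * k x)" "integrable \<mu> (\<lambda>x. cnj (u x) * r x * k x)"
    "integrable \<mu> (\<lambda>x. cnj (g x) * s x * v x)" "integrable \<mu> (\<lambda>x. cnj (u x) * q x * v x)"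
    "cmod (\<integral>x. cnj (u x) * r x * k x \<partial>\<mu>) \<le> K0 * A * (l2_norm \<mu> r * l2_norm \<mu> k)"
    "cmod (\<integral>x. cnj (g x) * s x * v x \<partial>\<mu>) \<le> K0 * D * (l2_norm \<mu> g * l2_norm \<mu> s)"
    "cmod (\<integral>x. cnj (u x) * q x * v x \<partial>\<mu>) \<le> K0 * A * (K0 * D) * (\<integral>x. cmod (q x) \<partial>\<mu>)"
proof -
  note mu = h1_measurable[OF u] and mv = h1_measurable[OF v]
  note L = h1_L2[OF u] h1_L2[OF v]
  have KA: "0 \<le> K0 * A" using K0_pos l2_norm_nonneg[of \<mu> u] l2_norm_nonneg[of \<mu> g] by (simp add: A_def)
  have bu: "AE x in \<mu>. cmod (u x) \<le> K0 * A" and bv: "AE x in \<mu>. cmod (v x) \<le> K0 * D"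
    using h1_AE_bound[OF u] h1_AE_bound[OF v] by (simp_all add: A_def D_def)
  have bcu: "AE x in \<mu>. cmod (cnj (u x)) \<le> K0 * A" using bu by simp
  have buv: "AE x in \<mu>. cmod (cnj (u x) * v x) \<le> K0 * A * (K0 * D)"
    using bu bv
  proof eventually_elim
    case (elim x)
    then show ?case using KA by (simp add: norm_mult mult_mono)
  qed
  show "integrable \<mu> (\<lambda>x. cnj (g x) * k x)" by (rule L2_inner_integrable[OF L])
  have rk: "integrable \<mu> (\<lambda>x. r x * k x)" by (rule L2_mult_integrable[OF r L(2)])
  have gs: "integrable \<mu> (\<lambda>x. cnj (g x) * s x)" by (rule L2_inner_integrable[OF L(1) s])
  have mcu: "(\<lambda>x. cnj (u x)) \<in> borel_measurable \<mu>" "(\<lambda>x. cnj (u x) * v x) \<in> borel_measurable \<mu>"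
    using mu mv by measurable
  note 1 = bounded_mult_integral[OF rk mcu(1) bcu]
  note 2 = bounded_mult_integral[OF gs mv(1) bv]
  note 3 = bounded_mult_integral[OF q mcu(2) buv]
  have e: "cnj (u x) * r x * k x = cnj (u x) * (r x * k x)" "cnj (g x) * s x * v x = v x * (cnj (g x) * s x)"
    "cnj (u x) * q x * v x = (cnj (u x) * v x) * q x" for x by simp_all
  show "integrable \<mu> (\<lambda>x. cnj (u x) * r x * k x)" "integrable \<mu> (\<lambda>x. cnj (g x) * s x * v x)"
    "integrable \<mu> (\<lambda>x. cnj (u x) * q x * v x)"
    unfolding e by (fact 1(1) 2(1) 3(1))+
  have KC: "0 \<le> K0 * D" using K0_pos l2_norm_nonneg[of \<mu> v] l2_norm_nonneg[of \<mu> k] by (simp add: D_def)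
  show "cmod (\<integral>x. cnj (u x) * r x * k x \<partial>\<mu>) \<le> K0 * A * (l2_norm \<mu> r * l2_norm \<mu> k)"
    unfolding e using order_trans[OF 1(2) mult_left_mono[OF integral_abs_mult_le[OF r L(2)] KA]] .
  have "(\<integral>x. cmod (cnj (g x) * s x) \<partial>\<mu>) \<le> l2_norm \<mu> (\<lambda>x. cnj (g x)) * l2_norm \<mu> s"
    by (rule integral_abs_mult_le[OF L2_cnj[OF L(1)] s])
  also have "l2_norm \<mu> (\<lambda>x. cnj (g x)) = l2_norm \<mu> g" by (simp add: l2_norm_def)
  finally show "cmod (\<integral>x. cnj (g x) * s x * v x \<partial>\<mu>) \<le> K0 * D * (l2_norm \<mu> g * l2_norm \<mu> s)"
    unfolding e using order_trans[OF 2(2) mult_left_mono[OF _ KC]] by blast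
  show "cmod (\<integral>x. cnj (u x) * q x * v x \<partial>\<mu>) \<le> K0 * A * (K0 * D) * (\<integral>x. cmod (q x) \<partial>\<mu>)"
    unfolding e by (fact 3(2))
qed

lemma B_split:
  assumes u: "h1 a b u g" and v: "h1 a b v k"
  shows "B u g v k = l2_inner \<mu> g k + (\<integral>x. cnj (u x) * r x * k x \<partial>\<mu>) + (\<integral>x. cnj (g x) * s x * v x \<partial>\<mu>)
    + (\<integral>x. cnj (u x) * q x * v x \<partial>\<mu>) - ca * cnj (u a) * v a - cb * cnj (u b) * v b"
  unfolding B_def l2_inner_def using B_terms(1-4)[OF u v] by simp

lemma B_integrable:
  assumes "h1 a b u g" "h1 a b v k"
  shows "integrable \<mu> (\<lambda>x. cnj (g x) * k x + cnj (u x) * r x * k x + cnj (g x) * s x * v x + cnj (u x) * q x * v x)"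
  using B_terms(1-4)[OF assms] by simp

lemma B_lin_right:
  assumes u: "h1 a b u g" and v: "h1 a b v k" and w: "h1 a b w l"
  shows "B u g (\<lambda>x. v x + c * w x) (\<lambda>x. k x + c * l x) = B u g v k + c * B u g w l"
proof -
  let ?i = "\<lambda>v k x. cnj (g x) * k x + cnj (u x) * r x * k x + cnj (g x) * s x * v x + cnj (u x) * q x * v x"
  have "?i (\<lambda>x. v x + c * w x) (\<lambda>x. k x + c * l x) x = ?i v k x + c * ?i w l x" for x by (simp add: algebra_simps)
  then have "(\<integral>x. ?i (\<lambda>x. v x + c * w x) (\<lambda>x. k x + c * l x) x \<partial>\<mu>) = (\<integral>x. ?i v k x \<partial>\<mu>) + c * (\<integral>x. ?i w l x \<partial>\<mu>)"
    using B_integrable[OF u v] B_integrable[OF u w] by simp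
  then show ?thesis unfolding B_def by (simp only:) (simp add: algebra_simps)
qed

lemma B_lin_left:
  assumes u: "h1 a b u g" and v: "h1 a b v k" and w: "h1 a b w l"
  shows "B (\<lambda>x. v x + c * w x) (\<lambda>x. k x + c * l x) u g = B v k u g + cnj c * B w l u g"
proof -
  let ?i = "\<lambda>v k x. cnj (k x) * g x + cnj (v x) * r x * g x + cnj (k x) * s x * u x + cnj (v x) * q x * u x"
  have "?i (\<lambda>x. v x + c * w x) (\<lambda>x. k x + c * l x) x = ?i v k x + cnj c * ?i w l x" for x by (simp add: algebra_simps)
  then have "(\<integral>x. ?i (\<lambda>x. v x + c * w x) (\<lambda>x. k x + c * l x) x \<partial>\<mu>) = (\<integral>x. ?i v k x \<partial>\<mu>) + cnj c * (\<integral>x. ?i w l x \<partial>\<mu>)"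
    using B_integrable[OF v u] B_integrable[OF w u] by simp
  then show ?thesis unfolding B_def by (simp only:) (simp add: algebra_simps)
qed

definition KB :: real where
  "KB = 1 + K0 * l2_norm \<mu> r + K0 * l2_norm \<mu> s + K0 * K0 * (\<integral>x. cmod (q x) \<partial>\<mu>) + K0 * K0 * cmod ca + K0 * K0 * cmod cb"

text \<open>Continuity in the Sobolev norm, by the sup bound; it serves to pass from partial sums of
  the expansions to their limits.\<close>

lemma B_bound:
  assumes u: "h1 a b u g" and v: "h1 a b v k"
  shows "cmod (B u g v k) \<le> KB * (l2_norm \<mu> u + l2_norm \<mu> g) * (l2_norm \<mu> v + l2_norm \<mu> k)"
proof -
  define A where "A = l2_norm \<mu> u + l2_norm \<mu> g"
  define D where "D = l2_norm \<mu> v + l2_norm \<mu> k"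
  have g: "0 \<le> l2_norm \<mu> g" "l2_norm \<mu> g \<le> A" and k: "0 \<le> l2_norm \<mu> k" "l2_norm \<mu> k \<le> D"
    using l2_norm_nonneg[of \<mu>] by (simp_all add: A_def D_def)
  have A: "0 \<le> A" and D: "0 \<le> D" using g k by linarith+
  have nr: "0 \<le> l2_norm \<mu> r" "0 \<le> l2_norm \<mu> s" by (simp_all add: l2_norm_nonneg)
  note T = B_terms(5-7)[OF u v, folded A_def D_def]
  have 0: "cmod (l2_inner \<mu> g k) \<le> A * D"
    using order_trans[OF cmod_l2_inner_le[OF h1_L2[OF u] h1_L2[OF v]] mult_mono[OF g(2) k(2) A k(1)]] .
  have 1: "cmod (\<integral>x. cnj (u x) * r x * k x \<partial>\<mu>) \<le> K0 * A * (l2_norm \<mu> r * D)"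
    using order_trans[OF T(1) mult_left_mono[OF mult_left_mono[OF k(2) nr(1)]]] K0_pos A by simp
  have 2: "cmod (\<integral>x. cnj (g x) * s x * v x \<partial>\<mu>) \<le> K0 * D * (A * l2_norm \<mu> s)"
    using order_trans[OF T(2) mult_left_mono[OF mult_right_mono[OF g(2) nr(2)]]] K0_pos D by simp
  have bc: "cmod (c * cnj (u x) * v x) \<le> K0 * K0 * cmod c * (A * D)" if x: "x \<in> {a..b}" for c x
  proof -
    have "cmod (u x) * cmod (v x) \<le> (K0 * A) * (K0 * D)"
      using sup_bound[OF u x] sup_bound[OF v x] K0_pos A by (intro mult_mono) (auto simp: K0_def A_def D_def)
    then have "cmod c * (cmod (u x) * cmod (v x)) \<le> cmod c * ((K0 * A) * (K0 * D))" by (rule mult_left_mono) simp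
    then show ?thesis by (simp add: norm_mult algebra_simps)
  qed
  have aa: "a \<in> {a..b}" "b \<in> {a..b}" using ab by auto
  have tri: "cmod (x0 + x1 + x2 + x3 - x4 - x5) \<le> cmod x0 + cmod x1 + cmod x2 + cmod x3 + cmod x4 + cmod x5" for x0 x1 x2 x3 x4 x5
    by (intro order_trans[OF norm_triangle_ineq4] order_trans[OF norm_triangle_ineq] add_mono order_refl)
  have "cmod (B u g v k) \<le> A * D + K0 * A * (l2_norm \<mu> r * D) + K0 * D * (A * l2_norm \<mu> s)
      + K0 * A * (K0 * D) * (\<integral>x. cmod (q x) \<partial>\<mu>) + K0 * K0 * cmod ca * (A * D) + K0 * K0 * cmod cb * (A * D)"
    unfolding B_split[OF u v] by (rule order_trans[OF tri]) (intro add_mono 0 1 2 T(3) bc aa)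
  also have "\<dots> = KB * A * D" by (simp add: KB_def algebra_simps)
  finally show ?thesis by (simp add: A_def D_def)
qed

lemma B_tendsto_right:
  assumes u: "h1 a b u g" and v: "\<And>n. h1 a b (v n) (k n)" "h1 a b w l"
    and lim: "(\<lambda>n. l2_norm \<mu> (\<lambda>x. v n x - w x)) \<longlonglongrightarrow> 0" "(\<lambda>n. l2_norm \<mu> (\<lambda>x. k n x - l x)) \<longlonglongrightarrow> 0"
  shows "(\<lambda>n. B u g (v n) (k n)) \<longlonglongrightarrow> B u g w l"
proof (rule LIM_zero_cancel, rule Lim_null_comparison)
  define A where "A = l2_norm \<mu> u + l2_norm \<mu> g"
  have "norm (B u g (v n) (k n) - B u g w l) \<le> KB * A * (l2_norm \<mu> (\<lambda>x. v n x - w x) + l2_norm \<mu> (\<lambda>x. k n x - l x))" for n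
    using B_bound[OF u h1_lin[OF v(1)[of n] v(2), of "-1"]] B_lin_right[OF u v(1)[of n] v(2), of "-1"] by (simp add: A_def)
  then show "\<forall>\<^sub>F n in sequentially. norm (B u g (v n) (k n) - B u g w l)
      \<le> KB * A * (l2_norm \<mu> (\<lambda>x. v n x - w x) + l2_norm \<mu> (\<lambda>x. k n x - l x))" by simp
  show "(\<lambda>n. KB * A * (l2_norm \<mu> (\<lambda>x. v n x - w x) + l2_norm \<mu> (\<lambda>x. k n x - l x))) \<longlonglongrightarrow> 0"
    using tendsto_mult_left[OF tendsto_add[OF lim], of "KB * A"] by simp
qed

lemma B_tendsto_left:
  assumes u: "h1 a b u g" and v: "\<And>n. h1 a b (v n) (k n)" "h1 a b w l"
    and lim: "(\<lambda>n. l2_norm \<mu> (\<lambda>x. v n x - w x)) \<longlonglongrightarrow> 0" "(\<lambda>n. l2_norm \<mu> (\<lambda>x. k n x - l x)) \<longlonglongrightarrow> 0"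
  shows "(\<lambda>n. B (v n) (k n) u g) \<longlonglongrightarrow> B w l u g"
proof (rule LIM_zero_cancel, rule Lim_null_comparison)
  define A where "A = l2_norm \<mu> u + l2_norm \<mu> g"
  have "norm (B (v n) (k n) u g - B w l u g) \<le> KB * A * (l2_norm \<mu> (\<lambda>x. v n x - w x) + l2_norm \<mu> (\<lambda>x. k n x - l x))" for n
    using B_bound[OF h1_lin[OF v(1)[of n] v(2), of "-1"] u] B_lin_left[OF u v(1)[of n] v(2), of "-1"]
    by (simp add: A_def mult.commute mult.left_commute)
  then show "\<forall>\<^sub>F n in sequentially. norm (B (v n) (k n) u g - B w l u g)
      \<le> KB * A * (l2_norm \<mu> (\<lambda>x. v n x - w x) + l2_norm \<mu> (\<lambda>x. k n x - l x))" by simp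
  show "(\<lambda>n. KB * A * (l2_norm \<mu> (\<lambda>x. v n x - w x) + l2_norm \<mu> (\<lambda>x. k n x - l x))) \<longlonglongrightarrow> 0"
    using tendsto_mult_left[OF tendsto_add[OF lim], of "KB * A"] by simp
qed

text \<open>\<open>R m n\<close> and \<open>S m n\<close> are \<open>psi\<close>-coefficients of
  \<open>r\<close> and \<open>s\<close> times a uniformly bounded function, the frequency of the
  differentiated factor being taken out. Bessel's inequality bounds the rows of \<open>R\<close> and
  the columns of \<open>S\<close> uniformly, whereas \<open>Q\<close> merely has bounded
  entries.\<close>

definition R :: "nat \<Rightarrow> nat \<Rightarrow> complex" where "R m n = l2_inner \<mu> (psi n) (\<lambda>x. phi m x * r x)"
definition S :: "nat \<Rightarrow> nat \<Rightarrow> complex" where "S m n = l2_inner \<mu> (psi m) (\<lambda>x. phi n x * s x)"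
definition Q :: "nat \<Rightarrow> nat \<Rightarrow> complex" where
  "Q m n = (\<integral>x. (phi m x * phi n x) * q x \<partial>\<mu>) - ca * (phi m a * phi n a) - cb * (phi m b * phi n b)"
definition P :: "nat \<Rightarrow> nat \<Rightarrow> complex" where
  "P m n = of_real (kap n) * R m n + of_real (kap m) * S m n + Q m n"

lemma B_basis:
  "B (phi m) (\<lambda>x. of_real (kap m) * psi m x) (phi n) (\<lambda>x. of_real (kap n) * psi n x)
    = (if m = n then of_real ((kap m)\<^sup>2) else 0) + P m n"
proof -
  have "l2_inner \<mu> (\<lambda>x. of_real (kap m) * psi m x) (\<lambda>x. of_real (kap n) * psi n x)
      = (if m = n then of_real ((kap m)\<^sup>2 * nu m) else 0)"
    by (simp add: l2_inner_cmult_left l2_inner_cmult_right psi_orthogonal power2_eq_square)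
  \<comment> \<open>\<open>nu m\<close> differs from 1 only where \<open>kap m\<close> is 0.\<close>
  also have "(kap m)\<^sup>2 * nu m = (kap m)\<^sup>2" by (simp add: nu_def kap_def)
  finally have 0: "l2_inner \<mu> (\<lambda>x. of_real (kap m) * psi m x) (\<lambda>x. of_real (kap n) * psi n x)
      = (if m = n then of_real ((kap m)\<^sup>2) else 0)" .
  have "cnj (phi m x) * r x * (of_real (kap n) * psi n x) = of_real (kap n) * (cnj (psi n x) * (phi m x * r x))" for x by simp
  then have 1: "(\<integral>x. cnj (phi m x) * r x * (of_real (kap n) * psi n x) \<partial>\<mu>) = of_real (kap n) * R m n"
    by (simp only: R_def l2_inner_def integral_mult_right_zero)
  have "cnj (of_real (kap m) * psi m x) * s x * phi n x = of_real (kap m) * (cnj (psi m x) * (phi n x * s x))" for x by simp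
  then have 2: "(\<integral>x. cnj (of_real (kap m) * psi m x) * s x * phi n x \<partial>\<mu>) = of_real (kap m) * S m n"
    by (simp only: S_def l2_inner_def integral_mult_right_zero)
  have "cnj (phi m x) * q x * phi n x = phi m x * phi n x * q x" for x by simp
  then have 3: "(\<integral>x. cnj (phi m x) * q x * phi n x \<partial>\<mu>) = (\<integral>x. phi m x * phi n x * q x \<partial>\<mu>)"
    by (simp only:)
  show ?thesis
    unfolding B_split[OF Vp_h1[OF phi_Vp] Vp_h1[OF phi_Vp]] 0 1 2 3 by (simp add: P_def Q_def algebra_simps)
qed

definition KQ :: real where "KQ = bnd * bnd * ((\<integral>x. cmod (q x) \<partial>\<mu>) + cmod ca + cmod cb)"

lemma phi_phi_le: "cmod (phi m x * phi n x) \<le> bnd * bnd"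
  unfolding norm_mult by (intro mult_mono phi_le bnd_nonneg) simp

lemma phi_measurable: "phi m \<in> borel_measurable \<mu>"
  by (rule L2_measurable[OF phi_L2])

lemma Q_le: "cmod (Q m n) \<le> KQ"
proof -
  have ae: "AE x in \<mu>. cmod (phi m x * phi n x) \<le> bnd * bnd" by (simp only: phi_phi_le) simp
  have me: "(\<lambda>x. phi m x * phi n x) \<in> borel_measurable \<mu>" using phi_measurable by measurable
  have c: "cmod (c * (phi m x * phi n x)) \<le> bnd * bnd * cmod c" for c x
    using mult_right_mono[OF phi_phi_le[of m x n], of "cmod c"] by (simp add: norm_mult mult.commute)
  have "cmod (Q m n) \<le> cmod (\<integral>x. (phi m x * phi n x) * q x \<partial>\<mu>) + cmod (ca * (phi m a * phi n a)) + cmod (cb * (phi m b * phi n b))"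
    unfolding Q_def by (intro order_trans[OF norm_triangle_ineq4] add_mono order_refl)
  also have "\<dots> \<le> bnd * bnd * (\<integral>x. cmod (q x) \<partial>\<mu>) + bnd * bnd * cmod ca + bnd * bnd * cmod cb"
    by (intro add_mono bounded_mult_integral(2)[OF q me ae] c)
  finally show ?thesis by (simp add: KQ_def algebra_simps)
qed

lemma R_sum_le: "(\<Sum>n<M. (cmod (R m n))\<^sup>2) \<le> (bnd * l2_norm \<mu> r)\<^sup>2"
  and S_sum_le: "(\<Sum>m<M. (cmod (S m n))\<^sup>2) \<le> (bnd * l2_norm \<mu> s)\<^sup>2"
proof -
  have *: "(\<Sum>n<M. (cmod (l2_inner \<mu> (psi n) (\<lambda>x. phi m x * f x)))\<^sup>2) \<le> (bnd * l2_norm \<mu> f)\<^sup>2" if f: "f \<in> L2 \<mu>" for f m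
  proof -
    have ae: "AE x in \<mu>. cmod (phi m x) \<le> bnd" by (simp only: phi_le) simp
    have "(\<Sum>n<M. (cmod (l2_inner \<mu> (psi n) (\<lambda>x. phi m x * f x)))\<^sup>2) \<le> (l2_norm \<mu> (\<lambda>x. phi m x * f x))\<^sup>2"
      by (rule psi.Bessel[OF L2_bounded_mult[OF f phi_measurable ae]]) simp
    also have "\<dots> \<le> (bnd * l2_norm \<mu> f)\<^sup>2"
      by (intro power_mono l2_norm_bounded_mult[OF f phi_measurable ae] bnd_nonneg l2_norm_nonneg)
    finally show ?thesis .
  qed
  show "(\<Sum>n<M. (cmod (R m n))\<^sup>2) \<le> (bnd * l2_norm \<mu> r)\<^sup>2" unfolding R_def by (rule *[OF r])
  show "(\<Sum>m<M. (cmod (S m n))\<^sup>2) \<le> (bnd * l2_norm \<mu> s)\<^sup>2" unfolding S_def by (rule *[OF s])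
qed

end

section \<open>Smallness of the perturbation for large shifts\<close>

lemma ell2_finite_square_sums:
  fixes x :: "nat \<times> nat \<Rightarrow> complex"
  assumes le: "\<And>M. (\<Sum>m<M. \<Sum>n<M. (cmod (x (m, n)))\<^sup>2) \<le> C\<^sup>2" and C: "0 \<le> C"
  shows "coord (Ell2 x) = x" "norm (Ell2 x) \<le> C"
proof -
  have fin: "(\<Sum>p\<in>F. (cmod (x p))\<^sup>2) \<le> C\<^sup>2" if F: "finite F" for F
  proof -
    obtain M where M: "\<And>k. k \<in> fst ` F \<union> snd ` F \<Longrightarrow> k < M"
      using finite_nat_set_iff_bounded[of "fst ` F \<union> snd ` F"] F by blast
    have "F \<subseteq> {..<M} \<times> {..<M}" using M by force
    then have "(\<Sum>p\<in>F. (cmod (x p))\<^sup>2) \<le> (\<Sum>p\<in>{..<M} \<times> {..<M}. (cmod (x p))\<^sup>2)"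
      by (intro sum_mono2) auto
    also have "\<dots> = (\<Sum>m<M. \<Sum>n<M. (cmod (x (m, n)))\<^sup>2)" by (simp add: sum.cartesian_product case_prod_unfold)
    finally show ?thesis using le[of M] by simp
  qed
  have sm: "(\<lambda>p. (cmod (x p))\<^sup>2) summable_on UNIV"
    by (rule nonneg_bdd_above_summable_on) (auto simp: bdd_above_def intro!: exI[of _ "C\<^sup>2"] fin)
  show c: "coord (Ell2 x) = x" by (rule coord_Ell2[OF sm])
  have "(\<Sum>\<^sub>\<infinity>p. (cmod (x p))\<^sup>2) \<le> C\<^sup>2"
    by (rule infsum_le_finite_sums[OF sm]) (auto intro: fin)
  then show "norm (Ell2 x) \<le> C"
    using norm_ell2_le[of "Ell2 x" _ C] has_sum_infsum[OF sm] C by (simp add: c)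
qed

context sl_coefficients
begin

definition lam :: "real \<Rightarrow> nat \<Rightarrow> real" where "lam E n = sqrt ((kap n)\<^sup>2 + E)"

lemma lam_facts:
  assumes E: "1 \<le> E"
  shows "1 \<le> lam E n" "0 < lam E n" "kap n \<le> lam E n" "(lam E n)\<^sup>2 = (kap n)\<^sup>2 + E"
proof -
  have p: "0 \<le> (kap n)\<^sup>2" by simp
  have "1 \<le> (kap n)\<^sup>2 + E" using E p by linarith
  then show 1: "1 \<le> lam E n" by (simp add: lam_def)
  then show "0 < lam E n" by linarith
  show "kap n \<le> lam E n" unfolding lam_def using E by (intro real_le_rsqrt) simp
  show "(lam E n)\<^sup>2 = (kap n)\<^sup>2 + E" unfolding lam_def using E p by (intro real_sqrt_pow2) linarith
qed

text \<open>The bound of \<open>sum_inverse_square_le\<close> for spacing \<pi> / len and e = sqrt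
  E.\<close>

definition sig :: "real \<Rightarrow> real" where "sig E = 2 / (pi / len) * (1 / (sqrt E - pi / len))"

lemma sum_lam_le:
  assumes E: "1 \<le> E" "pi / len < sqrt E"
  shows "(\<Sum>n<M. 1 / (lam E n)\<^sup>2) \<le> sig E"
proof -
  have "(\<Sum>n<M. 1 / (lam E n)\<^sup>2) \<le> (\<Sum>n<M. 1 / ((real n * (pi / len))\<^sup>2 + (sqrt E)\<^sup>2))"
  proof (rule sum_mono)
    fix n
    have "(real n * (pi / len))\<^sup>2 \<le> (kap n)\<^sup>2" using kap_ge len_pos by (intro power_mono) auto
    then have "(real n * (pi / len))\<^sup>2 + (sqrt E)\<^sup>2 \<le> (lam E n)\<^sup>2" using E lam_facts(4)[OF E(1)] by simp
    moreover have "0 < (real n * (pi / len))\<^sup>2 + (sqrt E)\<^sup>2" using E by (intro add_nonneg_pos) auto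
    ultimately show "1 / (lam E n)\<^sup>2 \<le> 1 / ((real n * (pi / len))\<^sup>2 + (sqrt E)\<^sup>2)"
      by (intro divide_left_mono mult_pos_pos) auto
  qed
  also have "\<dots> \<le> sig E"
    unfolding sig_def using E len_pos by (intro sum_inverse_square_le) auto
  finally show ?thesis .
qed

lemma sig_tendsto: "(sig \<longlongrightarrow> 0) at_top"
proof -
  have "filterlim (\<lambda>E. - (pi / len) + sqrt E) at_top at_top"
    by (rule filterlim_tendsto_add_at_top[OF tendsto_const sqrt_at_top])
  then have "((\<lambda>E. inverse (- (pi / len) + sqrt E)) \<longlongrightarrow> 0) at_top" by (rule tendsto_inverse_0_at_top)
  from tendsto_mult_left[OF this, of "2 / (pi / len)"] show ?thesis
    by (simp add: sig_def[abs_def] inverse_eq_divide)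
qed

definition W0 :: "real \<Rightarrow> nat \<times> nat \<Rightarrow> complex" where
  "W0 E = (\<lambda>(m, n). P m n / of_real ((lam E m + lam E n) * min (lam E m) (lam E n)))"

definition HS :: "real \<Rightarrow> real" where
  "HS E = 3 * (sig E * (bnd * l2_norm \<mu> r)\<^sup>2 + sig E * (bnd * l2_norm \<mu> s)\<^sup>2 + KQ\<^sup>2 * (sig E * sig E))"

text \<open>By x y \<le> (x + y) min x y and kap \<le> lam, an entry is at most |R| / lam m + |S| /
  lam n + KQ / (lam m lam n): the summable weight falls on just the index over which Bessel's
  inequality does not sum. The factor 3 comes from squaring three terms.\<close>

lemma W0_le:
  assumes E: "1 \<le> E"
  shows "(cmod (W0 E (m, n)))\<^sup>2 \<le> 3 * ((cmod (R m n))\<^sup>2 * (1 / (lam E m)\<^sup>2) + (cmod (S m n))\<^sup>2 * (1 / (lam E n)\<^sup>2)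
    + KQ\<^sup>2 * (1 / (lam E m)\<^sup>2 * (1 / (lam E n)\<^sup>2)))"
proof -
  define x where "x = lam E m"
  define y where "y = lam E n"
  have pos: "0 < x" "0 < y" using lam_facts(2)[OF E] by (simp_all add: x_def y_def)
  have den: "x * y \<le> (x + y) * min x y"
  proof (cases "x \<le> y")
    case True
    then show ?thesis using pos by (simp add: min_def algebra_simps)
  next
    case False
    then show ?thesis using pos by (simp add: min_def algebra_simps)
  qed
  have k: "cmod (of_real (kap n)) \<le> y" "cmod (of_real (kap m)) \<le> x"
    using lam_facts(3)[OF E] kap_nonneg by (simp_all add: x_def y_def)
  define \<rho> where "\<rho> = cmod (R m n) / x"
  define \<tau> where "\<tau> = cmod (S m n) / y"
  define \<omega> where "\<omega> = KQ / (x * y)"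
  have "cmod (P m n) \<le> cmod (of_real (kap n) * R m n) + cmod (of_real (kap m) * S m n) + cmod (Q m n)"
    unfolding P_def by (intro order_trans[OF norm_triangle_ineq] add_mono order_refl)
  also have "\<dots> \<le> y * cmod (R m n) + x * cmod (S m n) + KQ"
    unfolding norm_mult by (intro add_mono mult_right_mono k Q_le norm_ge_zero)
  finally have Ple: "cmod (P m n) \<le> y * cmod (R m n) + x * cmod (S m n) + KQ" .
  have "cmod (W0 E (m, n)) = cmod (P m n) / ((x + y) * min x y)"
    using pos by (simp add: W0_def x_def[symmetric] y_def[symmetric] norm_divide abs_mult del: of_real_mult of_real_add)
  also have "\<dots> \<le> cmod (P m n) / (x * y)"
    by (rule divide_left_mono[OF den norm_ge_zero]) (use pos in \<open>simp add: min_def\<close>)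
  also have "\<dots> \<le> (y * cmod (R m n) + x * cmod (S m n) + KQ) / (x * y)"
    by (rule divide_right_mono[OF Ple]) (use pos in simp)
  also have "\<dots> = \<rho> + \<tau> + \<omega>" using pos by (simp add: \<rho>_def \<tau>_def \<omega>_def add_divide_distrib)
  finally have "(cmod (W0 E (m, n)))\<^sup>2 \<le> (\<rho> + \<tau> + \<omega>)\<^sup>2" by (intro power_mono) auto
  also have "\<dots> \<le> 3 * (\<rho>\<^sup>2 + \<tau>\<^sup>2 + \<omega>\<^sup>2)"
    using zero_le_power2[of "\<rho> - \<tau>"] zero_le_power2[of "\<rho> - \<omega>"] zero_le_power2[of "\<tau> - \<omega>"]
    by (simp add: power2_eq_square algebra_simps)
  also have "\<dots> = 3 * ((cmod (R m n))\<^sup>2 * (1 / x\<^sup>2) + (cmod (S m n))\<^sup>2 * (1 / y\<^sup>2) + KQ\<^sup>2 * (1 / x\<^sup>2 * (1 / y\<^sup>2)))"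
    by (simp add: \<rho>_def \<tau>_def \<omega>_def power_divide power_mult_distrib)
  finally show ?thesis by (simp only: x_def y_def)
qed

lemma W0_sum_le:
  assumes E: "1 \<le> E" "pi / len < sqrt E"
  shows "(\<Sum>m<M. \<Sum>n<M. (cmod (W0 E (m, n)))\<^sup>2) \<le> HS E"
proof -
  have sig0: "0 \<le> sig E" using sum_lam_le[OF E, of 0] by simp
  define i where "i n = 1 / (lam E n)\<^sup>2" for n
  have i0: "0 \<le> i n" for n by (simp add: i_def)
  have isum: "(\<Sum>n<M. i n) \<le> sig E" using sum_lam_le[OF E] by (simp add: i_def)
  have "(\<Sum>m<M. \<Sum>n<M. (cmod (W0 E (m, n)))\<^sup>2)
      \<le> (\<Sum>m<M. \<Sum>n<M. 3 * ((cmod (R m n))\<^sup>2 * i m + (cmod (S m n))\<^sup>2 * i n + KQ\<^sup>2 * (i m * i n)))"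
    unfolding i_def by (intro sum_mono W0_le E)
  also have "\<dots> = 3 * ((\<Sum>m<M. (\<Sum>n<M. (cmod (R m n))\<^sup>2) * i m) + (\<Sum>m<M. \<Sum>n<M. (cmod (S m n))\<^sup>2 * i n)
      + KQ\<^sup>2 * ((\<Sum>m<M. i m) * (\<Sum>n<M. i n)))"
    unfolding sum_product by (simp add: sum.distrib sum_distrib_left sum_distrib_right)
  also have "(\<Sum>m<M. \<Sum>n<M. (cmod (S m n))\<^sup>2 * i n) = (\<Sum>n<M. (\<Sum>m<M. (cmod (S m n))\<^sup>2) * i n)"
    by (subst sum.swap) (simp add: sum_distrib_right)
  also have "3 * ((\<Sum>m<M. (\<Sum>n<M. (cmod (R m n))\<^sup>2) * i m) + (\<Sum>n<M. (\<Sum>m<M. (cmod (S m n))\<^sup>2) * i n)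
      + KQ\<^sup>2 * ((\<Sum>m<M. i m) * (\<Sum>n<M. i n)))
    \<le> 3 * ((\<Sum>m<M. (bnd * l2_norm \<mu> r)\<^sup>2 * i m) + (\<Sum>n<M. (bnd * l2_norm \<mu> s)\<^sup>2 * i n) + KQ\<^sup>2 * (sig E * sig E))"
    using isum i0 sig0
    by (intro mult_left_mono add_mono sum_mono mult_right_mono R_sum_le S_sum_le mult_mono sum_nonneg) auto
  also have "\<dots> = 3 * ((bnd * l2_norm \<mu> r)\<^sup>2 * (\<Sum>m<M. i m) + (bnd * l2_norm \<mu> s)\<^sup>2 * (\<Sum>n<M. i n) + KQ\<^sup>2 * (sig E * sig E))"
    by (simp add: sum_distrib_left)
  also have "\<dots> \<le> 3 * ((bnd * l2_norm \<mu> r)\<^sup>2 * sig E + (bnd * l2_norm \<mu> s)\<^sup>2 * sig E + KQ\<^sup>2 * (sig E * sig E))"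
    using sig0 by (intro mult_left_mono add_mono isum) auto
  also have "\<dots> = HS E" by (simp add: HS_def mult.commute)
  finally show ?thesis .
qed

lemma large_shift: "\<forall>\<^sub>F E in at_top. 1 \<le> E \<and> pi / len < sqrt E \<and> HS E \<le> (1 / 8)\<^sup>2"
proof -
  have "((\<lambda>E. 3 * (sig E * (bnd * l2_norm \<mu> r)\<^sup>2 + sig E * (bnd * l2_norm \<mu> s)\<^sup>2 + KQ\<^sup>2 * (sig E * sig E)))
      \<longlongrightarrow> 3 * (0 * (bnd * l2_norm \<mu> r)\<^sup>2 + 0 * (bnd * l2_norm \<mu> s)\<^sup>2 + KQ\<^sup>2 * (0 * 0))) at_top"
    by (intro tendsto_intros sig_tendsto)
  then have "(HS \<longlongrightarrow> 0) at_top" by (simp add: HS_def[abs_def])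
  from order_tendstoD(2)[OF this, of "(1 / 8)\<^sup>2"] have "\<forall>\<^sub>F E in at_top. HS E < (1 / 8)\<^sup>2" by simp
  moreover have "\<forall>\<^sub>F E in at_top. pi / len < sqrt E"
    using sqrt_at_top by (simp add: filterlim_at_top_dense)
  moreover have "\<forall>\<^sub>F E in at_top. (1 :: real) \<le> E" by (rule eventually_ge_at_top)
  ultimately show ?thesis by eventually_elim simp
qed

text \<open>\<open>N\<close> represents the lower order part of the form with respect to the orthonormal basis \<open>phi\<close>, both
  arguments being normalised by \<open>\<Lambda> = (kap\<^sup>2 + E)\<^sup>1\<^sup>/\<^sup>2\<close>.\<close>

lemma diagonalisation:
  assumes E: "1 \<le> E" "pi / len < sqrt E" "HS E \<le> (1 / 8)\<^sup>2"
  obtains Y Zl Zr H where "diag_perturbation (lam E) Y Zl Zr H"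
    "\<And>m n. P m n = of_real (lam E m * lam E n) * coord (diag_perturbation.N Zl Zr) (m, n)"
proof -
  have le: "(\<Sum>m<M. \<Sum>n<M. (cmod (W0 E (m, n)))\<^sup>2) \<le> (1 / 8)\<^sup>2" for M
    using W0_sum_le[OF E(1,2), of M] E(3) by linarith
  have W0: "coord (Ell2 (W0 E)) = W0 E" "norm (Ell2 (W0 E)) \<le> 1 / 8"
    by (rule ell2_finite_square_sums[OF le]; simp)+
  have W0': "coord (Ell2 (W0 E)) (m, n) = P m n / of_real ((lam E m + lam E n) * min (lam E m) (lam E n))" for m n
    by (simp only: W0(1)) (simp add: W0_def)
  obtain Y Zl Zr H where D: "diag_perturbation (lam E) Y Zl Zr H"
    and eq: "\<And>m n. of_real (lam E m + lam E n) * Y m n + of_real (lam E m * lam E n) * coord (mat_mul Zl Zr) (m, n) = P m n"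
    by (rule riccati_solution[of "lam E", OF lam_facts(1)[OF E(1)] W0' W0(2)]) (rule that)
  interpret D: diag_perturbation "lam E" Y Zl Zr H by (rule D)
  have "P m n = of_real (lam E m * lam E n) * coord (diag_perturbation.N Zl Zr) (m, n)" for m n
  proof -
    have "lam E m \<noteq> 0" "lam E n \<noteq> 0" using lam_facts(2)[OF E(1)] by (metis less_irrefl)+
    then have "of_real (lam E m * lam E n) * coord (diag_perturbation.N Zl Zr) (m, n)
       = of_real (lam E m + lam E n) * Y m n + of_real (lam E m * lam E n) * coord (mat_mul Zl Zr) (m, n)"
      by (simp add: D.N_def D.Zl(1) D.Zr(1) field_simps)
    then show ?thesis using eq[of m n] by simp
  qed
  then show ?thesis using D that by blast
qed

end

section \<open>The associated operator\<close>

lemma cinner_LIMSEQ: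
  fixes x y :: "nat ell2"
  shows "(\<lambda>N. \<Sum>n<N. cnj (coord x n) * coord y n) \<longlonglongrightarrow> cinner x y"
  using has_sum_imp_sums[OF has_sum_infsum[OF cinner_summable[of x y]]] by (simp add: sums_def cinner_def)

context sl_coefficients
begin

definition dom :: "(real \<Rightarrow> complex) set" where
  "dom = {f \<in> L2 \<mu>. \<exists>u g. Vp u g \<and> (AE x in \<mu>. f x = u x)}"

definition val :: "(real \<Rightarrow> complex) \<Rightarrow> (real \<Rightarrow> complex) \<Rightarrow> complex" where
  "val f g = B (ac_rep a b f) (ac_deriv a b f) (ac_rep a b g) (ac_deriv a b g)"

text \<open>The largest relation satisfying the form identity; every candidate for
  \<open>form_op\<close> is contained in it.\<close>

definition T :: "real l2_op" where
  "T = {(f, u). f \<in> dom \<and> u \<in> L2 \<mu> \<and> (\<forall>g\<in>dom. val g f = l2_inner \<mu> g u)}"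

lemma dom_rep:
  assumes f: "f \<in> dom"
  shows "f \<in> L2 \<mu>" "Vp (ac_rep a b f) (ac_deriv a b f)" "AE x in \<mu>. f x = ac_rep a b f x"
proof -
  show L: "f \<in> L2 \<mu>" using f by (simp add: dom_def)
  obtain u g where ug: "Vp u g" "AE x in \<mu>. f x = u x" using f unfolding dom_def by blast
  have W: "f \<in> W12 a b" unfolding W12_iff[OF ab] using L ug Vp_h1 by blast
  show "AE x in \<mu>. f x = ac_rep a b f x" by (rule W12_h1(2)[OF ab W])
  have "a \<in> {a..b}" "b \<in> {a..b}" using ab by auto
  then have "ac_rep a b f a = u a" "ac_rep a b f b = u b"
    using ac_rep_eq(1)[OF ab Vp_h1[OF ug(1)] ug(2)] by blast+
  then show "Vp (ac_rep a b f) (ac_deriv a b f)"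
    using W12_h1(1)[OF ab W] ug(1) unfolding Vp_def by simp
qed

lemma B_zero: "B u g (\<lambda>_. 0) (\<lambda>_. 0) = 0" "B (\<lambda>_. 0) (\<lambda>_. 0) u g = 0"
  by (simp_all add: B_def)

end

text \<open>Joins the form to its factorisation for one admissible shift; \<open>P_eq\<close> says
  that \<open>N\<close> is \<Lambda>^-1 P \<Lambda>^-1.\<close>

locale sl_shift = sl_coefficients a b da db q r s ca cb + D: diag_perturbation lm Y Zl Zr H
  for a b da db q r s ca cb lm Y Zl Zr H +
  fixes E :: real
  assumes E: "1 \<le> E" and lm: "\<And>n. lm n = lam E n"
    and P_eq: "\<And>m n. P m n = of_real (lm m * lm n) * coord D.N (m, n)"
begin

lemma lm_pos: "0 < lm n" and lm_square: "(lm n)\<^sup>2 = (kap n)\<^sup>2 + E"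
  using lam_facts[OF E, of n] by (simp_all add: lm)

text \<open>Row m of \<Lambda>^2 + P applied to \<Lambda>^-1 y, found by expanding the right
  argument; kap^2 + E = lam^2 absorbs the shift.\<close>

lemma B_basis_left:
  assumes v: "Vp v k" and y: "\<And>n. l2_inner \<mu> (phi n) v = coord (D.LamI y) n"
  shows "B (phi m) (\<lambda>x. of_real (kap m) * psi m x) v k + of_real E * l2_inner \<mu> (phi m) v
    = of_real (lm m) * coord (y + mat_app D.N y) m"
proof -
  define c where "c n = l2_inner \<mu> (phi n) v" for n
  have cy: "c n * of_real (lm n) = coord y n" for n using y[of n] lm_pos[of n] by (simp add: c_def)
  let ?B = "B (phi m) (\<lambda>x. of_real (kap m) * psi m x)"
  note hm = Vp_h1[OF phi_Vp[of m]]
  have fin: "?B (fsum c N) (dsum c N) = (\<Sum>n<N. c n * ((if m = n then of_real ((kap m)\<^sup>2) else 0) + P m n))" for N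
  proof (induction N)
    case 0
    then show ?case by (simp add: fsum_0 dsum_0 B_zero)
  next
    case (Suc N)
    have "?B (fsum c (Suc N)) (dsum c (Suc N)) = ?B (fsum c N) (dsum c N) + c N * ?B (phi N) (\<lambda>x. of_real (kap N) * psi N x)"
      unfolding fsum_Suc dsum_Suc by (rule B_lin_right[OF hm Vp_h1[OF fsum_Vp] Vp_h1[OF phi_Vp]])
    then show ?case by (simp only: Suc B_basis sum.lessThan_Suc)
  qed
  have sum_eq: "(\<Sum>n<N. c n * ((if m = n then of_real ((kap m)\<^sup>2) else 0) + P m n))
      = c m * of_real ((kap m)\<^sup>2) + of_real (lm m) * (\<Sum>n<N. cnj (coord (crow D.N m) n) * coord y n)" if "m < N" for N
  proof -
    have "c n * P m n = of_real (lm m) * (cnj (coord (crow D.N m) n) * coord y n)" for n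
      unfolding P_eq cy[symmetric] by simp
    then have "(\<Sum>n<N. c n * ((if m = n then of_real ((kap m)\<^sup>2) else 0) + P m n))
        = (\<Sum>n<N. (if m = n then c n * of_real ((kap m)\<^sup>2) else 0)) + (\<Sum>n<N. of_real (lm m) * (cnj (coord (crow D.N m) n) * coord y n))"
      unfolding sum.distrib[symmetric] by (intro sum.cong) (auto simp: distrib_left)
    also have "(\<Sum>n<N. (if m = n then c n * of_real ((kap m)\<^sup>2) else 0)) = c m * of_real ((kap m)\<^sup>2)"
      using that by (subst sum.delta') auto
    finally show ?thesis by (simp only: sum_distrib_left)
  qed
  have "(\<lambda>N. ?B (fsum c N) (dsum c N)) \<longlonglongrightarrow> ?B v k"
    by (rule B_tendsto_right[OF hm Vp_h1[OF fsum_Vp] Vp_h1[OF v] Vp_expansion[OF v]]) (simp_all add: c_def)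
  moreover have "(\<lambda>N. ?B (fsum c N) (dsum c N)) \<longlonglongrightarrow> c m * of_real ((kap m)\<^sup>2) + of_real (lm m) * cinner (crow D.N m) y"
  proof (rule Lim_transform_eventually)
    show "(\<lambda>N. c m * of_real ((kap m)\<^sup>2) + of_real (lm m) * (\<Sum>n<N. cnj (coord (crow D.N m) n) * coord y n))
        \<longlonglongrightarrow> c m * of_real ((kap m)\<^sup>2) + of_real (lm m) * cinner (crow D.N m) y"
      by (intro tendsto_intros cinner_LIMSEQ)
    show "\<forall>\<^sub>F N in sequentially. c m * of_real ((kap m)\<^sup>2) + of_real (lm m) * (\<Sum>n<N. cnj (coord (crow D.N m) n) * coord y n)
        = ?B (fsum c N) (dsum c N)"
      using eventually_gt_at_top[of m] by eventually_elim (simp only: fin sum_eq)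
  qed
  ultimately have B: "?B v k = c m * of_real ((kap m)\<^sup>2) + of_real (lm m) * coord (mat_app D.N y) m"
    unfolding coord_mat_app by (rule LIMSEQ_unique)
  have "?B v k + of_real E * l2_inner \<mu> (phi m) v = c m * of_real ((lm m)\<^sup>2) + of_real (lm m) * coord (mat_app D.N y) m"
    unfolding B by (simp add: lm_square c_def[symmetric] algebra_simps)
  also have "c m * of_real ((lm m)\<^sup>2) = of_real (lm m) * coord y m"
    unfolding cy[symmetric] by (simp add: power2_eq_square)
  finally show ?thesis by (simp add: algebra_simps)
qed

text \<open>The left argument is expanded only after the right one has been summed, so continuity in
  one argument at a time suffices and no double series arises.\<close>

lemma B_diagonal:
  assumes u: "Vp u g" and v: "Vp v k"
    and x: "\<And>n. l2_inner \<mu> (phi n) u = coord (D.LamI x) n" and y: "\<And>n. l2_inner \<mu> (phi n) v = coord (D.LamI y) n"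
  shows "B u g v k + of_real E * l2_inner \<mu> u v = cinner x (y + mat_app D.N y)"
proof -
  define c where "c n = l2_inner \<mu> (phi n) u" for n
  define w where "w = y + mat_app D.N y"
  have cx: "cnj (c n) * of_real (lm n) = cnj (coord x n)" for n using x[of n] lm_pos[of n] by (simp add: c_def)
  have uL2: "u \<in> L2 \<mu>" and vL2: "v \<in> L2 \<mu>" using Vp_L2[OF u] Vp_L2[OF v] by blast+
  have fL2: "fsum c N \<in> L2 \<mu>" for N using Vp_L2[OF fsum_Vp] by blast
  have fin: "B (fsum c N) (dsum c N) v k + of_real E * l2_inner \<mu> (fsum c N) v = (\<Sum>n<N. cnj (coord x n) * coord w n)" for N
  proof (induction N)
    case 0
    then show ?case by (simp add: fsum_0 dsum_0 B_zero)
  next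
    case (Suc N)
    have "B (fsum c (Suc N)) (dsum c (Suc N)) v k
        = B (fsum c N) (dsum c N) v k + cnj (c N) * B (phi N) (\<lambda>x. of_real (kap N) * psi N x) v k"
      unfolding fsum_Suc dsum_Suc by (rule B_lin_left[OF Vp_h1[OF v] Vp_h1[OF fsum_Vp] Vp_h1[OF phi_Vp]])
    moreover have "l2_inner \<mu> (fsum c (Suc N)) v = l2_inner \<mu> (fsum c N) v + cnj (c N) * l2_inner \<mu> (phi N) v"
      unfolding fsum_Suc using l2_inner_add_left[OF vL2 fL2[of N] L2_cmult[OF phi_L2[of N], of "c N"]] by (simp add: l2_inner_cmult_left)
    ultimately have "B (fsum c (Suc N)) (dsum c (Suc N)) v k + of_real E * l2_inner \<mu> (fsum c (Suc N)) v
        = (B (fsum c N) (dsum c N) v k + of_real E * l2_inner \<mu> (fsum c N) v)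
        + cnj (c N) * (B (phi N) (\<lambda>x. of_real (kap N) * psi N x) v k + of_real E * l2_inner \<mu> (phi N) v)"
      by (simp add: algebra_simps)
    also have "\<dots> = (\<Sum>n<N. cnj (coord x n) * coord w n) + cnj (c N) * of_real (lm N) * coord w N"
      unfolding Suc B_basis_left[OF v y] w_def by (simp only: mult.assoc)
    finally show ?case by (simp only: cx sum.lessThan_Suc)
  qed
  have "(\<lambda>N. l2_inner \<mu> v (fsum c N)) \<longlonglongrightarrow> l2_inner \<mu> v u"
    by (rule l2_inner_tendsto[OF fL2 uL2 Vp_expansion(1)[OF u] vL2]) (simp add: c_def)
  then have "(\<lambda>N. cnj (l2_inner \<mu> v (fsum c N))) \<longlonglongrightarrow> cnj (l2_inner \<mu> v u)" by (rule tendsto_cnj)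
  then have "(\<lambda>N. l2_inner \<mu> (fsum c N) v) \<longlonglongrightarrow> l2_inner \<mu> u v" by (simp only: l2_inner_commute[symmetric])
  moreover have "(\<lambda>N. B (fsum c N) (dsum c N) v k) \<longlonglongrightarrow> B u g v k"
    by (rule B_tendsto_left[OF Vp_h1[OF v] Vp_h1[OF fsum_Vp] Vp_h1[OF u] Vp_expansion[OF u]]) (simp_all add: c_def)
  ultimately have "(\<lambda>N. B (fsum c N) (dsum c N) v k + of_real E * l2_inner \<mu> (fsum c N) v) \<longlonglongrightarrow> B u g v k + of_real E * l2_inner \<mu> u v"
    by (intro tendsto_intros)
  then have "(\<lambda>N. \<Sum>n<N. cnj (coord x n) * coord w n) \<longlonglongrightarrow> B u g v k + of_real E * l2_inner \<mu> u v" by (simp only: fin)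
  from LIMSEQ_unique[OF this cinner_LIMSEQ] show ?thesis by (simp only: w_def)
qed

text \<open>Since lam^2 = kap^2 + E, the weights \<open>lm\<close> and \<open>kap\<close> impose the
  same condition on square-summable coefficients, and the weight \<open>kap\<close> characterises
  the form domain.\<close>

lemma dom_iff: "f \<in> dom \<longleftrightarrow> f \<in> L2 \<mu> \<and> phi.U f \<in> range D.LamI"
proof (intro iffI conjI)
  assume f: "f \<in> dom"
  note rep = dom_rep[OF f]
  show L: "f \<in> L2 \<mu>" by (rule rep(1))
  define u where "u = ac_rep a b f"
  have uL2: "u \<in> L2 \<mu>" using Vp_L2[OF rep(2)] by (simp add: u_def)
  have co: "coord (phi.U f) n = l2_inner \<mu> (phi n) u" for n
    using phi.U_eq_iff[OF L uL2] rep(3) phi.coord_U[OF uL2] by (simp add: u_def)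
  have "(cmod (of_real (lm n) * coord (phi.U f) n))\<^sup>2
      = (cmod (of_real (kap n) * l2_inner \<mu> (phi n) u))\<^sup>2 + E * (cmod (coord (phi.U f) n))\<^sup>2" for n
    by (simp add: co norm_mult power_mult_distrib lm_square algebra_simps)
  moreover have "(\<lambda>n. (cmod (of_real (kap n) * l2_inner \<mu> (phi n) u))\<^sup>2 + E * (cmod (coord (phi.U f) n))\<^sup>2) summable_on UNIV"
    unfolding u_def by (intro summable_on_add Vp_weights[OF rep(2)] summable_on_cmult_right coord_summable)
  ultimately show "phi.U f \<in> range D.LamI" by (simp add: D.range_LamI)
next
  assume "f \<in> L2 \<mu> \<and> phi.U f \<in> range D.LamI"
  then have f: "f \<in> L2 \<mu>" and r: "phi.U f \<in> range D.LamI" by auto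
  define c where "c n = l2_inner \<mu> (phi n) f" for n
  have s: "(\<lambda>n. (cmod (of_real (lm n) * c n))\<^sup>2) summable_on UNIV"
    using r by (simp only: D.range_LamI phi.coord_U[OF f] c_def)
  have "(\<lambda>n. (cmod (of_real (kap n / lm n) * (of_real (lm n) * c n)))\<^sup>2) summable_on UNIV"
  proof (rule square_summable_mult[OF s])
    show "cmod (of_real (kap n / lm n)) \<le> 1" for n
      using lam_facts(3)[OF E, of n] lm_pos[of n] kap_nonneg[of n] by (simp add: lm norm_divide del: of_real_divide)
  qed
  moreover have "of_real (kap n / lm n) * (of_real (lm n) * c n) = of_real (kap n) * c n" for n
    using lm_pos[of n] by simp
  ultimately have w: "(\<lambda>n. (cmod (of_real (kap n) * c n))\<^sup>2) summable_on UNIV" by (simp only:)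
  obtain u g where "Vp u g" "AE x in \<mu>. f x = u x" by (rule Vp_converse[OF f c_def w])
  then show "f \<in> dom" using f unfolding dom_def by blast
qed

lemma val_diagonal:
  assumes f: "f \<in> dom" "phi.U f = D.LamI y" and g: "g \<in> dom" "phi.U g = D.LamI x"
  shows "val g f + of_real E * l2_inner \<mu> g f = cinner x (y + mat_app D.N y)"
proof -
  have *: "l2_inner \<mu> (phi n) (ac_rep a b h) = coord (D.LamI z) n" if h: "h \<in> dom" "phi.U h = D.LamI z" for h z n
  proof -
    have L: "ac_rep a b h \<in> L2 \<mu>" using Vp_L2[OF dom_rep(2)[OF h(1)]] by blast
    have "phi.U h = phi.U (ac_rep a b h)" using phi.U_eq_iff[OF dom_rep(1)[OF h(1)] L] dom_rep(3)[OF h(1)] by simp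
    then show ?thesis using phi.coord_U[OF L, of n] h(2) by simp
  qed
  have "l2_inner \<mu> g f = l2_inner \<mu> (ac_rep a b g) (ac_rep a b f)"
    by (intro l2_inner_cong_AE dom_rep f g L2_measurable Vp_L2(1)[OF dom_rep(2)])
  then show ?thesis
    unfolding val_def using B_diagonal[OF dom_rep(2)[OF g(1)] dom_rep(2)[OF f(1)] *[OF g] *[OF f]] by simp
qed

text \<open>Under \<open>U\<close> the identity defining \<open>T\<close> becomes the weak equation
  of \<open>op_rel_iff\<close>, the test functions in \<open>dom\<close> corresponding to all
  vectors \<Lambda>^-1 w.\<close>

lemma shift_T: "shift_op (of_real E) T = phi.lift D.op_rel"
proof (rule set_eqI)
  fix p :: "(real \<Rightarrow> complex) \<times> (real \<Rightarrow> complex)"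
  obtain f u where p: "p = (f, u)" by (cases p)
  have "p \<in> shift_op (of_real E) T \<longleftrightarrow> (f, \<lambda>x. u x - of_real E * f x) \<in> T"
  proof
    assume "p \<in> shift_op (of_real E) T"
    then obtain v where "(f, v) \<in> T" "u = (\<lambda>x. v x + of_real E * f x)" unfolding shift_op_def p by auto
    then show "(f, \<lambda>x. u x - of_real E * f x) \<in> T" by simp
  next
    assume "(f, \<lambda>x. u x - of_real E * f x) \<in> T"
    then show "p \<in> shift_op (of_real E) T" unfolding shift_op_def p by (force intro: image_eqI)
  qed
  also have "\<dots> \<longleftrightarrow> f \<in> L2 \<mu> \<and> u \<in> L2 \<mu> \<and> (phi.U f, phi.U u) \<in> D.op_rel"
  proof (cases "f \<in> dom \<and> u \<in> L2 \<mu>")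
    case True
    then have f: "f \<in> dom" and u: "u \<in> L2 \<mu>" by auto
    have fL2: "f \<in> L2 \<mu>" by (rule dom_rep(1)[OF f])
    have v: "(\<lambda>x. u x - of_real E * f x) \<in> L2 \<mu>" by (intro L2_diff L2_cmult u fL2)
    obtain y where y: "phi.U f = D.LamI y" using f dom_iff by blast
    have eq: "l2_inner \<mu> g (\<lambda>x. u x - of_real E * f x) = l2_inner \<mu> g u - of_real E * l2_inner \<mu> g f" if "g \<in> dom" for g
      using dom_rep(1)[OF that] u fL2 by (simp add: l2_inner_diff_right l2_inner_cmult_right L2_cmult)
    have "(f, \<lambda>x. u x - of_real E * f x) \<in> T \<longleftrightarrow> (\<forall>g\<in>dom. val g f + of_real E * l2_inner \<mu> g f = l2_inner \<mu> g u)"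
      using f v by (auto simp: T_def eq algebra_simps)
    also have "\<dots> \<longleftrightarrow> (\<forall>w. cinner w (y + mat_app D.N y) = cinner (D.LamI w) (phi.U u))"
    proof (intro iffI allI ballI)
      fix w assume all: "\<forall>g\<in>dom. val g f + of_real E * l2_inner \<mu> g f = l2_inner \<mu> g u"
      obtain g where g: "g \<in> L2 \<mu>" "phi.U g = D.LamI w" by (rule phi.U_onto)
      then have gd: "g \<in> dom" by (simp add: dom_iff)
      show "cinner w (y + mat_app D.N y) = cinner (D.LamI w) (phi.U u)"
        using val_diagonal[OF f y gd g(2)] bspec[OF all gd] phi.cinner_U[OF u g(1)] g(2) by simp
    next
      fix g assume all: "\<forall>w. cinner w (y + mat_app D.N y) = cinner (D.LamI w) (phi.U u)" and gd: "g \<in> dom"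
      obtain w where w: "phi.U g = D.LamI w" using gd dom_iff by blast
      show "val g f + of_real E * l2_inner \<mu> g f = l2_inner \<mu> g u"
        using val_diagonal[OF f y gd w] spec[OF all, of w] phi.cinner_U[OF u dom_rep(1)[OF gd]] w by simp
    qed
    also have "\<dots> \<longleftrightarrow> (phi.U f, phi.U u) \<in> D.op_rel" unfolding y by (rule D.op_rel_iff[symmetric])
    finally show ?thesis using fL2 u by simp
  next
    case False
    have "\<not> (f, \<lambda>x. u x - of_real E * f x) \<in> T"
    proof
      assume "(f, \<lambda>x. u x - of_real E * f x) \<in> T"
      then have f: "f \<in> dom" and v: "(\<lambda>x. u x - of_real E * f x) \<in> L2 \<mu>" by (auto simp: T_def)
      have "(\<lambda>x. (u x - of_real E * f x) + of_real E * f x) \<in> L2 \<mu>" by (intro L2_add L2_cmult v dom_rep(1)[OF f])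
      then show False using False f by simp
    qed
    moreover have "f \<in> dom" if "f \<in> L2 \<mu>" "(phi.U f, phi.U u) \<in> D.op_rel"
      using that unfolding dom_iff D.op_rel_def by blast
    ultimately show ?thesis using False by blast
  qed
  also have "\<dots> \<longleftrightarrow> p \<in> phi.lift D.op_rel" by (simp add: p phi.lift_def)
  finally show "p \<in> shift_op (of_real E) T \<longleftrightarrow> p \<in> phi.lift D.op_rel" .
qed

end

context sl_shift
begin

lemma m_accretive_shift: "m_accretive \<mu> (shift_op (of_real E) T)"
  unfolding shift_T
proof (rule phi.m_accretive_lift[OF D.op_rel_0 D.op_rel_lin D.op_rel_single D.op_rel_accretive])
  fix z :: complex and u assume "0 < Re z"
  then obtain f v where "(f, v) \<in> D.op_rel" "v + scaleC z f = u" using D.op_rel_onto[of z u] by auto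
  then show "\<exists>f v. (f, v) \<in> D.op_rel \<and> v + scaleC z f = u" by blast
qed

text \<open>The lifted graph of \<Lambda> + Y is m-accretive with the right square, hence it is the
  root; its domain is the lifted range of \<Lambda>^-1.\<close>

lemma Domain_sqrt_shift: "Domain (sqrt_op \<mu> (shift_op (of_real E) T)) = dom"
proof -
  have acc: "m_accretive \<mu> (phi.lift D.root_rel)"
  proof (rule phi.m_accretive_lift[OF D.root_rel_0 D.root_rel_lin D.root_rel_single D.root_rel_accretive])
    fix z :: complex and u assume z: "0 < Re z"
    have le: "lm n \<le> 2 * cmod (of_real (lm n) + z)" for n
      using abs_Re_le_cmod[of "of_real (lm n) + z"] lm_pos[of n] z by simp
    obtain g v where "(g, v) \<in> D.root_rel" "v + scaleC z g = u" by (rule D.root_rel_onto[OF le])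
    then show "\<exists>f v. (f, v) \<in> D.root_rel \<and> v + scaleC z f = u" by blast
  qed
  have "sqrt_op \<mu> (phi.lift (D.root_rel O D.root_rel)) = phi.lift D.root_rel"
    by (rule phi.sqrt_op_lift[OF acc]) (rule D.root_unique; simp add: D.root_rel_square)
  then have "Domain (sqrt_op \<mu> (shift_op (of_real E) T)) = Domain (phi.lift D.root_rel)"
    by (simp only: shift_T D.root_rel_square)
  also have "\<dots> = dom"
  proof (intro set_eqI iffI)
    fix f assume "f \<in> Domain (phi.lift D.root_rel)"
    then obtain u where "f \<in> L2 \<mu>" "(phi.U f, phi.U u) \<in> D.root_rel" by (auto simp: phi.lift_def)
    then show "f \<in> dom" using D.Domain_root_rel by (auto simp: dom_iff)
  next
    fix f assume f: "f \<in> dom"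
    then have "phi.U f \<in> Domain D.root_rel" by (simp add: dom_iff D.Domain_root_rel)
    then obtain v where v: "(phi.U f, v) \<in> D.root_rel" by blast
    obtain u where "u \<in> L2 \<mu>" "phi.U u = v" by (rule phi.U_onto)
    then show "f \<in> Domain (phi.lift D.root_rel)" using v f by (auto simp: phi.lift_def dom_iff)
  qed
  finally show ?thesis .
qed

lemma m_sectorial_T: "m_sectorial \<mu> T"
proof -
  have "linear_op \<mu> (shift_op (- of_real E) (shift_op (of_real E) T))"
    by (rule linear_op_shift) (use m_accretive_shift in \<open>simp add: m_accretive_def\<close>)
  then have lin: "linear_op \<mu> T" by (simp add: shift_op_shift_op shift_op_0)
  \<comment> \<open>The form plus \<open>E\<close> has real part at least 7/16 and modulus at most
    25/16 of the squared norm of \<open>y\<close>; their quotient is the cosine 7/25.\<close>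
  have "\<zeta> \<in> sector (- E) (arccos (7 / 25))" if z: "\<zeta> \<in> numerical_range \<mu> T" for \<zeta>
  proof -
    obtain f u where fu: "(f, u) \<in> T" "l2_norm \<mu> f = 1" "\<zeta> = l2_inner \<mu> f u"
      using z by (auto simp: numerical_range_def)
    have L: "f \<in> L2 \<mu>" "u \<in> L2 \<mu>" using lin fu(1) by (auto simp: linear_op_def)
    define v where "v = (\<lambda>x. u x + of_real E * f x)"
    have v: "v \<in> L2 \<mu>" unfolding v_def by (intro L2_add L2_cmult L)
    have "(f, v) \<in> shift_op (of_real E) T" using fu(1) by (simp add: shift_op_iff v_def)
    then have "(phi.U f, phi.U v) \<in> D.op_rel" by (simp add: shift_T phi.lift_def)
    then obtain y where y: "cinner (phi.U f) (phi.U v) = cinner y (y + mat_app D.N y)" by (rule D.op_rel_cinner)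
    have "\<zeta> - of_real (- E) = l2_inner \<mu> f v"
      using fu(2,3) L by (simp add: v_def l2_inner_add_right L2_cmult l2_inner_cmult_right l2_inner_self)
    also have "\<dots> = cinner y (y + mat_app D.N y)" using y phi.cinner_U[OF v L(1)] by simp
    finally have e: "\<zeta> - of_real (- E) = cinner y (y + mat_app D.N y)" .
    have "7 / 25 * cmod (\<zeta> - of_real (- E)) \<le> Re (\<zeta> - of_real (- E))"
      unfolding e using D.Re_quadratic_form[of y] D.cmod_quadratic_form[of y] by linarith
    then show ?thesis unfolding sector_def by (simp only: mem_Collect_eq) (rule abs_Arg_le_arccos; simp)
  qed
  moreover have "0 \<le> arccos (7 / 25)" by (rule arccos_lbound) auto
  moreover have "arccos (7 / 25) < pi / 2"
    using arccos_less_arccos[of 0 "7 / 25"] by simp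
  ultimately have "sectorial \<mu> T" unfolding sectorial_def by blast
  then show ?thesis using lin m_accretive_shift unfolding m_sectorial_def by blast
qed

lemma T_shift_inj:
  assumes "(f, u) \<in> T" "(g, v) \<in> T" and eq: "\<And>x. u x + of_real E * f x = v x + of_real E * g x"
  shows "AE x in \<mu>. f x = g x"
proof -
  have lin: "linear_op \<mu> T" using m_sectorial_T by (simp add: m_sectorial_def)
  have L: "f \<in> L2 \<mu>" "g \<in> L2 \<mu>" using lin assms(1,2) by (auto simp: linear_op_def)
  have fu: "(f, \<lambda>x. u x + of_real E * f x) \<in> shift_op (of_real E) T"
    using assms(1) by (simp add: shift_op_iff)
  have gv: "(g, \<lambda>x. u x + of_real E * f x) \<in> shift_op (of_real E) T"
    unfolding eq using assms(2) by (simp add: shift_op_iff)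
  define w where "w = phi.U (\<lambda>x. u x + of_real E * f x)"
  have "(phi.U f, w) \<in> D.op_rel" "(phi.U g, w) \<in> D.op_rel"
    using fu gv by (simp_all add: shift_T phi.lift_def w_def)
  from D.op_rel_lin[OF this, of "-1"] have "(phi.U f - phi.U g, 0) \<in> D.op_rel" by (simp add: scaleC_minus_one)
  then have "phi.U f = phi.U g" using D.op_rel_bound by fastforce
  then show ?thesis by (simp add: phi.U_eq_iff[OF L])
qed

end

section \<open>From admissible shifts to the operator of the form\<close>

context sl_coefficients
begin

lemma sl_shift_exists: "\<forall>\<^sub>F E in at_top. \<exists>Y Zl Zr H. sl_shift a b da db q r s ca cb (lam E) Y Zl Zr H E"
  using large_shift
proof eventually_elim
  case (elim E)
  then have E: "1 \<le> E" "pi / len < sqrt E" "HS E \<le> (1 / 8)\<^sup>2" by auto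
  obtain Y Zl Zr H where D: "diag_perturbation (lam E) Y Zl Zr H"
    and P: "\<And>m n. P m n = of_real (lam E m * lam E n) * coord (diag_perturbation.N Zl Zr) (m, n)"
    by (rule diagonalisation[OF E]) (rule that)
  interpret D: diag_perturbation "lam E" Y Zl Zr H by (rule D)
  have "sl_shift a b da db q r s ca cb (lam E) Y Zl Zr H E" by unfold_locales (use E P in auto)
  then show ?case by blast
qed

text \<open>A candidate lies in \<open>T\<close> by maximality. Conversely \<open>T1\<close> + E is
  onto and \<open>T\<close> + E is injective, and a surjective operator has no proper injective
  extension.\<close>

lemma form_op_unique:
  assumes T1: "m_sectorial \<mu> T1" "Domain T1 \<subseteq> dom" "\<And>f u g. (f, u) \<in> T1 \<Longrightarrow> g \<in> dom \<Longrightarrow> val g f = l2_inner \<mu> g u"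
  shows "T1 = T"
proof
  have lin: "linear_op \<mu> T1" using T1(1) by (simp add: m_sectorial_def)
  show sub: "T1 \<subseteq> T"
  proof clarify
    fix f u assume fu: "(f, u) \<in> T1"
    then have "u \<in> L2 \<mu>" using lin by (auto simp: linear_op_def)
    moreover have "f \<in> dom" using T1(2) fu by blast
    ultimately show "(f, u) \<in> T" using T1(3)[OF fu] unfolding T_def by blast
  qed
  obtain E1 :: real where E1: "m_accretive \<mu> (shift_op (of_real E1) T1)" using T1(1) unfolding m_sectorial_def by blast
  \<comment> \<open>\<open>E\<close> exceeds \<open>E1\<close>, so that the m-accretive operator
    \<open>T1\<close> + E1 gives surjectivity of \<open>T1\<close> + E, and is also admissible for
    the factorisation.\<close>
  obtain E Y Zl Zr H where S: "sl_shift a b da db q r s ca cb (lam E) Y Zl Zr H E" and E: "E1 < E"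
    using eventually_happens'[OF trivial_limit_at_top_linorder eventually_conj[OF sl_shift_exists eventually_gt_at_top[of E1]]]
    by blast
  interpret S: sl_shift a b da db q r s ca cb "lam E" Y Zl Zr H E by (rule S)
  show "T \<subseteq> T1"
  proof clarify
    fix f u assume fu: "(f, u) \<in> T"
    then have L: "f \<in> L2 \<mu>" "u \<in> L2 \<mu>" using dom_rep(1) by (auto simp: T_def)
    have "Range (shift_op (of_real (E - E1)) (shift_op (of_real E1) T1)) = L2 \<mu>"
      using E1 E unfolding m_accretive_def by (simp del: of_real_diff)
    then have "Range (shift_op (of_real E) T1) = L2 \<mu>" by (simp add: shift_op_shift_op)
    moreover have "(\<lambda>x. u x + of_real E * f x) \<in> L2 \<mu>" by (intro L2_add L2_cmult L)
    ultimately obtain g where "(g, \<lambda>x. u x + of_real E * f x) \<in> shift_op (of_real E) T1" by blast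
    then obtain v where v: "(g, v) \<in> T1" "(\<lambda>x. u x + of_real E * f x) = (\<lambda>x. v x + of_real E * g x)"
      unfolding shift_op_def by auto
    have eq: "u x + of_real E * f x = v x + of_real E * g x" for x using v(2) by (rule fun_cong)
    have fg: "AE x in \<mu>. f x = g x" by (rule S.T_shift_inj[OF fu _ eq]) (use sub v(1) in blast)
    have "AE x in \<mu>. u x = v x" using fg
    proof eventually_elim
      case (elim x)
      then show ?case using eq[of x] by simp
    qed
    then show "(f, u) \<in> T1" using lin v(1) L fg unfolding linear_op_def by blast
  qed
qed

lemma m_sectorial_op: "m_sectorial \<mu> T"
proof -
  obtain E Y Zl Zr H where S: "sl_shift a b da db q r s ca cb (lam E) Y Zl Zr H E"
    using eventually_happens'[OF trivial_limit_at_top_linorder sl_shift_exists] by blast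
  show ?thesis by (rule sl_shift.m_sectorial_T[OF S])
qed

text \<open>Two properties valid for all large \<open>E\<close> hold at a common value, which
  settles uniqueness of the domain described.\<close>

lemma sqrt_dom_T: "sqrt_dom \<mu> T = dom"
  unfolding sqrt_dom_def
proof (rule the_equality)
  show ev: "\<forall>\<^sub>F E::real in at_top. m_accretive \<mu> (shift_op (of_real E) T) \<and> Domain (sqrt_op \<mu> (shift_op (of_real E) T)) = dom"
    using sl_shift_exists
  proof eventually_elim
    case (elim E)
    then obtain Y Zl Zr H where S: "sl_shift a b da db q r s ca cb (lam E) Y Zl Zr H E" by blast
    show ?case using sl_shift.m_accretive_shift[OF S] sl_shift.Domain_sqrt_shift[OF S] by (rule conjI)
  qed
  fix D assume "\<forall>\<^sub>F E::real in at_top. m_accretive \<mu> (shift_op (of_real E) T) \<and> Domain (sqrt_op \<mu> (shift_op (of_real E) T)) = D"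
  from eventually_happens'[OF trivial_limit_at_top_linorder eventually_conj[OF ev this]] show "D = dom" by auto
qed

end

theorem theorem4p6:
  fixes a b :: real and q r s :: "real \<Rightarrow> complex" and \<theta>a \<theta>b :: complex
  assumes "a < b"
    and "integrable (lebesgue_on {a<..<b}) q"
    and "r \<in> L2 (lebesgue_on {a<..<b})" and "s \<in> L2 (lebesgue_on {a<..<b})"
    and "\<theta>a \<in> S_pi" and "\<theta>b \<in> S_pi"
  shows "sqrt_dom (lebesgue_on {a<..<b}) (form_op (lebesgue_on {a<..<b}) (sl_form a b \<theta>a \<theta>b q r s))
           = form_dom (sl_form a b \<theta>a \<theta>b q r s)
       \<and> form_dom (sl_form a b \<theta>a \<theta>b q r s)
           = form_dom (sl_form a b \<theta>a \<theta>b (\<lambda>_. 0) (\<lambda>_. 0) (\<lambda>_. 0))"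
proof
  define ca where "ca = (if \<theta>a = 0 then 0 else cot \<theta>a)"
  define cb where "cb = (if \<theta>b = 0 then 0 else cot \<theta>b)"
  \<comment> \<open>Parameter 0 means a Dirichlet end. Every other value gives a free end, compared
    with the Neumann condition, and its cotangent term is part of the perturbation.\<close>
  interpret sl_coefficients a b "\<theta>a = 0" "\<theta>b = 0" q r s ca cb
    by unfold_locales (use assms in auto)
  let ?Q = "sl_form a b \<theta>a \<theta>b q r s"
  have dom: "form_dom ?Q = dom"
  proof (intro set_eqI iffI)
    fix f assume f: "f \<in> form_dom ?Q"
    then have "f \<in> W12 a b" by (simp add: sl_form_def)
    from W12_h1[OF assms(1) this] f show "f \<in> dom"
      by (auto simp: dom_def sl_form_def W12_def Vp_def DA_def DB_def)
  next
    fix f assume f: "f \<in> dom"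
    have "f \<in> W12 a b"
      unfolding W12_iff[OF assms(1)] using dom_rep[OF f] Vp_h1 by blast
    then show "f \<in> form_dom ?Q"
      using dom_rep(2)[OF f] by (simp add: sl_form_def Vp_def DA_def DB_def)
  qed
  have val: "form_val ?Q f g = val f g" for f g
    unfolding val_def B_def by (simp add: sl_form_def ca_def cb_def)
  have "form_op (Leb a b) ?Q = T"
    unfolding form_op_def dom val
  proof (rule the_equality)
    show "m_sectorial (Leb a b) T \<and> Domain T \<subseteq> dom \<and> (\<forall>(f, u)\<in>T. \<forall>g\<in>dom. val g f = l2_inner (Leb a b) g u)"
      using m_sectorial_op by (auto simp: T_def)
    fix T1 assume "m_sectorial (Leb a b) T1 \<and> Domain T1 \<subseteq> dom \<and> (\<forall>(f, u)\<in>T1. \<forall>g\<in>dom. val g f = l2_inner (Leb a b) g u)"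
    then show "T1 = T" by (intro form_op_unique) auto
  qed
  then show "sqrt_dom (Leb a b) (form_op (Leb a b) ?Q) = form_dom ?Q" by (simp only: sqrt_dom_T dom)
  \<comment> \<open>The form domain of \<open>sl_form\<close> depends only on the interval and on
    which parameters vanish.\<close>
  show "form_dom ?Q = form_dom (sl_form a b \<theta>a \<theta>b (\<lambda>_. 0) (\<lambda>_. 0) (\<lambda>_. 0))"
    by (simp add: sl_form_def)
qed

end
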